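(* Let $(\mathcal{M},g,N,K)$ be a nearly Robinson manifold of dimension $2m+2$ with congruence of null geodesics $\mathcal{K}$. Then $\mathcal{M}$ is locally diffeomorphic to the trivial line bundle $\varpi:\mathbb{R}\times\underline{\mathcal{M}}\to\underline{\mathcal{M}}$, where $\underline{\mathcal{M}}$ is the local leaf space of $\mathcal{K}$ and is equipped with an almost CR structure $(\underline{H},\underline{J})$. Further, locally, $g$ takes the form $$g=4\,\varpi^*\underline\theta^0\,\lambda+2\,h_{\alpha\bar\beta}\,\varpi^*\underline\theta^\alpha\,\varpi^*\overline{\underline\theta}{}^{\bar\beta}$$ for some CR coframe $(\underline\theta^0,\underline\theta^\alpha,\overline{\underline\theta}{}^{\bar\alpha})$ on $\underline{\mathcal{M}}$, some Hermitian matrix $h_{\alpha\bar\beta}$ depending smoothly on $\mathcal{M}$, and some $1$-form $\lambda$ on $\mathcal{M}$ that never vanishes on $K$.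
   Context: $(\mathcal{M},g)$ is an oriented, time-oriented Lorentzian manifold of dimension $2m+2$. An almost Robinson structure $(N,K)$ is a complex rank-$(m+1)$ distribution $N\subset{}^{\mathbb{C}}T\mathcal{M}$ totally null for ${}^{\mathbb{C}}g$ and a real line distribution $K$ with ${}^{\mathbb{C}}K=N\cap\overline N$. It is nearly Robinson if $[K,N]\subset N$ (the integral curves of $K$ are then null geodesics); $\mathcal{K}$ is the congruence of integral curves of $K$. The almost CR structure on the leaf space is the one to which $(N,K)$ descends: $\underline{H}$ is the image of $K^\perp/K$, and $N/{}^{\mathbb{C}}K$, $\overline N/{}^{\mathbb{C}}K$ descend to the $-i$- and $+i$-eigenbundles $\underline{H}^{(0,1)},\underline{H}^{(1,0)}$ of $\underline{J}$. An almost CR structure on a $(2m+1)$-manifold is a rank-$2m$ distribution $\underline{H}$ with a bundle complex structure $\underline{J}$ on $\underline{H}$. A CR coframe is a coframe consisting of a real $1$-form $\underline\theta^0$, $m$ complex $1$-forms $\underline\theta^\alpha$ and their conjugates, with $\underline{H}=\mathrm{Ann}(\underline\theta^0)$, $\underline{H}^{(0,1)}=\mathrm{Ann}(\underline\theta^0,\underline\theta^\alpha)$. Juxtaposition of $1$-forms is the symmetric product. *)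

theory Defs
  imports "HOL-Analysis.Analysis" "HOL-Library.Function_Algebras"
begin

section \<open>Smooth manifolds\<close>

(* The usual C^k condition, through iterated directional derivatives; only meaningful for open S. *)
primrec ck_on :: "nat \<Rightarrow> 'e::euclidean_space set \<Rightarrow> ('e \<Rightarrow> 'v::real_normed_vector) \<Rightarrow> bool" where
  "ck_on 0 = (\<lambda>S f. continuous_on S f)"
| "ck_on (Suc k) = (\<lambda>S f. (\<forall>x\<in>S. f differentiable (at x)) \<and>
      (\<forall>v. ck_on k S (\<lambda>x. frechet_derivative f (at x) v)))"

definition smooth_on :: "'e::euclidean_space set \<Rightarrow> ('e \<Rightarrow> 'v::real_normed_vector) \<Rightarrow> bool" where
  "smooth_on S f \<longleftrightarrow> (\<forall>k. ck_on k S f)"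

record ('a, 'e) mfd =
  mtop :: "'a topology"
  atlas :: "('a set \<times> ('a \<Rightarrow> 'e)) set"

definition smooth_manifold :: "('a, 'e::euclidean_space) mfd \<Rightarrow> bool" where
  "smooth_manifold M \<longleftrightarrow>
     Hausdorff_space (mtop M) \<and> second_countable (mtop M) \<and>
     topspace (mtop M) = \<Union> (fst ` atlas M) \<and>
     (\<forall>(U, \<phi>)\<in>atlas M. openin (mtop M) U \<and> open (\<phi> ` U) \<and>
        homeomorphic_map (subtopology (mtop M) U) (top_of_set (\<phi> ` U)) \<phi>) \<and>
     (\<forall>(U, \<phi>)\<in>atlas M. \<forall>(V, \<psi>)\<in>atlas M. smooth_on (\<phi> ` (U \<inter> V)) (\<psi> \<circ> inv_into U \<phi>))"

definition euclidean_mfd :: "'e::euclidean_space set \<Rightarrow> ('e, 'e) mfd" where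
  "euclidean_mfd S = \<lparr>mtop = top_of_set S, atlas = {(S, id)}\<rparr>"

definition open_submfd :: "('a, 'e) mfd \<Rightarrow> 'a set \<Rightarrow> ('a, 'e) mfd" where
  "open_submfd M U = \<lparr>mtop = subtopology (mtop M) U, atlas = {(V \<inter> U, \<phi>) |V \<phi>. (V, \<phi>) \<in> atlas M}\<rparr>"

definition prod_mfd :: "('a, 'e) mfd \<Rightarrow> ('b, 'f) mfd \<Rightarrow> ('a \<times> 'b, 'e \<times> 'f) mfd" where
  "prod_mfd M B = \<lparr>mtop = prod_topology (mtop M) (mtop B),
     atlas = {(U \<times> V, map_prod \<phi> \<psi>) |U \<phi> V \<psi>. (U, \<phi>) \<in> atlas M \<and> (V, \<psi>) \<in> atlas B}\<rparr>"

definition smooth_fun :: "('a, 'e::euclidean_space) mfd \<Rightarrow> 'a set \<Rightarrow> ('a \<Rightarrow> 'v::real_normed_vector) \<Rightarrow> bool" where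
  "smooth_fun M W f \<longleftrightarrow> openin (mtop M) W \<and>
     (\<forall>(U, \<phi>)\<in>atlas M. smooth_on (\<phi> ` (U \<inter> W)) (f \<circ> inv_into U \<phi>))"

definition smooth_near :: "('a, 'e::euclidean_space) mfd \<Rightarrow> 'a \<Rightarrow> ('a \<Rightarrow> complex) \<Rightarrow> bool" where
  "smooth_near M p f \<longleftrightarrow> (\<exists>W. p \<in> W \<and> smooth_fun M W f)"

definition smooth_map ::
  "('a, 'e::euclidean_space) mfd \<Rightarrow> ('b, 'f::euclidean_space) mfd \<Rightarrow> ('a \<Rightarrow> 'b) \<Rightarrow> bool" where
  "smooth_map M B F \<longleftrightarrow> continuous_map (mtop M) (mtop B) F \<and>
     (\<forall>(U, \<phi>)\<in>atlas M. \<forall>(V, \<psi>)\<in>atlas B.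
        smooth_on (\<phi> ` (U \<inter> F -` V)) (\<psi> \<circ> F \<circ> inv_into U \<phi>))"

definition diffeomorphism ::
  "('a, 'e::euclidean_space) mfd \<Rightarrow> ('b, 'f::euclidean_space) mfd \<Rightarrow> ('a \<Rightarrow> 'b) \<Rightarrow> bool" where
  "diffeomorphism M B F \<longleftrightarrow>
     bij_betw F (topspace (mtop M)) (topspace (mtop B)) \<and>
     smooth_map M B F \<and> smooth_map B M (inv_into (topspace (mtop M)) F)"


section \<open>Real and complexified tangent vectors\<close>

(* A complexified tangent vector at p is the operator on germs at p of smooth complex functions
   given in a chart by differentiation along v + i w. The operators take the value 0 on functions
   that are not smooth near p, so that equality of operators is equality of tangent vectors. *)
type_synonym 'a tvec = "('a \<Rightarrow> complex) \<Rightarrow> complex"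

definition ctangent :: "('a, 'e::euclidean_space) mfd \<Rightarrow> 'a \<Rightarrow> 'a tvec set" where
  "ctangent M p = {Z. \<exists>(U, \<phi>)\<in>atlas M. p \<in> U \<and> (\<exists>v w. Z = (\<lambda>f.
      if smooth_near M p f
      then frechet_derivative (f \<circ> inv_into U \<phi>) (at (\<phi> p)) v
           + \<i> * frechet_derivative (f \<circ> inv_into U \<phi>) (at (\<phi> p)) w
      else 0))}"

definition tscale :: "complex \<Rightarrow> 'a tvec \<Rightarrow> 'a tvec" where
  "tscale c Z = (\<lambda>f. c * Z f)"

definition rtscale :: "real \<Rightarrow> 'a tvec \<Rightarrow> 'a tvec" where
  "rtscale r Z = tscale (complex_of_real r) Z"

global_interpretation ctv: vector_space "tscale :: complex \<Rightarrow> 'a tvec \<Rightarrow> 'a tvec"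
  by unfold_locales (auto simp: tscale_def fun_eq_iff algebra_simps)

global_interpretation rtv: vector_space "rtscale :: real \<Rightarrow> 'a tvec \<Rightarrow> 'a tvec"
  by unfold_locales (auto simp: rtscale_def tscale_def fun_eq_iff algebra_simps)

definition tconj :: "'a tvec \<Rightarrow> 'a tvec" where
  "tconj Z = (\<lambda>f. cnj (Z (\<lambda>x. cnj (f x))))"

definition tRe :: "'a tvec \<Rightarrow> 'a tvec" where
  "tRe Z = tscale (1/2) (Z + tconj Z)"

definition tIm :: "'a tvec \<Rightarrow> 'a tvec" where
  "tIm Z = tscale (1 / (2 * \<i>)) (Z - tconj Z)"

definition rtangent :: "('a, 'e::euclidean_space) mfd \<Rightarrow> 'a \<Rightarrow> 'a tvec set" where
  "rtangent M p = {Z \<in> ctangent M p. tconj Z = Z}"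

(* The differential at p of a map F into B. *)
definition push :: "('b, 'f::euclidean_space) mfd \<Rightarrow> ('a \<Rightarrow> 'b) \<Rightarrow> 'a \<Rightarrow> 'a tvec \<Rightarrow> 'b tvec" where
  "push B F p Z = (\<lambda>f. if smooth_near B (F p) f then Z (f \<circ> F) else 0)"

definition velocity :: "('a, 'e::euclidean_space) mfd \<Rightarrow> (real \<Rightarrow> 'a) \<Rightarrow> real \<Rightarrow> 'a tvec" where
  "velocity M \<gamma> t = (\<lambda>f. if smooth_near M (\<gamma> t) f then vector_derivative (f \<circ> \<gamma>) (at t) else 0)"


section \<open>Fields\<close>

definition cvector_field :: "('a, 'e::euclidean_space) mfd \<Rightarrow> 'a set \<Rightarrow> ('a \<Rightarrow> 'a tvec) \<Rightarrow> bool" where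
  "cvector_field M W X \<longleftrightarrow> openin (mtop M) W \<and> (\<forall>p\<in>W. X p \<in> ctangent M p) \<and>
     (\<forall>V f. V \<subseteq> W \<longrightarrow> smooth_fun M V (f :: 'a \<Rightarrow> complex) \<longrightarrow> smooth_fun M V (\<lambda>p. X p f))"

definition rvector_field :: "('a, 'e::euclidean_space) mfd \<Rightarrow> 'a set \<Rightarrow> ('a \<Rightarrow> 'a tvec) \<Rightarrow> bool" where
  "rvector_field M W X \<longleftrightarrow> cvector_field M W X \<and> (\<forall>p\<in>W. X p \<in> rtangent M p)"

definition lie_bracket ::
  "('a, 'e::euclidean_space) mfd \<Rightarrow> ('a \<Rightarrow> 'a tvec) \<Rightarrow> ('a \<Rightarrow> 'a tvec) \<Rightarrow> 'a \<Rightarrow> 'a tvec" where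
  "lie_bracket M X Y p = (\<lambda>f. if smooth_near M p f
     then X p (\<lambda>q. Y q f) - Y p (\<lambda>q. X q f) else 0)"

definition complex_linear_on :: "'a tvec set \<Rightarrow> ('a tvec \<Rightarrow> complex) \<Rightarrow> bool" where
  "complex_linear_on T \<omega> \<longleftrightarrow>
     (\<forall>Z\<in>T. \<forall>Z'\<in>T. \<omega> (Z + Z') = \<omega> Z + \<omega> Z') \<and> (\<forall>c. \<forall>Z\<in>T. \<omega> (tscale c Z) = c * \<omega> Z)"

type_synonym 'a form = "'a \<Rightarrow> 'a tvec \<Rightarrow> complex"

(* Complex-valued 1-forms on W, extended complex-linearly to complexified tangent vectors. *)
definition cform :: "('a, 'e::euclidean_space) mfd \<Rightarrow> 'a set \<Rightarrow> 'a form \<Rightarrow> bool" where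
  "cform M W \<theta> \<longleftrightarrow> openin (mtop M) W \<and> (\<forall>p\<in>W. complex_linear_on (ctangent M p) (\<theta> p)) \<and>
     (\<forall>V X. V \<subseteq> W \<longrightarrow> cvector_field M V X \<longrightarrow> smooth_fun M V (\<lambda>p. \<theta> p (X p)))"

definition conj_form :: "'a form \<Rightarrow> 'a form" where
  "conj_form \<theta> p Z = cnj (\<theta> p (tconj Z))"

definition rform :: "('a, 'e::euclidean_space) mfd \<Rightarrow> 'a set \<Rightarrow> 'a form \<Rightarrow> bool" where
  "rform M W \<theta> \<longleftrightarrow> cform M W \<theta> \<and> (\<forall>p\<in>W. \<forall>X\<in>rtangent M p. \<theta> p X \<in> \<real>)"

definition pull :: "('b, 'f::euclidean_space) mfd \<Rightarrow> ('a \<Rightarrow> 'b) \<Rightarrow> 'b form \<Rightarrow> 'a form" where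
  "pull B F \<theta> p Z = \<theta> (F p) (push B F p Z)"

(* The juxtaposition of 1-forms at a point. *)
definition symprod :: "('a tvec \<Rightarrow> complex) \<Rightarrow> ('a tvec \<Rightarrow> complex) \<Rightarrow> 'a tvec \<Rightarrow> 'a tvec \<Rightarrow> complex" where
  "symprod \<mu> \<nu> X Y = (\<mu> X * \<nu> Y + \<nu> X * \<mu> Y) / 2"

definition real_distribution ::
  "('a, 'e::euclidean_space) mfd \<Rightarrow> nat \<Rightarrow> ('a \<Rightarrow> 'a tvec set) \<Rightarrow> bool" where
  "real_distribution M r D \<longleftrightarrow> (\<forall>p\<in>topspace (mtop M). \<exists>W X. p \<in> W \<and>
     openin (mtop M) W \<and> (\<forall>i<r. rvector_field M W (X i)) \<and>
     (\<forall>q\<in>W. D q = rtv.span ((\<lambda>i. X i q) ` {..<r}) \<and> rtv.dim (D q) = r))"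

definition complex_distribution ::
  "('a, 'e::euclidean_space) mfd \<Rightarrow> nat \<Rightarrow> ('a \<Rightarrow> 'a tvec set) \<Rightarrow> bool" where
  "complex_distribution M r D \<longleftrightarrow> (\<forall>p\<in>topspace (mtop M). \<exists>W X. p \<in> W \<and>
     openin (mtop M) W \<and> (\<forall>i<r. cvector_field M W (X i)) \<and>
     (\<forall>q\<in>W. D q = ctv.span ((\<lambda>i. X i q) ` {..<r}) \<and> ctv.dim (D q) = r))"


section \<open>Oriented and time-oriented Lorentzian manifolds\<close>

type_synonym 'a metric = "'a \<Rightarrow> 'a tvec \<Rightarrow> 'a tvec \<Rightarrow> real"

(* Signature (+,...,+,-). *)
definition lorentzian_metric :: "('a, 'e::euclidean_space) mfd \<Rightarrow> 'a metric \<Rightarrow> bool" where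
  "lorentzian_metric M g \<longleftrightarrow>
     (\<forall>p\<in>topspace (mtop M).
        (\<forall>X\<in>rtangent M p. \<forall>Y\<in>rtangent M p. g p X Y = g p Y X) \<and>
        (\<forall>X\<in>rtangent M p. \<forall>Y\<in>rtangent M p. \<forall>Z\<in>rtangent M p. g p (X + Y) Z = g p X Z + g p Y Z) \<and>
        (\<forall>c. \<forall>X\<in>rtangent M p. \<forall>Y\<in>rtangent M p. g p (rtscale c X) Y = c * g p X Y) \<and>
        (\<exists>E :: nat \<Rightarrow> 'a tvec. (\<forall>i<DIM('e). E i \<in> rtangent M p) \<and>
           rtangent M p = rtv.span (E ` {..<DIM('e)}) \<and>
           (\<forall>i<DIM('e). \<forall>j<DIM('e).
              g p (E i) (E j) = (if i \<noteq> j then 0 else if i = 0 then -1 else 1)))) \<and>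
     (\<forall>W X Y. rvector_field M W X \<longrightarrow> rvector_field M W Y \<longrightarrow> smooth_fun M W (\<lambda>p. g p (X p) (Y p)))"

(* The complex-bilinear extension of g. *)
definition complexify :: "'a metric \<Rightarrow> 'a \<Rightarrow> 'a tvec \<Rightarrow> 'a tvec \<Rightarrow> complex" where
  "complexify g p Z W = Complex
     (g p (tRe Z) (tRe W) - g p (tIm Z) (tIm W))
     (g p (tRe Z) (tIm W) + g p (tIm Z) (tRe W))"

(* An orientation is given by a nowhere vanishing form of top degree representing it. *)
definition orientation_form ::
  "('a, 'e::euclidean_space) mfd \<Rightarrow> ('a \<Rightarrow> 'a tvec list \<Rightarrow> real) \<Rightarrow> bool" where
  "orientation_form M vol \<longleftrightarrow>
     (\<forall>p\<in>topspace (mtop M).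
        (\<forall>Xs. set Xs \<subseteq> rtangent M p \<longrightarrow> length Xs = DIM('e) \<longrightarrow>
           (\<forall>i<DIM('e). \<forall>X\<in>rtangent M p. \<forall>Y\<in>rtangent M p. \<forall>a b.
              vol p (Xs[i := rtscale a X + rtscale b Y]) =
                a * vol p (Xs[i := X]) + b * vol p (Xs[i := Y])) \<and>
           (\<not> distinct Xs \<longrightarrow> vol p Xs = 0)) \<and>
        (\<exists>Xs. set Xs \<subseteq> rtangent M p \<and> length Xs = DIM('e) \<and> vol p Xs \<noteq> 0)) \<and>
     (\<forall>W Xs. openin (mtop M) W \<longrightarrow> length Xs = DIM('e) \<longrightarrow> (\<forall>X\<in>set Xs. rvector_field M W X) \<longrightarrow>
        smooth_fun M W (\<lambda>p. vol p (map (\<lambda>X. X p) Xs)))"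

(* A time-orientation is given by a global timelike vector field representing it. *)
definition time_orientation_field ::
  "('a, 'e::euclidean_space) mfd \<Rightarrow> 'a metric \<Rightarrow> ('a \<Rightarrow> 'a tvec) \<Rightarrow> bool" where
  "time_orientation_field M g \<tau> \<longleftrightarrow> rvector_field M (topspace (mtop M)) \<tau> \<and>
     (\<forall>p\<in>topspace (mtop M). g p (\<tau> p) (\<tau> p) < 0)"


section \<open>Almost Robinson structures\<close>

definition almost_robinson ::
  "('a, 'e::euclidean_space) mfd \<Rightarrow> 'a metric \<Rightarrow> nat \<Rightarrow> ('a \<Rightarrow> 'a tvec set) \<Rightarrow> ('a \<Rightarrow> 'a tvec set) \<Rightarrow> bool" where
  "almost_robinson M g m N K \<longleftrightarrow>
     complex_distribution M (m + 1) N \<and> real_distribution M 1 K \<and>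
     (\<forall>p\<in>topspace (mtop M). (\<forall>Z\<in>N p. \<forall>W\<in>N p. complexify g p Z W = 0) \<and>
        ctv.span (K p) = N p \<inter> tconj ` N p)"

definition nearly_robinson ::
  "('a, 'e::euclidean_space) mfd \<Rightarrow> 'a metric \<Rightarrow> nat \<Rightarrow> ('a \<Rightarrow> 'a tvec set) \<Rightarrow> ('a \<Rightarrow> 'a tvec set) \<Rightarrow> bool" where
  "nearly_robinson M g m N K \<longleftrightarrow> almost_robinson M g m N K \<and>
     (\<forall>W X Z. rvector_field M W X \<longrightarrow> (\<forall>p\<in>W. X p \<in> K p) \<longrightarrow>
        cvector_field M W Z \<longrightarrow> (\<forall>p\<in>W. Z p \<in> N p) \<longrightarrow> (\<forall>p\<in>W. lie_bracket M X Z p \<in> N p))"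

definition integral_curve_in ::
  "('a, 'e::euclidean_space) mfd \<Rightarrow> ('a \<Rightarrow> 'a tvec set) \<Rightarrow> 'a set \<Rightarrow> real \<Rightarrow> real \<Rightarrow> (real \<Rightarrow> 'a) \<Rightarrow> bool" where
  "integral_curve_in M K U a b \<gamma> \<longleftrightarrow> smooth_map (euclidean_mfd {a<..<b}) M \<gamma> \<and>
     (\<forall>t\<in>{a<..<b}. \<gamma> t \<in> U \<and> velocity M \<gamma> t \<in> K (\<gamma> t) \<and> velocity M \<gamma> t \<noteq> 0)"

(* The maximal integral curve in U through p, as a point set. *)
definition leaf ::
  "('a, 'e::euclidean_space) mfd \<Rightarrow> ('a \<Rightarrow> 'a tvec set) \<Rightarrow> 'a set \<Rightarrow> 'a \<Rightarrow> 'a set" where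
  "leaf M K U p = \<Union> {\<gamma> ` {a<..<b} |a b \<gamma>. integral_curve_in M K U a b \<gamma> \<and> p \<in> \<gamma> ` {a<..<b}}"

(* B is the local leaf space: its points are the leaves in U. The leaf projection is a component
   of a diffeomorphism from U onto the trivial line bundle over B. *)
definition leaf_space_trivialization ::
  "('a, 'e::euclidean_space) mfd \<Rightarrow> ('a \<Rightarrow> 'a tvec set) \<Rightarrow> 'a set \<Rightarrow> ('a set, 'f::euclidean_space) mfd \<Rightarrow>
    ('a \<Rightarrow> real \<times> 'a set) \<Rightarrow> bool" where
  "leaf_space_trivialization M K U B \<Phi> \<longleftrightarrow>
     smooth_manifold B \<and> topspace (mtop B) = leaf M K U ` U \<and>
     diffeomorphism (open_submfd M U) (prod_mfd (euclidean_mfd UNIV) B) \<Phi> \<and>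
     (\<forall>p\<in>U. snd (\<Phi> p) = leaf M K U p)"

definition perp :: "('a, 'e::euclidean_space) mfd \<Rightarrow> 'a metric \<Rightarrow> ('a \<Rightarrow> 'a tvec set) \<Rightarrow> 'a \<Rightarrow> 'a tvec set" where
  "perp M g K p = {X \<in> rtangent M p. \<forall>Y\<in>K p. g p X Y = 0}"


section \<open>Almost CR structures\<close>

definition almost_CR ::
  "('b, 'f::euclidean_space) mfd \<Rightarrow> nat \<Rightarrow> ('b \<Rightarrow> 'b tvec set) \<Rightarrow> ('b \<Rightarrow> 'b tvec \<Rightarrow> 'b tvec) \<Rightarrow> bool" where
  "almost_CR B m H J \<longleftrightarrow> DIM('f) = 2 * m + 1 \<and> real_distribution B (2 * m) H \<and>
     (\<forall>q\<in>topspace (mtop B). J q ` H q \<subseteq> H q \<and>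
        (\<forall>X\<in>H q. \<forall>Y\<in>H q. J q (X + Y) = J q X + J q Y) \<and>
        (\<forall>c. \<forall>X\<in>H q. J q (rtscale c X) = rtscale c (J q X)) \<and>
        (\<forall>X\<in>H q. J q (J q X) = - X)) \<and>
     (\<forall>W X. rvector_field B W X \<longrightarrow> (\<forall>q\<in>W. X q \<in> H q) \<longrightarrow> rvector_field B W (\<lambda>q. J q (X q)))"

definition J_eigen :: "('b \<Rightarrow> 'b tvec set) \<Rightarrow> ('b \<Rightarrow> 'b tvec \<Rightarrow> 'b tvec) \<Rightarrow> complex \<Rightarrow> 'b \<Rightarrow> 'b tvec set" where
  "J_eigen H J c q = {Z \<in> ctv.span (H q). J q (tRe Z) + tscale \<i> (J q (tIm Z)) = tscale c Z}"

abbreviation "H10 H J \<equiv> J_eigen H J \<i>"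
abbreviation "H01 H J \<equiv> J_eigen H J (- \<i>)"

definition descends_to ::
  "('a, 'e::euclidean_space) mfd \<Rightarrow> 'a metric \<Rightarrow> ('a \<Rightarrow> 'a tvec set) \<Rightarrow> ('a \<Rightarrow> 'a tvec set) \<Rightarrow> 'a set \<Rightarrow>
    ('b, 'f::euclidean_space) mfd \<Rightarrow> ('a \<Rightarrow> 'b) \<Rightarrow>
    ('b \<Rightarrow> 'b tvec set) \<Rightarrow> ('b \<Rightarrow> 'b tvec \<Rightarrow> 'b tvec) \<Rightarrow> bool" where
  "descends_to M g N K U B pr H J \<longleftrightarrow> (\<forall>p\<in>U.
     push B pr p ` perp M g K p = H (pr p) \<and>
     push B pr p ` N p = H01 H J (pr p) \<and>
     push B pr p ` tconj ` N p = H10 H J (pr p))"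

(* The covectors of fs at each point form a basis of the complexified cotangent space. *)
definition coframe :: "('b, 'f::euclidean_space) mfd \<Rightarrow> 'b form list \<Rightarrow> bool" where
  "coframe B fs \<longleftrightarrow> (\<forall>q\<in>topspace (mtop B). \<forall>\<omega>. complex_linear_on (ctangent B q) \<omega> \<longrightarrow>
     (\<exists>!c. c \<in> extensional {..<length fs} \<and>
        (\<forall>Z\<in>ctangent B q. \<omega> Z = (\<Sum>i<length fs. c i * (fs ! i) q Z))))"

definition CR_coframe ::
  "('b, 'f::euclidean_space) mfd \<Rightarrow> nat \<Rightarrow> ('b \<Rightarrow> 'b tvec set) \<Rightarrow> ('b \<Rightarrow> 'b tvec \<Rightarrow> 'b tvec) \<Rightarrow>
    'b form \<Rightarrow> (nat \<Rightarrow> 'b form) \<Rightarrow> bool" where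
  "CR_coframe B m H J \<theta>\<^sub>0 \<theta> \<longleftrightarrow>
     rform B (topspace (mtop B)) \<theta>\<^sub>0 \<and> (\<forall>\<alpha><m. cform B (topspace (mtop B)) (\<theta> \<alpha>)) \<and>
     coframe B (\<theta>\<^sub>0 # map \<theta> [0..<m] @ map (\<lambda>\<alpha>. conj_form (\<theta> \<alpha>)) [0..<m]) \<and>
     (\<forall>q\<in>topspace (mtop B).
        H q = {X \<in> rtangent B q. \<theta>\<^sub>0 q X = 0} \<and>
        H01 H J q = {Z \<in> ctangent B q. \<theta>\<^sub>0 q Z = 0 \<and> (\<forall>\<alpha><m. \<theta> \<alpha> q Z = 0)})"

end

theory Submission
  imports Defs
begin

text \<open>By the flow box theorem \<open>K\<close> is locally spanned by \<open>X = \<partial>\<^sub>t\<close> in coordinates \<open>(t, x)\<close>; once \<open>t\<close> is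
  rescaled to range over the whole line, \<open>(t, x)\<close> trivialises the leaf projection. Let \<open>\<omega>\<close> be a covector of the leaf
  space that annihilates the projection of \<open>N\<close> at one point of a leaf. Since \<open>[X, N] \<subseteq> N\<close>, the values of \<open>\<omega>\<close> on
  the projections of a frame of \<open>N\<close> along the leaf solve a homogeneous linear differential equation, so they vanish.
  Hence \<open>N\<close> and its conjugate descend, and projecting a frame from the slice \<open>t = 0\<close> gives a CR coframe.
  Its real form \<open>\<theta>\<^sub>0\<close> annihilates the projections of \<open>N\<close> and of its conjugate, and so does \<open>g(X, \<cdot>)\<close> because \<open>N\<close>
  is null; by dimension \<open>g(X, \<cdot>)\<close> is a multiple of the pullback of \<open>\<theta>\<^sub>0\<close>. Expanding \<open>g\<close> in a lift of the dual
  frame, only the terms of the normal form survive.\<close>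

section \<open>Calculus of $C^k$ maps\<close>

text \<open>The analytic weight lies in differentiating flows with respect to their initial values,
  since a chart must be smooth in both directions. This is a bootstrap: the derivative of a flow
  solves a linear equation whose coefficients are as smooth as the flow itself, which raises the
  order of differentiability by one. The other recurring smoothness question (for inverse maps,
  coframes, bracket coefficients) concerns the solution of a linear system with smooth entries and
  is settled by one elimination argument. The leaf space has to consist of the actual leaves inside
  \<open>U\<close>, so \<open>U\<close> must be a box whose \<open>t\<close>-fibres are exactly
  these leaves. Rescaling \<open>t\<close> multiplies \<open>X\<close> by a function, which is
  harmless because the bracket condition is assumed for every section of \<open>K\<close>. The
  remaining free choice is a constant direction \<open>b0\<close> not orthogonal to
  \<open>K\<close>; nondegeneracy of \<open>g\<close> supplies it. Its field \<open>L\<close>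
  completes the frame and projects to the leaf space, but it need not be null, and this is why
  \<open>lam\<close> is not simply half of \<open>g(L, -)\<close>.\<close>

lemma ck_on_SucI:
  assumes "open S" "\<And>x. x \<in> S \<Longrightarrow> (f has_derivative f' x) (at x)" "\<And>v. ck_on k S (\<lambda>x. f' x v)"
    and cong: "\<And>g h :: 'e::euclidean_space \<Rightarrow> 'v::real_normed_vector. (\<And>x. x \<in> S \<Longrightarrow> g x = h x) \<Longrightarrow> ck_on k S g \<Longrightarrow> ck_on k S h"
  shows "ck_on (Suc k) S (f :: 'e \<Rightarrow> 'v)"
proof -
  have eq: "f' x = frechet_derivative f (at x)" if "x \<in> S" for x
    using assms(2)[OF that] by (rule frechet_derivative_at)
  have "ck_on k S (\<lambda>x. frechet_derivative f (at x) v)" for v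
    by (rule cong[OF _ assms(3)[of v]]) (simp add: eq)
  then show ?thesis using assms(2) by (auto simp: differentiable_def)
qed

lemma ck_on_cong:
  fixes f :: "'e::euclidean_space \<Rightarrow> 'v::real_normed_vector"
  assumes "open S" "\<And>x. x \<in> S \<Longrightarrow> f x = g x" "ck_on k S f"
  shows "ck_on k S g"
  using assms(2,3)
proof (induction k arbitrary: f g)
  case 0
  then have "continuous_on S f = continuous_on S g" by (intro continuous_on_cong) auto
  then show ?case using 0 by simp
next
  case (Suc k)
  have d: "(g has_derivative frechet_derivative f (at x)) (at x)" if "x \<in> S" for x
    using Suc.prems that assms(1)
    by (auto intro!: has_derivative_transform_within_open[of f _ x UNIV S g] simp: frechet_derivative_works[symmetric])
  show ?case
    by (rule ck_on_SucI[OF assms(1) d]) (use Suc in auto)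
qed

text \<open>\<open>ck_on_SucI\<close> freed of its congruence premise. That premise was a device:
  \<open>ck_on_cong\<close> is itself proved by induction through \<open>ck_on_SucI\<close>, with
  the induction hypothesis in its place. A candidate derivative \<open>f'\<close> is easier to
  handle than \<open>frechet_derivative\<close>, with which it is known to agree only on
  \<open>S\<close>.\<close>

lemma ck_on_derivI:
  fixes f :: "'e::euclidean_space \<Rightarrow> 'v::real_normed_vector"
  assumes "open S" "\<And>x. x \<in> S \<Longrightarrow> (f has_derivative f' x) (at x)" "\<And>v. ck_on k S (\<lambda>x. f' x v)"
  shows "ck_on (Suc k) S f"
  by (rule ck_on_SucI[OF assms]) (use ck_on_cong[OF assms(1)] in blast)+

lemma ck_on_has_derivative:
  "ck_on (Suc k) S f \<Longrightarrow> x \<in> S \<Longrightarrow> (f has_derivative frechet_derivative f (at x)) (at x)"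
  by (simp add: frechet_derivative_works[symmetric])

lemma ck_on_frechet: "ck_on (Suc k) S f \<Longrightarrow> ck_on k S (\<lambda>x. frechet_derivative f (at x) v)"
  by simp

lemma ck_on_subset: "ck_on k S f \<Longrightarrow> T \<subseteq> S \<Longrightarrow> ck_on k T f"
  by (induction k arbitrary: f) (auto intro: continuous_on_subset)

text \<open>The recursion for \<open>ck_on\<close> asks for differentiability and for
  \<open>ck_on k\<close> derivatives, but not for \<open>ck_on k\<close> of the function itself, so
  monotonicity in \<open>k\<close> takes an induction; at the bottom, differentiability gives
  continuity.\<close>

lemma ck_on_SucD: "ck_on (Suc k) S f \<Longrightarrow> ck_on k S f"
proof (induction k arbitrary: f)
  case 0
  then have "continuous_on S f"
    by (auto intro!: continuous_at_imp_continuous_on differentiable_imp_continuous_within)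
  then show ?case by simp
next
  case (Suc k)
  have "ck_on k S (\<lambda>x. frechet_derivative f (at x) v)" for v
    by (rule Suc.IH[OF ck_on_frechet[OF Suc.prems]])
  then show ?case using Suc.prems by simp
qed

lemma ck_on_continuous: "ck_on k S f \<Longrightarrow> continuous_on S f"
  by (induction k) (use ck_on_SucD in auto)

text \<open>Derivatives are taken \<open>at x\<close> in the full space, so only the germ of
  \<open>f\<close> at each point of \<open>S\<close> matters and \<open>T\<close> may stick out of
  \<open>S\<close>.\<close>

lemma ck_on_local:
  assumes "\<And>x. x \<in> S \<Longrightarrow> \<exists>T. open T \<and> x \<in> T \<and> ck_on k T f"
  shows "ck_on k S f"
  using assms
proof (induction k arbitrary: f)
  case 0
  then show ?case
    unfolding ck_on.simps by (intro continuous_at_imp_continuous_on ballI) (metis continuous_on_eq_continuous_at)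
next
  case (Suc k)
  have "f differentiable at x" if "x \<in> S" for x
    using Suc.prems[OF that] by auto
  moreover have "ck_on k S (\<lambda>x. frechet_derivative f (at x) v)" for v
  proof (rule Suc.IH)
    fix x assume "x \<in> S"
    then obtain T where "open T" "x \<in> T" "ck_on (Suc k) T f" using Suc.prems by blast
    then show "\<exists>T. open T \<and> x \<in> T \<and> ck_on k T (\<lambda>x. frechet_derivative f (at x) v)"
      using ck_on_frechet by blast
  qed
  ultimately show ?case by simp
qed

lemma ck_on_const: "open S \<Longrightarrow> ck_on k S (\<lambda>x. c)"
proof (induction k arbitrary: c)
  case (Suc k)
  show ?case
    by (rule ck_on_derivI[of _ _ "\<lambda>_ _. 0"]) (use Suc in auto)
qed simp

lemma ck_on_bounded_linear:
  assumes "open S" "bounded_linear f"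
  shows "ck_on k S f"
proof (cases k)
  case 0
  then show ?thesis using assms by (simp add: linear_continuous_on)
next
  case (Suc n)
  show ?thesis unfolding Suc
    by (rule ck_on_derivI[of _ _ "\<lambda>_. f"]) (use assms in \<open>auto intro: ck_on_const bounded_linear_imp_has_derivative\<close>)
qed

lemma ck_on_linear_compose:
  fixes f :: "'e::euclidean_space \<Rightarrow> 'v::real_normed_vector"
  assumes "open S" "bounded_linear L" "ck_on k S f"
  shows "ck_on k S (\<lambda>x. L (f x))"
  using assms(3)
proof (induction k arbitrary: f)
  case 0
  then show ?case using bounded_linear.continuous_on[OF assms(2)] by simp
next
  case (Suc k)
  show ?case
  proof (rule ck_on_derivI[OF assms(1)])
    show "((\<lambda>x. L (f x)) has_derivative (\<lambda>v. L (frechet_derivative f (at x) v))) (at x)" if "x \<in> S" for x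
      by (rule bounded_linear.has_derivative[OF assms(2) ck_on_has_derivative[OF Suc.prems that]])
    show "ck_on k S (\<lambda>x. L (frechet_derivative f (at x) v))" for v
      by (rule Suc.IH[OF ck_on_frechet[OF Suc.prems]])
  qed
qed

lemma ck_on_add:
  fixes f g :: "'e::euclidean_space \<Rightarrow> 'v::real_normed_vector"
  assumes "open S" "ck_on k S f" "ck_on k S g"
  shows "ck_on k S (\<lambda>x. f x + g x)"
  using assms(2,3)
proof (induction k arbitrary: f g)
  case 0
  then show ?case by (auto intro!: continuous_intros)
next
  case (Suc k)
  show ?case
  proof (rule ck_on_derivI[OF assms(1)])
    show "((\<lambda>x. f x + g x) has_derivative (\<lambda>v. frechet_derivative f (at x) v + frechet_derivative g (at x) v)) (at x)"
      if "x \<in> S" for x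
      by (rule has_derivative_add[OF ck_on_has_derivative[OF Suc.prems(1) that] ck_on_has_derivative[OF Suc.prems(2) that]])
    show "ck_on k S (\<lambda>x. frechet_derivative f (at x) v + frechet_derivative g (at x) v)" for v
      by (rule Suc.IH[OF ck_on_frechet[OF Suc.prems(1)] ck_on_frechet[OF Suc.prems(2)]])
  qed
qed

lemma ck_on_sum:
  fixes f :: "'i \<Rightarrow> 'e::euclidean_space \<Rightarrow> 'v::real_normed_vector"
  assumes "open S" "\<And>i. i \<in> I \<Longrightarrow> ck_on k S (f i)"
  shows "ck_on k S (\<lambda>x. \<Sum>i\<in>I. f i x)"
proof (cases "finite I")
  case True
  then show ?thesis using assms(2)
    by (induction I) (simp_all add: ck_on_const ck_on_add assms(1) del: ck_on.simps)
qed (simp add: ck_on_const assms(1) del: ck_on.simps)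

text \<open>Product rule: the derivative of a bilinear expression is a sum of two such expressions
  with one factor differentiated, hence the induction over both \<open>f\<close> and
  \<open>g\<close>.\<close>

lemma ck_on_bilinear:
  fixes f :: "'e::euclidean_space \<Rightarrow> 'u::real_normed_vector" and g :: "'e \<Rightarrow> 'w::real_normed_vector"
  assumes "open S" "bounded_bilinear B" "ck_on k S f" "ck_on k S g"
  shows "ck_on k S (\<lambda>x. B (f x) (g x))"
  using assms(3,4)
proof (induction k arbitrary: f g)
  case 0
  then show ?case using bounded_bilinear.continuous_on[OF assms(2)] by auto
next
  case (Suc k)
  show ?case
  proof (rule ck_on_derivI[OF assms(1)])
    show "((\<lambda>x. B (f x) (g x)) has_derivative
       (\<lambda>v. B (f x) (frechet_derivative g (at x) v) + B (frechet_derivative f (at x) v) (g x))) (at x)"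
      if "x \<in> S" for x
      by (rule bounded_bilinear.FDERIV[OF assms(2) ck_on_has_derivative[OF Suc.prems(1) that]
         ck_on_has_derivative[OF Suc.prems(2) that]])
    show "ck_on k S (\<lambda>x. B (f x) (frechet_derivative g (at x) v) + B (frechet_derivative f (at x) v) (g x))" for v
      by (intro ck_on_add assms(1) Suc.IH[OF ck_on_SucD[OF Suc.prems(1)] ck_on_frechet[OF Suc.prems(2)]]
        Suc.IH[OF ck_on_frechet[OF Suc.prems(1)] ck_on_SucD[OF Suc.prems(2)]])
  qed
qed

lemmas ck_on_mult = ck_on_bilinear[OF _ bounded_bilinear_mult]
lemmas ck_on_scaleR = ck_on_bilinear[OF _ bounded_bilinear_scaleR]

lemma ck_on_minus:
  fixes f :: "'e::euclidean_space \<Rightarrow> 'v::real_normed_vector"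
  shows "open S \<Longrightarrow> ck_on k S f \<Longrightarrow> ck_on k S (\<lambda>x. - f x)"
  by (rule ck_on_linear_compose[of _ uminus]) (auto intro: bounded_linear_minus bounded_linear_ident)

lemma ck_on_diff:
  fixes f g :: "'e::euclidean_space \<Rightarrow> 'v::real_normed_vector"
  shows "open S \<Longrightarrow> ck_on k S f \<Longrightarrow> ck_on k S g \<Longrightarrow> ck_on k S (\<lambda>x. f x - g x)"
  using ck_on_add[of S k f "\<lambda>x. - g x"] ck_on_minus[of S k g] by simp

lemma ck_on_divide:
  fixes f g :: "'e::euclidean_space \<Rightarrow> 'v::real_normed_field"
  assumes "open S" "ck_on k S f" "ck_on k S g" "\<And>x. x \<in> S \<Longrightarrow> g x \<noteq> 0"
  shows "ck_on k S (\<lambda>x. f x / g x)"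
proof -
  have "ck_on k S (\<lambda>x. inverse (g x))"
    using assms(3,4)
  proof (induction k)
    case 0
    then show ?case by (auto intro!: continuous_intros)
  next
    case (Suc k)
    show ?case
    proof (rule ck_on_derivI[OF assms(1)])
      show "((\<lambda>x. inverse (g x)) has_derivative
         (\<lambda>v. - (inverse (g x) * frechet_derivative g (at x) v * inverse (g x)))) (at x)" if "x \<in> S" for x
        by (rule Deriv.has_derivative_inverse[OF Suc.prems(2)[OF that] ck_on_has_derivative[OF Suc.prems(1) that]])
      show "ck_on k S (\<lambda>x. - (inverse (g x) * frechet_derivative g (at x) v * inverse (g x)))" for v
        by (intro ck_on_minus ck_on_mult assms(1) Suc.IH ck_on_SucD[OF Suc.prems(1)] ck_on_frechet[OF Suc.prems(1)] Suc.prems(2))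
    qed
  qed
  then show ?thesis unfolding divide_inverse by (intro ck_on_mult assms)
qed

text \<open>In the chain rule the direction \<open>frechet_derivative f (at x) v\<close> moves with
  \<open>x\<close>, while \<open>ck_on\<close> speaks of fixed directions only. Expanding it over
  \<open>Basis\<close> leaves products of derivatives of \<open>f\<close> with derivatives of
  \<open>g\<close> in fixed directions composed with \<open>f\<close>, and to the latter the
  induction hypothesis applies.\<close>

lemma ck_on_compose:
  fixes f :: "'e::euclidean_space \<Rightarrow> 'f::euclidean_space" and g :: "'f \<Rightarrow> 'v::real_normed_vector"
  assumes "open S" "ck_on k S f" "ck_on k T g" "f ` S \<subseteq> T"
  shows "ck_on k S (\<lambda>x. g (f x))"
  using assms(2,3)
proof (induction k arbitrary: g)
  case 0
  then show ?case using continuous_on_compose2[of T g S f] assms(4) by simp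
next
  case (Suc k)
  have gd: "(g has_derivative frechet_derivative g (at (f x))) (at (f x))" if "x \<in> S" for x
    using that assms(4) by (intro ck_on_has_derivative[OF Suc.prems(2)]) blast
  have eq: "frechet_derivative g (at (f x)) w = (\<Sum>b\<in>Basis. (w \<bullet> b) *\<^sub>R frechet_derivative g (at (f x)) b)"
    if "x \<in> S" for x w
  proof -
    interpret bounded_linear "frechet_derivative g (at (f x))"
      using gd[OF that] by (rule has_derivative_bounded_linear)
    have "frechet_derivative g (at (f x)) w = frechet_derivative g (at (f x)) (\<Sum>b\<in>Basis. (w \<bullet> b) *\<^sub>R b)"
      by (simp add: euclidean_representation)
    then show ?thesis by (simp add: sum scaleR)
  qed
  show ?case
  proof (rule ck_on_derivI[OF assms(1)])
    show "((\<lambda>x. g (f x)) has_derivative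
       (\<lambda>v. \<Sum>b\<in>Basis. (frechet_derivative f (at x) v \<bullet> b) *\<^sub>R frechet_derivative g (at (f x)) b)) (at x)"
      if "x \<in> S" for x
      using has_derivative_compose[OF ck_on_has_derivative[OF Suc.prems(1) that] gd[OF that]]
      by (simp only: eq[OF that, of "frechet_derivative f (at x) v" for v, symmetric])
    show "ck_on k S (\<lambda>x. \<Sum>b\<in>Basis. (frechet_derivative f (at x) v \<bullet> b) *\<^sub>R frechet_derivative g (at (f x)) b)" for v
      by (intro ck_on_sum ck_on_scaleR assms(1) ck_on_linear_compose[OF assms(1) bounded_linear_inner_left]
         Suc.IH[OF ck_on_SucD[OF Suc.prems(1)] ck_on_frechet[OF Suc.prems(2)]] ck_on_frechet[OF Suc.prems(1)])
  qed
qed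

lemma ck_on_Pair:
  fixes f :: "'e::euclidean_space \<Rightarrow> 'u::real_normed_vector" and g :: "'e \<Rightarrow> 'w::real_normed_vector"
  assumes "open S" "ck_on k S f" "ck_on k S g"
  shows "ck_on k S (\<lambda>x. (f x, g x))"
proof -
  have "ck_on k S (\<lambda>x. (f x, 0 :: 'w) + (0 :: 'u, g x))"
    by (rule ck_on_add[OF assms(1) ck_on_linear_compose[OF assms(1) _ assms(2)] ck_on_linear_compose[OF assms(1) _ assms(3)]])
      (simp_all add: bounded_linear_Pair bounded_linear_ident bounded_linear_zero)
  then show ?thesis by simp
qed

text \<open>The maps \<open>A x\<close> are controlled on fixed vectors only; expanding the moving
  argument over \<open>Basis\<close> reduces to these.\<close>

lemma ck_on_linear_basis:
  fixes A :: "'e::euclidean_space \<Rightarrow> 'f::euclidean_space \<Rightarrow> 'v::real_normed_vector"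
  assumes "open S" "\<And>x. x \<in> S \<Longrightarrow> linear (A x)" "\<And>b. ck_on k S (\<lambda>x. A x b)" "ck_on k S y"
  shows "ck_on k S (\<lambda>x. A x (y x))"
proof -
  have *: "ck_on k S (\<lambda>x. \<Sum>b\<in>Basis. (y x \<bullet> b) *\<^sub>R A x b)"
    by (intro ck_on_sum ck_on_scaleR ck_on_linear_compose[OF assms(1) bounded_linear_inner_left] assms)
  have "(\<Sum>b\<in>Basis. (y x \<bullet> b) *\<^sub>R A x b) = A x (y x)" if "x \<in> S" for x
  proof -
    interpret linear "A x" by (rule assms(2)[OF that])
    have "A x (y x) = A x (\<Sum>b\<in>Basis. (y x \<bullet> b) *\<^sub>R b)" by (simp add: euclidean_representation)
    then show ?thesis by (simp add: sum scale)
  qed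
  then show ?thesis by (rule ck_on_cong[OF assms(1) _ *])
qed

section \<open>Dependence of solutions of differential equations on parameters\<close>

lemma vector_derivative_bound:
  fixes f :: "real \<Rightarrow> 'v::real_normed_vector"
  assumes "convex S" "\<And>t. t \<in> S \<Longrightarrow> (f has_vector_derivative f' t) (at t within S)"
    "\<And>t. t \<in> S \<Longrightarrow> norm (f' t) \<le> B" "a \<in> S" "b \<in> S"
  shows "norm (f a - f b) \<le> B * \<bar>a - b\<bar>"
proof -
  have "norm (f a - f b) \<le> B * norm (a - b)"
  proof (rule differentiable_bound[OF assms(1) _ _ assms(4,5)])
    show "(f has_derivative (\<lambda>h. h *\<^sub>R f' t)) (at t within S)" if "t \<in> S" for t
      using assms(2)[OF that] by (simp add: has_vector_derivative_def)
    show "onorm (\<lambda>h. h *\<^sub>R f' t) \<le> B" if "t \<in> S" for t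
      using mult_right_mono[OF assms(3)[OF that] abs_ge_zero] by (intro onorm_le) (simp add: mult.commute)
  qed
  then show ?thesis by simp
qed

text \<open>A short-time substitute for Gronwall's inequality. At a point \<open>s\<close> where
  \<open>norm (r s)\<close> is maximal, the mean value inequality bounds it by
  \<open>norm (r 0) + T * (L * norm (r s) + e)\<close>; as \<open>L * T \<le> 1/2\<close>, half of
  the maximum can be absorbed on the left, whence the factor 2.\<close>

lemma ode_estimate:
  fixes r :: "real \<Rightarrow> 'v::real_normed_vector"
  assumes "0 \<le> T" and r: "\<And>t. t \<in> {-T..T} \<Longrightarrow> (r has_vector_derivative r' t) (at t within {-T..T})"
    and b: "\<And>t. t \<in> {-T..T} \<Longrightarrow> norm (r' t) \<le> L * norm (r t) + e"
    and "0 \<le> L" "L * T \<le> 1/2" "0 \<le> e" "t \<in> {-T..T}"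
  shows "norm (r t) \<le> 2 * (norm (r 0) + T * e)"
proof -
  have "continuous_on {-T..T} r"
    using r by (meson continuous_on_eq_continuous_within has_vector_derivative_continuous)
  then have "continuous_on {-T..T} (\<lambda>t. norm (r t))" by (rule continuous_on_norm)
  moreover have "{-T..T} \<noteq> {}" using assms(1) by simp
  ultimately obtain s where s: "s \<in> {-T..T}" "\<And>t. t \<in> {-T..T} \<Longrightarrow> norm (r t) \<le> norm (r s)"
    using continuous_attains_sup[of "{-T..T}" "\<lambda>t. norm (r t)"] compact_Icc by blast
  have B: "norm (r' t) \<le> L * norm (r s) + e" if "t \<in> {-T..T}" for t
    using b[OF that] mult_left_mono[OF s(2)[OF that] assms(4)] by linarith
  have "norm (r s - r 0) \<le> (L * norm (r s) + e) * \<bar>s - 0\<bar>"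
    using vector_derivative_bound[OF _ r B, where a=s and b=0] s(1) assms(1) by simp
  also have "\<dots> \<le> (L * norm (r s) + e) * T"
    using s(1) assms by (intro mult_left_mono) (auto simp: abs_le_iff)
  also have "\<dots> = (L * T) * norm (r s) + T * e" by (simp add: algebra_simps)
  also have "\<dots> \<le> 1/2 * norm (r s) + T * e"
    using mult_right_mono[OF assms(5) norm_ge_zero[of "r s"]] by simp
  finally have "norm (r s) - norm (r 0) \<le> 1/2 * norm (r s) + T * e"
    using norm_triangle_ineq2[of "r s" "r 0"] by (rule order_trans[rotated])
  then have "norm (r s) \<le> 2 * (norm (r 0) + T * e)" by (simp add: algebra_simps)
  then show ?thesis using s(2)[OF assms(7)] by linarith
qed

text \<open>Picard's contraction: the equation becomes a fixed point problem on the complete space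
  of bounded continuous functions, on which the integral operator contracts by the factor
  \<open>L * T \<le> 1/2\<close>.\<close>

lemma ode_exists:
  fixes F :: "real \<Rightarrow> 'v::banach \<Rightarrow> 'v"
  assumes "0 \<le> T" and F: "continuous_on ({-T..T} \<times> UNIV) (\<lambda>(t, y). F t y)"
    and Lip: "\<And>t y z. t \<in> {-T..T} \<Longrightarrow> norm (F t y - F t z) \<le> L * norm (y - z)"
    and "0 \<le> L" "L * T \<le> 1/2"
  obtains y where "y 0 = y0" "\<And>t. t \<in> {-T..T} \<Longrightarrow> (y has_vector_derivative F t (y t)) (at t within {-T..T})"
proof -
  \<comment> \<open>Clamping time to the interval lets functions on the whole line stand for
    functions on \<open>{-T..T}\<close>, so that the type of bounded continuous functions can be
    used.\<close>
  define c where "c t = max (-T) (min T t)" for t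
  have c: "c t \<in> {-T..T}" "t \<in> {-T..T} \<Longrightarrow> c t = t" for t using assms(1) by (auto simp: c_def)
  have cc: "continuous_on UNIV c" unfolding c_def by (intro continuous_intros)
  define H where "H \<phi> t = integral {-T..t} (\<lambda>s. F s (apply_bcontfun \<phi> s))" for \<phi> :: "real \<Rightarrow>\<^sub>C 'v" and t
  have Fc: "continuous_on {-T..T} (\<lambda>s. F s (apply_bcontfun \<phi> s))" for \<phi> :: "real \<Rightarrow>\<^sub>C 'v"
  proof -
    have "continuous_on {-T..T} (\<lambda>s. (\<lambda>(t, y). F t y) (s, apply_bcontfun \<phi> s))"
      by (rule continuous_on_compose2[OF F]) (auto intro!: continuous_intros)
    then show ?thesis by simp
  qed
  have Hd: "(H \<phi> has_vector_derivative F t (apply_bcontfun \<phi> t)) (at t within {-T..T})" if "t \<in> {-T..T}" for t \<phi>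
    unfolding H_def by (rule integral_has_vector_derivative[OF Fc that])
  \<comment> \<open>The integral starts at \<open>-T\<close>; subtracting its value at 0 moves the
    initial condition to time 0 and serves both directions of time.\<close>
  define g where "g \<phi> t = y0 + (H \<phi> (c t) - H \<phi> 0)" for \<phi> t
  have g: "g \<phi> \<in> bcontfun" for \<phi>
  proof -
    have Hc: "continuous_on {-T..T} (H \<phi>)"
      using Hd by (meson continuous_on_eq_continuous_within has_vector_derivative_continuous)
    then have "compact (H \<phi> ` {-T..T})" by (intro compact_continuous_image) auto
    then obtain B where B: "\<And>t. t \<in> {-T..T} \<Longrightarrow> norm (H \<phi> t) \<le> B"
      by (meson bounded_iff compact_imp_bounded image_eqI)
    have "continuous_on UNIV (\<lambda>t. H \<phi> (c t))"
      by (rule continuous_on_compose2[OF Hc cc]) (use c in auto)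
    then have "continuous_on UNIV (g \<phi>)" unfolding g_def by (intro continuous_intros)
    moreover have "norm (g \<phi> t) \<le> norm y0 + (B + norm (H \<phi> 0))" for t
      unfolding g_def using B[OF c(1), of t]
      by (intro norm_triangle_le add_left_mono norm_triangle_le_diff) simp
    ultimately show ?thesis by (rule bcontfun_normI)
  qed
  define G where "G \<phi> = Bcontfun (g \<phi>)" for \<phi>
  have G: "apply_bcontfun (G \<phi>) = g \<phi>" for \<phi>
    unfolding G_def using g by (rule Bcontfun_inverse)
  have "dist (G \<phi>) (G \<psi>) \<le> 1/2 * dist \<phi> \<psi>" for \<phi> \<psi>
  proof (rule dist_bound)
    fix t
    let ?D = "\<lambda>t. H \<phi> t - H \<psi> t"
    have "norm (?D (c t) - ?D 0) \<le> (L * dist \<phi> \<psi>) * \<bar>c t - 0\<bar>"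
    proof (rule vector_derivative_bound[of "{-T..T}"])
      show "(?D has_vector_derivative F s (apply_bcontfun \<phi> s) - F s (apply_bcontfun \<psi> s)) (at s within {-T..T})"
        if "s \<in> {-T..T}" for s by (intro has_vector_derivative_diff Hd that)
      show "norm (F s (apply_bcontfun \<phi> s) - F s (apply_bcontfun \<psi> s)) \<le> L * dist \<phi> \<psi>" if "s \<in> {-T..T}" for s
        using Lip[OF that, of "apply_bcontfun \<phi> s" "apply_bcontfun \<psi> s"]
          mult_left_mono[OF dist_bounded[of \<phi> s \<psi>] assms(4)] by (simp add: dist_norm)
    qed (use c assms(1) in auto)
    also have "\<dots> \<le> (L * dist \<phi> \<psi>) * T"
      using c(1)[of t] assms(1,4) by (intro mult_left_mono) (auto simp: abs_le_iff)
    also have "\<dots> = (L * T) * dist \<phi> \<psi>" by simp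
    also have "\<dots> \<le> 1/2 * dist \<phi> \<psi>" using assms(5) by (intro mult_right_mono) auto
    finally show "dist (apply_bcontfun (G \<phi>) t) (apply_bcontfun (G \<psi>) t) \<le> 1/2 * dist \<phi> \<psi>"
      unfolding G g_def dist_norm by (simp add: algebra_simps)
  qed
  then obtain \<phi> where \<phi>: "G \<phi> = \<phi>"
    using banach_fix_type[of "1/2" G] by auto
  have eq: "apply_bcontfun \<phi> t = y0 + (H \<phi> (c t) - H \<phi> 0)" for t
    using G[of \<phi>] unfolding \<phi> g_def by metis
  show ?thesis
  proof
    show "apply_bcontfun \<phi> 0 = y0" unfolding eq using c(2)[of 0] assms(1) by simp
    fix t assume t: "t \<in> {-T..T}"
    have "((\<lambda>t. y0 + (H \<phi> t - H \<phi> 0)) has_vector_derivative 0 + (F t (apply_bcontfun \<phi> t) - 0)) (at t within {-T..T})"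
      by (intro has_vector_derivative_add has_vector_derivative_diff has_vector_derivative_const Hd t)
    then have "((\<lambda>t. y0 + (H \<phi> t - H \<phi> 0)) has_vector_derivative F t (apply_bcontfun \<phi> t)) (at t within {-T..T})"
      by simp
    then show "(apply_bcontfun \<phi> has_vector_derivative F t (apply_bcontfun \<phi> t)) (at t within {-T..T})"
      by (rule has_vector_derivative_transform[OF t, rotated]) (simp add: eq c)
  qed
qed

text \<open>The first-order Taylor remainder is small uniformly along a compact set, because the
  partial derivatives are uniformly continuous on a slightly larger compact set. It will be applied
  along the graph of a solution, where the remainder must be controlled for all times at
  once.\<close>

lemma uniformly_differentiable_on_compact:
  fixes F :: "'z::euclidean_space \<Rightarrow> 'v::real_normed_vector"
  assumes F: "ck_on (Suc 0) S F" and "open S" "compact C" "C \<subseteq> S" "0 < e"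
  obtains d where "0 < d"
    "\<And>z k. z \<in> C \<Longrightarrow> norm k \<le> d \<Longrightarrow> norm (F (z + k) - F z - frechet_derivative F (at z) k) \<le> e * norm k"
proof -
  obtain d0 where d0: "0 < d0" "(\<Union>x\<in>C. cball x d0) \<subseteq> S"
    using compact_subset_open_imp_cball_epsilon_subset[OF assms(3,2,4)] .
  define K where "K = (\<Union>x\<in>C. cball x d0)"
  have K: "compact K" "K \<subseteq> S" unfolding K_def using compact_minkowski_sum_cball[OF assms(3)] d0 by auto
  \<comment> \<open>The error is estimated coordinate by coordinate, and the \<open>DIM('z)\<close>
    contributions must add up to \<open>e\<close>.\<close>
  define e' where "e' = e / DIM('z)"
  have e': "0 < e'" unfolding e'_def using assms(5) by simp
  have "\<exists>d>0. \<forall>z\<in>K. \<forall>z'\<in>K. dist z' z < d \<longrightarrow>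
      dist (frechet_derivative F (at z') b) (frechet_derivative F (at z) b) < e'" for b
  proof -
    have "continuous_on K (\<lambda>z. frechet_derivative F (at z) b)"
      by (rule continuous_on_subset[OF ck_on_continuous[OF ck_on_frechet[OF F]] K(2)])
    then have "uniformly_continuous_on K (\<lambda>z. frechet_derivative F (at z) b)"
      using K(1) by (rule compact_uniformly_continuous)
    then show ?thesis using e' unfolding uniformly_continuous_on_def by blast
  qed
  then obtain d where d: "\<And>b. 0 < d b" "\<And>b z z'. z \<in> K \<Longrightarrow> z' \<in> K \<Longrightarrow> dist z' z < d b \<Longrightarrow>
      dist (frechet_derivative F (at z') b) (frechet_derivative F (at z) b) < e'"
    by metis
  \<comment> \<open>\<open>d0\<close> keeps \<open>z + h\<close> inside the enlarged compact set;
    halving the minimum gives the strict inequality \<open>d1 < d b\<close> for every basis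
    vector.\<close>
  define d1 where "d1 = min d0 (Min (d ` (Basis :: 'z set)) / 2)"
  have Min: "0 < Min (d ` (Basis :: 'z set))" using d(1) by (simp add: Min_gr_iff)
  have d1: "0 < d1" "d1 \<le> d0" unfolding d1_def using d0(1) Min by auto
  have d1b: "d1 < d b" if "b \<in> Basis" for b
  proof -
    have "Min (d ` (Basis :: 'z set)) \<le> d b" using that by simp
    then show ?thesis unfolding d1_def using Min d(1)[of b] by linarith
  qed
  show ?thesis
  proof
    show "0 < d1" by (rule d1)
    fix z k :: 'z assume z: "z \<in> C" and k: "norm k \<le> d1"
    define g where "g h = F (z + h) - F z - frechet_derivative F (at z) h" for h
    have inK: "z + h \<in> K" if "h \<in> cball 0 d1" for h :: 'z
      unfolding K_def using z that d1 by (auto intro!: bexI[of _ z] simp: dist_norm)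
    have zK: "z \<in> K" using inK[of 0] d1 by simp
    have blz: "bounded_linear (frechet_derivative F (at w))" if "w \<in> K" for w
      using ck_on_has_derivative[OF F] that K(2) has_derivative_bounded_linear by blast
    have "norm (g k - g 0) \<le> e * norm (k - 0)"
    proof (rule differentiable_bound[of "cball 0 d1"])
      fix h :: 'z assume h: "h \<in> cball 0 d1"
      have zh: "z + h \<in> S" using inK[OF h] K(2) by blast
      have "((\<lambda>h. F (z + h)) has_derivative (\<lambda>v. frechet_derivative F (at (z + h)) (0 + v))) (at h)"
        by (rule has_derivative_compose[of "\<lambda>h. z + h", OF _ ck_on_has_derivative[OF F zh]])
          (intro has_derivative_add has_derivative_const has_derivative_ident)
      then have "((\<lambda>h. F (z + h)) has_derivative frechet_derivative F (at (z + h))) (at h)" by simp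
      from has_derivative_diff[OF has_derivative_diff[OF this has_derivative_const]
          bounded_linear_imp_has_derivative[OF blz[OF zK]]]
      have "(g has_derivative (\<lambda>v. frechet_derivative F (at (z + h)) v - 0 - frechet_derivative F (at z) v)) (at h)"
        unfolding g_def .
      then show "(g has_derivative (\<lambda>v. frechet_derivative F (at (z + h)) v - frechet_derivative F (at z) v)) (at h within cball 0 d1)"
        by (auto intro: has_derivative_at_withinI)
      interpret A: bounded_linear "\<lambda>v. frechet_derivative F (at (z + h)) v - frechet_derivative F (at z) v"
        by (intro bounded_linear_sub blz inK[OF h] zK)
      let ?A = "\<lambda>v. frechet_derivative F (at (z + h)) v - frechet_derivative F (at z) v"
      show "onorm ?A \<le> e"
      proof (rule onorm_le)
        fix v
        have "?A v = ?A (\<Sum>b\<in>Basis. (v \<bullet> b) *\<^sub>R b)" by (simp only: euclidean_representation)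
        also have "\<dots> = (\<Sum>b\<in>Basis. (v \<bullet> b) *\<^sub>R ?A b)" by (simp only: A.sum A.scaleR)
        finally have "norm (?A v) = norm (\<Sum>b\<in>Basis. (v \<bullet> b) *\<^sub>R ?A b)" by simp
        also have "\<dots> \<le> (\<Sum>b\<in>Basis. norm ((v \<bullet> b) *\<^sub>R ?A b))" by (rule norm_sum)
        also have "\<dots> \<le> (\<Sum>b\<in>(Basis::'z set). norm v * e')"
        proof (rule sum_mono)
          fix b :: 'z assume b: "b \<in> Basis"
          have "dist (z + h) z < d b" using d1b[OF b] h by (simp add: dist_norm)
          then have "norm (?A b) < e'" using d(2)[OF zK inK[OF h]] by (simp add: dist_norm)
          then show "norm ((v \<bullet> b) *\<^sub>R ?A b) \<le> norm v * e'"
            using Basis_le_norm[OF b, of v] by (simp add: mult_mono)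
        qed
        also have "\<dots> = e * norm v" unfolding e'_def by simp
        finally show "norm (?A v) \<le> e * norm v" .
      qed
    qed (use k d1 in auto)
    moreover have "g 0 = 0" unfolding g_def using blz[OF zK] by (simp add: linear_simps)
    ultimately show "norm (F (z + k) - F z - frechet_derivative F (at z) k) \<le> e * norm k"
      unfolding g_def by simp
  qed
qed


text \<open>The difference of two solutions satisfies \<open>ode_estimate\<close>: the Lipschitz
  bound handles the change of the solution, and the change of the parameter contributes
  \<open>F x' t (y x t) - F x t (y x t)\<close>, which is small uniformly in \<open>t\<close> on a
  compact interval. Hence the passage from \<open>T\<close> to some \<open>t0 < T\<close>.\<close>

lemma ode_uniform_dependence:
  fixes y :: "'p::metric_space \<Rightarrow> real \<Rightarrow> 'v::real_normed_vector"
  assumes ode: "\<And>x t. x \<in> W \<Longrightarrow> t \<in> {-T<..<T} \<Longrightarrow> (y x has_vector_derivative F x t (y x t)) (at t)"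
    and init: "continuous_on W (\<lambda>x. y x 0)"
    and F: "continuous_on (W \<times> {-T<..<T} \<times> UNIV) (\<lambda>(x, t, v). F x t v)"
    and Lip: "\<And>x t v w. x \<in> W \<Longrightarrow> t \<in> {-T<..<T} \<Longrightarrow> norm (F x t v - F x t w) \<le> L * norm (v - w)"
    and L: "0 \<le> L" "L * T \<le> 1/2" and x: "x \<in> W" and t0: "0 < t0" "t0 < T" and e: "0 < e"
  obtains X where "open X" "x \<in> X" "\<And>x' t. x' \<in> X \<Longrightarrow> x' \<in> W \<Longrightarrow> t \<in> {-t0..t0} \<Longrightarrow> norm (y x' t - y x t) \<le> e"
proof -
  let ?I = "{-t0..t0}"
  have I: "t \<in> {-T<..<T}" if "t \<in> ?I" for t using that t0 by auto
  have Lt0: "L * t0 \<le> 1/2" using L t0 mult_left_mono[of t0 T L] by linarith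
  \<comment> \<open>Chosen to make the bound \<open>2 * (e' + t0 * e')\<close> delivered by
    \<open>ode_estimate\<close> equal to \<open>e\<close>.\<close>
  define e' where "e' = e / (2 * (1 + t0))"
  have e': "0 < e'" "2 * (e' + t0 * e') = e" proof -
    show "0 < e'" unfolding e'_def using e t0 by simp
    have "2 * (e' + t0 * e') = (2 * (1 + t0)) * e'" by (simp add: algebra_simps)
    also have "\<dots> = e" unfolding e'_def using t0 by simp
    finally show "2 * (e' + t0 * e') = e" .
  qed
  have yc: "continuous_on ?I (y x)"
    using ode[OF x I] by (meson continuous_on_eq_continuous_within has_vector_derivative_continuous continuous_at_imp_continuous_within)
  have "continuous_on (W \<times> ?I) (\<lambda>z. (\<lambda>(x, t, v). F x t v) (fst z, snd z, y x (snd z)))"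
    by (rule continuous_on_compose2[OF F], intro continuous_intros continuous_on_compose2[OF yc])
      (use I in auto)
  then have \<psi>: "continuous_on (W \<times> ?I) (\<lambda>z. F (fst z) (snd z) (y x (snd z)))" by simp
  obtain X1 where X1: "x \<in> X1" "open X1"
    "\<forall>x'\<in>X1 \<inter> W. \<forall>t\<in>?I. dist (F (fst (x', t)) (snd (x', t)) (y x (snd (x', t)))) (F (fst (x, t)) (snd (x, t)) (y x (snd (x, t)))) \<le> e'"
    by (rule continuous_on_prod_compactE[OF \<psi> compact_Icc x e'(1)])
  obtain d where d: "0 < d" "\<forall>x'\<in>W. dist x' x < d \<longrightarrow> dist (y x' 0) (y x 0) < e'"
    using init x e'(1) unfolding continuous_on_iff by blast
  show ?thesis
  proof
    show "open (X1 \<inter> ball x d)" "x \<in> X1 \<inter> ball x d" using X1 d by auto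
    fix x' t assume x': "x' \<in> X1 \<inter> ball x d" "x' \<in> W" and t: "t \<in> ?I"
    have "norm (y x' t - y x t) \<le> 2 * (norm (y x' 0 - y x 0) + t0 * e')"
    proof (rule ode_estimate[of t0 "\<lambda>t. y x' t - y x t" "\<lambda>t. F x' t (y x' t) - F x t (y x t)" L e'])
      fix s assume s: "s \<in> ?I"
      show "((\<lambda>t. y x' t - y x t) has_vector_derivative F x' s (y x' s) - F x s (y x s)) (at s within ?I)"
        by (intro has_vector_derivative_diff has_vector_derivative_at_within[OF ode] x' x I s)
      have "norm (F x' s (y x s) - F x s (y x s)) \<le> e'"
        using X1(3) x' s by (auto simp: dist_norm)
      with Lip[OF x'(2) I[OF s], of "y x' s" "y x s"]
      have "norm (F x' s (y x' s) - F x' s (y x s)) + norm (F x' s (y x s) - F x s (y x s)) \<le> L * norm (y x' s - y x s) + e'"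
        by (rule add_mono)
      then show "norm (F x' s (y x' s) - F x s (y x s)) \<le> L * norm (y x' s - y x s) + e'"
        by (rule order_trans[rotated]) (metis diff_add_cancel add_diff_eq norm_triangle_ineq)
    qed (use t0 L e' t Lt0 in auto)
    also have "\<dots> \<le> 2 * (e' + t0 * e')"
    proof -
      have "dist x' x < d" using x' by (simp add: dist_commute)
      then have "norm (y x' 0 - y x 0) \<le> e'" using d(2) x' by (auto simp: dist_norm less_imp_le)
      then show ?thesis by simp
    qed
    finally show "norm (y x' t - y x t) \<le> e" using e' by simp
  qed
qed

lemma ode_continuous_dependence:
  fixes y :: "'p::metric_space \<Rightarrow> real \<Rightarrow> 'v::real_normed_vector"
  assumes ode: "\<And>x t. x \<in> W \<Longrightarrow> t \<in> {-T<..<T} \<Longrightarrow> (y x has_vector_derivative F x t (y x t)) (at t)"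
    and init: "continuous_on W (\<lambda>x. y x 0)"
    and F: "continuous_on (W \<times> {-T<..<T} \<times> UNIV) (\<lambda>(x, t, v). F x t v)"
    and Lip: "\<And>x t v w. x \<in> W \<Longrightarrow> t \<in> {-T<..<T} \<Longrightarrow> norm (F x t v - F x t w) \<le> L * norm (v - w)"
    and L: "0 \<le> L" "L * T \<le> 1/2"
  shows "continuous_on (W \<times> {-T<..<T}) (\<lambda>(x, t). y x t)"
  unfolding continuous_on_topological
proof (intro ballI allI impI)
  fix z B assume z: "z \<in> W \<times> {-T<..<T}" and B: "open B" "(case z of (x, t) \<Rightarrow> y x t) \<in> B"
  obtain x t where zz: "z = (x, t)" "x \<in> W" "t \<in> {-T<..<T}" using z by auto
  obtain e where e: "0 < e" "ball (y x t) e \<subseteq> B" using B zz(1) open_contains_ball[of B] by auto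
  \<comment> \<open>Strictly between \<open>\<bar>t\<bar>\<close> and \<open>T\<close>, so that a
    neighbourhood of \<open>t\<close> stays in the compact interval.\<close>
  define t0 where "t0 = (\<bar>t\<bar> + T) / 2"
  have t0: "\<bar>t\<bar> < t0" "t0 < T" "0 < t0" using zz(3) unfolding t0_def by auto
  obtain X where X: "open X" "x \<in> X"
    "\<And>x' t. x' \<in> X \<Longrightarrow> x' \<in> W \<Longrightarrow> t \<in> {-t0..t0} \<Longrightarrow> norm (y x' t - y x t) \<le> e / 2"
    using ode_uniform_dependence[OF ode init F Lip L zz(2) t0(3,2), of "e / 2"] e(1) by (metis half_gt_zero)
  have "isCont (y x) t" using ode[OF zz(2,3)] by (rule has_vector_derivative_continuous)
  then obtain d where d: "0 < d" "\<And>s. dist s t < d \<Longrightarrow> dist (y x s) (y x t) < e / 2"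
    using e(1) unfolding continuous_at_eps_delta by (metis half_gt_zero)
  show "\<exists>A. open A \<and> z \<in> A \<and> (\<forall>w\<in>W \<times> {-T<..<T}. w \<in> A \<longrightarrow> (case w of (x, t) \<Rightarrow> y x t) \<in> B)"
  proof (intro exI conjI ballI impI)
    show "open (X \<times> (ball t d \<inter> {-t0<..<t0}))" by (intro open_Times X open_Int) auto
    show "z \<in> X \<times> (ball t d \<inter> {-t0<..<t0})" using zz X d t0 by auto
    fix w assume w: "w \<in> W \<times> {-T<..<T}" "w \<in> X \<times> (ball t d \<inter> {-t0<..<t0})"
    obtain x' s where ws: "w = (x', s)" by (cases w)
    have "dist (y x' s) (y x s) \<le> e / 2" using X(3)[of x' s] w ws by (auto simp: dist_norm)
    moreover have "dist (y x s) (y x t) < e / 2" using d(2)[of s] w ws by (auto simp: dist_commute)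
    ultimately have "dist (y x' s) (y x t) < e" using dist_triangle[of "y x' s" "y x t" "y x s"] by linarith
    then show "(case w of (x, t) \<Rightarrow> y x t) \<in> B" using e(2) ws by (auto simp: dist_commute)
  qed
qed


text \<open>The candidate for the derivative in \<open>x\<close> is the solution \<open>Z\<close> of
  the variational equation, that is, of the equation linearised along the solution through
  \<open>x\<close>. The remainder \<open>R = \<Delta> - Z h\<close> starts with size
  \<open>o(norm h)\<close> and solves the linearised equation up to an error of \<open>e1\<close>
  times the norm of the increment, so \<open>ode_estimate\<close> keeps it of size
  \<open>o(norm h)\<close> throughout the interval.\<close>

lemma ode_differentiable_dependence_aux:
  fixes F :: "('p::euclidean_space \<times> real) \<times> 'v::euclidean_space \<Rightarrow> 'v" and y :: "'p \<times> real \<Rightarrow> 'v"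
  assumes W: "open W" and ode: "\<And>x t. x \<in> W \<Longrightarrow> t \<in> {-T<..<T} \<Longrightarrow>
      ((\<lambda>t. y (x, t)) has_vector_derivative F ((x, t), y (x, t))) (at t)"
    and cont: "continuous_on (W \<times> {-T<..<T}) y"
    and S: "open S" and F: "ck_on (Suc 0) S F" and graph: "\<And>z. z \<in> W \<times> {-T<..<T} \<Longrightarrow> (z, y z) \<in> S"
    and DL: "\<And>z v. z \<in> W \<times> {-T<..<T} \<Longrightarrow> norm (frechet_derivative F (at (z, y z)) (0, v)) \<le> L * norm v"
    and L: "0 \<le> L" "L * T \<le> 1/2"
    and init: "((\<lambda>x. y (x, 0)) has_derivative y0') (at x)"
    and x: "x \<in> W" and t0: "0 < t0" "t0 < T"
  obtains Z where "\<And>h. Z 0 h = y0' h"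
    "\<And>t h. t \<in> {-t0..t0} \<Longrightarrow>
      ((\<lambda>t. Z t h) has_vector_derivative frechet_derivative F (at ((x, t), y (x, t))) ((h, 0), Z t h)) (at t within {-t0..t0})"
    "\<And>t. t \<in> {-t0..t0} \<Longrightarrow> ((\<lambda>x. y (x, t)) has_derivative Z t) (at x)"
proof -
  let ?I = "{-t0..t0}"
  have I: "t \<in> {-T<..<T}" if "t \<in> ?I" for t using that t0 by auto
  define G where "G t = ((x, t), y (x, t))" for t
  define A where "A t = frechet_derivative F (at (G t))" for t
  have GS: "G t \<in> S" if "t \<in> ?I" for t unfolding G_def using graph x I[OF that] by blast
  have Gc: "continuous_on ?I G" unfolding G_def
    by (intro continuous_intros continuous_on_compose2[OF cont]) (use x I in auto)
  have blA: "bounded_linear (A t)" if "t \<in> ?I" for t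
    unfolding A_def using ck_on_has_derivative[OF F GS[OF that]] by (rule has_derivative_bounded_linear)
  have Asplit: "A t (a, b) = A t (a, 0) + A t (0, b)" if "t \<in> ?I" for t a b
    using bounded_linear.linear[OF blA[OF that], THEN linear_add, of "(a, 0)" "(0, b)"] by simp
  have Ac: "continuous_on ?I (\<lambda>t. A t k)" for k
    unfolding A_def by (rule continuous_on_compose2[OF ck_on_continuous[OF ck_on_frechet[OF F]] Gc]) (use GS in auto)
  have Lin: "norm (A t (a, v) - A t (a, w)) \<le> L * norm (v - w)" if "t \<in> ?I" for t a v w
  proof -
    have "A t (a, v) - A t (a, w) = A t (0, v - w)"
      using bounded_linear.linear[OF blA[OF that], THEN linear_diff, of "(a, v)" "(a, w)"] by simp
    then show ?thesis using DL[of "(x, t)" "v - w"] x I[OF that] unfolding A_def G_def by simp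
  qed
  have Lt0: "L * t0 \<le> 1/2" using L t0 mult_left_mono[of t0 T L] by linarith
  \<comment> \<open>Solving the variational equation for basis directions and extending linearly
    makes the candidate linear in \<open>h\<close> by construction.\<close>
  have "\<exists>z. z 0 = y0' b \<and> (\<forall>t\<in>?I. (z has_vector_derivative A t ((b, 0), z t)) (at t within ?I))" for b
  proof -
    have cn: "continuous_on (?I \<times> UNIV) (\<lambda>(t, v). A t ((b, 0), v))"
    proof (rule continuous_on_eq)
      show "continuous_on (?I \<times> UNIV) (\<lambda>z. A (fst z) ((b, 0), 0) + (\<Sum>c\<in>Basis. (snd z \<bullet> c) *\<^sub>R A (fst z) (0, c)))"
        by (intro continuous_intros continuous_on_compose2[OF Ac]) auto
      fix z :: "real \<times> 'v" assume "z \<in> ?I \<times> UNIV"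
      then obtain t v where z: "z = (t, v)" "t \<in> ?I" by auto
      have "linear (\<lambda>v. A t (0, v))"
        using bounded_linear.linear[OF bounded_linear_compose[OF blA[OF z(2)] bounded_linear_Pair[OF bounded_linear_zero bounded_linear_ident]]] .
      then have "A t (0, \<Sum>c\<in>Basis. (v \<bullet> c) *\<^sub>R c) = (\<Sum>c\<in>Basis. (v \<bullet> c) *\<^sub>R A t (0, c))"
        by (simp only: linear_sum[of "\<lambda>v. A t (0, v)"] linear_cmul[of "\<lambda>v. A t (0, v)"] o_def)
      then show "A (fst z) ((b, 0), 0) + (\<Sum>c\<in>Basis. (snd z \<bullet> c) *\<^sub>R A (fst z) (0, c)) = (\<lambda>(t, v). A t ((b, 0), v)) z"
        unfolding z using Asplit[OF z(2), of "(b, 0)" v] by (simp add: euclidean_representation)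
    qed
    obtain z where "z 0 = y0' b" "\<And>t. t \<in> ?I \<Longrightarrow> (z has_vector_derivative A t ((b, 0), z t)) (at t within ?I)"
      by (rule ode_exists[of t0 "\<lambda>t v. A t ((b, 0), v)", OF _ cn Lin L(1) Lt0]) (use t0 in auto)
    then show ?thesis by blast
  qed
  then obtain zb where zb: "\<And>b. zb b 0 = y0' b"
    "\<And>b t. t \<in> ?I \<Longrightarrow> (zb b has_vector_derivative A t ((b, 0), zb b t)) (at t within ?I)"
    by metis
  define Z where "Z t h = (\<Sum>b\<in>Basis. (h \<bullet> b) *\<^sub>R zb b t)" for t and h :: 'p
  have linZ: "bounded_linear (Z t)" for t
    unfolding Z_def by (intro bounded_linear_sum bounded_linear_scaleR_const bounded_linear_inner_left)
  have Z0: "Z 0 h = y0' h" for h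
  proof -
    have "linear y0'" using init has_derivative_bounded_linear bounded_linear.linear by blast
    then have "y0' (\<Sum>b\<in>Basis. (h \<bullet> b) *\<^sub>R b) = Z 0 h" unfolding Z_def zb by (simp add: linear_sum linear_cmul)
    then show ?thesis by (simp add: euclidean_representation)
  qed
  have Zd: "((\<lambda>t. Z t h) has_vector_derivative A t ((h, 0), Z t h)) (at t within ?I)" if t: "t \<in> ?I" for t h
  proof -
    have "((\<lambda>t. Z t h) has_vector_derivative (\<Sum>b\<in>Basis. (h \<bullet> b) *\<^sub>R A t ((b, 0), zb b t))) (at t within ?I)"
      unfolding Z_def
      by (intro has_vector_derivative_sum bounded_linear.has_vector_derivative[OF bounded_linear_scaleR_right] zb t)
    moreover have "(\<Sum>b\<in>Basis. (h \<bullet> b) *\<^sub>R A t ((b, 0), zb b t)) = A t (\<Sum>b\<in>Basis. (h \<bullet> b) *\<^sub>R ((b, 0), zb b t))"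
      using bounded_linear.linear[OF blA[OF t]] by (simp only: linear_sum linear_cmul)
    moreover have "(\<Sum>b\<in>Basis. (h \<bullet> b) *\<^sub>R ((b, 0::real), zb b t)) = ((h, 0), Z t h)"
      unfolding Z_def prod_eq_iff by (simp add: fst_sum snd_sum euclidean_representation)
    ultimately show ?thesis by (simp only:)
  qed
  have "\<exists>C\<ge>0. \<forall>t\<in>?I. \<forall>h. norm (Z t h) \<le> C * norm h"
  proof -
    have "\<exists>C. \<forall>t\<in>?I. norm (zb b t) \<le> C" for b
    proof -
      have "continuous_on ?I (zb b)"
        using zb(2) by (meson continuous_on_eq_continuous_within has_vector_derivative_continuous)
      then have "bounded (zb b ` ?I)" by (intro compact_imp_bounded compact_continuous_image) auto
      then show ?thesis unfolding bounded_iff by blast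
    qed
    then obtain C where C: "\<And>b t. t \<in> ?I \<Longrightarrow> norm (zb b t) \<le> C b" by metis
    have C0: "0 \<le> C b" for b using order_trans[OF norm_ge_zero C[of 0 b]] t0 by simp
    show ?thesis
    proof (intro exI conjI ballI allI)
      show "0 \<le> (\<Sum>b\<in>Basis. C b)" by (intro sum_nonneg C0)
      fix t h assume t: "t \<in> ?I"
      have "norm (Z t h) \<le> (\<Sum>b\<in>Basis. norm h * C b)"
        unfolding Z_def
        by (rule sum_norm_le) (use Basis_le_norm[of _ h] C[OF t] in \<open>auto intro!: mult_mono\<close>)
      then show "norm (Z t h) \<le> (\<Sum>b\<in>Basis. C b) * norm h" by (simp add: sum_distrib_left mult.commute)
    qed
  qed
  then obtain C where C: "0 \<le> C" "\<And>t h. t \<in> ?I \<Longrightarrow> norm (Z t h) \<le> C * norm h" by blast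
  \<comment> \<open>Strictness comes from \<open>t0 < T\<close> and leaves room to enlarge the
    constant \<open>L\<close> to \<open>L + e1\<close> below.\<close>
  have Lt1: "L * t0 < 1/2"
  proof (cases "L = 0")
    case False
    then have "L * t0 < L * T" using L t0 by (intro mult_strict_left_mono) auto
    then show ?thesis using L by linarith
  qed simp
  have der: "((\<lambda>x. y (x, t)) has_derivative Z t) (at x)" if t: "t \<in> ?I" for t
    unfolding has_derivative_at_alt
  proof (intro conjI allI impI linZ)
    fix e :: real assume e: "0 < e"
    \<comment> \<open>\<open>D\<close> collects the constants of the final estimate, which reads
      \<open>e1 * D * norm h\<close>. The second bound on \<open>e1\<close> keeps
      \<open>(L + e1) * t0\<close> at most 1/2, as \<open>ode_estimate\<close> requires.\<close>
    define D where "D = 2 * (1 + t0 * (1 + C))"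
    have D: "0 < D" unfolding D_def using t0 C(1) by (simp add: add_pos_nonneg)
    define e1 where "e1 = min (e / D) ((1/2 - L * t0) / t0)"
    have e1: "0 < e1" "e1 * D \<le> e" "(L + e1) * t0 \<le> 1/2"
    proof -
      show "0 < e1" unfolding e1_def using e D Lt1 t0 by simp
      have "e1 \<le> e / D" "e1 \<le> (1/2 - L * t0) / t0" unfolding e1_def by auto
      then show "e1 * D \<le> e" "(L + e1) * t0 \<le> 1/2"
        using D t0 by (simp_all add: pos_le_divide_eq algebra_simps)
    qed
    have "compact (G ` ?I)" using Gc by (intro compact_continuous_image) auto
    moreover have "G ` ?I \<subseteq> S" using GS by auto
    ultimately obtain d1 where d1: "0 < d1" "\<And>z k. z \<in> G ` ?I \<Longrightarrow> norm k \<le> d1 \<Longrightarrow>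
        norm (F (z + k) - F z - frechet_derivative F (at z) k) \<le> e1 * norm k"
      using uniformly_differentiable_on_compact[OF F S _ _ e1(1)] by metis
    have cy: "continuous_on (W \<times> ?I) y" by (rule continuous_on_subset[OF cont]) (use I in auto)
    obtain X where X: "x \<in> X" "open X" "\<forall>x'\<in>X \<inter> W. \<forall>t\<in>?I. dist (y (x', t)) (y (x, t)) \<le> d1 / 2"
      by (rule continuous_on_prod_compactE[OF cy compact_Icc x, of "d1 / 2"]) (use d1 in auto)
    obtain d2 where d2: "0 < d2" "\<And>x'. norm (x' - x) < d2 \<Longrightarrow>
        norm (y (x', 0) - y (x, 0) - y0' (x' - x)) \<le> e1 * norm (x' - x)"
      using init e1(1) unfolding has_derivative_at_alt by blast
    obtain d3 where d3: "0 < d3" "ball x d3 \<subseteq> X \<inter> W" using X W x by (meson IntI open_Int open_contains_ball)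
    show "\<exists>d>0. \<forall>x'. norm (x' - x) < d \<longrightarrow> norm (y (x', t) - y (x, t) - Z t (x' - x)) \<le> e * norm (x' - x)"
    proof (intro exI conjI allI impI)
      \<comment> \<open>The increments \<open>h\<close> and \<open>\<Delta> s\<close> each get half
        of \<open>d1\<close>; \<open>d2\<close> controls the initial values, and \<open>d3\<close>
        keeps \<open>x'\<close> in \<open>W\<close> and in the neighbourhood where
        \<open>\<Delta>\<close> is small.\<close>
      show "0 < min d3 (min d2 (d1 / 2))" using d1 d2 d3 by simp
      fix x' assume x': "norm (x' - x) < min d3 (min d2 (d1 / 2))"
      define h where "h = x' - x"
      have xin: "x' \<in> X" "x' \<in> W" using x' d3(2) by (auto simp: dist_norm norm_minus_commute)
      define \<Delta> where "\<Delta> s = y (x', s) - y (x, s)" for s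
      define R where "R s = \<Delta> s - Z s h" for s
      have "norm (R t) \<le> 2 * (norm (R 0) + t0 * (e1 * (1 + C) * norm h))"
      proof (rule ode_estimate[of t0 R _ "L + e1"])
        fix s assume s: "s \<in> ?I"
        show "(R has_vector_derivative F (G s + ((h, 0), \<Delta> s)) - F (G s) - A s ((h, 0), Z s h)) (at s within ?I)"
        proof -
          have eq: "G s + ((h, 0), \<Delta> s) = ((x', s), y (x', s))" unfolding G_def \<Delta>_def h_def by simp
          show ?thesis unfolding eq unfolding R_def \<Delta>_def G_def
            by (intro has_vector_derivative_diff Zd s has_vector_derivative_at_within[OF ode] xin x I)
        qed
        let ?k = "((h, 0 :: real), \<Delta> s)"
        have n1: "norm ((h, 0 :: real), \<Delta> s) \<le> norm h + norm (\<Delta> s)"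
          using norm_Pair_le[of "(h, 0 :: real)" "\<Delta> s"] by simp
        have "norm (\<Delta> s) \<le> d1 / 2" using X(3) xin s unfolding \<Delta>_def by (auto simp: dist_norm)
        moreover have "norm h \<le> d1 / 2" using x' unfolding h_def by simp
        ultimately have "norm ?k \<le> d1" using n1 by linarith
        then have a: "norm (F (G s + ?k) - F (G s) - A s ?k) \<le> e1 * norm ?k"
          unfolding A_def using d1(2)[of "G s" ?k] s by blast
        have "norm (\<Delta> s) \<le> norm (R s) + norm (Z s h)" unfolding R_def using norm_triangle_ineq[of "\<Delta> s - Z s h" "Z s h"] by simp
        then have "norm ?k \<le> norm (R s) + (1 + C) * norm h"
          using n1 C(2)[OF s, of h] by (simp add: algebra_simps)
        then have a2: "e1 * norm ?k \<le> e1 * norm (R s) + e1 * (1 + C) * norm h"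
          using mult_left_mono[of "norm ?k" "norm (R s) + (1 + C) * norm h" e1] e1(1)
          by (simp add: algebra_simps)
        have b: "norm (A s ?k - A s ((h, 0), Z s h)) \<le> L * norm (R s)"
          using Lin[OF s] unfolding R_def .
        have "norm (F (G s + ?k) - F (G s) - A s ((h, 0), Z s h)) \<le>
            norm (F (G s + ?k) - F (G s) - A s ?k) + norm (A s ?k - A s ((h, 0), Z s h))"
          using norm_triangle_ineq[of "F (G s + ?k) - F (G s) - A s ?k" "A s ?k - A s ((h, 0), Z s h)"] by simp
        also have "\<dots> \<le> (L + e1) * norm (R s) + e1 * (1 + C) * norm h"
          using a a2 b by (simp add: algebra_simps)
        finally show "norm (F (G s + ?k) - F (G s) - A s ((h, 0), Z s h)) \<le> (L + e1) * norm (R s) + e1 * (1 + C) * norm h" .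
      qed (use t0 L e1 t C in auto)
      also have "norm (R 0) \<le> e1 * norm h"
        using d2(2)[of x'] x' unfolding R_def \<Delta>_def Z0 h_def by simp
      also have "2 * (e1 * norm h + t0 * (e1 * (1 + C) * norm h)) = (e1 * D) * norm h"
        unfolding D_def by (simp add: algebra_simps)
      also have "\<dots> \<le> e * norm h" using e1(2) by (intro mult_right_mono) auto
      finally show "norm (y (x', t) - y (x, t) - Z t (x' - x)) \<le> e * norm (x' - x)"
        unfolding R_def \<Delta>_def h_def by simp
    qed
  qed
  show ?thesis by (rule that[OF Z0 Zd[unfolded A_def G_def] der])
qed

lemma ck_on_mono: "ck_on k S f \<Longrightarrow> j \<le> k \<Longrightarrow> ck_on j S f"
  by (induction k) (use ck_on_SucD le_Suc_eq in \<open>blast+\<close>)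

text \<open>Joint differentiability follows from the derivative in \<open>x\<close> at the one point
  together with continuity of the derivative in \<open>t\<close>, which is the right-hand side
  \<open>F\<close>. The other two conclusions say that the spatial derivative is again governed by
  an initial value problem; the bootstrap in \<open>linear_ode_ck\<close> and
  \<open>flow_smooth\<close> feeds on this.\<close>

lemma ode_differentiable_dependence:
  fixes F :: "('p::euclidean_space \<times> real) \<times> 'v::euclidean_space \<Rightarrow> 'v" and y :: "'p \<times> real \<Rightarrow> 'v"
  assumes W: "open W" and T: "0 < T" and ode: "\<And>x t. x \<in> W \<Longrightarrow> t \<in> {-T<..<T} \<Longrightarrow>
      ((\<lambda>t. y (x, t)) has_vector_derivative F ((x, t), y (x, t))) (at t)"
    and cont: "continuous_on (W \<times> {-T<..<T}) y"
    and S: "open S" and F: "ck_on (Suc 0) S F" and graph: "\<And>z. z \<in> W \<times> {-T<..<T} \<Longrightarrow> (z, y z) \<in> S"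
    and DL: "\<And>z v. z \<in> W \<times> {-T<..<T} \<Longrightarrow> norm (frechet_derivative F (at (z, y z)) (0, v)) \<le> L * norm v"
    and L: "0 \<le> L" "L * T \<le> 1/2"
    and init: "\<And>x. x \<in> W \<Longrightarrow> ((\<lambda>x. y (x, 0)) has_derivative y0' x) (at x)"
    and x: "x \<in> W" "t \<in> {-T<..<T}"
  shows "(y has_derivative (\<lambda>(h, s). frechet_derivative y (at (x, t)) (h, 0) + s *\<^sub>R F ((x, t), y (x, t)))) (at (x, t))"
    "frechet_derivative y (at (x, 0)) (h, 0) = y0' x h"
    "((\<lambda>t. frechet_derivative y (at (x, t)) (h, 0)) has_vector_derivative
       frechet_derivative F (at ((x, t), y (x, t))) ((h, 0), frechet_derivative y (at (x, t)) (h, 0))) (at t)"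
proof -
  let ?J = "{-T<..<T}"
  define t0 where "t0 = (\<bar>t\<bar> + T) / 2"
  have t0: "\<bar>t\<bar> < t0" "t0 < T" "0 < t0" using x(2) unfolding t0_def by auto
  obtain Z where Z: "\<And>h. Z 0 h = y0' x h"
    "\<And>t h. t \<in> {-t0..t0} \<Longrightarrow>
      ((\<lambda>t. Z t h) has_vector_derivative frechet_derivative F (at ((x, t), y (x, t))) ((h, 0), Z t h)) (at t within {-t0..t0})"
    "\<And>t. t \<in> {-t0..t0} \<Longrightarrow> ((\<lambda>x. y (x, t)) has_derivative Z t) (at x)"
    by (rule ode_differentiable_dependence_aux[OF W ode cont S F graph DL L init[OF x(1)] x(1) t0(3,2)]) blast+
  have der: "(y has_derivative (\<lambda>(h, s). Z t h + s *\<^sub>R F ((x, t), y (x, t)))) (at (x, t))" if t: "t \<in> {-t0..t0}" for t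
  proof -
    have tJ: "t \<in> ?J" using t t0 by auto
    have Fc: "continuous_on (W \<times> ?J) (\<lambda>z. F (z, y z))"
      by (rule continuous_on_compose2[OF ck_on_continuous[OF F]], intro continuous_intros cont) (use graph in auto)
    have "((\<lambda>(x, t). y (x, t)) has_derivative (\<lambda>(h, s). Z t h + blinfun_scaleR_left (F ((x, t), y (x, t))) s))
      (at (x, t) within W \<times> ?J)"
    proof (rule has_derivative_partialsI[where f = "\<lambda>x t. y (x, t)" and fy = "\<lambda>x t. blinfun_scaleR_left (F ((x, t), y (x, t)))"])
      show "((\<lambda>x. y (x, t)) has_derivative Z t) (at x within W)"
        by (rule has_derivative_at_withinI[OF Z(3)[OF t]])
      show "((\<lambda>t. y (x, t)) has_derivative blinfun_apply (blinfun_scaleR_left (F ((x, t), y (x, t))))) (at t within ?J)"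
        if "x \<in> W" "t \<in> ?J" for x t
        using ode[OF that] by (auto simp: has_vector_derivative_def intro: has_derivative_at_withinI)
      have "continuous_on (W \<times> ?J) (\<lambda>(x, t). blinfun_scaleR_left (F ((x, t), y (x, t))))"
        using bounded_linear.continuous_on[OF bounded_linear_blinfun_scaleR_left Fc]
        by (simp add: split_beta')
      then show "continuous (at (x, t) within W \<times> ?J) (\<lambda>(x, t). blinfun_scaleR_left (F ((x, t), y (x, t))))"
        unfolding continuous_on_eq_continuous_within using x tJ by blast
    qed (use tJ in auto)
    moreover have "at (x, t) within W \<times> ?J = at (x, t)"
      using x tJ by (intro at_within_open open_Times W) auto
    ultimately show ?thesis by simp
  qed
  have Z_eq: "frechet_derivative y (at (x, t)) (h, 0) = Z t h" if "t \<in> {-t0..t0}" for t h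
    using frechet_derivative_at[OF der[OF that]] by (metis (no_types, lifting) add.right_neutral case_prod_conv scaleR_zero_left)
  have tI: "t \<in> {-t0..t0}" "0 \<in> {-t0..t0}" using t0 by auto
  show "(y has_derivative (\<lambda>(h, s). frechet_derivative y (at (x, t)) (h, 0) + s *\<^sub>R F ((x, t), y (x, t)))) (at (x, t))"
    unfolding Z_eq[OF tI(1)] by (rule der[OF tI(1)])
  show "frechet_derivative y (at (x, 0)) (h, 0) = y0' x h"
    unfolding Z_eq[OF tI(2)] by (rule Z)
  show "((\<lambda>t. frechet_derivative y (at (x, t)) (h, 0)) has_vector_derivative
       frechet_derivative F (at ((x, t), y (x, t))) ((h, 0), frechet_derivative y (at (x, t)) (h, 0))) (at t)"
    unfolding Z_eq[OF tI(1)]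
  proof (rule has_vector_derivative_transform_within_open)
    have "at t within {-t0..t0} = at t" using t0 by (intro at_within_interior) auto
    then show "((\<lambda>t. Z t h) has_vector_derivative frechet_derivative F (at ((x, t), y (x, t))) ((h, 0), Z t h)) (at t)"
      using Z(2)[OF tI(1)] by simp
    show "t \<in> {-t0<..<t0}" using t0 by auto
    show "Z s h = frechet_derivative y (at (x, s)) (h, 0)" if "s \<in> {-t0<..<t0}" for s
      using that by (intro Z_eq[symmetric]) auto
  qed simp
qed

text \<open>Differentiating a linear equation in the parameter gives a linear equation with the same
  \<open>A\<close> and a new inhomogeneous term, which contains the solution itself, already known
  to be smooth to one order less. Allowing the term \<open>f\<close> and an arbitrary constant
  initial value is what closes the induction: the differentiated solution starts at 0.\<close>

lemma linear_ode_ck: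
  fixes A :: "'p::euclidean_space \<times> real \<Rightarrow> 'v::euclidean_space \<Rightarrow> 'v"
  assumes W: "open W" and T: "0 < T"
    and linA: "\<And>z. z \<in> W \<times> {-T<..<T} \<Longrightarrow> linear (A z)"
    and A: "\<And>b. ck_on k (W \<times> {-T<..<T}) (\<lambda>z. A z b)" "\<And>z v. z \<in> W \<times> {-T<..<T} \<Longrightarrow> norm (A z v) \<le> L * norm v"
    and L: "0 \<le> L" "L * T \<le> 1/2"
    and f: "ck_on k (W \<times> {-T<..<T}) f"
    and ode: "\<And>x t. x \<in> W \<Longrightarrow> t \<in> {-T<..<T} \<Longrightarrow>
      ((\<lambda>t. V (x, t)) has_vector_derivative A (x, t) (V (x, t)) + f (x, t)) (at t)"
    and init: "\<And>x. x \<in> W \<Longrightarrow> V (x, 0) = c"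
  shows "ck_on k (W \<times> {-T<..<T}) V"
  using A(1) f ode init
proof (induction k arbitrary: f V c)
  let ?D = "W \<times> {-T<..<T}"
  have lin_eq: "A z v = (\<Sum>b\<in>Basis. (v \<bullet> b) *\<^sub>R A z b)" if "z \<in> ?D" for z v
  proof -
    interpret linear "A z" by (rule linA[OF that])
    have "A z v = A z (\<Sum>b\<in>Basis. (v \<bullet> b) *\<^sub>R b)" by (simp add: euclidean_representation)
    then show ?thesis by (simp add: sum scale)
  qed
  {
    case 0
    have Fc: "continuous_on (W \<times> {-T<..<T} \<times> UNIV) (\<lambda>(x, t, v). A (x, t) v + f (x, t))"
    proof (rule continuous_on_eq)
      have Ac: "continuous_on ?D (\<lambda>z. A z b)" for b using 0(1)[of b] by simp
      have fc: "continuous_on ?D f" using 0 by simp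
      show "continuous_on (W \<times> {-T<..<T} \<times> UNIV)
        (\<lambda>w. (\<Sum>b\<in>Basis. (snd (snd w) \<bullet> b) *\<^sub>R A (fst w, fst (snd w)) b) + f (fst w, fst (snd w)))"
        by (intro continuous_intros continuous_on_compose2[OF Ac] continuous_on_compose2[OF fc]) auto
      show "(\<Sum>b\<in>Basis. (snd (snd w) \<bullet> b) *\<^sub>R A (fst w, fst (snd w)) b) + f (fst w, fst (snd w)) =
         (\<lambda>(x, t, v). A (x, t) v + f (x, t)) w" if "w \<in> W \<times> {-T<..<T} \<times> UNIV" for w
      proof -
        obtain x t v where w: "w = (x, t, v)" by (cases w)
        then have "(x, t) \<in> ?D" using that by simp
        from lin_eq[OF this, of v, symmetric] show ?thesis unfolding w by simp
      qed
    qed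
    have "continuous_on ?D (\<lambda>(x, t). V (x, t))"
    proof (rule ode_continuous_dependence[OF _ _ Fc _ L])
      show "((\<lambda>t. V (x, t)) has_vector_derivative A (x, t) (V (x, t)) + f (x, t)) (at t)"
        if "x \<in> W" "t \<in> {-T<..<T}" for x t by (rule 0(3)[OF that])
      show "continuous_on W (\<lambda>x. V (x, 0))"
        using continuous_on_const[of W c] by (rule continuous_on_eq) (simp add: 0(4))
      show "norm (A (x, t) v + f (x, t) - (A (x, t) w + f (x, t))) \<le> L * norm (v - w)"
        if "x \<in> W" "t \<in> {-T<..<T}" for x t v w
        using A(2)[of "(x, t)" "v - w"] linear_diff[OF linA[of "(x, t)"], of v w] that by simp
    qed
    then show ?case by simp
  next
    case (Suc k)
    have oD: "open ?D" by (intro open_Times W) auto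
    have Vk: "ck_on k ?D V"
      by (rule Suc.IH[OF ck_on_SucD[OF Suc.prems(1)] ck_on_SucD[OF Suc.prems(2)] Suc.prems(3,4)])
    define S where "S = ?D \<times> (UNIV :: 'v set)"
    have S: "open S" unfolding S_def by (intro open_Times oD) auto
    \<comment> \<open>Written over \<open>Basis\<close> because \<open>A z\<close> is known to be
      linear only for \<open>z \<in> ?D\<close> and to be smooth only on fixed vectors, whereas
      \<open>F\<close> has to be a differentiable function of the pair
      \<open>(z, v)\<close>.\<close>
    define F where "F w = (\<Sum>b\<in>Basis. (snd w \<bullet> b) *\<^sub>R A (fst w) b) + f (fst w)" for w
    have A1: "ck_on (Suc 0) S (\<lambda>w. A (fst w) b)" for b
      by (rule ck_on_compose[OF S ck_on_bounded_linear[OF S bounded_linear_fst] ck_on_mono[OF Suc.prems(1)]])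
        (auto simp: S_def)
    have f1: "ck_on (Suc 0) S (\<lambda>w. f (fst w))"
      by (rule ck_on_compose[OF S ck_on_bounded_linear[OF S bounded_linear_fst] ck_on_mono[OF Suc.prems(2)]])
        (auto simp: S_def)
    have F1: "ck_on (Suc 0) S F"
      unfolding F_def
      by (intro ck_on_add ck_on_sum ck_on_scaleR S A1 f1 ck_on_linear_compose[OF S bounded_linear_inner_left]
          ck_on_bounded_linear[OF S bounded_linear_snd])
    have Feq: "F (z, v) = A z v + f z" if "z \<in> ?D" for z v using lin_eq[OF that, of v, symmetric] by (simp add: F_def)
    \<comment> \<open>The inhomogeneous term of the differentiated equation: the derivative of
      \<open>A\<close> in the parameter direction \<open>h\<close>, applied to \<open>V\<close>,
      plus that of \<open>f\<close>.\<close>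
    define g where "g h z = (\<Sum>b\<in>Basis. (V z \<bullet> b) *\<^sub>R frechet_derivative (\<lambda>z. A z b) (at z) (h, 0)) +
      frechet_derivative f (at z) (h, 0)" for h z
    have F': "frechet_derivative F (at (z, v)) (a, w) =
      (\<Sum>b\<in>Basis. (v \<bullet> b) *\<^sub>R frechet_derivative (\<lambda>z. A z b) (at z) a) + frechet_derivative f (at z) a + A z w"
      if z: "z \<in> ?D" for z v a w
    proof -
      have hf: "((\<lambda>w. f (fst w)) has_derivative (\<lambda>k. frechet_derivative f (at z) (fst k))) (at (z, v))"
        by (rule has_derivative_compose[of fst]) 
          (use ck_on_has_derivative[OF Suc.prems(2) z] in \<open>auto intro!: derivative_eq_intros\<close>)
      have hA: "((\<lambda>w. A (fst w) b) has_derivative (\<lambda>k. frechet_derivative (\<lambda>z. A z b) (at z) (fst k))) (at (z, v))" for b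
        by (rule has_derivative_compose[of fst _ _ _ "\<lambda>z. A z b"])
          (use ck_on_has_derivative[OF Suc.prems(1) z] in \<open>auto intro!: derivative_eq_intros\<close>)
      have hs: "((\<lambda>w. snd w \<bullet> b) has_derivative (\<lambda>k. snd k \<bullet> b)) (at (z, v))" for b :: 'v
        by (auto intro!: derivative_eq_intros)
      have "(F has_derivative (\<lambda>k. (\<Sum>b\<in>Basis. (snd (z, v) \<bullet> b) *\<^sub>R frechet_derivative (\<lambda>z. A z b) (at z) (fst k) +
          (snd k \<bullet> b) *\<^sub>R A (fst (z, v)) b) + frechet_derivative f (at z) (fst k))) (at (z, v))"
        unfolding F_def by (intro has_derivative_add has_derivative_sum has_derivative_scaleR hA hf hs)
      note d = this
      have "frechet_derivative F (at (z, v)) (a, w) = (\<Sum>b\<in>Basis. (v \<bullet> b) *\<^sub>R frechet_derivative (\<lambda>z. A z b) (at z) a +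
          (w \<bullet> b) *\<^sub>R A z b) + frechet_derivative f (at z) a"
        unfolding frechet_derivative_at[OF d, symmetric] by simp
      then show ?thesis using lin_eq[OF z, of w, symmetric] by (simp add: sum.distrib)
    qed
    have F'0: "frechet_derivative F (at (z, V z)) (0, w) = A z w" if "z \<in> ?D" for z w
    proof -
      have "frechet_derivative (\<lambda>z. A z b) (at z) 0 = 0" "frechet_derivative f (at z) 0 = 0" for b
        by (rule linear_0[OF has_derivative_linear[OF ck_on_has_derivative[OF Suc.prems(1) that]]],
            rule linear_0[OF has_derivative_linear[OF ck_on_has_derivative[OF Suc.prems(2) that]]])
      then show ?thesis unfolding F'[OF that] by simp
    qed
    have odeF: "((\<lambda>t. V (x, t)) has_vector_derivative F ((x, t), V (x, t))) (at t)" if "x \<in> W" "t \<in> {-T<..<T}" for x t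
      using Suc.prems(3)[OF that] Feq[of "(x, t)"] that by simp
    have gr: "(z, V z) \<in> S" if "z \<in> ?D" for z using that by (simp add: S_def)
    have DL: "norm (frechet_derivative F (at (z, V z)) (0, v)) \<le> L * norm v" if "z \<in> ?D" for z v
      unfolding F'0[OF that] by (rule A(2)[OF that])
    have ini: "((\<lambda>x. V (x, 0)) has_derivative (\<lambda>_. 0)) (at x)" if "x \<in> W" for x
      by (rule has_derivative_transform_within_open[OF has_derivative_const W that]) (simp add: Suc.prems(4))
    have dep: "(V has_derivative (\<lambda>(h, s). frechet_derivative V (at (x, t)) (h, 0) + s *\<^sub>R F ((x, t), V (x, t)))) (at (x, t))"
      "frechet_derivative V (at (x, 0)) (h, 0) = 0"
      "((\<lambda>t. frechet_derivative V (at (x, t)) (h, 0)) has_vector_derivative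
         frechet_derivative F (at ((x, t), V (x, t))) ((h, 0), frechet_derivative V (at (x, t)) (h, 0))) (at t)"
      if "x \<in> W" "t \<in> {-T<..<T}" for x t h
    proof -
      note d = ode_differentiable_dependence[OF W T odeF ck_on_continuous[OF Vk] S F1 gr DL L ini that]
      show "(V has_derivative (\<lambda>(h, s). frechet_derivative V (at (x, t)) (h, 0) + s *\<^sub>R F ((x, t), V (x, t)))) (at (x, t))"
        by (rule d(1))
      show "frechet_derivative V (at (x, 0)) (h, 0) = 0" by (rule d(2))
      show "((\<lambda>t. frechet_derivative V (at (x, t)) (h, 0)) has_vector_derivative
         frechet_derivative F (at ((x, t), V (x, t))) ((h, 0), frechet_derivative V (at (x, t)) (h, 0))) (at t)"
        by (rule d(3))
    qed
    have Zk: "ck_on k ?D (\<lambda>z. frechet_derivative V (at z) (h, 0))" for h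
    proof (rule Suc.IH)
      show "ck_on k ?D (\<lambda>z. A z b)" for b by (rule ck_on_SucD[OF Suc.prems(1)])
      show "ck_on k ?D (g h)" unfolding g_def
        by (intro ck_on_add ck_on_sum ck_on_scaleR oD ck_on_linear_compose[OF oD bounded_linear_inner_left Vk]
            ck_on_frechet[OF Suc.prems(1)] ck_on_frechet[OF Suc.prems(2)])
      show "frechet_derivative V (at (x, 0)) (h, 0) = 0" if "x \<in> W" for x
        using dep(2)[OF that, of 0 h] T by simp
      show "((\<lambda>t. frechet_derivative V (at (x, t)) (h, 0)) has_vector_derivative
         A (x, t) (frechet_derivative V (at (x, t)) (h, 0)) + g h (x, t)) (at t)" if "x \<in> W" "t \<in> {-T<..<T}" for x t
      proof -
        have "(x, t) \<in> ?D" using that by simp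
        from F'[OF this, of "V (x, t)" "(h, 0)"] dep(3)[OF that, of h] show ?thesis
          by (simp add: g_def add.commute)
      qed
    qed
    show ?case
    proof (rule ck_on_derivI[OF oD])
      show "(V has_derivative (\<lambda>k. frechet_derivative V (at z) (fst k, 0) + snd k *\<^sub>R F (z, V z))) (at z)" if "z \<in> ?D" for z
        using dep(1)[of "fst z" "snd z"] that by (auto simp: split_beta')
      have "ck_on k ?D (\<lambda>z. A z (V z))"
        by (rule ck_on_linear_basis[OF oD linA ck_on_SucD[OF Suc.prems(1)] Vk])
      then have "ck_on k ?D (\<lambda>z. A z (V z) + f z)"
        by (intro ck_on_add oD ck_on_SucD[OF Suc.prems(2)])
      then have "ck_on k ?D (\<lambda>z. F (z, V z))"
        by (rule ck_on_cong[OF oD, rotated]) (simp add: Feq)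
      then show "ck_on k ?D (\<lambda>z. frechet_derivative V (at z) (fst v, 0) + snd v *\<^sub>R F (z, V z))" for v :: "'p \<times> real"
        by (intro ck_on_add ck_on_scaleR oD Zk ck_on_const)
    qed
  }
qed

text \<open>If the flow is \<open>C^k\<close>, its spatial derivative solves the linear equation
  with coefficients \<open>frechet_derivative X (at (u z))\<close>, which are \<open>C^k\<close>
  too, and starts at the constant \<open>h\<close>. By \<open>linear_ode_ck\<close> it is
  \<open>C^k\<close>; so is the time derivative \<open>X (u z)\<close>, and the flow is
  \<open>C^(k+1)\<close>.\<close>

lemma flow_smooth:
  fixes u :: "'e::euclidean_space \<times> real \<Rightarrow> 'e"
  assumes Q: "open Q" and X: "smooth_on Q X" and W: "open W" and T: "0 < T"
    and ode: "\<And>x t. x \<in> W \<Longrightarrow> t \<in> {-T<..<T} \<Longrightarrow> ((\<lambda>t. u (x, t)) has_vector_derivative X (u (x, t))) (at t)"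
    and init: "\<And>x. x \<in> W \<Longrightarrow> u (x, 0) = x"
    and u: "u ` (W \<times> {-T<..<T}) \<subseteq> Q" "continuous_on (W \<times> {-T<..<T}) u"
    and L: "\<And>x v. x \<in> Q \<Longrightarrow> norm (frechet_derivative X (at x) v) \<le> L * norm v" "0 \<le> L" "L * T \<le> 1/2"
  shows "smooth_on (W \<times> {-T<..<T}) u"
  unfolding smooth_on_def
proof
  let ?D = "W \<times> {-T<..<T}"
  have oD: "open ?D" by (intro open_Times W) auto
  have Xk: "ck_on k Q X" for k using X by (simp add: smooth_on_def)
  \<comment> \<open>The autonomous field is viewed as depending trivially on \<open>(x, t)\<close>,
    to match the form of \<open>ode_differentiable_dependence\<close>.\<close>
  define S where "S = (UNIV :: ('e \<times> real) set) \<times> Q"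
  have S: "open S" unfolding S_def by (intro open_Times Q) auto
  define F where "F w = X (snd w)" for w :: "('e \<times> real) \<times> 'e"
  have F1: "ck_on (Suc 0) S F" unfolding F_def
    by (rule ck_on_compose[OF S ck_on_bounded_linear[OF S bounded_linear_snd] Xk]) (auto simp: S_def)
  have F': "frechet_derivative F (at (z, x)) (a, w) = frechet_derivative X (at x) w" if "x \<in> Q" for z x a w
  proof -
    have "(F has_derivative (\<lambda>k. frechet_derivative X (at x) (snd k))) (at (z, x))" unfolding F_def
      by (rule has_derivative_compose[of snd]) 
          (use ck_on_has_derivative[OF Xk that] in \<open>auto intro!: derivative_eq_intros\<close>)
    from frechet_derivative_at[OF this] show ?thesis by (metis snd_conv)
  qed
  have uO: "u z \<in> Q" if "z \<in> ?D" for z using u(1) that by blast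
  have dep: "(u has_derivative (\<lambda>(h, s). frechet_derivative u (at (x, t)) (h, 0) + s *\<^sub>R F ((x, t), u (x, t)))) (at (x, t))"
    "frechet_derivative u (at (x, 0)) (h, 0) = h"
    "((\<lambda>t. frechet_derivative u (at (x, t)) (h, 0)) has_vector_derivative
       frechet_derivative F (at ((x, t), u (x, t))) ((h, 0), frechet_derivative u (at (x, t)) (h, 0))) (at t)"
    if "x \<in> W" "t \<in> {-T<..<T}" for x t h
  proof -
    have gr: "(z, u z) \<in> S" if "z \<in> ?D" for z using uO[OF that] by (simp add: S_def)
    have DL: "norm (frechet_derivative F (at (z, u z)) (0, v)) \<le> L * norm v" if "z \<in> ?D" for z v
      using L(1) uO[OF that] F'[OF uO[OF that]] by simp
    have ini: "((\<lambda>x. u (x, 0)) has_derivative (\<lambda>h. h)) (at x)" if "x \<in> W" for x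
      by (rule has_derivative_transform_within_open[OF has_derivative_ident W that]) (simp add: init)
    have odeF: "((\<lambda>t. u (x, t)) has_vector_derivative F ((x, t), u (x, t))) (at t)" if "x \<in> W" "t \<in> {-T<..<T}" for x t
      using ode[OF that] by (simp add: F_def)
    note d = ode_differentiable_dependence[OF W T odeF u(2) S F1 gr DL L(2,3) ini that]
    show "(u has_derivative (\<lambda>(h, s). frechet_derivative u (at (x, t)) (h, 0) + s *\<^sub>R F ((x, t), u (x, t)))) (at (x, t))"
      by (rule d(1))
    show "frechet_derivative u (at (x, 0)) (h, 0) = h" by (rule d(2))
    show "((\<lambda>t. frechet_derivative u (at (x, t)) (h, 0)) has_vector_derivative
       frechet_derivative F (at ((x, t), u (x, t))) ((h, 0), frechet_derivative u (at (x, t)) (h, 0))) (at t)"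
      by (rule d(3))
  qed
  fix k show "ck_on k ?D u"
  proof (induction k)
    case 0
    then show ?case using u(2) by simp
  next
    case (Suc k)
    have Zk: "ck_on k ?D (\<lambda>z. frechet_derivative u (at z) (h, 0))" for h
    proof (rule linear_ode_ck[OF W T, of "\<lambda>z. frechet_derivative X (at (u z))" _ L "\<lambda>_. 0"])
      show "linear (frechet_derivative X (at (u z)))" if "z \<in> ?D" for z
        using ck_on_has_derivative[OF Xk uO[OF that]] by (intro bounded_linear.linear has_derivative_bounded_linear)
      show "ck_on k ?D (\<lambda>z. frechet_derivative X (at (u z)) b)" for b
        by (rule ck_on_compose[OF oD Suc ck_on_frechet[OF Xk] u(1)])
      show "norm (frechet_derivative X (at (u z)) v) \<le> L * norm v" if "z \<in> ?D" for z v
        by (rule L(1)[OF uO[OF that]])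
      show "((\<lambda>t. frechet_derivative u (at (x, t)) (h, 0)) has_vector_derivative
          frechet_derivative X (at (u (x, t))) (frechet_derivative u (at (x, t)) (h, 0)) + 0) (at t)"
        if "x \<in> W" "t \<in> {-T<..<T}" for x t
        using dep(3)[OF that, of h] F'[OF uO, of "(x, t)"] that by simp
      show "frechet_derivative u (at (x, 0)) (h, 0) = h" if "x \<in> W" for x
        using dep(2)[OF that, of 0] T by simp
    qed (use L in \<open>auto intro: ck_on_const oD\<close>)
    show ?case
    proof (rule ck_on_derivI[OF oD])
      show "(u has_derivative (\<lambda>k. frechet_derivative u (at z) (fst k, 0) + snd k *\<^sub>R X (u z))) (at z)" if "z \<in> ?D" for z
        using dep(1)[of "fst z" "snd z"] that by (auto simp: split_beta' F_def)
      show "ck_on k ?D (\<lambda>z. frechet_derivative u (at z) (fst v, 0) + snd v *\<^sub>R X (u z))" for v :: "'e \<times> real"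
        by (intro ck_on_add ck_on_scaleR oD Zk ck_on_const ck_on_compose[OF oD Suc Xk u(1)])
    qed
  qed
qed

text \<open>The field is precomposed with the nearest-point retraction onto a closed ball, which
  makes it bounded and globally Lipschitz, so that \<open>ode_exists\<close> applies. For starting
  points in the ball of half the radius and for short times the solutions stay inside the ball,
  where the modified field is the original one.\<close>

lemma local_flow:
  fixes X :: "'e::euclidean_space \<Rightarrow> 'e"
  assumes Q: "open Q" and X: "smooth_on Q X" and a: "a \<in> Q"
  obtains T W u where "0 < T" "open W" "a \<in> W" "W \<subseteq> Q" "smooth_on (W \<times> {-T<..<T}) u" "u ` (W \<times> {-T<..<T}) \<subseteq> Q"
    "\<And>x. x \<in> W \<Longrightarrow> u (x, 0) = x"
    "\<And>x t. x \<in> W \<Longrightarrow> t \<in> {-T<..<T} \<Longrightarrow> ((\<lambda>t. u (x, t)) has_vector_derivative X (u (x, t))) (at t)"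
proof -
  obtain R where R: "0 < R" "cball a R \<subseteq> Q" using Q a open_contains_cball by blast
  have Xk: "ck_on k Q X" for k using X by (simp add: smooth_on_def)
  let ?B = "cball a R"
  have Xd: "(X has_derivative frechet_derivative X (at x)) (at x)" if "x \<in> Q" for x
    by (rule ck_on_has_derivative[OF Xk that])
  have "\<exists>C. \<forall>x\<in>?B. norm (frechet_derivative X (at x) b) \<le> C" for b
  proof -
    have "continuous_on ?B (\<lambda>x. frechet_derivative X (at x) b)"
      by (rule continuous_on_subset[OF ck_on_continuous[OF ck_on_frechet[OF Xk, of 0]] R(2)])
    then have "bounded ((\<lambda>x. frechet_derivative X (at x) b) ` ?B)"
      by (intro compact_imp_bounded compact_continuous_image) auto
    then show ?thesis unfolding bounded_iff by blast
  qed
  then obtain C where C: "\<And>b x. x \<in> ?B \<Longrightarrow> norm (frechet_derivative X (at x) b) \<le> C b" by metis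
  have C0: "0 \<le> C b" for b using order_trans[OF norm_ge_zero C[of a b]] R by simp
  define L where "L = (\<Sum>b\<in>Basis. C b)"
  have L0: "0 \<le> L" unfolding L_def by (intro sum_nonneg C0)
  have L: "norm (frechet_derivative X (at x) v) \<le> L * norm v" if "x \<in> ?B" for x v
  proof -
    interpret bounded_linear "frechet_derivative X (at x)"
      using Xd that R(2) has_derivative_bounded_linear by blast
    have "frechet_derivative X (at x) v = frechet_derivative X (at x) (\<Sum>b\<in>Basis. (v \<bullet> b) *\<^sub>R b)"
      by (simp add: euclidean_representation)
    also have "\<dots> = (\<Sum>b\<in>Basis. (v \<bullet> b) *\<^sub>R frechet_derivative X (at x) b)" by (simp add: sum scaleR)
    also have "norm \<dots> \<le> (\<Sum>b\<in>Basis. C b * norm v)"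
    proof (rule sum_norm_le)
      fix b :: 'e assume b: "b \<in> Basis"
      show "norm ((v \<bullet> b) *\<^sub>R frechet_derivative X (at x) b) \<le> C b * norm v"
        using mult_mono[OF Basis_le_norm[OF b, of v] C[OF that, of b]] by (simp add: mult.commute)
    qed
    also have "\<dots> = L * norm v" unfolding L_def by (rule sum_distrib_right[symmetric])
    finally show ?thesis .
  qed
  have Lip: "norm (X x - X y) \<le> L * norm (x - y)" if "x \<in> ?B" "y \<in> ?B" for x y
    by (rule differentiable_bound[OF convex_cball _ _ that, of X "\<lambda>x. frechet_derivative X (at x)"])
      (use R(2) L in \<open>auto intro!: has_derivative_at_withinI[OF Xd] onorm_le\<close>)
  have "continuous_on ?B X" by (rule continuous_on_subset[OF ck_on_continuous[OF Xk[of 0]] R(2)])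
  then have "bounded (X ` ?B)" by (intro compact_imp_bounded compact_continuous_image) auto
  then obtain M where M: "\<And>x. x \<in> ?B \<Longrightarrow> norm (X x) \<le> M" unfolding bounded_iff by blast
  have M0: "0 \<le> M" using order_trans[OF norm_ge_zero M[of a]] R by simp
  define pr where "pr = closest_point ?B"
  have ne: "?B \<noteq> {}" using R by simp
  have pr: "pr x \<in> ?B" "x \<in> ?B \<Longrightarrow> pr x = x" "norm (pr x - pr y) \<le> norm (x - y)" for x y
    unfolding pr_def dist_norm[symmetric]
    by (rule closest_point_in_set[OF closed_cball ne] closest_point_self closest_point_lipschitz[OF convex_cball closed_cball ne];
        assumption?)+
  have prc: "continuous_on UNIV pr" unfolding pr_def by (intro continuous_on_closest_point convex_cball closed_cball ne)
  define Y where "Y x = X (pr x)" for x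
  have YL: "norm (Y x - Y y) \<le> L * norm (x - y)" for x y
    unfolding Y_def using Lip[OF pr(1,1), of x y] mult_left_mono[OF pr(3) L0, of x y] by linarith
  have Yc: "continuous_on UNIV Y" unfolding Y_def
    by (rule continuous_on_compose2[OF \<open>continuous_on ?B X\<close> prc]) (use pr in auto)
  \<comment> \<open>The first bound gives \<open>L * T \<le> 1/2\<close>; the second makes
    \<open>M * T < R / 2\<close>, so that a solution starting in \<open>W\<close> cannot reach the
    boundary of the ball. The added 1 guards against \<open>L = 0\<close> and
    \<open>M = 0\<close>.\<close>
  define T where "T = min (1 / (2 * (L + 1))) (R / (4 * (M + 1)))"
  have T: "0 < T" "L * T \<le> 1/2" "M * T < R / 2"
  proof -
    show T0: "0 < T" unfolding T_def using L0 M0 R by simp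
    have "T * (2 * (L + 1)) \<le> 1" "T * (4 * (M + 1)) \<le> R"
      unfolding T_def using L0 M0 by (simp_all add: pos_le_divide_eq[symmetric])
    moreover have "T * (2 * (L + 1)) = 2 * (L * T) + 2 * T" "T * (4 * (M + 1)) = 4 * (M * T) + 4 * T"
      by (simp_all add: algebra_simps)
    ultimately show "L * T \<le> 1/2" "M * T < R / 2" using T0 mult_nonneg_nonneg[OF M0 less_imp_le[OF T0]] by linarith+
  qed
  have "\<exists>y. y 0 = x \<and> (\<forall>t\<in>{-T..T}. (y has_vector_derivative Y (y t)) (at t within {-T..T}))" for x
  proof -
    have "continuous_on ({-T..T} \<times> UNIV) (\<lambda>(t, y). Y y)"
      using continuous_on_compose2[OF Yc continuous_on_snd[OF continuous_on_id]] by (auto simp: split_beta')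
    then show ?thesis using ode_exists[of T "\<lambda>t. Y" L x] T YL L0 by (metis less_imp_le)
  qed
  then obtain y where y: "\<And>x. y x 0 = x" "\<And>x t. t \<in> {-T..T} \<Longrightarrow> (y x has_vector_derivative Y (y x t)) (at t within {-T..T})"
    by metis
  define u where "u z = y (fst z) (snd z)" for z
  define W where "W = ball a (R / 2)"
  have uB: "u (x, t) \<in> ball a R" if "x \<in> W" "t \<in> {-T<..<T}" for x t
  proof -
    have "norm (y x t - y x 0) \<le> M * \<bar>t - 0\<bar>"
      by (rule vector_derivative_bound[OF _ y(2)]) (use that in \<open>auto simp: Y_def intro!: M pr(1)\<close>)
    also have "\<dots> \<le> M * T" using that M0 by (intro mult_left_mono) auto
    finally have "norm (u (x, t) - x) < R / 2" using T(3) y(1) by (simp add: u_def)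
    moreover have "norm (x - a) < R / 2" using that(1) by (simp add: W_def dist_norm norm_minus_commute)
    ultimately have "norm (u (x, t) - a) < R" using norm_triangle_ineq[of "u (x, t) - x" "x - a"] by simp
    then show ?thesis by (simp add: dist_norm norm_minus_commute)
  qed
  have odeY: "(y x has_vector_derivative Y (y x t)) (at t)" if "t \<in> {-T<..<T}" for x t
  proof -
    have "at t within {-T..T} = at t" using that by (intro at_within_interior) auto
    then show ?thesis using y(2)[of t x] that by auto
  qed
  have ode: "((\<lambda>t. u (x, t)) has_vector_derivative X (u (x, t))) (at t)" if "x \<in> W" "t \<in> {-T<..<T}" for x t
  proof -
    have "Y (y x t) = X (u (x, t))" using uB[OF that] pr(2)[of "y x t"] by (simp add: Y_def u_def)
    then show ?thesis using odeY[OF that(2), of x] by (simp add: u_def)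
  qed
  have uc: "continuous_on (W \<times> {-T<..<T}) u"
  proof -
    have "continuous_on (W \<times> {-T<..<T}) (\<lambda>(x, t). y x t)"
      by (rule ode_continuous_dependence[OF odeY _ _ YL L0 T(2)])
        (auto simp: y(1) split_beta' intro!: continuous_intros continuous_on_compose2[OF Yc])
    then show ?thesis by (simp add: u_def split_beta')
  qed
  have "smooth_on (W \<times> {-T<..<T}) u"
  proof (rule flow_smooth[of "ball a R" X, OF _ _ _ T(1) ode _ _ uc _ L0 T(2)])
    show "smooth_on (ball a R) X" using Xk R(2) unfolding smooth_on_def by (meson ball_subset_cball ck_on_subset order_trans)
  qed (use uB L y in \<open>auto simp: W_def u_def\<close>)
  moreover have "W \<subseteq> Q" using R unfolding W_def by force
  moreover have "u ` (W \<times> {-T<..<T}) \<subseteq> Q" using uB R(2) by force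
  ultimately show ?thesis
    using that[of T W u] T(1) R(1) ode y(1) by (simp add: W_def u_def)
qed

section \<open>Smoothness of coefficients\<close>

text \<open>\<open>P\<close> stands both for being \<open>C\<^sup>k\<close> near a point of a Euclidean space and for being smooth near a point of a manifold.\<close>

locale germ_ring =
  fixes P :: "('a \<Rightarrow> 'c::field) \<Rightarrow> bool" and p :: 'a and F :: "'a filter"
  assumes const: "P (\<lambda>_. c)"
    and add: "P f \<Longrightarrow> P g \<Longrightarrow> P (\<lambda>y. f y + g y)"
    and mult: "P f \<Longrightarrow> P g \<Longrightarrow> P (\<lambda>y. f y * g y)"
    and divide: "P f \<Longrightarrow> P g \<Longrightarrow> g p \<noteq> 0 \<Longrightarrow> P (\<lambda>y. f y / g y)"
    and nonzero: "P g \<Longrightarrow> g p \<noteq> 0 \<Longrightarrow> eventually (\<lambda>y. g y \<noteq> 0) F"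
    and cong: "eventually (\<lambda>y. f y = g y) F \<Longrightarrow> P g \<Longrightarrow> P f"
begin

lemma minus: "P f \<Longrightarrow> P (\<lambda>y. - f y)"
  using mult[OF const[of "-1"]] by simp

lemma diff: "P f \<Longrightarrow> P g \<Longrightarrow> P (\<lambda>y. f y - g y)"
  using add[of f "\<lambda>y. - g y"] minus[of g] by simp

lemma sum: "(\<And>i. i \<in> A \<Longrightarrow> P (f i)) \<Longrightarrow> P (\<lambda>y. \<Sum>i\<in>A. f i y)"
proof (induction A rule: infinite_finite_induct)
  case (insert i A)
  then have "P (\<lambda>y. f i y + (\<Sum>i\<in>A. f i y))" by (intro add) auto
  then show ?case using insert by simp
qed (simp_all add: const)

text \<open>Gaussian elimination: linear independence is only needed at the base point, and \<open>z\<close>, \<open>v\<close> may have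
  infinitely many components.\<close>

lemma coefficients:
  fixes z :: "nat \<Rightarrow> 'a \<Rightarrow> 'i \<Rightarrow> 'c"
  assumes "\<And>i j. i \<in> I \<Longrightarrow> j < n \<Longrightarrow> P (\<lambda>y. z j y i)" "\<And>i. i \<in> I \<Longrightarrow> P (\<lambda>y. v y i)"
    "\<And>i. i \<in> I \<Longrightarrow> eventually (\<lambda>y. v y i = (\<Sum>j<n. w j y * z j y i)) F"
    "\<And>c j. (\<And>i. i \<in> I \<Longrightarrow> (\<Sum>j<n. c j * z j p i) = 0) \<Longrightarrow> j < n \<Longrightarrow> c j = 0"
    "j < n"
  shows "P (w j)"
  using assms
proof (induction n arbitrary: z v w j)
  case (Suc n)
  have "\<exists>i\<in>I. z n p i \<noteq> 0"
  proof (rule ccontr)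
    assume *: "\<not> ?thesis"
    have "(\<Sum>j<Suc n. (if j = n then 1 else 0) * z j p i) = 0" if "i \<in> I" for i
      using * that by (intro sum.neutral) auto
    from Suc.prems(4)[OF this, of n] show False by simp
  qed
  \<comment> \<open>The pivot: some component of the last column \<open>z n\<close> is nonzero at
    the base point, hence also near it.\<close>
  then obtain i0 where i0: "i0 \<in> I" "z n p i0 \<noteq> 0" by blast
  have ev0: "eventually (\<lambda>y. z n y i0 \<noteq> 0) F"
    by (rule nonzero) (use Suc.prems(1) i0 in auto)
  define z' where "z' j y i = z j y i - z j y i0 / z n y i0 * z n y i" for j y i
  define v' where "v' y i = v y i - v y i0 / z n y i0 * z n y i" for y i
  have IH: "P (w j)" if "j < n" for j
  proof (rule Suc.IH[of z' v' w, OF _ _ _ _ that])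
    show "P (\<lambda>y. z' j y i)" if "i \<in> I" "j < n" for i j
      unfolding z'_def by (intro diff mult divide Suc.prems(1) i0 that) (use that in auto)
    show "P (\<lambda>y. v' y i)" if "i \<in> I" for i
      unfolding v'_def by (intro diff mult divide Suc.prems(1,2) i0 that) auto
    show "eventually (\<lambda>y. v' y i = (\<Sum>j<n. w j y * z' j y i)) F" if "i \<in> I" for i
      using ev0 Suc.prems(3)[OF that] Suc.prems(3)[OF i0(1)]
    proof eventually_elim
      case (elim y)
      have "(\<Sum>j<n. w j y * z' j y i) = (\<Sum>j<n. w j y * z j y i) - (\<Sum>j<n. w j y * z j y i0) / z n y i0 * z n y i"
        unfolding z'_def by (simp add: right_diff_distrib sum_subtractf sum_distrib_right sum_divide_distrib mult.assoc)
      then show ?case unfolding v'_def elim(2,3) using elim(1) by (simp add: field_simps)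
    qed
    fix c j assume c: "\<And>i. i \<in> I \<Longrightarrow> (\<Sum>j<n. c j * z' j p i) = 0" and j: "j < n"
    \<comment> \<open>A relation among the reduced columns is one among the original columns, once
      the coefficient of \<open>z n\<close> is determined from component \<open>i0\<close>.\<close>
    define d where "d j = (if j = n then - (\<Sum>j<n. c j * z j p i0) / z n p i0 else c j)" for j
    have "(\<Sum>j<Suc n. d j * z j p i) = 0" if "i \<in> I" for i
    proof -
      have "(\<Sum>j<n. c j * z' j p i) = (\<Sum>j<n. c j * z j p i) - (\<Sum>j<n. c j * z j p i0) / z n p i0 * z n p i"
        unfolding z'_def by (simp add: right_diff_distrib sum_subtractf sum_distrib_right sum_divide_distrib mult.assoc)
      moreover have "(\<Sum>j<n. d j * z j p i) = (\<Sum>j<n. c j * z j p i)"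
        by (rule sum.cong) (auto simp: d_def)
      ultimately show ?thesis using c[OF that] by (simp add: d_def)
    qed
    from Suc.prems(4)[OF this, of j] j show "c j = 0" by (simp add: d_def)
  qed
  have "P (\<lambda>y. (v y i0 - (\<Sum>j<n. w j y * z j y i0)) / z n y i0)"
    by (intro divide diff sum mult Suc.prems(1,2) IH i0) auto
  then have wn: "P (w n)"
  proof (rule cong[rotated])
    show "eventually (\<lambda>y. w n y = (v y i0 - (\<Sum>j<n. w j y * z j y i0)) / z n y i0) F"
      using ev0 Suc.prems(3)[OF i0(1)] by eventually_elim simp
  qed
  show ?case using IH wn Suc.prems(5) less_Suc_eq by auto
qed simp

end

section \<open>Smooth inverses and the flow box\<close>

lemma germ_ring_ck:
  fixes p :: "'e::euclidean_space"
  shows "germ_ring (\<lambda>f :: 'e \<Rightarrow> 'c::real_normed_field. \<exists>T. open T \<and> p \<in> T \<and> ck_on k T f) p (nhds p)"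
proof
  fix f g :: "'e \<Rightarrow> 'c" and c :: 'c
  show "\<exists>T. open T \<and> p \<in> T \<and> ck_on k T (\<lambda>_. c)" using ck_on_const[OF open_UNIV] by (rule_tac exI[of _ UNIV]) simp
  have nz: "\<exists>T. open T \<and> p \<in> T \<and> (\<forall>y\<in>T. g y \<noteq> 0)" if gT: "\<exists>T. open T \<and> p \<in> T \<and> ck_on k T g" and "g p \<noteq> 0"
  proof -
    obtain T where T: "open T" "p \<in> T" "ck_on k T g" using gT by blast
    have "open (T \<inter> g -` (- {0}))"
      by (rule continuous_open_preimage[OF ck_on_continuous[OF T(3)] T(1) open_Compl[OF closed_singleton]])
    moreover have "p \<in> T \<inter> g -` (- {0})" using T(2) \<open>g p \<noteq> 0\<close> by simp
    ultimately show ?thesis by blast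
  qed
  show "eventually (\<lambda>y. g y \<noteq> 0) (nhds p)" if "\<exists>T. open T \<and> p \<in> T \<and> ck_on k T g" "g p \<noteq> 0"
    using nz[OF that] unfolding eventually_nhds .
  show "\<exists>T. open T \<and> p \<in> T \<and> ck_on k T f"
    if ev: "eventually (\<lambda>y. f y = g y) (nhds p)" and gT: "\<exists>T. open T \<and> p \<in> T \<and> ck_on k T g"
  proof -
    obtain T where T: "open T" "p \<in> T" "ck_on k T g" using gT by blast
    obtain S where S: "open S" "p \<in> S" "\<And>y. y \<in> S \<Longrightarrow> f y = g y" using ev unfolding eventually_nhds by blast
    have "ck_on k (T \<inter> S) f"
      by (rule ck_on_cong[OF open_Int[OF T(1) S(1)] _ ck_on_subset[OF T(3)]]) (use S in auto)
    then show ?thesis using T S by (intro exI[of _ "T \<inter> S"]) auto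
  qed
  assume f: "\<exists>T. open T \<and> p \<in> T \<and> ck_on k T f" and g: "\<exists>T. open T \<and> p \<in> T \<and> ck_on k T g"
  obtain T where T: "open T" "p \<in> T" "ck_on k T f" using f by blast
  obtain S where S: "open S" "p \<in> S" "ck_on k S g" using g by blast
  have TS: "open (T \<inter> S)" "p \<in> T \<inter> S" "ck_on k (T \<inter> S) f" "ck_on k (T \<inter> S) g"
    using T S ck_on_subset by (auto intro: ck_on_subset)
  show "\<exists>T. open T \<and> p \<in> T \<and> ck_on k T (\<lambda>y. f y + g y)" using TS ck_on_add by blast
  show "\<exists>T. open T \<and> p \<in> T \<and> ck_on k T (\<lambda>y. f y * g y)" using TS ck_on_mult by blast
  show "\<exists>T. open T \<and> p \<in> T \<and> ck_on k T (\<lambda>y. f y / g y)" if gp: "g p \<noteq> 0"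
  proof -
    obtain R where R: "open R" "p \<in> R" "\<And>y. y \<in> R \<Longrightarrow> g y \<noteq> 0" using nz[OF g gp] by blast
    have "ck_on k (T \<inter> S \<inter> R) (\<lambda>y. f y / g y)"
      by (intro ck_on_divide ck_on_subset[OF TS(3)] ck_on_subset[OF TS(4)] open_Int TS(1) R) (use R in auto)
    then show ?thesis using TS R by (intro exI[of _ "T \<inter> S \<inter> R"]) auto
  qed
qed

text \<open>The components of \<open>g' y v\<close> are the unique solution of the linear system
  \<open>frechet_derivative G (at (g y)) w = v\<close>. Once \<open>g\<close> is \<open>C^k\<close>,
  so are the entries of this system, and elimination shows that the derivative of \<open>g\<close>
  is \<open>C^k\<close>.\<close>

lemma smooth_inverse:
  fixes G :: "'d::euclidean_space \<Rightarrow> 'e::euclidean_space"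
  assumes "open D" "smooth_on D G" "open V" "g ` V \<subseteq> D"
    and g': "\<And>y. y \<in> V \<Longrightarrow> (g has_derivative g' y) (at y)"
    and inv: "\<And>y v. y \<in> V \<Longrightarrow> frechet_derivative G (at (g y)) (g' y v) = v"
    and inj: "\<And>y w. y \<in> V \<Longrightarrow> frechet_derivative G (at (g y)) w = 0 \<Longrightarrow> w = 0"
  shows "smooth_on V g"
  unfolding smooth_on_def
proof
  have Gk: "ck_on k D G" for k using assms(2) by (simp add: smooth_on_def)
  obtain bs where bs: "set bs = (Basis :: 'd set)" "distinct bs" using finite_distinct_list[OF finite_Basis] by blast
  have bij: "bij_betw (\<lambda>j. bs ! j) {..<length bs} (Basis :: 'd set)" using bij_betw_nth[OF bs(2), of _ Basis] bs(1) by simp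
  have rep: "w = (\<Sum>j<length bs. (w \<bullet> bs ! j) *\<^sub>R bs ! j)" for w :: 'd
    using sum.reindex_bij_betw[OF bij, of "\<lambda>b. (w \<bullet> b) *\<^sub>R b"] by (simp add: euclidean_representation)
  fix k show "ck_on k V g"
  proof (induction k)
    case 0
    show ?case using g' by (auto intro!: continuous_at_imp_continuous_on has_derivative_continuous)
  next
    case (Suc k)
    show ?case
    proof (rule ck_on_derivI[OF assms(3) g'])
      fix v
      have *: "\<exists>T. open T \<and> p \<in> T \<and> ck_on k T (\<lambda>y. g' y v \<bullet> bs ! j)" if p: "p \<in> V" and j: "j < length bs" for p j
      proof -
        interpret germ_ring "\<lambda>f :: 'e \<Rightarrow> real. \<exists>T. open T \<and> p \<in> T \<and> ck_on k T f" p "nhds p" by (rule germ_ring_ck)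
        let ?z = "\<lambda>j y i. frechet_derivative G (at (g y)) (bs ! j) \<bullet> i"
        have lin: "linear (frechet_derivative G (at (g y)))" if "y \<in> V" for y
          using that assms(4) by (intro has_derivative_linear[OF ck_on_has_derivative[OF Gk]]) blast
        have sum_eq: "frechet_derivative G (at (g y)) (\<Sum>j<length bs. c j *\<^sub>R bs ! j) \<bullet> i = (\<Sum>j<length bs. c j * ?z j y i)"
          if "y \<in> V" for y c i
          by (simp add: linear_sum[OF lin[OF that]] linear_cmul[OF lin[OF that]] inner_sum_left)
        show ?thesis
        proof (rule coefficients[of Basis "length bs" ?z "\<lambda>y i. v \<bullet> i" "\<lambda>j y. g' y v \<bullet> bs ! j", OF _ _ _ _ j])
          show "\<exists>T. open T \<and> p \<in> T \<and> ck_on k T (\<lambda>y. ?z j y i)" for i j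
            by (intro exI[of _ V] conjI assms(3) p ck_on_linear_compose[OF assms(3) bounded_linear_inner_left]
                ck_on_compose[OF assms(3) Suc ck_on_frechet[OF Gk] assms(4)])
          show "\<exists>T. open T \<and> p \<in> T \<and> ck_on k T (\<lambda>y. v \<bullet> i)" for i by (rule const)
          show "eventually (\<lambda>y. v \<bullet> i = (\<Sum>j<length bs. g' y v \<bullet> bs ! j * ?z j y i)) (nhds p)" for i
            unfolding eventually_nhds
          proof (intro exI[of _ V] conjI ballI assms(3) p)
            fix y assume y: "y \<in> V"
            show "v \<bullet> i = (\<Sum>j<length bs. g' y v \<bullet> bs ! j * ?z j y i)"
              using sum_eq[OF y, of "\<lambda>j. g' y v \<bullet> bs ! j" i] inv[OF y, of v] rep[of "g' y v", symmetric] by simp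
          qed
          fix c j assume c: "\<And>i. i \<in> Basis \<Longrightarrow> (\<Sum>j<length bs. c j * ?z j p i) = 0" and j: "j < length bs"
          have "frechet_derivative G (at (g p)) (\<Sum>j<length bs. c j *\<^sub>R bs ! j) = 0"
            by (rule euclidean_eqI) (simp add: sum_eq[OF p] c)
          then have s0: "(\<Sum>j<length bs. c j *\<^sub>R bs ! j) = 0" by (rule inj[OF p])
          have "(\<Sum>l<length bs. c l *\<^sub>R bs ! l) \<bullet> bs ! j = (\<Sum>l<length bs. if l = j then c l else 0)"
            unfolding inner_sum_left
          proof (rule sum.cong[OF refl])
            fix l assume l: "l \<in> {..<length bs}"
            have "bs ! l \<in> Basis" "bs ! j \<in> Basis" using l j bs(1) nth_mem by blast+
            then show "c l *\<^sub>R bs ! l \<bullet> bs ! j = (if l = j then c l else 0)"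
              using nth_eq_iff_index_eq[OF bs(2), of l j] l j by (simp add: inner_Basis)
          qed
          then show "c j = 0" using s0 j by simp
        qed
      qed
      have "ck_on k V (\<lambda>y. \<Sum>j<length bs. (g' y v \<bullet> bs ! j) *\<^sub>R bs ! j)"
        by (intro ck_on_sum ck_on_scaleR ck_on_const assms(3) ck_on_local[of V k] *) auto
      then show "ck_on k V (\<lambda>y. g' y v)" unfolding rep[symmetric] .
    qed
  qed
qed

text \<open>\<open>G (t, x)\<close> follows the flow for time \<open>t\<close> from the point
  \<open>a + \<iota> x\<close> of the affine hyperplane through \<open>a\<close> orthogonal to
  \<open>X a\<close>. Its \<open>t\<close>-derivative is \<open>X\<close> by construction, and its
  derivative at the origin, which sends \<open>(t, x)\<close> to
  \<open>t *\<^sub>R X a + \<iota> x\<close>, is injective, so \<open>G\<close> is invertible near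
  the origin.\<close>

theorem flow_box:
  fixes X :: "'e::euclidean_space \<Rightarrow> 'e"
  assumes dim: "DIM('e) = DIM('f) + 1"
    and Q: "open Q" and X: "smooth_on Q X" and a: "a \<in> Q" "X a \<noteq> 0"
  obtains G :: "real \<times> 'f::euclidean_space \<Rightarrow> 'e" and g r where "0 < r" "smooth_on ({-r<..<r} \<times> ball 0 r) G"
    "open (G ` ({-r<..<r} \<times> ball 0 r))" "G ` ({-r<..<r} \<times> ball 0 r) \<subseteq> Q" "smooth_on (G ` ({-r<..<r} \<times> ball 0 r)) g"
    "\<And>z. z \<in> {-r<..<r} \<times> ball 0 r \<Longrightarrow> g (G z) = z" "G (0, 0) = a"
    "\<And>z. z \<in> {-r<..<r} \<times> ball 0 r \<Longrightarrow> frechet_derivative G (at z) (1, 0) = X (G z)"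
proof -
  obtain T W u where T: "0 < T" and W: "open W" "a \<in> W" "W \<subseteq> Q" and us: "smooth_on (W \<times> {-T<..<T}) u"
    and uQ: "u ` (W \<times> {-T<..<T}) \<subseteq> Q" and u0: "\<And>x. x \<in> W \<Longrightarrow> u (x, 0) = x"
    and ut: "\<And>x t. x \<in> W \<Longrightarrow> t \<in> {-T<..<T} \<Longrightarrow> ((\<lambda>t. u (x, t)) has_vector_derivative X (u (x, t))) (at t)"
    using local_flow[OF Q X a(1)] by metis
  have uk: "ck_on k (W \<times> {-T<..<T}) u" for k using us by (simp add: smooth_on_def)
  \<comment> \<open>Equality of dimensions yields an isometry \<open>\<iota>\<close> onto the
    orthogonal complement of \<open>X a\<close>; orthogonality will give injectivity of the
    derivative at the origin.\<close>
  have "dim (UNIV :: 'f set) = dim {x. X a \<bullet> x = 0}"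
    using dim_hyperplane[OF a(2)] dim by (simp add: dim_UNIV)
  from isometries_subspaces[OF subspace_UNIV subspace_hyperplane this]
  obtain \<iota> :: "'f \<Rightarrow> 'e" where \<iota>: "linear \<iota>" "range \<iota> = {x. X a \<bullet> x = 0}" "\<And>x. norm (\<iota> x) = norm x"
    by (metis UNIV_I)
  have bl\<iota>: "bounded_linear \<iota>" using \<iota>(1) by (simp add: linear_conv_bounded_linear)
  define s where "s z = (a + \<iota> (snd z), fst z)" for z :: "real \<times> 'f"
  have sk: "ck_on k UNIV s" for k unfolding s_def
    by (intro ck_on_Pair ck_on_add ck_on_const ck_on_bounded_linear bounded_linear_fst bounded_linear_compose[OF bl\<iota> bounded_linear_snd] open_UNIV)
  have sd: "(s has_derivative (\<lambda>k. (\<iota> (snd k), fst k))) (at z)" for z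
    unfolding s_def
    by (auto intro!: derivative_eq_intros bounded_linear_imp_has_derivative[OF bounded_linear_compose[OF bl\<iota> bounded_linear_snd]])
  define D0 where "D0 = s -` (W \<times> {-T<..<T})"
  have D0: "open D0" unfolding D0_def
    by (intro open_vimage open_Times W ck_on_continuous[OF sk]) auto
  define G where "G z = u (s z)" for z
  have sD: "s ` D0 \<subseteq> W \<times> {-T<..<T}" by (auto simp: D0_def)
  have Gk: "ck_on k D0 G" for k unfolding G_def
    by (rule ck_on_compose[OF D0 ck_on_subset[OF sk] uk sD]) simp
  have ud: "(u has_derivative frechet_derivative u (at z)) (at z)" if "z \<in> W \<times> {-T<..<T}" for z
    by (rule ck_on_has_derivative[OF uk that])
  have Gd: "(G has_derivative (\<lambda>k. frechet_derivative u (at (s z)) (\<iota> (snd k), fst k))) (at z)" if "z \<in> D0" for z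
    unfolding G_def using has_derivative_compose[OF sd ud] that by (simp add: D0_def)
  have G': "frechet_derivative G (at z) k = frechet_derivative u (at (s z)) (\<iota> (snd k), fst k)" if "z \<in> D0" for z k
    unfolding frechet_derivative_at[OF Gd[OF that], symmetric] by simp
  have ut': "frechet_derivative u (at (x, t)) (0, 1) = X (u (x, t))" if "x \<in> W" "t \<in> {-T<..<T}" for x t
  proof -
    have "((\<lambda>t. u (x, t)) has_derivative (\<lambda>h. frechet_derivative u (at (x, t)) (0, h))) (at t)"
      using that by (intro has_derivative_compose[of "\<lambda>t. (x, t)" _ _ _ u, OF _ ud]) (auto intro!: derivative_eq_intros)
    then have "(\<lambda>h. frechet_derivative u (at (x, t)) (0, h)) = (\<lambda>h. h *\<^sub>R X (u (x, t)))"
      using ut[OF that] unfolding has_vector_derivative_def by (rule has_derivative_unique)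
    then show ?thesis by (metis scaleR_one)
  qed
  have G1: "frechet_derivative G (at z) (1, 0) = X (G z)" if "z \<in> D0" for z
    using G'[OF that, of "(1, 0)"] ut'[of "a + \<iota> (snd z)" "fst z"] that linear_0[OF \<iota>(1)]
    by (auto simp: s_def D0_def G_def)
  have s0: "s 0 = (a, 0)" using linear_0[OF \<iota>(1)] by (simp add: s_def)
  have zD: "0 \<in> D0" using W T s0 by (simp add: D0_def)
  have G0: "G 0 = a" unfolding G_def s0 using u0 W by simp
  have ux: "frechet_derivative u (at (a, 0)) (h, 0) = h" for h
  proof -
    have "((\<lambda>x. u (x, 0)) has_derivative (\<lambda>h. frechet_derivative u (at (a, 0)) (h, 0))) (at a)"
      using W T by (intro has_derivative_compose[of "\<lambda>x. (x, 0)" _ _ _ u, OF _ ud]) (auto intro!: derivative_eq_intros)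
    moreover have "((\<lambda>x. u (x, 0)) has_derivative (\<lambda>h. h)) (at a)"
      by (rule has_derivative_transform_within_open[OF has_derivative_ident W(1,2)]) (simp add: u0)
    ultimately show ?thesis by (metis has_derivative_unique)
  qed
  have G'0: "frechet_derivative G (at 0) (t, x) = t *\<^sub>R X a + \<iota> x" for t x
  proof -
    have l: "linear (frechet_derivative u (at (a, 0)))" using ud[of "(a, 0)"] W T by (intro has_derivative_linear) auto
    have "frechet_derivative u (at (a, 0)) (\<iota> x, t) = frechet_derivative u (at (a, 0)) ((\<iota> x, 0) + t *\<^sub>R (0, 1))" by simp
    also have "\<dots> = \<iota> x + t *\<^sub>R X a"
      unfolding linear_add[OF l] linear_cmul[OF l] using ux ut'[of a 0] W T u0 by simp
    finally show ?thesis using G'[OF zD] s0 by simp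
  qed
  \<comment> \<open>The inverse function theorem concerns a map of a space into itself, so
    \<open>G\<close> is followed by a linear isomorphism \<open>j\<close> back to
    \<open>real \<times> 'f\<close>.\<close>
  have "DIM('e) = DIM(real \<times> 'f)" using dim by simp
  then obtain j :: "'e \<Rightarrow> real \<times> 'f" and k where j: "linear j" "linear k" "\<And>x. k (j x) = x" "\<And>y. j (k y) = y"
    by (rule isomorphisms_UNIV_UNIV) blast
  have blj: "bounded_linear j" "bounded_linear k" using j by (simp_all add: linear_conv_bounded_linear)
  define f where "f z = j (G z)" for z
  define f' where "f' z = Blinfun (\<lambda>k. j (frechet_derivative G (at z) k))" for z
  have f': "blinfun_apply (f' z) = (\<lambda>k. j (frechet_derivative G (at z) k))" if "z \<in> D0" for z
    unfolding f'_def
    by (intro bounded_linear_Blinfun_apply bounded_linear_compose[OF blj(1)] has_derivative_bounded_linear[OF ck_on_has_derivative[OF Gk that]])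
  have inj0: "k = 0" if "blinfun_apply (f' 0) k = 0" for k
  proof -
    obtain t x where k: "k = (t, x)" by (cases k)
    have "j (t *\<^sub>R X a + \<iota> x) = 0" using that unfolding f'[OF zD] k G'0 .
    then have e: "t *\<^sub>R X a + \<iota> x = 0" using j(3) linear_0[OF j(2)] by metis
    have "X a \<bullet> \<iota> x = 0" using \<iota>(2) by blast
    then have "t * (X a \<bullet> X a) = 0" using arg_cong[OF e, of "\<lambda>v. X a \<bullet> v"] by (simp add: inner_add_right)
    then have "t = 0" using a(2) by simp
    moreover from this have "x = 0" using e \<iota>(3)[of x] by simp
    ultimately show ?thesis by (simp add: k zero_prod_def)
  qed
  have "inj (blinfun_apply (f' 0))"
    using inj0 by (simp add: linear_injective_0 bounded_linear.linear[OF blinfun.bounded_linear_right])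
  then obtain iv where iv: "linear iv" "iv \<circ> blinfun_apply (f' 0) = id"
    using linear_injective_left_inverse[OF bounded_linear.linear[OF blinfun.bounded_linear_right]] by metis
  have ivf: "Blinfun iv o\<^sub>L f' 0 = id_blinfun"
  proof (rule blinfun_eqI)
    fix i
    have "blinfun_apply (Blinfun iv) = iv" using iv(1) by (simp add: bounded_linear_Blinfun_apply linear_conv_bounded_linear)
    then show "blinfun_apply (Blinfun iv o\<^sub>L f' 0) i = blinfun_apply id_blinfun i"
      using fun_cong[OF iv(2), of i] by simp
  qed
  have fd: "(f has_derivative blinfun_apply (f' z)) (at z)" if "z \<in> D0" for z
    unfolding f'[OF that] f_def by (rule bounded_linear.has_derivative[OF blj(1) ck_on_has_derivative[OF Gk that]])
  have f'c: "continuous_on D0 f'"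
  proof (rule continuous_on_blinfun_componentwise)
    fix i :: "real \<times> 'f"
    have "continuous_on D0 (\<lambda>z. j (frechet_derivative G (at z) i))"
      by (rule bounded_linear.continuous_on[OF blj(1) ck_on_continuous[OF ck_on_frechet[OF Gk, of 0]]])
    then show "continuous_on D0 (\<lambda>z. blinfun_apply (f' z) i)"
      by (rule continuous_on_eq) (simp add: f')
  qed
  obtain U V g g' where U: "open U" "U \<subseteq> D0" "0 \<in> U" and V: "open V" "homeomorphism U V f g"
    and g: "\<And>y. y \<in> V \<Longrightarrow> (g has_derivative (g' y)) (at y)" "\<And>y. y \<in> V \<Longrightarrow> g' y = inv (blinfun_apply (f'(g y)))"
    "\<And>y. y \<in> V \<Longrightarrow> bij (blinfun_apply (f'(g y)))"
    by (rule inverse_function_theorem[OF D0 fd f'c zD ivf]) ((rule that; assumption) | assumption)+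
  \<comment> \<open>Only a product neighbourhood is of use: the same time interval over every point
    of a ball.\<close>
  obtain A B where AB: "open A" "open B" "(0 :: real \<times> 'f) \<in> A \<times> B" "A \<times> B \<subseteq> U" using open_prod_elim[OF U(1,3)] by metis
  obtain r1 where r1: "0 < r1" "ball 0 r1 \<subseteq> A" using AB(1,3) open_contains_ball[of A] by (auto simp: zero_prod_def)
  obtain r2 where r2: "0 < r2" "ball 0 r2 \<subseteq> B" using AB(2,3) open_contains_ball[of B] by (auto simp: zero_prod_def)
  define r where "r = min r1 r2"
  define D where "D = {-r<..<r} \<times> ball (0::'f) r"
  have DU: "D \<subseteq> U" "0 < r"
  proof -
    have "{-r<..<r} \<subseteq> ball 0 r1" "ball 0 r \<subseteq> ball (0::'f) r2" unfolding r_def by (auto simp: dist_real_def)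
    then show "D \<subseteq> U" unfolding D_def using r1 r2 AB(4) by blast
    show "0 < r" using r1 r2 by (simp add: r_def)
  qed
  have oD: "open D" unfolding D_def by (intro open_Times) auto
  have gf: "g (f z) = z" if "z \<in> U" for z using V(2) that by (simp add: homeomorphism_apply1)
  have fg: "f (g y) = y" "g y \<in> U" if "y \<in> V" for y
    using V(2) that homeomorphism_image2[OF V(2)] by (auto simp: homeomorphism_apply2)
  have fV: "f z \<in> V" if "z \<in> U" for z using homeomorphism_image1[OF V(2)] that by blast
  have img: "G ` D = j -` (V \<inter> g -` D)"
  proof (intro equalityI subsetI)
    fix y assume "y \<in> G ` D"
    then obtain z where z: "z \<in> D" "y = G z" by blast
    then have "j y = f z" "z \<in> U" using DU by (auto simp: f_def)
    then show "y \<in> j -` (V \<inter> g -` D)" using fV gf z by simp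
  next
    fix y assume y: "y \<in> j -` (V \<inter> g -` D)"
    then have "j (G (g (j y))) = j y" using fg[of "j y"] by (simp add: f_def)
    then have "G (g (j y)) = y" using j(3) by metis
    then show "y \<in> G ` D" using y by (metis IntD2 image_eqI vimageE vimageI)
  qed
  have cg: "continuous_on V g" using V(2) by (simp add: homeomorphism_def)
  have cj: "continuous_on UNIV j" using blj(1) by (simp add: linear_continuous_on)
  have oV: "open (G ` D)" unfolding img
    by (rule open_vimage[OF continuous_open_preimage[OF cg V(1) oD] cj])
  have ig: "(\<lambda>y. g (j y)) (G z) = z" if "z \<in> D" for z using gf[of z] that DU by (auto simp: f_def)
  have jV: "j y \<in> V" "g (j y) \<in> D" "g (j y) \<in> D0" if "y \<in> G ` D" for y using that DU U unfolding img by auto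
  have "smooth_on (G ` D) (\<lambda>y. g (j y))"
  proof (rule smooth_inverse[OF D0 _ oV, of G "\<lambda>y. g (j y)" "\<lambda>y v. g' (j y) (j v)"])
    show "smooth_on D0 G" using Gk by (simp add: smooth_on_def)
    show "(\<lambda>y. g (j y)) ` G ` D \<subseteq> D0" using jV by blast
    fix y assume y: "y \<in> G ` D"
    show "((\<lambda>y. g (j y)) has_derivative (\<lambda>v. g' (j y) (j v))) (at y)"
      by (rule has_derivative_compose[OF bounded_linear_imp_has_derivative[OF blj(1)] g(1)[OF jV(1)[OF y]]])
    have b: "bij (\<lambda>k. j (frechet_derivative G (at (g (j y))) k))"
      using g(3)[OF jV(1)[OF y]] unfolding f'[OF jV(3)[OF y]] .
    show "frechet_derivative G (at (g (j y))) (g' (j y) (j v)) = v" for v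
    proof -
      have "j (frechet_derivative G (at (g (j y))) (g' (j y) (j v))) = j v"
        unfolding g(2)[OF jV(1)[OF y]] f'[OF jV(3)[OF y]] using surj_f_inv_f[OF bij_is_surj[OF b]] .
      then show ?thesis using j(3) by metis
    qed
    show "w = 0" if "frechet_derivative G (at (g (j y))) w = 0" for w
    proof -
      have "linear (frechet_derivative G (at (g (j y))))"
        by (rule has_derivative_linear[OF ck_on_has_derivative[OF Gk jV(3)[OF y]]])
      then have "frechet_derivative G (at (g (j y))) 0 = 0" by (rule linear_0)
      then show ?thesis using bij_is_inj[OF b] that unfolding inj_def by metis
    qed
  qed
  moreover have "smooth_on D G" using Gk DU U unfolding smooth_on_def by (meson ck_on_subset subset_trans)
  moreover have "G ` D \<subseteq> Q" using uQ sD DU(1) U(2) unfolding G_def by blast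
  ultimately show ?thesis
    using that[of r G "\<lambda>y. g (j y)"] DU(2) oV ig G0 G1 DU(1) U(2) unfolding D_def zero_prod_def by blast
qed

section \<open>Charts, tangent vectors and vector fields\<close>

text \<open>A chart of the maximal atlas, except that its target may be any Euclidean space:
  rectifying charts take values in \<open>real \<times> 'f\<close> and not in the model space
  \<open>'e\<close>.\<close>

definition compat_chart :: "('a, 'e::euclidean_space) mfd \<Rightarrow> 'a set \<Rightarrow> ('a \<Rightarrow> 'd::euclidean_space) \<Rightarrow> bool" where
  "compat_chart M U \<Psi> \<longleftrightarrow> openin (mtop M) U \<and> open (\<Psi> ` U) \<and>
     homeomorphic_map (subtopology (mtop M) U) (top_of_set (\<Psi> ` U)) \<Psi> \<and>
     (\<forall>(V, \<phi>)\<in>atlas M. smooth_on (\<phi> ` (V \<inter> U)) (\<Psi> \<circ> inv_into V \<phi>) \<and> smooth_on (\<Psi> ` (V \<inter> U)) (\<phi> \<circ> inv_into U \<Psi>))"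

lemma smooth_on_subset: "smooth_on S f \<Longrightarrow> T \<subseteq> S \<Longrightarrow> smooth_on T f"
  unfolding smooth_on_def using ck_on_subset by blast

lemma smooth_on_cong: "open S \<Longrightarrow> (\<And>x. x \<in> S \<Longrightarrow> f x = g x) \<Longrightarrow> smooth_on S f \<Longrightarrow> smooth_on S g"
  unfolding smooth_on_def using ck_on_cong by blast

lemma smooth_on_local: "(\<And>x. x \<in> S \<Longrightarrow> \<exists>T. open T \<and> x \<in> T \<and> smooth_on T f) \<Longrightarrow> smooth_on S f"
  unfolding smooth_on_def by (intro allI ck_on_local) blast

lemma smooth_on_compose: "open S \<Longrightarrow> smooth_on S f \<Longrightarrow> smooth_on T g \<Longrightarrow> f ` S \<subseteq> T \<Longrightarrow> smooth_on S (\<lambda>x. g (f x))"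
  unfolding smooth_on_def using ck_on_compose by blast

lemma smooth_on_bounded_linear: "open S \<Longrightarrow> bounded_linear f \<Longrightarrow> smooth_on S f"
  unfolding smooth_on_def using ck_on_bounded_linear by blast

lemma smooth_on_linear_compose: "open S \<Longrightarrow> bounded_linear L \<Longrightarrow> smooth_on S f \<Longrightarrow> smooth_on S (\<lambda>x. L (f x))"
  unfolding smooth_on_def using ck_on_linear_compose by blast

lemma smooth_on_has_derivative: "smooth_on S f \<Longrightarrow> x \<in> S \<Longrightarrow> (f has_derivative frechet_derivative f (at x)) (at x)"
  unfolding smooth_on_def using ck_on_has_derivative by blast

lemma smooth_on_frechet: "smooth_on S f \<Longrightarrow> smooth_on S (\<lambda>x. frechet_derivative f (at x) v)"
  unfolding smooth_on_def using ck_on_frechet by blast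

lemma smooth_on_id: "open S \<Longrightarrow> smooth_on S (\<lambda>x. x)"
  by (rule smooth_on_bounded_linear[OF _ bounded_linear_ident])

lemma compat_chart_inj: "compat_chart M U \<Psi> \<Longrightarrow> inj_on \<Psi> U"
  and compat_chart_openin: "compat_chart M U \<Psi> \<Longrightarrow> openin (mtop M) U"
  and compat_chart_subset: "compat_chart M U \<Psi> \<Longrightarrow> U \<subseteq> topspace (mtop M)"
proof -
  assume c: "compat_chart M U \<Psi>"
  then show U: "openin (mtop M) U" by (simp add: compat_chart_def)
  then show "U \<subseteq> topspace (mtop M)" by (rule openin_subset)
  then show "inj_on \<Psi> U" using c homeomorphic_imp_injective_map[of "subtopology (mtop M) U"]
    by (auto simp: compat_chart_def topspace_subtopology Int_absorb1)
qed

lemma compat_chart_inv: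
  assumes "compat_chart M U \<Psi>"
  shows "q \<in> U \<Longrightarrow> inv_into U \<Psi> (\<Psi> q) = q" "y \<in> \<Psi> ` U \<Longrightarrow> \<Psi> (inv_into U \<Psi> y) = y"
    "y \<in> \<Psi> ` U \<Longrightarrow> inv_into U \<Psi> y \<in> U"
  by (simp_all add: compat_chart_inj[OF assms] f_inv_into_f inv_into_into)

lemma compat_chart_open_iff:
  assumes "compat_chart M U \<Psi>" "V \<subseteq> U"
  shows "openin (mtop M) V \<longleftrightarrow> open (\<Psi> ` V)"
proof -
  have h: "homeomorphic_map (subtopology (mtop M) U) (top_of_set (\<Psi> ` U)) \<Psi>" and U: "openin (mtop M) U" "open (\<Psi> ` U)"
    using assms(1) by (simp_all add: compat_chart_def)
  have "V \<subseteq> topspace (subtopology (mtop M) U)"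
    using assms(2) openin_subset[OF U(1)] by (auto simp: topspace_subtopology)
  from homeomorphic_map_openness[OF h this]
  have "openin (top_of_set (\<Psi> ` U)) (\<Psi> ` V) \<longleftrightarrow> openin (subtopology (mtop M) U) V" .
  moreover have "openin (top_of_set (\<Psi> ` U)) (\<Psi> ` V) \<longleftrightarrow> open (\<Psi> ` V)"
    using openin_open_eq[OF U(2)] assms(2) by (auto simp: image_mono)
  moreover have "openin (subtopology (mtop M) U) V \<longleftrightarrow> openin (mtop M) V"
    using openin_open_subtopology[OF U(1)] assms(2) by auto
  ultimately show ?thesis by simp
qed

lemma compat_chart_preimage:
  assumes "compat_chart M U \<Psi>" "open S" "S \<subseteq> \<Psi> ` U"
  shows "openin (mtop M) (U \<inter> \<Psi> -` S)" "\<Psi> ` (U \<inter> \<Psi> -` S) = S"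
proof -
  show "\<Psi> ` (U \<inter> \<Psi> -` S) = S" using assms(3) by auto
  then show "openin (mtop M) (U \<inter> \<Psi> -` S)" using compat_chart_open_iff[OF assms(1), of "U \<inter> \<Psi> -` S"] assms(2) by simp
qed

lemma compat_chart_atlas:
  assumes "smooth_manifold M" "(U, \<phi>) \<in> atlas M"
  shows "compat_chart M U \<phi>"
proof -
  have "smooth_on (\<phi> ` (U \<inter> V)) (\<psi> \<circ> inv_into U \<phi>)" "smooth_on (\<psi> ` (V \<inter> U)) (\<phi> \<circ> inv_into V \<psi>)"
    if "(V, \<psi>) \<in> atlas M" for V \<psi>
    using assms that unfolding smooth_manifold_def by blast+
  moreover have "openin (mtop M) U \<and> open (\<phi> ` U) \<and> homeomorphic_map (subtopology (mtop M) U) (top_of_set (\<phi> ` U)) \<phi>"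
    using assms unfolding smooth_manifold_def by blast
  ultimately show ?thesis unfolding compat_chart_def by (auto simp: Int_commute)
qed

lemma manifold_chart_at:
  assumes "smooth_manifold M" "p \<in> topspace (mtop M)"
  obtains U \<phi> where "(U, \<phi>) \<in> atlas M" "p \<in> U" "compat_chart M U \<phi>"
proof -
  have "p \<in> \<Union> (fst ` atlas M)" using assms unfolding smooth_manifold_def by simp
  then obtain U \<phi> where "(U, \<phi>) \<in> atlas M" "p \<in> U" by auto
  then show ?thesis using that compat_chart_atlas[OF assms(1)] by blast
qed

lemma manifold_chart_ex:
  fixes M :: "('a, 'e::euclidean_space) mfd"
  shows "smooth_manifold M \<Longrightarrow> p \<in> topspace (mtop M) \<Longrightarrow> \<exists>U (\<phi> :: 'a \<Rightarrow> 'e). p \<in> U \<and> compat_chart M U \<phi>"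
  by (erule (1) manifold_chart_at) (intro exI conjI; assumption)

section \<open>Smooth functions on a manifold\<close>

lemma smooth_fun_subset:
  assumes "smooth_manifold M" "smooth_fun M W f" "openin (mtop M) V" "V \<subseteq> W"
  shows "smooth_fun M V f"
  using assms(2-4) unfolding smooth_fun_def by (fast intro: smooth_on_subset image_mono)

text \<open>On the overlap with any atlas chart the two coordinate expressions differ by a smooth
  transition map, so a single compatible chart containing \<open>V\<close> decides
  smoothness.\<close>

lemma smooth_fun_chart_iff:
  fixes f :: "'a \<Rightarrow> 'v::real_normed_vector"
  assumes M: "smooth_manifold M" and c: "compat_chart M U \<Psi>" and V: "V \<subseteq> U" "openin (mtop M) V"
  shows "smooth_fun M V f \<longleftrightarrow> smooth_on (\<Psi> ` V) (f \<circ> inv_into U \<Psi>)"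
proof
  note inv = compat_chart_inv[OF c]
  {
    assume f: "smooth_fun M V f"
    show "smooth_on (\<Psi> ` V) (f \<circ> inv_into U \<Psi>)"
    proof (rule smooth_on_local)
      fix y assume "y \<in> \<Psi> ` V"
      then obtain q where q: "q \<in> V" "y = \<Psi> q" by blast
      then have "q \<in> topspace (mtop M)" using V(2) openin_subset by blast
      from manifold_chart_at[OF M this] obtain W \<phi> where W: "(W, \<phi>) \<in> atlas M" "q \<in> W" "compat_chart M W \<phi>" .
      have o: "openin (mtop M) (W \<inter> V)" using V(2) compat_chart_openin[OF W(3)] by (rule openin_Int[rotated])
      have oS: "open (\<Psi> ` (W \<inter> V))" using compat_chart_open_iff[OF c, of "W \<inter> V"] o V(1) by auto
      have s1: "smooth_on (\<Psi> ` (W \<inter> V)) (\<phi> \<circ> inv_into U \<Psi>)"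
        using c W(1) V(1) unfolding compat_chart_def by (fast intro: smooth_on_subset)
      have s2: "smooth_on (\<phi> ` (W \<inter> V)) (f \<circ> inv_into W \<phi>)" using f W(1) unfolding smooth_fun_def by blast
      have "smooth_on (\<Psi> ` (W \<inter> V)) (\<lambda>y. (f \<circ> inv_into W \<phi>) ((\<phi> \<circ> inv_into U \<Psi>) y))"
        by (rule smooth_on_compose[OF oS s1 s2]) (use inv(1) V(1) in \<open>auto simp: subset_iff\<close>)
      then have "smooth_on (\<Psi> ` (W \<inter> V)) (f \<circ> inv_into U \<Psi>)"
        by (rule smooth_on_cong[OF oS, rotated]) (use inv(1) V(1) compat_chart_inv(1)[OF W(3)] in \<open>auto simp: subset_iff\<close>)
      then show "\<exists>T. open T \<and> y \<in> T \<and> smooth_on T (f \<circ> inv_into U \<Psi>)" using oS q W(2) by blast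
    qed
  next
    assume f: "smooth_on (\<Psi> ` V) (f \<circ> inv_into U \<Psi>)"
    show "smooth_fun M V f" unfolding smooth_fun_def
    proof (intro conjI V(2) ballI, clarify)
      fix W \<phi> assume W: "(W, \<phi>) \<in> atlas M"
      note cW = compat_chart_atlas[OF M W]
      have oS: "open (\<phi> ` (W \<inter> V))"
        using compat_chart_open_iff[OF cW, of "W \<inter> V"] V(2) compat_chart_openin[OF cW] by auto
      have s1: "smooth_on (\<phi> ` (W \<inter> V)) (\<Psi> \<circ> inv_into W \<phi>)"
        using c W V(1) unfolding compat_chart_def by (fast intro: smooth_on_subset)
      have "smooth_on (\<phi> ` (W \<inter> V)) (\<lambda>y. (f \<circ> inv_into U \<Psi>) ((\<Psi> \<circ> inv_into W \<phi>) y))"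
        by (rule smooth_on_compose[OF oS s1 f]) (use compat_chart_inv(1)[OF cW] in auto)
      then show "smooth_on (\<phi> ` (W \<inter> V)) (f \<circ> inv_into W \<phi>)"
        by (rule smooth_on_cong[OF oS, rotated]) (use inv(1) V(1) compat_chart_inv(1)[OF cW] in \<open>auto simp: subset_iff\<close>)
    qed
  }
qed

lemma smooth_near_fun: "smooth_fun M W f \<Longrightarrow> p \<in> W \<Longrightarrow> smooth_near M p f"
  unfolding smooth_near_def by blast

lemma smooth_near_chart_iff:
  assumes M: "smooth_manifold M" and c: "compat_chart M U \<Psi>" and p: "p \<in> U"
  shows "smooth_near M p f \<longleftrightarrow> (\<exists>S. open S \<and> \<Psi> p \<in> S \<and> S \<subseteq> \<Psi> ` U \<and> smooth_on S (f \<circ> inv_into U \<Psi>))"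
proof
  assume "smooth_near M p f"
  then obtain W where W: "p \<in> W" "smooth_fun M W f" unfolding smooth_near_def by blast
  then have "openin (mtop M) W" by (simp add: smooth_fun_def)
  then have o: "openin (mtop M) (W \<inter> U)" using compat_chart_openin[OF c] by blast
  have "smooth_on (\<Psi> ` (W \<inter> U)) (f \<circ> inv_into U \<Psi>)"
    by (rule iffD1[OF smooth_fun_chart_iff[OF M c _ o] smooth_fun_subset[OF M W(2) o]]) auto
  moreover have "open (\<Psi> ` (W \<inter> U))" using compat_chart_open_iff[OF c, of "W \<inter> U"] o by simp
  ultimately show "\<exists>S. open S \<and> \<Psi> p \<in> S \<and> S \<subseteq> \<Psi> ` U \<and> smooth_on S (f \<circ> inv_into U \<Psi>)"
    using W(1) p by (intro exI[of _ "\<Psi> ` (W \<inter> U)"]) auto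
next
  assume "\<exists>S. open S \<and> \<Psi> p \<in> S \<and> S \<subseteq> \<Psi> ` U \<and> smooth_on S (f \<circ> inv_into U \<Psi>)"
  then obtain S where S: "open S" "\<Psi> p \<in> S" "S \<subseteq> \<Psi> ` U" "smooth_on S (f \<circ> inv_into U \<Psi>)" by blast
  note pre = compat_chart_preimage[OF c S(1,3)]
  have "smooth_fun M (U \<inter> \<Psi> -` S) f"
    using smooth_fun_chart_iff[OF M c _ pre(1), of f] S(4) unfolding pre(2) by simp
  then show "smooth_near M p f" by (rule smooth_near_fun) (use p S(2) in simp)
qed

text \<open>Turns smoothness on an open set into a pointwise condition on germs, the form in which
  the ring operations and the elimination of \<open>germ_ring\<close> are stated.\<close>

lemma smooth_fun_iff:
  assumes M: "smooth_manifold M"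
  shows "smooth_fun M W f \<longleftrightarrow> openin (mtop M) W \<and> (\<forall>p\<in>W. smooth_near M p f)"
proof
  assume "smooth_fun M W f"
  then show "openin (mtop M) W \<and> (\<forall>p\<in>W. smooth_near M p f)"
    using smooth_near_fun by (fastforce simp: smooth_fun_def)
next
  assume W: "openin (mtop M) W \<and> (\<forall>p\<in>W. smooth_near M p f)"
  show "smooth_fun M W f" unfolding smooth_fun_def
  proof (intro conjI ballI, use W in simp, clarify)
    fix U \<phi> assume U: "(U, \<phi>) \<in> atlas M"
    note cU = compat_chart_atlas[OF M U]
    have o: "open (\<phi> ` (U \<inter> W))"
      using compat_chart_open_iff[OF cU, of "U \<inter> W"] W compat_chart_openin[OF cU] by auto
    show "smooth_on (\<phi> ` (U \<inter> W)) (f \<circ> inv_into U \<phi>)"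
    proof (rule smooth_on_local)
      fix y assume "y \<in> \<phi> ` (U \<inter> W)"
      then obtain p where p: "p \<in> U" "p \<in> W" "y = \<phi> p" by blast
      then show "\<exists>T. open T \<and> y \<in> T \<and> smooth_on T (f \<circ> inv_into U \<phi>)"
        using W smooth_near_chart_iff[OF M cU p(1)] by blast
    qed
  qed
qed

lemma smooth_near_open:
  assumes M: "smooth_manifold M" and "smooth_near M p f"
  shows "\<exists>W. openin (mtop M) W \<and> p \<in> W \<and> (\<forall>q\<in>W. smooth_near M q f)"
  using assms smooth_fun_iff[OF M] unfolding smooth_near_def by blast

lemma smooth_near_cong:
  fixes M :: "('a, 'e::euclidean_space) mfd"
  assumes M: "smooth_manifold M" and W: "openin (mtop M) W" "p \<in> W" "\<And>q. q \<in> W \<Longrightarrow> f q = g q" and g: "smooth_near M p g"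
  shows "smooth_near M p f"
proof -
  have "p \<in> topspace (mtop M)" using W openin_subset by blast
  then obtain U and \<phi> :: "'a \<Rightarrow> 'e" where U: "p \<in> U" "compat_chart M U \<phi>" using manifold_chart_ex[OF M] by blast
  obtain S where S: "open S" "\<phi> p \<in> S" "S \<subseteq> \<phi> ` U" "smooth_on S (g \<circ> inv_into U \<phi>)"
    using g smooth_near_chart_iff[OF M U(2,1)] by blast
  have o: "open (\<phi> ` (U \<inter> W))"
    using compat_chart_open_iff[OF U(2), of "U \<inter> W"] W compat_chart_openin[OF U(2)] by auto
  have "smooth_on (S \<inter> \<phi> ` (U \<inter> W)) (f \<circ> inv_into U \<phi>)"
    by (rule smooth_on_cong[OF open_Int[OF S(1) o] _ smooth_on_subset[OF S(4)]])
      (use W compat_chart_inv[OF U(2)] in auto)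
  then show ?thesis unfolding smooth_near_chart_iff[OF M U(2,1)]
    using S o U W by (intro exI[of _ "S \<inter> \<phi> ` (U \<inter> W)"]) auto
qed

lemma smooth_near_lift1:
  fixes M :: "('a, 'e::euclidean_space) mfd"
  assumes M: "smooth_manifold M" and p: "p \<in> topspace (mtop M)" and f: "smooth_near M p f"
    and B: "\<And>S (h :: 'e \<Rightarrow> complex). open S \<Longrightarrow> smooth_on S h \<Longrightarrow> smooth_on S (\<lambda>x. B (h x))"
  shows "smooth_near M p (\<lambda>q. B (f q))"
proof -
  obtain U and \<phi> :: "'a \<Rightarrow> 'e" where U: "p \<in> U" "compat_chart M U \<phi>" using manifold_chart_ex[OF M p] by blast
  obtain S where S: "open S" "\<phi> p \<in> S" "S \<subseteq> \<phi> ` U" "smooth_on S (f \<circ> inv_into U \<phi>)"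
    using f smooth_near_chart_iff[OF M U(2,1)] by blast
  have "smooth_on S ((\<lambda>q. B (f q)) \<circ> inv_into U \<phi>)" using B[OF S(1,4)] by (simp add: o_def)
  then show ?thesis unfolding smooth_near_chart_iff[OF M U(2,1)] using S by blast
qed

lemma smooth_near_lift2:
  fixes M :: "('a, 'e::euclidean_space) mfd"
  assumes M: "smooth_manifold M" and p: "p \<in> topspace (mtop M)" and f: "smooth_near M p f" and g: "smooth_near M p g"
    and B: "\<And>S (h :: 'e \<Rightarrow> complex) k. open S \<Longrightarrow> smooth_on S h \<Longrightarrow> smooth_on S k \<Longrightarrow> smooth_on S (\<lambda>x. B (h x) (k x))"
  shows "smooth_near M p (\<lambda>q. B (f q) (g q))"
proof -
  obtain U and \<phi> :: "'a \<Rightarrow> 'e" where U: "p \<in> U" "compat_chart M U \<phi>" using manifold_chart_ex[OF M p] by blast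
  obtain S where S: "open S" "\<phi> p \<in> S" "S \<subseteq> \<phi> ` U" "smooth_on S (f \<circ> inv_into U \<phi>)"
    using f smooth_near_chart_iff[OF M U(2,1)] by blast
  obtain T where T: "open T" "\<phi> p \<in> T" "T \<subseteq> \<phi> ` U" "smooth_on T (g \<circ> inv_into U \<phi>)"
    using g smooth_near_chart_iff[OF M U(2,1)] by blast
  have "smooth_on (S \<inter> T) ((\<lambda>q. B (f q) (g q)) \<circ> inv_into U \<phi>)"
    using B[OF open_Int[OF S(1) T(1)] smooth_on_subset[OF S(4)] smooth_on_subset[OF T(4)]] by (simp add: o_def)
  then show ?thesis unfolding smooth_near_chart_iff[OF M U(2,1)] using S T by (intro exI[of _ "S \<inter> T"]) auto
qed

lemma smooth_near_const:
  fixes M :: "('a, 'e::euclidean_space) mfd"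
  shows "smooth_manifold M \<Longrightarrow> p \<in> topspace (mtop M) \<Longrightarrow> smooth_near M p (\<lambda>_. c)"
proof -
  assume M: "smooth_manifold M" and p: "p \<in> topspace (mtop M)"
  obtain U and \<phi> :: "'a \<Rightarrow> 'e" where U: "p \<in> U" "compat_chart M U \<phi>" using manifold_chart_ex[OF M p] by blast
  then have "open (\<phi> ` U)" by (simp add: compat_chart_def)
  moreover from this have "smooth_on (\<phi> ` U) ((\<lambda>_. c) \<circ> inv_into U \<phi>)" by (simp add: smooth_on_def o_def ck_on_const)
  ultimately show ?thesis unfolding smooth_near_chart_iff[OF M U(2,1)] using U(1) by blast
qed

lemma smooth_near_nonzero:
  fixes M :: "('a, 'e::euclidean_space) mfd"
  assumes M: "smooth_manifold M" and p: "p \<in> topspace (mtop M)" and g: "smooth_near M p g" "g p \<noteq> 0"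
  obtains W where "openin (mtop M) W" "p \<in> W" "\<And>q. q \<in> W \<Longrightarrow> g q \<noteq> 0"
proof -
  obtain U and \<phi> :: "'a \<Rightarrow> 'e" where U: "p \<in> U" "compat_chart M U \<phi>" using manifold_chart_ex[OF M p] by blast
  obtain S where S: "open S" "\<phi> p \<in> S" "S \<subseteq> \<phi> ` U" "smooth_on S (g \<circ> inv_into U \<phi>)"
    using g smooth_near_chart_iff[OF M U(2,1)] by blast
  have "continuous_on S (g \<circ> inv_into U \<phi>)" using S(4) ck_on_continuous unfolding smooth_on_def by blast
  from continuous_open_preimage[OF this S(1) open_Compl[OF closed_singleton[of 0]]]
  have o: "open (S \<inter> (g \<circ> inv_into U \<phi>) -` (- {0}))" .
  have "S \<inter> (g \<circ> inv_into U \<phi>) -` (- {0}) \<subseteq> \<phi> ` U" using S(3) by blast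
  from compat_chart_preimage(1)[OF U(2) o this]
  show ?thesis
    by (rule that) (use U S g(2) compat_chart_inv[OF U(2)] in auto)
qed

text \<open>Through this instance the elimination argument applies to functions on the manifold.
  Division also has to shrink the neighbourhood to where the denominator does not vanish.\<close>

lemma germ_ring_smooth:
  fixes M :: "('a, 'e::euclidean_space) mfd"
  assumes M: "smooth_manifold M" and p: "p \<in> topspace (mtop M)"
  shows "germ_ring (smooth_near M p) p (nhdsin (mtop M) p)"
proof
  fix f g :: "'a \<Rightarrow> complex" and c :: complex
  show "smooth_near M p (\<lambda>_. c)" by (rule smooth_near_const[OF assms])
  show "smooth_near M p (\<lambda>y. f y + g y)" if "smooth_near M p f" "smooth_near M p g"
    by (rule smooth_near_lift2[OF M p that]) (simp add: smooth_on_def ck_on_add)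
  show "smooth_near M p (\<lambda>y. f y * g y)" if "smooth_near M p f" "smooth_near M p g"
    by (rule smooth_near_lift2[OF M p that]) (simp add: smooth_on_def ck_on_mult)
  have nz: "\<forall>\<^sub>F y in nhdsin (mtop M) p. g y \<noteq> 0" if "smooth_near M p g" "g p \<noteq> 0"
    using smooth_near_nonzero[OF M p that] p unfolding eventually_nhdsin by metis
  show "\<forall>\<^sub>F y in nhdsin (mtop M) p. g y \<noteq> 0" if "smooth_near M p g" "g p \<noteq> 0" by (rule nz[OF that])
  show "smooth_near M p f" if "\<forall>\<^sub>F y in nhdsin (mtop M) p. f y = g y" "smooth_near M p g"
    using that p smooth_near_cong[OF M _ _ _ that(2)] unfolding eventually_nhdsin by metis
  show "smooth_near M p (\<lambda>y. f y / g y)" if "smooth_near M p f" "smooth_near M p g" "g p \<noteq> 0"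
  proof -
    obtain U and \<phi> :: "'a \<Rightarrow> 'e" where U: "p \<in> U" "compat_chart M U \<phi>" using manifold_chart_ex[OF M p] by blast
    obtain S where S: "open S" "\<phi> p \<in> S" "S \<subseteq> \<phi> ` U" "smooth_on S (f \<circ> inv_into U \<phi>)"
      using \<open>smooth_near M p f\<close> smooth_near_chart_iff[OF M U(2,1)] by blast
    obtain T where T: "open T" "\<phi> p \<in> T" "T \<subseteq> \<phi> ` U" "smooth_on T (g \<circ> inv_into U \<phi>)"
      using \<open>smooth_near M p g\<close> smooth_near_chart_iff[OF M U(2,1)] by blast
    obtain W where W: "openin (mtop M) W" "p \<in> W" "\<And>q. q \<in> W \<Longrightarrow> g q \<noteq> 0"
      using smooth_near_nonzero[OF M p \<open>smooth_near M p g\<close> \<open>g p \<noteq> 0\<close>] by blast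
    have o: "open (\<phi> ` (U \<inter> W))"
      using compat_chart_open_iff[OF U(2), of "U \<inter> W"] W compat_chart_openin[OF U(2)] by auto
    have "smooth_on (S \<inter> T \<inter> \<phi> ` (U \<inter> W)) (\<lambda>x. (f \<circ> inv_into U \<phi>) x / (g \<circ> inv_into U \<phi>) x)"
      unfolding smooth_on_def
    proof (intro allI ck_on_divide open_Int S(1) T(1) o)
      show "ck_on k (S \<inter> T \<inter> \<phi> ` (U \<inter> W)) (f \<circ> inv_into U \<phi>)" for k
        using S(4) ck_on_subset unfolding smooth_on_def by blast
      show "ck_on k (S \<inter> T \<inter> \<phi> ` (U \<inter> W)) (g \<circ> inv_into U \<phi>)" for k
        using T(4) ck_on_subset unfolding smooth_on_def by blast
    qed (use W compat_chart_inv[OF U(2)] in auto)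
    then have "smooth_on (S \<inter> T \<inter> \<phi> ` (U \<inter> W)) ((\<lambda>y. f y / g y) \<circ> inv_into U \<phi>)" by (simp add: o_def)
    then show ?thesis unfolding smooth_near_chart_iff[OF M U(2,1)]
      using S T o U W by (intro exI[of _ "S \<inter> T \<inter> \<phi> ` (U \<inter> W)"]) auto
  qed
qed

lemma smooth_near_linear:
  assumes M: "smooth_manifold M" and p: "p \<in> topspace (mtop M)" and f: "smooth_near M p f" and L: "bounded_linear L"
  shows "smooth_near M p (\<lambda>q. L (f q))"
  by (rule smooth_near_lift1[OF M p f]) (use L in \<open>simp add: smooth_on_linear_compose\<close>)

text \<open>The operators of \<open>ctangent\<close>, but for every compatible chart and not only
  for those of the atlas; \<open>v\<close> and \<open>w\<close> are the real and imaginary parts of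
  the component vector.\<close>

definition chart_tvec ::
  "('a, 'e::euclidean_space) mfd \<Rightarrow> 'a set \<Rightarrow> ('a \<Rightarrow> 'd::euclidean_space) \<Rightarrow> 'a \<Rightarrow> 'd \<Rightarrow> 'd \<Rightarrow> 'a tvec" where
  "chart_tvec M U \<Psi> p v w = (\<lambda>f. if smooth_near M p f
     then frechet_derivative (f \<circ> inv_into U \<Psi>) (at (\<Psi> p)) v + \<i> * frechet_derivative (f \<circ> inv_into U \<Psi>) (at (\<Psi> p)) w
     else 0)"

definition coord :: "('a \<Rightarrow> 'd::euclidean_space) \<Rightarrow> 'd \<Rightarrow> 'a \<Rightarrow> complex" where
  "coord \<Psi> b q = complex_of_real (\<Psi> q \<bullet> b)"

lemma sum_tvec_apply: "(\<Sum>i\<in>A. Z i) f = (\<Sum>i\<in>A. Z i f)" for Z :: "'i \<Rightarrow> 'a tvec"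
  by (induction A rule: infinite_finite_induct) auto

lemma chart_has_derivative:
  assumes "smooth_manifold M" "compat_chart M U \<Psi>" "p \<in> U" "smooth_near M p f"
  shows "((f \<circ> inv_into U \<Psi>) has_derivative frechet_derivative (f \<circ> inv_into U \<Psi>) (at (\<Psi> p))) (at (\<Psi> p))"
proof -
  obtain S where "\<Psi> p \<in> S" "smooth_on S (f \<circ> inv_into U \<Psi>)"
    using assms(4) unfolding smooth_near_chart_iff[OF assms(1-3)] by blast
  then show ?thesis using smooth_on_has_derivative by blast
qed

lemma transition_smooth:
  fixes \<Psi> :: "'a \<Rightarrow> 'd::euclidean_space" and \<Psi>' :: "'a \<Rightarrow> 'c::euclidean_space"
  assumes M: "smooth_manifold M" and c: "compat_chart M U \<Psi>" and c': "compat_chart M U' \<Psi>'"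
  shows "smooth_on (\<Psi> ` (U \<inter> U')) (\<Psi>' \<circ> inv_into U \<Psi>)"
proof -
  have o: "openin (mtop M) (U \<inter> U')" using compat_chart_openin[OF c] compat_chart_openin[OF c'] by blast
  have oS: "open (\<Psi>' ` (U \<inter> U'))" using compat_chart_open_iff[OF c', of "U \<inter> U'"] o by auto
  have "smooth_on (\<Psi>' ` (U \<inter> U')) (\<Psi>' \<circ> inv_into U' \<Psi>')"
    by (rule smooth_on_cong[OF oS _ smooth_on_id[OF oS]]) (use compat_chart_inv[OF c'] in auto)
  then have "smooth_fun M (U \<inter> U') \<Psi>'" by (rule iffD2[OF smooth_fun_chart_iff[OF M c' _ o], rotated]) auto
  then show ?thesis by (rule iffD1[OF smooth_fun_chart_iff[OF M c _ o], rotated]) auto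
qed

text \<open>Chain rule for the transition map. It makes the choice of chart immaterial, in
  particular that of the atlas chart in \<open>ctangent\<close>.\<close>

lemma chart_tvec_change:
  fixes \<Psi> :: "'a \<Rightarrow> 'd::euclidean_space" and \<Psi>' :: "'a \<Rightarrow> 'c::euclidean_space"
  assumes M: "smooth_manifold M" and c: "compat_chart M U \<Psi>" and c': "compat_chart M U' \<Psi>'" and p: "p \<in> U" "p \<in> U'"
  shows "chart_tvec M U \<Psi> p v w = chart_tvec M U' \<Psi>' p
    (frechet_derivative (\<Psi>' \<circ> inv_into U \<Psi>) (at (\<Psi> p)) v) (frechet_derivative (\<Psi>' \<circ> inv_into U \<Psi>) (at (\<Psi> p)) w)"
proof -
  let ?J = "frechet_derivative (\<Psi>' \<circ> inv_into U \<Psi>) (at (\<Psi> p))"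
  have J: "((\<Psi>' \<circ> inv_into U \<Psi>) has_derivative ?J) (at (\<Psi> p))"
    by (rule smooth_on_has_derivative[OF transition_smooth[OF M c c']]) (use p in auto)
  have "frechet_derivative (f \<circ> inv_into U \<Psi>) (at (\<Psi> p)) = (\<lambda>v. frechet_derivative (f \<circ> inv_into U' \<Psi>') (at (\<Psi>' p)) (?J v))"
    if f: "smooth_near M p f" for f
  proof (rule frechet_derivative_at[symmetric])
    have e: "(\<Psi>' \<circ> inv_into U \<Psi>) (\<Psi> p) = \<Psi>' p" using compat_chart_inv[OF c] p by simp
    have "((\<lambda>x. (f \<circ> inv_into U' \<Psi>') ((\<Psi>' \<circ> inv_into U \<Psi>) x)) has_derivative
      (\<lambda>v. frechet_derivative (f \<circ> inv_into U' \<Psi>') (at (\<Psi>' p)) (?J v))) (at (\<Psi> p))"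
      by (rule has_derivative_compose[OF J]) (unfold e, rule chart_has_derivative[OF M c' p(2) f])
    moreover have "open (\<Psi> ` (U \<inter> U'))"
      using compat_chart_open_iff[OF c, of "U \<inter> U'"] compat_chart_openin[OF c] compat_chart_openin[OF c'] by auto
    ultimately show "((f \<circ> inv_into U \<Psi>) has_derivative
      (\<lambda>v. frechet_derivative (f \<circ> inv_into U' \<Psi>') (at (\<Psi>' p)) (?J v))) (at (\<Psi> p))"
      by (rule has_derivative_transform_within_open)
        (use p compat_chart_inv[OF c] compat_chart_inv[OF c'] in auto)
  qed
  then show ?thesis unfolding chart_tvec_def by auto
qed

lemma ctangent_chart:
  assumes M: "smooth_manifold M" and c: "compat_chart M U \<Psi>" and p: "p \<in> U"
  shows "chart_tvec M U \<Psi> p v w \<in> ctangent M p" "Z \<in> ctangent M p \<Longrightarrow> \<exists>v w. Z = chart_tvec M U \<Psi> p v w"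
proof -
  have "p \<in> topspace (mtop M)" using compat_chart_subset[OF c] p by blast
  from manifold_chart_at[OF M this] obtain V \<phi> where V: "(V, \<phi>) \<in> atlas M" "p \<in> V" "compat_chart M V \<phi>" .
  show "chart_tvec M U \<Psi> p v w \<in> ctangent M p"
    unfolding chart_tvec_change[OF M c V(3) p V(2)] unfolding ctangent_def chart_tvec_def using V(1,2) by blast
  assume "Z \<in> ctangent M p"
  then obtain V \<phi> v w where V: "(V, \<phi>) \<in> atlas M" "p \<in> V" "Z = chart_tvec M V \<phi> p v w"
    unfolding ctangent_def chart_tvec_def by blast
  show "\<exists>v w. Z = chart_tvec M U \<Psi> p v w"
    unfolding V(3) chart_tvec_change[OF M compat_chart_atlas[OF M V(1)] c V(2) p] by blast
qed

lemma chart_linear: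
  assumes "smooth_manifold M" "compat_chart M U \<Psi>" "p \<in> U" "smooth_near M p f"
  shows "linear (frechet_derivative (f \<circ> inv_into U \<Psi>) (at (\<Psi> p)))"
  by (rule has_derivative_linear[OF chart_has_derivative[OF assms]])

lemma chart_tvec_linear:
  assumes M: "smooth_manifold M" and c: "compat_chart M U \<Psi>" and p: "p \<in> U"
  shows "chart_tvec M U \<Psi> p v w + chart_tvec M U \<Psi> p v' w' = chart_tvec M U \<Psi> p (v + v') (w + w')"
    "tscale z (chart_tvec M U \<Psi> p v w) = chart_tvec M U \<Psi> p (Re z *\<^sub>R v - Im z *\<^sub>R w) (Re z *\<^sub>R w + Im z *\<^sub>R v)"
    "chart_tvec M U \<Psi> p 0 0 = 0"
    "tconj (chart_tvec M U \<Psi> p v w) = chart_tvec M U \<Psi> p v (- w)"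
proof -
  note lin = chart_linear[OF M c p]
  show "chart_tvec M U \<Psi> p v w + chart_tvec M U \<Psi> p v' w' = chart_tvec M U \<Psi> p (v + v') (w + w')"
    by (rule ext) (simp add: chart_tvec_def linear_add[OF lin] algebra_simps)
  show "chart_tvec M U \<Psi> p 0 0 = 0"
    by (rule ext) (simp add: chart_tvec_def linear_0[OF lin])
  show "tscale z (chart_tvec M U \<Psi> p v w) = chart_tvec M U \<Psi> p (Re z *\<^sub>R v - Im z *\<^sub>R w) (Re z *\<^sub>R w + Im z *\<^sub>R v)"
  proof (rule ext)
    fix f
    have alg: "z * (a + \<i> * b) = (Re z *\<^sub>R a - Im z *\<^sub>R b) + \<i> * (Re z *\<^sub>R b + Im z *\<^sub>R a)" for a b :: complex
      by (simp add: complex_eq_iff algebra_simps)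
    show "tscale z (chart_tvec M U \<Psi> p v w) f = chart_tvec M U \<Psi> p (Re z *\<^sub>R v - Im z *\<^sub>R w) (Re z *\<^sub>R w + Im z *\<^sub>R v) f"
      by (simp add: tscale_def chart_tvec_def linear_add[OF lin] linear_diff[OF lin] linear_cmul[OF lin] alg)
  qed
  have pt: "p \<in> topspace (mtop M)" using compat_chart_subset[OF c] p by blast
  have sc: "smooth_near M p (\<lambda>x. cnj (f x)) \<longleftrightarrow> smooth_near M p f" for f
    using smooth_near_linear[OF M pt _ bounded_linear_cnj, of f] smooth_near_linear[OF M pt _ bounded_linear_cnj, of "\<lambda>x. cnj (f x)"]
    by auto
  have fc: "frechet_derivative ((\<lambda>x. cnj (f x)) \<circ> inv_into U \<Psi>) (at (\<Psi> p)) = (\<lambda>v. cnj (frechet_derivative (f \<circ> inv_into U \<Psi>) (at (\<Psi> p)) v))"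
    if "smooth_near M p f" for f
    using frechet_derivative_at[OF bounded_linear.has_derivative[OF bounded_linear_cnj chart_has_derivative[OF M c p that]], symmetric]
    by (simp add: o_def)
  show "tconj (chart_tvec M U \<Psi> p v w) = chart_tvec M U \<Psi> p v (- w)"
    by (rule ext) (auto simp: tconj_def chart_tvec_def sc fc linear_neg[OF lin])
qed

lemma coord_smooth:
  assumes M: "smooth_manifold M" and c: "compat_chart M U \<Psi>"
  shows "smooth_fun M U (coord \<Psi> b)"
proof -
  have o: "open (\<Psi> ` U)" using c by (simp add: compat_chart_def)
  have "smooth_on (\<Psi> ` U) (\<lambda>y. complex_of_real (y \<bullet> b))"
    by (intro smooth_on_bounded_linear o bounded_linear_compose[OF bounded_linear_of_real] bounded_linear_inner_left)
  then have "smooth_on (\<Psi> ` U) (coord \<Psi> b \<circ> inv_into U \<Psi>)"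
    by (rule smooth_on_cong[OF o, rotated]) (simp add: coord_def compat_chart_inv[OF c])
  then show ?thesis by (rule iffD2[OF smooth_fun_chart_iff[OF M c order_refl compat_chart_openin[OF c]]])
qed

lemma chart_tvec_coord:
  assumes M: "smooth_manifold M" and c: "compat_chart M U \<Psi>" and p: "p \<in> U"
  shows "chart_tvec M U \<Psi> p v w (coord \<Psi> b) = complex_of_real (v \<bullet> b) + \<i> * complex_of_real (w \<bullet> b)"
proof -
  have o: "open (\<Psi> ` U)" using c by (simp add: compat_chart_def)
  have "((\<lambda>y. complex_of_real (y \<bullet> b)) has_derivative (\<lambda>y. complex_of_real (y \<bullet> b))) (at (\<Psi> p))"
    by (intro bounded_linear_imp_has_derivative bounded_linear_compose[OF bounded_linear_of_real] bounded_linear_inner_left)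
  then have "((coord \<Psi> b \<circ> inv_into U \<Psi>) has_derivative (\<lambda>y. complex_of_real (y \<bullet> b))) (at (\<Psi> p))"
    by (rule has_derivative_transform_within_open[OF _ o]) (use p compat_chart_inv[OF c] in \<open>auto simp: coord_def\<close>)
  from frechet_derivative_at[OF this, symmetric] show ?thesis
    using smooth_near_fun[OF coord_smooth[OF M c] p] by (simp add: chart_tvec_def)
qed

text \<open>Evaluation on the real coordinate functions recovers both component vectors as real and
  imaginary parts.\<close>

lemma chart_tvec_inj:
  assumes "smooth_manifold M" "compat_chart M U \<Psi>" "p \<in> U" "chart_tvec M U \<Psi> p v w = chart_tvec M U \<Psi> p v' w'"
  shows "v = v'" "w = w'"
proof -
  have "complex_of_real (v \<bullet> b) + \<i> * complex_of_real (w \<bullet> b) = complex_of_real (v' \<bullet> b) + \<i> * complex_of_real (w' \<bullet> b)" for b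
    using chart_tvec_coord[OF assms(1-3)] assms(4) by metis
  then have "v \<bullet> b = v' \<bullet> b" "w \<bullet> b = w' \<bullet> b" for b by (simp_all add: complex_eq_iff)
  then show "v = v'" "w = w'" by (auto intro: euclidean_eqI)
qed

lemma chart_tvec_expand:
  assumes M: "smooth_manifold M" and c: "compat_chart M U \<Psi>" and p: "p \<in> U" and Z: "Z \<in> ctangent M p"
  shows "Z = (\<Sum>b\<in>Basis. tscale (Z (coord \<Psi> b)) (chart_tvec M U \<Psi> p b 0))"
proof -
  obtain v w where vw: "Z = chart_tvec M U \<Psi> p v w" using ctangent_chart(2)[OF M c p Z] by blast
  have sum: "(\<Sum>b\<in>B. chart_tvec M U \<Psi> p (f b) (g b)) = chart_tvec M U \<Psi> p (\<Sum>b\<in>B. f b) (\<Sum>b\<in>B. g b)" if "finite B" for f g and B :: "'i set"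
    using that by (induction B) (simp_all add: chart_tvec_linear(1,3)[OF M c p])
  have "(\<Sum>b\<in>Basis. tscale (Z (coord \<Psi> b)) (chart_tvec M U \<Psi> p b 0)) =
    chart_tvec M U \<Psi> p (\<Sum>b\<in>Basis. (v \<bullet> b) *\<^sub>R b) (\<Sum>b\<in>Basis. (w \<bullet> b) *\<^sub>R b)"
    by (simp add: vw chart_tvec_coord[OF M c p] chart_tvec_linear(2)[OF M c p] sum)
  then show ?thesis by (simp add: vw euclidean_representation)
qed

lemma ctangent_closed:
  fixes M :: "('a, 'e::euclidean_space) mfd"
  assumes M: "smooth_manifold M"
  shows "p \<in> topspace (mtop M) \<Longrightarrow> 0 \<in> ctangent M p"
    "Z \<in> ctangent M p \<Longrightarrow> W \<in> ctangent M p \<Longrightarrow> Z + W \<in> ctangent M p"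
    "Z \<in> ctangent M p \<Longrightarrow> tscale c Z \<in> ctangent M p"
    "Z \<in> ctangent M p \<Longrightarrow> tconj Z \<in> ctangent M p"
proof -
  have pt: "p \<in> topspace (mtop M)" if "Z \<in> ctangent M p" for Z
    using that compat_chart_subset[OF compat_chart_atlas[OF M]] unfolding ctangent_def by blast
  {
    assume p: "p \<in> topspace (mtop M)"
    obtain U and \<phi> :: "'a \<Rightarrow> 'e" where U: "p \<in> U" "compat_chart M U \<phi>" using manifold_chart_ex[OF M p] by blast
    show "0 \<in> ctangent M p" using ctangent_chart(1)[OF M U(2,1), of 0 0] chart_tvec_linear(3)[OF M U(2,1)] by simp
  next
    assume Z: "Z \<in> ctangent M p"
    obtain U and \<phi> :: "'a \<Rightarrow> 'e" where U: "p \<in> U" "compat_chart M U \<phi>" using manifold_chart_ex[OF M pt[OF Z]] by blast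
    note cl = chart_tvec_linear[OF M U(2,1)] and ct = ctangent_chart[OF M U(2,1)]
    obtain v w where vw: "Z = chart_tvec M U \<phi> p v w" using ct(2)[OF Z] by blast
    show "tscale c Z \<in> ctangent M p" unfolding vw cl by (rule ct)
    show "tconj Z \<in> ctangent M p" unfolding vw cl by (rule ct)
    show "Z + W \<in> ctangent M p" if W: "W \<in> ctangent M p"
    proof -
      obtain v' w' where "W = chart_tvec M U \<phi> p v' w'" using ct(2)[OF W] by blast
      then show ?thesis unfolding vw using cl(1) ct(1) by simp
    qed
  }
qed

lemma ctangent_sum:
  assumes M: "smooth_manifold M" "p \<in> topspace (mtop M)" "\<And>i. i \<in> A \<Longrightarrow> Z i \<in> ctangent M p"
  shows "(\<Sum>i\<in>A. Z i) \<in> ctangent M p"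
  using assms(3) by (induction A rule: infinite_finite_induct) (simp_all add: ctangent_closed[OF M(1)] M(2))

lemma ctangent_not_smooth: "Z \<in> ctangent M p \<Longrightarrow> \<not> smooth_near M p f \<Longrightarrow> Z f = 0"
  unfolding ctangent_def by auto

section \<open>Conjugation, real and imaginary parts\<close>

lemma tconj_simps:
  "tconj (Z + W) = tconj Z + tconj W" "tconj (tscale c Z) = tscale (cnj c) (tconj Z)" "tconj (tconj Z) = Z"
  "tconj 0 = 0" "tconj (- Z) = - tconj Z" "tconj (Z - W) = tconj Z - tconj W"
  by (auto simp: tconj_def tscale_def fun_eq_iff)

lemma tconj_sum: "tconj (\<Sum>i\<in>A. Z i) = (\<Sum>i\<in>A. tconj (Z i))"
  by (induction A rule: infinite_finite_induct) (simp_all only: sum.infinite sum.empty sum.insert tconj_simps not_False_eq_True)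

lemma tRe_tIm: "Z = tRe Z + tscale \<i> (tIm Z)" "tRe (tconj Z) = tRe Z" "tIm (tconj Z) = - tIm Z"
  "tRe (Z + W) = tRe Z + tRe W" "tIm (Z + W) = tIm Z + tIm W"
  "tRe (tscale c Z) = rtscale (Re c) (tRe Z) + rtscale (- Im c) (tIm Z)"
  "tIm (tscale c Z) = rtscale (Re c) (tIm Z) + rtscale (Im c) (tRe Z)"
proof -
  show "tRe (tconj Z) = tRe Z" "tIm (tconj Z) = - tIm Z" "tRe (Z + W) = tRe Z + tRe W" "tIm (Z + W) = tIm Z + tIm W"
    by (auto simp: tRe_def tIm_def tconj_simps tscale_def fun_eq_iff field_simps)
  show "Z = tRe Z + tscale \<i> (tIm Z)" by (auto simp: tRe_def tIm_def tscale_def fun_eq_iff field_simps)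
  have c: "c = complex_of_real (Re c) + \<i> * complex_of_real (Im c)" "cnj c = complex_of_real (Re c) - \<i> * complex_of_real (Im c)"
    by (simp_all add: complex_eq_iff)
  have alg: "1/2 * (c * a + cnj c * b) = complex_of_real (Re c) * (1/2 * (a + b)) - complex_of_real (Im c) * (1 / (2 * \<i>) * (a - b))"
    "1 / (2 * \<i>) * (c * a - cnj c * b) = complex_of_real (Re c) * (1 / (2 * \<i>) * (a - b)) + complex_of_real (Im c) * (1/2 * (a + b))" for a b
    by (subst (1) c(1), subst (1) c(2), simp add: field_simps)+
  show "tRe (tscale c Z) = rtscale (Re c) (tRe Z) + rtscale (- Im c) (tIm Z)"
    "tIm (tscale c Z) = rtscale (Re c) (tIm Z) + rtscale (Im c) (tRe Z)"
    unfolding tRe_def tIm_def tconj_simps using alg by (auto simp: tscale_def rtscale_def fun_eq_iff)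
qed

lemma tRe_real: "tconj Z = Z \<Longrightarrow> tRe Z = Z" "tconj Z = Z \<Longrightarrow> tIm Z = 0"
  by (auto simp: tRe_def tIm_def tscale_def fun_eq_iff)

lemma tconj_tRe: "tconj (tRe Z) = tRe Z" "tconj (tIm Z) = tIm Z"
  unfolding tRe_def tIm_def tconj_simps by (auto simp: tscale_def fun_eq_iff field_simps)

lemma ctv_minus: "- Z = tscale (-1) Z" by (auto simp: tscale_def)

lemma ctangent_diff:
  assumes "smooth_manifold M" "Z \<in> ctangent M p" "W \<in> ctangent M p"
  shows "- Z \<in> ctangent M p" "Z - W \<in> ctangent M p"
  using ctangent_closed(2)[OF assms(1,2) ctangent_closed(3)[OF assms(1,3), of "-1"]] ctangent_closed(3)[OF assms(1,2), of "-1"]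
  by (simp_all add: ctv_minus[symmetric])

lemma rtangent_tRe:
  assumes "smooth_manifold M" "Z \<in> ctangent M p"
  shows "tRe Z \<in> rtangent M p" "tIm Z \<in> rtangent M p"
  unfolding rtangent_def using ctangent_closed[OF assms(1)] ctangent_diff[OF assms(1)] assms(2) tconj_tRe
  by (auto simp: tRe_def tIm_def)

lemma rtangent_closed:
  assumes "smooth_manifold M"
  shows "X \<in> rtangent M p \<Longrightarrow> Y \<in> rtangent M p \<Longrightarrow> X + Y \<in> rtangent M p"
    "X \<in> rtangent M p \<Longrightarrow> rtscale r X \<in> rtangent M p" "X \<in> rtangent M p \<Longrightarrow> - X \<in> rtangent M p"
  unfolding rtangent_def rtscale_def
  by (auto simp: ctangent_closed[OF assms] tconj_simps ctangent_diff[OF assms])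

section \<open>Smooth vector fields\<close>

lemma cvector_field_iff:
  assumes M: "smooth_manifold M"
  shows "cvector_field M W X \<longleftrightarrow> openin (mtop M) W \<and>
    (\<forall>p\<in>W. X p \<in> ctangent M p \<and> (\<forall>f. smooth_near M p f \<longrightarrow> smooth_near M p (\<lambda>q. X q f)))"
proof
  assume X: "cvector_field M W X"
  show "openin (mtop M) W \<and> (\<forall>p\<in>W. X p \<in> ctangent M p \<and> (\<forall>f. smooth_near M p f \<longrightarrow> smooth_near M p (\<lambda>q. X q f)))"
  proof (intro conjI ballI allI impI)
    show W: "openin (mtop M) W" using X by (simp add: cvector_field_def)
    fix p assume p: "p \<in> W"
    show "X p \<in> ctangent M p" using X p by (simp add: cvector_field_def)
    fix f assume "smooth_near M p f"
    then obtain V where V: "p \<in> V" "smooth_fun M V f" unfolding smooth_near_def by blast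
    then have o: "openin (mtop M) (V \<inter> W)" using W by (auto simp: smooth_fun_def)
    have "smooth_fun M (V \<inter> W) (\<lambda>q. X q f)"
      using X smooth_fun_subset[OF M V(2) o] unfolding cvector_field_def by simp
    then show "smooth_near M p (\<lambda>q. X q f)" by (rule smooth_near_fun) (use V p in simp)
  qed
next
  assume "openin (mtop M) W \<and> (\<forall>p\<in>W. X p \<in> ctangent M p \<and> (\<forall>f. smooth_near M p f \<longrightarrow> smooth_near M p (\<lambda>q. X q f)))"
  then show "cvector_field M W X" unfolding cvector_field_def smooth_fun_iff[OF M] by blast
qed

lemma cvector_field_subset:
  assumes M: "smooth_manifold M" and "cvector_field M W X" "openin (mtop M) V" "V \<subseteq> W"
  shows "cvector_field M V X"
  using assms(2-4) unfolding cvector_field_iff[OF M] by blast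

lemma cvector_field_combination:
  assumes M: "smooth_manifold M" and W: "openin (mtop M) W" and A: "finite A"
    and Z: "\<And>i. i \<in> A \<Longrightarrow> cvector_field M W (Z i)" and c: "\<And>i p. i \<in> A \<Longrightarrow> p \<in> W \<Longrightarrow> smooth_near M p (c i)"
  shows "cvector_field M W (\<lambda>q. \<Sum>i\<in>A. tscale (c i q) (Z i q))"
  unfolding cvector_field_iff[OF M]
proof (intro conjI ballI allI impI W)
  fix p assume p: "p \<in> W"
  have pt: "p \<in> topspace (mtop M)" using W p openin_subset by blast
  have Zp: "Z i p \<in> ctangent M p" "smooth_near M p f \<Longrightarrow> smooth_near M p (\<lambda>q. Z i q f)" if "i \<in> A" for i f
    using Z[OF that] p unfolding cvector_field_iff[OF M] by auto
  show "(\<Sum>i\<in>A. tscale (c i p) (Z i p)) \<in> ctangent M p"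
    by (intro ctangent_sum[OF M pt] ctangent_closed[OF M] Zp)
  fix f assume f: "smooth_near M p f"
  interpret germ_ring "smooth_near M p" p "nhdsin (mtop M) p" by (rule germ_ring_smooth[OF M pt])
  show "smooth_near M p (\<lambda>q. (\<Sum>i\<in>A. tscale (c i q) (Z i q)) f)"
    unfolding sum_tvec_apply tscale_def by (intro sum mult c Zp p f)
qed

lemma cvector_field_conj:
  assumes M: "smooth_manifold M" and X: "cvector_field M W X"
  shows "cvector_field M W (\<lambda>q. tconj (X q))"
  unfolding cvector_field_iff[OF M]
proof (intro conjI ballI allI impI)
  show W: "openin (mtop M) W" using X by (simp add: cvector_field_def)
  fix p assume p: "p \<in> W"
  have pt: "p \<in> topspace (mtop M)" using W p openin_subset by blast
  show "tconj (X p) \<in> ctangent M p" using X p ctangent_closed[OF M] by (simp add: cvector_field_def)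
  fix f assume f: "smooth_near M p f"
  have "smooth_near M p (\<lambda>q. X q (\<lambda>x. cnj (f x)))"
    using X p smooth_near_linear[OF M pt f bounded_linear_cnj] unfolding cvector_field_iff[OF M] by blast
  then show "smooth_near M p (\<lambda>q. tconj (X q) f)"
    unfolding tconj_def by (rule smooth_near_linear[OF M pt _ bounded_linear_cnj])
qed

lemma cvector_field_linear2:
  assumes M: "smooth_manifold M" and X: "cvector_field M W X" and Y: "cvector_field M W Y"
  shows "cvector_field M W (\<lambda>q. tscale a (X q) + tscale b (Y q))"
proof -
  have W: "openin (mtop M) W" using X by (simp add: cvector_field_def)
  have "cvector_field M W (\<lambda>q. \<Sum>i\<in>(UNIV :: bool set). tscale ((\<lambda>_. if i then a else b) q) ((if i then X else Y) q))"
    by (intro cvector_field_combination[OF M W]) (use X Y W openin_subset[OF W] in \<open>auto intro!: smooth_near_const[OF M]\<close>)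
  then show ?thesis by (simp add: UNIV_bool add.commute)
qed

lemma rvector_field_tRe:
  assumes M: "smooth_manifold M" and X: "cvector_field M W X"
  shows "rvector_field M W (\<lambda>q. tRe (X q))" "rvector_field M W (\<lambda>q. tIm (X q))"
proof -
  have e: "tRe (X q) = tscale (1/2) (X q) + tscale (1/2) (tconj (X q))" "tIm (X q) = tscale (1 / (2 * \<i>)) (X q) + tscale (- (1 / (2 * \<i>))) (tconj (X q))" for q
    by (auto simp: tRe_def tIm_def tscale_def fun_eq_iff field_simps)
  have "cvector_field M W (\<lambda>q. tRe (X q))" "cvector_field M W (\<lambda>q. tIm (X q))"
    unfolding e by (rule cvector_field_linear2[OF M X cvector_field_conj[OF M X]])+
  moreover have "X q \<in> ctangent M q" if "q \<in> W" for q using X that by (simp add: cvector_field_def)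
  ultimately show "rvector_field M W (\<lambda>q. tRe (X q))" "rvector_field M W (\<lambda>q. tIm (X q))"
    unfolding rvector_field_def using rtangent_tRe[OF M] by auto
qed

lemma chart_tvec_field:
  assumes M: "smooth_manifold M" and c: "compat_chart M U \<Psi>"
  shows "cvector_field M U (\<lambda>q. chart_tvec M U \<Psi> q v w)"
  unfolding cvector_field_iff[OF M]
proof (intro conjI ballI allI impI compat_chart_openin[OF c] ctangent_chart(1)[OF M c])
  fix p f assume p: "p \<in> U" and f: "smooth_near M p f"
  obtain S where S: "open S" "\<Psi> p \<in> S" "S \<subseteq> \<Psi> ` U" "smooth_on S (f \<circ> inv_into U \<Psi>)"
    using f smooth_near_chart_iff[OF M c p] by blast
  let ?F = "\<lambda>y v. frechet_derivative (f \<circ> inv_into U \<Psi>) (at y) v"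
  have sm: "smooth_near M q f" if "q \<in> U" "\<Psi> q \<in> S" for q
    using S that smooth_near_chart_iff[OF M c that(1)] by blast
  have "smooth_on S (\<lambda>y. ?F y v + \<i> * ?F y w)"
    using smooth_on_frechet[OF S(4)] S(1) unfolding smooth_on_def
    by (intro allI ck_on_add ck_on_linear_compose[OF S(1) bounded_linear_mult_right]) blast+
  then have "smooth_on S ((\<lambda>q. chart_tvec M U \<Psi> q v w f) \<circ> inv_into U \<Psi>)"
    by (rule smooth_on_cong[OF S(1), rotated])
      (use S(3) sm compat_chart_inv[OF c] in \<open>auto simp: chart_tvec_def subset_iff\<close>)
  then show "smooth_near M p (\<lambda>q. chart_tvec M U \<Psi> q v w f)"
    unfolding smooth_near_chart_iff[OF M c p] using S by blast
qed

section \<open>Linear algebra of families\<close>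

context vector_space
begin

text \<open>Independence of an indexed family: a repeated vector counts as a relation, whereas
  \<open>dependent\<close> sees only the set of values.\<close>

definition indep_family :: "nat \<Rightarrow> (nat \<Rightarrow> 'b) \<Rightarrow> bool" where
  "indep_family n Z \<longleftrightarrow> (\<forall>c. (\<Sum>i<n. scale (c i) (Z i)) = 0 \<longrightarrow> (\<forall>i<n. c i = 0))"

lemma span_family: "span (Z ` {..<n}) = {\<Sum>i<n. scale (c i) (Z i) |c. True}" for Z :: "nat \<Rightarrow> 'b"
proof (intro equalityI subsetI)
  fix x assume "x \<in> span (Z ` {..<n})"
  then show "x \<in> {\<Sum>i<n. scale (c i) (Z i) |c. True}"
  proof (induction rule: span_induct_alt)
    case base
    show ?case by (auto intro!: exI[of _ "\<lambda>_. 0"])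
  next
    case (step c x y)
    then obtain j d where j: "x = Z j" "j < n" and d: "y = (\<Sum>i<n. scale (d i) (Z i))" by auto
    have "scale c x + y = (\<Sum>i<n. scale ((if i = j then c else 0) + d i) (Z i))"
      unfolding d j(1) scale_left_distrib sum.distrib using j(2)
      by (simp add: if_distrib[of "\<lambda>c. scale c _"] cong: if_cong)
    then show ?case by auto
  qed
next
  fix x assume "x \<in> {\<Sum>i<n. scale (c i) (Z i) |c. True}"
  then obtain c where c: "x = (\<Sum>i<n. scale (c i) (Z i))" by blast
  show "x \<in> span (Z ` {..<n})" unfolding c by (intro span_sum span_scale span_base) auto
qed

lemma indep_family_imp_inj:
  fixes Z :: "nat \<Rightarrow> 'b"
  assumes "local.indep_family n Z" shows "inj_on Z {..<n}" "\<not> local.dependent (Z ` {..<n})"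
proof -
  show inj: "inj_on Z {..<n}"
  proof (rule inj_onI, rule ccontr)
    fix i j assume ij: "i \<in> {..<n}" "j \<in> {..<n}" "Z i = Z j" "i \<noteq> j"
    \<comment> \<open>If \<open>Z i = Z j\<close> with \<open>i \<noteq> j\<close>, the family has
      the relation \<open>Z i - Z j = 0\<close>.\<close>
    define c where "c l = (if l = i then 1 else 0) + (if l = j then - 1 else (0::'a))" for l
    have "(\<Sum>l<n. scale (c l) (Z l)) = 0"
      unfolding c_def scale_left_distrib sum.distrib using ij
      by (simp add: if_distrib[of "\<lambda>c. scale c _"] cong: if_cong)
    then have "c i = 0" using assms ij unfolding indep_family_def by blast
    then show False using ij by (simp add: c_def)
  qed
  show "\<not> local.dependent (Z ` {..<n})"
  proof (rule independent_if_scalars_zero)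
    fix f x assume s: "(\<Sum>x\<in>Z ` {..<n}. scale (f x) x) = 0" and x: "x \<in> Z ` {..<n}"
    have "(\<Sum>i<n. scale (f (Z i)) (Z i)) = 0" using s by (simp add: sum.reindex[OF inj])
    then show "f x = 0" using assms x unfolding indep_family_def by (auto dest!: spec[of _ "\<lambda>i. f (Z i)"])
  qed simp
qed

text \<open>A nontrivial relation expresses one member through the others, and then fewer than
  \<open>n\<close> vectors would span a space of dimension \<open>n\<close>.\<close>

lemma indep_family_if_dim:
  fixes Z :: "nat \<Rightarrow> 'b"
  assumes "local.dim (local.span (Z ` {..<n})) = n" shows "local.indep_family n Z"
  unfolding indep_family_def
proof (intro allI impI, rule ccontr)
  fix c i assume s: "(\<Sum>i<n. scale (c i) (Z i)) = 0" and i: "i < n" and ci: "c i \<noteq> 0"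
  have "(\<Sum>j<n. scale (c j) (Z j)) = scale (c i) (Z i) + (\<Sum>j\<in>{..<n} - {i}. scale (c j) (Z j))"
    using i by (subst sum.remove[of _ i]) auto
  then have "scale (c i) (Z i) = - (\<Sum>j\<in>{..<n} - {i}. scale (c j) (Z j))" using s by (simp add: eq_neg_iff_add_eq_0)
  also have "\<dots> \<in> span (Z ` ({..<n} - {i}))"
    by (intro span_neg span_sum span_scale span_base) auto
  finally have "scale (inverse (c i)) (scale (c i) (Z i)) \<in> span (Z ` ({..<n} - {i}))" by (rule span_scale)
  then have Zi: "Z i \<in> span (Z ` ({..<n} - {i}))" using ci by simp
  have "Z ` {..<n} \<subseteq> span (Z ` ({..<n} - {i}))"
  proof
    fix x assume "x \<in> Z ` {..<n}"
    then obtain j where "j < n" "x = Z j" by auto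
    then show "x \<in> span (Z ` ({..<n} - {i}))" using Zi by (cases "j = i") (auto intro: span_base)
  qed
  then have "span (Z ` {..<n}) \<subseteq> span (Z ` ({..<n} - {i}))" by (rule span_minimal) simp
  then have "dim (span (Z ` {..<n})) \<le> card (Z ` ({..<n} - {i}))" by (intro dim_le_card) auto
  also have "\<dots> \<le> card ({..<n} - {i})" by (rule card_image_le) simp
  also have "\<dots> < n" using i by simp
  finally show False using assms by simp
qed

lemma dim_indep_family: "local.indep_family n Z \<Longrightarrow> dim (span (Z ` {..<n})) = n"
  using dim_span_eq_card_independent[OF indep_family_imp_inj(2)] card_image[OF indep_family_imp_inj(1)] by simp

text \<open>A vector outside the span of the family could be added to it, giving
  \<open>n + 1\<close> independent vectors in a space spanned by at most \<open>n\<close>.\<close>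

lemma indep_family_spans:
  fixes Z :: "nat \<Rightarrow> 'b"
  assumes "local.indep_family n Z" "finite Y" "card Y \<le> n" "\<And>i. i < n \<Longrightarrow> Z i \<in> span Y" "x \<in> span Y"
  shows "\<exists>c. x = (\<Sum>i<n. scale (c i) (Z i))"
proof -
  have "x \<in> span (Z ` {..<n})"
  proof (rule ccontr)
    assume x: "x \<notin> span (Z ` {..<n})"
    have "\<not> local.dependent (insert x (Z ` {..<n}))"
      using indep_family_imp_inj(2)[OF assms(1)] x independent_insert by (metis span_base)
    moreover have "insert x (Z ` {..<n}) \<subseteq> span Y" using assms(4,5) by auto
    ultimately have "card (insert x (Z ` {..<n})) \<le> card Y" using independent_span_bound[OF assms(2)] by blast
    moreover have "x \<notin> Z ` {..<n}"
    proof
      assume "x \<in> Z ` {..<n}"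
      then have "x \<in> span (Z ` {..<n})" by (rule span_base)
      then show False using x by simp
    qed
    ultimately show False using card_image[OF indep_family_imp_inj(1)[OF assms(1)]] assms(3) by simp
  qed
  then show ?thesis unfolding span_family by blast
qed

end

text \<open>The elimination runs over an infinite set of components: a tangent vector is a function
  on functions, and its values on all \<open>f\<close> smooth near \<open>p\<close> serve as
  components. They determine it, since it is 0 on all other functions, and no chart has to be
  chosen.\<close>

lemma field_coefficients_smooth:
  assumes M: "smooth_manifold M" and W: "openin (mtop M) W" "p \<in> W"
    and Z: "\<And>j. j < n \<Longrightarrow> cvector_field M W (Z j)" and V: "cvector_field M W V"
    and eq: "\<And>q. q \<in> W \<Longrightarrow> V q = (\<Sum>j<n. tscale (w j q) (Z j q))"
    and indep: "ctv.indep_family n (\<lambda>j. Z j p)" and j: "j < n"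
  shows "smooth_near M p (w j)"
proof -
  have pt: "p \<in> topspace (mtop M)" using W openin_subset by blast
  interpret germ_ring "smooth_near M p" p "nhdsin (mtop M) p" by (rule germ_ring_smooth[OF M pt])
  show ?thesis
  proof (rule coefficients[of "{f. smooth_near M p f}" n "\<lambda>j q f. Z j q f" "\<lambda>q f. V q f" w, OF _ _ _ _ j])
    show "smooth_near M p (\<lambda>y. Z j y i)" if "i \<in> {f. smooth_near M p f}" "j < n" for i j
      using Z[OF that(2)] that(1) W(2) unfolding cvector_field_iff[OF M] by auto
    show "smooth_near M p (\<lambda>y. V y i)" if "i \<in> {f. smooth_near M p f}" for i
      using V that W(2) unfolding cvector_field_iff[OF M] by auto
    show "\<forall>\<^sub>F y in nhdsin (mtop M) p. V y i = (\<Sum>j<n. w j y * Z j y i)" for i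
      unfolding eventually_nhdsin using W eq by (auto simp: sum_tvec_apply tscale_def intro!: exI[of _ W])
    fix c j assume c: "\<And>i. i \<in> {f. smooth_near M p f} \<Longrightarrow> (\<Sum>j<n. c j * Z j p i) = 0" and j: "j < n"
    have "(\<Sum>j<n. tscale (c j) (Z j p)) = 0"
    proof (rule ext)
      fix f
      have "Z j p f = 0" if "j < n" "\<not> smooth_near M p f" for j
        by (rule ctangent_not_smooth[OF _ that(2)]) (use Z[OF that(1)] W(2) in \<open>simp add: cvector_field_def\<close>)
      then show "(\<Sum>j<n. tscale (c j) (Z j p)) f = 0 f"
        using c[of f] by (cases "smooth_near M p f") (simp_all add: sum_tvec_apply tscale_def)
    qed
    then show "c j = 0" using indep j unfolding ctv.indep_family_def by blast
  qed
qed

section \<open>The complexified metric\<close>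

lemma smooth_near_of_real:
  assumes M: "smooth_manifold M" and r: "smooth_fun M W (r :: 'a \<Rightarrow> real)" and p: "p \<in> W"
  shows "smooth_near M p (\<lambda>q. complex_of_real (r q))"
proof -
  have W: "openin (mtop M) W" using r by (simp add: smooth_fun_def)
  have "smooth_fun M W (\<lambda>q. complex_of_real (r q))"
    unfolding smooth_fun_def
  proof (intro conjI W ballI, clarify)
    fix U \<phi> assume U: "(U, \<phi>) \<in> atlas M"
    note cU = compat_chart_atlas[OF M U]
    have o: "open (\<phi> ` (U \<inter> W))"
      using compat_chart_open_iff[OF cU, of "U \<inter> W"] W compat_chart_openin[OF cU] by auto
    have "smooth_on (\<phi> ` (U \<inter> W)) (r \<circ> inv_into U \<phi>)" using r U unfolding smooth_fun_def by blast
    from smooth_on_linear_compose[OF o bounded_linear_of_real this]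
    show "smooth_on (\<phi> ` (U \<inter> W)) ((\<lambda>q. complex_of_real (r q)) \<circ> inv_into U \<phi>)" by (simp add: o_def)
  qed
  then show ?thesis using p by (rule smooth_near_fun)
qed

context
  fixes M :: "('a, 'e::euclidean_space) mfd" and g :: "'a metric" and p :: 'a
  assumes M: "smooth_manifold M" and g: "lorentzian_metric M g" and p: "p \<in> topspace (mtop M)"
begin

lemma metric_rules:
  "X \<in> rtangent M p \<Longrightarrow> Y \<in> rtangent M p \<Longrightarrow> g p X Y = g p Y X"
  "X \<in> rtangent M p \<Longrightarrow> X' \<in> rtangent M p \<Longrightarrow> Y \<in> rtangent M p \<Longrightarrow> g p (X + X') Y = g p X Y + g p X' Y"
  "X \<in> rtangent M p \<Longrightarrow> Y \<in> rtangent M p \<Longrightarrow> g p (rtscale r X) Y = r * g p X Y"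
  using g p unfolding lorentzian_metric_def by blast+

lemma complexify_sym:
  "Z \<in> ctangent M p \<Longrightarrow> W \<in> ctangent M p \<Longrightarrow> complexify g p Z W = complexify g p W Z"
  unfolding complexify_def using metric_rules(1) rtangent_tRe[OF M] by (simp add: add.commute)

lemma complexify_add:
  "Z \<in> ctangent M p \<Longrightarrow> Z' \<in> ctangent M p \<Longrightarrow> W \<in> ctangent M p \<Longrightarrow>
    complexify g p (Z + Z') W = complexify g p Z W + complexify g p Z' W"
  unfolding complexify_def tRe_tIm using rtangent_tRe[OF M] by (simp add: metric_rules(2) complex_eq_iff)

lemma complexify_scale:
  "Z \<in> ctangent M p \<Longrightarrow> W \<in> ctangent M p \<Longrightarrow> complexify g p (tscale c Z) W = c * complexify g p Z W"
proof -
  assume Z: "Z \<in> ctangent M p" and W: "W \<in> ctangent M p"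
  have h: "g p (rtscale a A + rtscale b B) C = a * g p A C + b * g p B C"
    if "A \<in> rtangent M p" "B \<in> rtangent M p" "C \<in> rtangent M p" for a b A B C
    using metric_rules(2)[OF rtangent_closed(2)[OF M that(1)] rtangent_closed(2)[OF M that(2)] that(3), of a b]
    by (simp add: metric_rules(3) that)
  note r = rtangent_tRe[OF M Z] rtangent_tRe[OF M W]
  show ?thesis
    unfolding complexify_def tRe_tIm(6,7)
      h[OF r(1,2,3)] h[OF r(1,2,4)] h[OF r(2,1,3)] h[OF r(2,1,4)]
    by (simp add: complex_eq_iff algebra_simps)
qed

lemma complexify_add2:
  "Z \<in> ctangent M p \<Longrightarrow> Z' \<in> ctangent M p \<Longrightarrow> W \<in> ctangent M p \<Longrightarrow>
    complexify g p W (Z + Z') = complexify g p W Z + complexify g p W Z'"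
  using complexify_add complexify_sym ctangent_closed(2)[OF M] by metis

lemma complexify_scale2:
  "Z \<in> ctangent M p \<Longrightarrow> W \<in> ctangent M p \<Longrightarrow> complexify g p W (tscale c Z) = c * complexify g p W Z"
  using complexify_scale complexify_sym ctangent_closed(3)[OF M] by metis

lemma complexify_zero: "W \<in> ctangent M p \<Longrightarrow> complexify g p 0 W = 0" "W \<in> ctangent M p \<Longrightarrow> complexify g p W 0 = 0"
  using complexify_scale[of 0 W 0] complexify_scale2[of 0 W 0] ctangent_closed(1)[OF M p] by auto

lemma complexify_sum:
  assumes "W \<in> ctangent M p" "\<And>i. i \<in> A \<Longrightarrow> Z i \<in> ctangent M p"
  shows "complexify g p (\<Sum>i\<in>A. tscale (c i) (Z i)) W = (\<Sum>i\<in>A. c i * complexify g p (Z i) W)"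
  using assms(2)
  by (induction A rule: infinite_finite_induct)
    (simp_all add: complexify_zero assms(1) complexify_add complexify_scale ctangent_closed[OF M] ctangent_sum[OF M p])

lemma complexify_sum2:
  assumes "W \<in> ctangent M p" "\<And>i. i \<in> A \<Longrightarrow> Z i \<in> ctangent M p"
  shows "complexify g p W (\<Sum>i\<in>A. tscale (c i) (Z i)) = (\<Sum>i\<in>A. c i * complexify g p W (Z i))"
  using assms(2)
  by (induction A rule: infinite_finite_induct)
    (simp_all add: complexify_zero assms(1) complexify_add2 complexify_scale2 ctangent_closed[OF M] ctangent_sum[OF M p])

lemma complexify_conj:
  assumes "Z \<in> ctangent M p" "W \<in> ctangent M p"
  shows "complexify g p (tconj Z) (tconj W) = cnj (complexify g p Z W)"
proof -
  have n: "g p (- X) Y = - g p X Y" "g p Y (- X) = - g p Y X" if "X \<in> rtangent M p" "Y \<in> rtangent M p" for X Y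
  proof -
    have "- X = rtscale (-1) X" by (simp add: rtscale_def tscale_def fun_eq_iff)
    then show "g p (- X) Y = - g p X Y" using metric_rules(3)[OF that, of "-1"] by simp
    then show "g p Y (- X) = - g p Y X" using metric_rules(1) that rtangent_closed(3)[OF M that(1)] by simp
  qed
  show ?thesis
    unfolding complexify_def tRe_tIm(2,3)
    using assms rtangent_tRe[OF M] rtangent_closed(3)[OF M] by (simp add: n complex_eq_iff)
qed

lemma complexify_real:
  assumes "X \<in> rtangent M p" "Y \<in> rtangent M p"
  shows "complexify g p X Y = complex_of_real (g p X Y)"
proof -
  have "0 \<in> rtangent M p" unfolding rtangent_def using ctangent_closed(1)[OF M p] by (simp add: tconj_simps)
  moreover have "rtscale 0 X = 0" for X :: "'a tvec" by (simp add: rtscale_def tscale_def fun_eq_iff)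
  ultimately have "g p 0 Z = 0" "g p Z 0 = 0" if "Z \<in> rtangent M p" for Z
    using metric_rules(3)[of 0 Z 0] metric_rules(1)[of 0 Z] that by auto
  moreover have "tRe X = X" "tIm X = 0" "tRe Y = Y" "tIm Y = 0"
    using assms tRe_real by (auto simp: rtangent_def)
  ultimately show ?thesis using assms \<open>0 \<in> rtangent M p\<close> by (simp add: complexify_def complex_eq_iff)
qed

text \<open>Pairing with the members of an orthonormal frame isolates the coefficients of
  \<open>Z\<close>, up to the sign of the timelike one.\<close>

lemma complexify_nondegenerate:
  assumes Z: "Z \<in> ctangent M p" and 0: "\<And>W. W \<in> ctangent M p \<Longrightarrow> complexify g p W Z = 0"
  shows "Z = 0"
proof -
  obtain E :: "nat \<Rightarrow> 'a tvec" where E: "\<And>i. i < DIM('e) \<Longrightarrow> E i \<in> rtangent M p"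
    "rtangent M p = rtv.span (E ` {..<DIM('e)})"
    "\<And>i j. i < DIM('e) \<Longrightarrow> j < DIM('e) \<Longrightarrow> g p (E i) (E j) = (if i \<noteq> j then 0 else if i = 0 then -1 else 1)"
    using conjunct2[OF conjunct2[OF conjunct2[OF bspec[OF conjunct1[OF g[unfolded lorentzian_metric_def]] p]]]] by blast
  have Ec: "E i \<in> ctangent M p" if "i < DIM('e)" for i using E(1)[OF that] by (simp add: rtangent_def)
  have rsum: "\<exists>c. Y = (\<Sum>i<DIM('e). tscale (complex_of_real (c i)) (E i))" if "Y \<in> rtangent M p" for Y
    using that unfolding E(2) rtv.span_family by (auto simp: rtscale_def)
  obtain a where a: "tRe Z = (\<Sum>i<DIM('e). tscale (complex_of_real (a i)) (E i))" using rsum rtangent_tRe[OF M Z] by blast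
  obtain b where b: "tIm Z = (\<Sum>i<DIM('e). tscale (complex_of_real (b i)) (E i))" using rsum rtangent_tRe[OF M Z] by blast
  have Zs: "Z = (\<Sum>i<DIM('e). tscale (complex_of_real (a i) + \<i> * complex_of_real (b i)) (E i))"
    by (subst tRe_tIm(1)[of Z]) (simp add: a b ctv.scale_sum_right ctv.scale_left_distrib sum.distrib)
  have "complex_of_real (a j) + \<i> * complex_of_real (b j) = 0" if j: "j < DIM('e)" for j
  proof -
    have "0 = complexify g p (E j) Z" using 0[OF Ec[OF j]] by simp
    also have "\<dots> = (\<Sum>i<DIM('e). (complex_of_real (a i) + \<i> * complex_of_real (b i)) * complexify g p (E j) (E i))"
      unfolding Zs by (rule complexify_sum2) (use Ec j in auto)
    also have "\<dots> = (\<Sum>i<DIM('e). if i = j then (complex_of_real (a i) + \<i> * complex_of_real (b i)) * complex_of_real (if i = 0 then -1 else 1) else 0)"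
      by (rule sum.cong) (auto simp: complexify_real E(1,3) j)
    also have "\<dots> = (complex_of_real (a j) + \<i> * complex_of_real (b j)) * complex_of_real (if j = 0 then -1 else 1)"
      using j by simp
    finally show ?thesis by (auto split: if_splits)
  qed
  then show ?thesis unfolding Zs by (intro sum.neutral) simp
qed

end

text \<open>Real and imaginary parts of smooth fields are smooth real fields, so the complex
  statement is four instances of the real one.\<close>

lemma complexify_smooth:
  assumes M: "smooth_manifold M" and g: "lorentzian_metric M g" and X: "cvector_field M W X" and Y: "cvector_field M W Y" and p: "p \<in> W"
  shows "smooth_near M p (\<lambda>q. complexify g q (X q) (Y q))"
proof -
  have "openin (mtop M) W" using X by (simp add: cvector_field_def)
  then have pt: "p \<in> topspace (mtop M)" using p openin_subset by blast
  interpret germ_ring "smooth_near M p" p "nhdsin (mtop M) p" by (rule germ_ring_smooth[OF M pt])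
  have s: "smooth_near M p (\<lambda>q. complex_of_real (g q (A q) (B q)))" if "rvector_field M W A" "rvector_field M W B" for A B
    by (rule smooth_near_of_real[OF M _ p])
      (rule conjunct2[OF g[unfolded lorentzian_metric_def], rule_format, OF that])
  note r = rvector_field_tRe[OF M X] rvector_field_tRe[OF M Y]
  have eq: "complexify g q (X q) (Y q) =
     (complex_of_real (g q (tRe (X q)) (tRe (Y q))) - complex_of_real (g q (tIm (X q)) (tIm (Y q)))) +
     \<i> * (complex_of_real (g q (tRe (X q)) (tIm (Y q))) + complex_of_real (g q (tIm (X q)) (tRe (Y q))))" for q
    unfolding complexify_def by (rule complex_eqI) simp_all
  show ?thesis unfolding eq
    by (rule add[OF diff[OF s[OF r(1,3)] s[OF r(2,4)]] mult[OF const[of \<i>] add[OF s[OF r(1,4)] s[OF r(2,3)]]]])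
qed

section \<open>Flow boxes on manifolds\<close>

text \<open>A change of coordinates inside a given chart, with \<open>G\<close> mapping new to old
  coordinates. The third conclusion transports components by the derivative of \<open>G\<close>; it
  is how the direction of \<open>K\<close> is followed through the flow box and through the
  rescaling of \<open>t\<close>.\<close>

lemma compat_chart_compose:
  fixes \<phi> :: "'a \<Rightarrow> 'c::euclidean_space" and G :: "'d::euclidean_space \<Rightarrow> 'c" and g :: "'c \<Rightarrow> 'd"
  assumes M: "smooth_manifold M" and c: "compat_chart M U \<phi>" and D: "open D" "open (G ` D)" "G ` D \<subseteq> \<phi> ` U"
    and gG: "\<And>z. z \<in> D \<Longrightarrow> g (G z) = z" and G: "smooth_on D G" and g: "smooth_on (G ` D) g"
  defines "U' \<equiv> U \<inter> \<phi> -` G ` D"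
  shows "compat_chart M U' (\<lambda>q. g (\<phi> q))" "(\<lambda>q. g (\<phi> q)) ` U' = D"
    "\<And>q v w. q \<in> U' \<Longrightarrow> chart_tvec M U' (\<lambda>q. g (\<phi> q)) q v w =
       chart_tvec M U \<phi> q (frechet_derivative G (at (g (\<phi> q))) v) (frechet_derivative G (at (g (\<phi> q))) w)"
proof -
  note inv = compat_chart_inv[OF c]
  have U': "openin (mtop M) U'" "\<phi> ` U' = G ` D" "U' \<subseteq> U" unfolding U'_def using compat_chart_preimage[OF c D(2,3)] by auto
  have img: "(\<lambda>q. g (\<phi> q)) ` U' = D"
  proof -
    have "(\<lambda>q. g (\<phi> q)) ` U' = g ` (\<phi> ` U')" by auto
    then show ?thesis unfolding U'(2) using gG by (force simp: image_image)
  qed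
  show "(\<lambda>q. g (\<phi> q)) ` U' = D" by (rule img)
  have cont: "continuous_on D G" "continuous_on (G ` D) g"
    using G g ck_on_continuous unfolding smooth_on_def by blast+
  have Gg: "G (g y) = y" "g y \<in> D" if y: "y \<in> G ` D" for y using y gG by auto
  have hom: "homeomorphic_map (subtopology (mtop M) U') (top_of_set ((\<lambda>q. g (\<phi> q)) ` U')) (\<lambda>q. g (\<phi> q))"
  proof -
    have h: "homeomorphic_map (subtopology (mtop M) U) (top_of_set (\<phi> ` U)) \<phi>" using c by (simp add: compat_chart_def)
    have "\<phi> ` (topspace (subtopology (mtop M) U) \<inter> U') = topspace (top_of_set (\<phi> ` U)) \<inter> G ` D"
      using U' D(3) openin_subset[OF U'(1)] by (auto simp: topspace_subtopology Int_absorb1)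
    from homeomorphic_map_subtopologies[OF h this]
    have h1: "homeomorphic_map (subtopology (mtop M) U') (top_of_set (G ` D)) \<phi>"
      using U'(3) D(3) by (simp add: subtopology_subtopology Int_absorb1)
    have "homeomorphic_maps (top_of_set (G ` D)) (top_of_set D) g G"
      unfolding homeomorphic_maps_def continuous_map_subtopology_eu
      using cont gG Gg by auto
    then have h2: "homeomorphic_map (top_of_set (G ` D)) (top_of_set D) g" using homeomorphic_map_maps by blast
    show ?thesis unfolding img using homeomorphic_map_compose[OF h1 h2] by (simp add: o_def)
  qed
  have inv': "inv_into U' (\<lambda>q. g (\<phi> q)) y = inv_into U \<phi> (G y)" if y: "y \<in> D" for y
  proof (rule inv_into_f_eq)
    show "inj_on (\<lambda>q. g (\<phi> q)) U'"
      using compat_chart_inj[OF c] Gg(1) unfolding U'_def inj_on_def by (metis IntD1 IntD2 vimageE)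
    have "G y \<in> \<phi> ` U" using y D(3) by blast
    then show "inv_into U \<phi> (G y) \<in> U'" "g (\<phi> (inv_into U \<phi> (G y))) = y"
      unfolding U'_def using inv(2,3)[of "G y"] y gG by auto
  qed
  show cc: "compat_chart M U' (\<lambda>q. g (\<phi> q))"
    unfolding compat_chart_def
  proof (intro conjI U'(1) hom ballI, use img D(1) in simp, clarify)
    fix W \<psi> assume W: "(W, \<psi>) \<in> atlas M"
    note cW = compat_chart_atlas[OF M W]
    have oW: "openin (mtop M) (W \<inter> U')" using compat_chart_openin[OF cW] U'(1) by blast
    have s: "smooth_on (\<psi> ` (W \<inter> U)) (\<phi> \<circ> inv_into W \<psi>)" "smooth_on (\<phi> ` (W \<inter> U)) (\<psi> \<circ> inv_into U \<phi>)"
      using c W unfolding compat_chart_def by blast+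
    have o1: "open (\<psi> ` (W \<inter> U'))" using compat_chart_open_iff[OF cW, of "W \<inter> U'"] oW by auto
    have "smooth_on (\<psi> ` (W \<inter> U')) (\<lambda>y. g ((\<phi> \<circ> inv_into W \<psi>) y))"
      by (rule smooth_on_compose[OF o1 smooth_on_subset[OF s(1)] g])
        (use U' compat_chart_inv[OF cW] in auto)
    then have "smooth_on (\<psi> ` (W \<inter> U')) ((\<lambda>q. g (\<phi> q)) \<circ> inv_into W \<psi>)" by (simp add: o_def)
    have o2: "open ((\<lambda>q. g (\<phi> q)) ` (W \<inter> U'))"
    proof -
      have "open (\<phi> ` (W \<inter> U'))" using compat_chart_open_iff[OF c, of "W \<inter> U'"] oW U'(3) by auto
      moreover have "(\<lambda>q. g (\<phi> q)) ` (W \<inter> U') = D \<inter> G -` (\<phi> ` (W \<inter> U'))"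
      proof (intro equalityI subsetI)
        fix y assume "y \<in> (\<lambda>q. g (\<phi> q)) ` (W \<inter> U')"
        then obtain q where q: "q \<in> W \<inter> U'" "y = g (\<phi> q)" by blast
        then have "\<phi> q \<in> G ` D" using U'(2) by blast
        then have "G y = \<phi> q" "y \<in> D" using Gg q(2) by auto
        then show "y \<in> D \<inter> G -` (\<phi> ` (W \<inter> U'))" using q(1) by auto
      next
        fix y assume y: "y \<in> D \<inter> G -` (\<phi> ` (W \<inter> U'))"
        then obtain q where q: "q \<in> W \<inter> U'" "G y = \<phi> q" by blast
        then have "y = g (\<phi> q)" using gG[of y] y by simp
        then show "y \<in> (\<lambda>q. g (\<phi> q)) ` (W \<inter> U')" using q by blast
      qed
      ultimately show ?thesis using continuous_open_preimage[OF cont(1) D(1)] by simp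
    qed
    have sub: "(\<lambda>q. g (\<phi> q)) ` (W \<inter> U') \<subseteq> D" using img by blast
    have "smooth_on ((\<lambda>q. g (\<phi> q)) ` (W \<inter> U')) (\<lambda>y. (\<psi> \<circ> inv_into U \<phi>) (G y))"
    proof (rule smooth_on_compose[OF o2 smooth_on_subset[OF G sub] s(2)], rule image_subsetI)
      fix y assume "y \<in> (\<lambda>q. g (\<phi> q)) ` (W \<inter> U')"
      then obtain q where q: "q \<in> W \<inter> U'" "y = g (\<phi> q)" by blast
      then have "G y = \<phi> q" using Gg U'(2) by blast
      then show "G y \<in> \<phi> ` (W \<inter> U)" using q U'(3) by blast
    qed
    then have "smooth_on ((\<lambda>q. g (\<phi> q)) ` (W \<inter> U')) (\<psi> \<circ> inv_into U' (\<lambda>q. g (\<phi> q)))"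
      by (rule smooth_on_cong[OF o2, rotated]) (use inv' sub in auto)
    then show "smooth_on (\<psi> ` (W \<inter> U')) ((\<lambda>q. g (\<phi> q)) \<circ> inv_into W \<psi>) \<and>
      smooth_on ((\<lambda>q. g (\<phi> q)) ` (W \<inter> U')) (\<psi> \<circ> inv_into U' (\<lambda>q. g (\<phi> q)))"
      using \<open>smooth_on (\<psi> ` (W \<inter> U')) ((\<lambda>q. g (\<phi> q)) \<circ> inv_into W \<psi>)\<close> by blast
  qed
  fix q v w assume q: "q \<in> U'"
  have qD: "g (\<phi> q) \<in> D" using img q by blast
  have "(\<phi> \<circ> inv_into U' (\<lambda>q. g (\<phi> q)) has_derivative frechet_derivative G (at (g (\<phi> q)))) (at (g (\<phi> q)))"
  proof (rule has_derivative_transform_within_open[OF smooth_on_has_derivative[OF G qD] D(1) qD])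
    show "G x = (\<phi> \<circ> inv_into U' (\<lambda>q. g (\<phi> q))) x" if x: "x \<in> D" for x
      using inv'[OF x] inv(2)[of "G x"] x D(3) by auto
  qed
  from frechet_derivative_at[OF this, symmetric]
  show "chart_tvec M U' (\<lambda>q. g (\<phi> q)) q v w =
       chart_tvec M U \<phi> q (frechet_derivative G (at (g (\<phi> q))) v) (frechet_derivative G (at (g (\<phi> q))) w)"
    using chart_tvec_change[OF M cc c q, of v w] q U'(3) by auto
qed

lemma smooth_on_exp: "smooth_on UNIV (exp :: real \<Rightarrow> real)"
  unfolding smooth_on_def
proof
  fix k show "ck_on k UNIV (exp :: real \<Rightarrow> real)"
  proof (induction k)
    case (Suc k)
    show ?case
    proof (rule ck_on_derivI[OF open_UNIV])
      show "(exp has_derivative (\<lambda>v. exp x * v)) (at x)" for x :: real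
        using DERIV_exp[of x] by (simp add: has_field_derivative_def)
      show "ck_on k UNIV (\<lambda>x. exp x * v)" for v :: real
        by (rule ck_on_linear_compose[OF open_UNIV bounded_linear_mult_left Suc])
    qed
  qed (simp add: continuous_on_exp)
qed

lemma smooth_on_ln: "smooth_on {0<..} (ln :: real \<Rightarrow> real)"
  unfolding smooth_on_def
proof
  fix k :: nat
  have "ck_on (Suc k) {0<..} (ln :: real \<Rightarrow> real)"
  proof (rule ck_on_derivI)
    show "(ln has_derivative (\<lambda>v. v / x)) (at x)" if "x \<in> {0<..}" for x :: real
      using DERIV_ln[of x] that by (simp add: has_field_derivative_def divide_inverse mult_commute_abs)
    show "ck_on k {0<..} (\<lambda>x. v / x)" for v :: real
      by (intro ck_on_divide ck_on_const ck_on_bounded_linear[OF _ bounded_linear_ident]) auto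
  qed simp
  then show "ck_on k {0<..} (ln :: real \<Rightarrow> real)" by (rule ck_on_SucD)
qed

text \<open>\<open>k s\<close> is \<open>r * tanh (s / 2)\<close> and \<open>h t\<close> is
  \<open>2 * artanh (t / r)\<close>, written with \<open>exp\<close> and \<open>ln\<close> so that
  smoothness follows from that of these two functions.\<close>

lemma interval_diffeo:
  assumes r: "0 < (r :: real)"
  obtains h k h' where "smooth_on {-r<..<r} h" "smooth_on UNIV k" "\<And>s. k s \<in> {-r<..<r}" "\<And>s. h (k s) = s"
    "\<And>t. t \<in> {-r<..<r} \<Longrightarrow> k (h t) = t" "h 0 = 0" "\<And>s. (k has_real_derivative h' s) (at s)" "\<And>s. h' s \<noteq> 0"
proof -
  define k where "k s = r * ((exp s - 1) / (exp s + 1))" for s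
  define h where "h t = ln ((r + t) / (r - t))" for t
  have p: "exp s + 1 \<noteq> (0::real)" "0 < exp s + 1" for s using exp_gt_zero[of s] by linarith+
  have sk: "smooth_on UNIV k" unfolding smooth_on_def k_def
    using smooth_on_exp p unfolding smooth_on_def
    by (intro allI ck_on_mult ck_on_divide ck_on_add ck_on_diff ck_on_const open_UNIV) blast+
  have sh: "smooth_on {-r<..<r} h"
    unfolding h_def
  proof (rule smooth_on_compose[OF _ _ smooth_on_ln])
    show "smooth_on {-r<..<r} (\<lambda>t. (r + t) / (r - t))" unfolding smooth_on_def
      by (intro allI ck_on_divide ck_on_add ck_on_diff ck_on_const ck_on_bounded_linear[OF _ bounded_linear_ident]) auto
  qed auto
  have kr: "k s \<in> {-r<..<r}" for s
  proof -
    have "r * (exp s - 1) < r * (exp s + 1)" "- (r * (exp s + 1)) < r * (exp s - 1)"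
      using r mult_pos_pos[OF r exp_gt_zero[of s]] by (simp_all add: algebra_simps)
    then show ?thesis unfolding k_def using p(2)[of s] by (simp add: pos_less_divide_eq pos_divide_less_eq)
  qed
  have hk: "h (k s) = s" for s
  proof -
    have e: "r + k s = 2 * r * exp s / (exp s + 1)" "r - k s = 2 * r / (exp s + 1)"
      unfolding k_def using p(1)[of s] by (simp_all add: field_simps)
    have "(r + k s) / (r - k s) = exp s" unfolding e using p(1)[of s] r by simp
    then show ?thesis unfolding h_def by simp
  qed
  have kh: "k (h t) = t" if t: "t \<in> {-r<..<r}" for t
  proof -
    have "0 < (r + t) / (r - t)" using t by simp
    then have e: "exp (h t) = (r + t) / (r - t)" unfolding h_def by simp
    have "exp (h t) - 1 = 2 * t / (r - t)" "exp (h t) + 1 = 2 * r / (r - t)" unfolding e using t by (simp_all add: field_simps)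
    then show ?thesis unfolding k_def using r t by simp
  qed
  have dk: "(k has_real_derivative r * ((exp s * (exp s + 1) - (exp s - 1) * exp s) / ((exp s + 1) * (exp s + 1)))) (at s)" for s
    unfolding k_def using p(1)[of s] by (auto intro!: derivative_eq_intros simp: algebra_simps)
  have "r * ((exp s * (exp s + 1) - (exp s - 1) * exp s) / ((exp s + 1) * (exp s + 1))) \<noteq> 0" for s
  proof -
    have "exp s * (exp s + 1) - (exp s - 1) * exp s = 2 * exp s" by (simp add: algebra_simps)
    then show ?thesis using r p(1)[of s] by simp
  qed
  from that[OF sh sk kr hk kh _ dk this] show ?thesis using r by (simp add: h_def)
qed

text \<open>The factor \<open>c\<close> may depend on \<open>q\<close>: only the line
  \<open>K q\<close> is straightened, so the property survives a rescaling of the first coordinate.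
  By linearity \<open>c\<close> can be normalised to 1, see \<open>rectifies_span\<close>.\<close>

definition rectifies ::
  "('a, 'e::euclidean_space) mfd \<Rightarrow> ('a \<Rightarrow> 'a tvec set) \<Rightarrow> 'a set \<Rightarrow> ('a \<Rightarrow> real \<times> 'f::euclidean_space) \<Rightarrow> bool" where
  "rectifies M K U \<Psi> \<longleftrightarrow> compat_chart M U \<Psi> \<and>
     (\<forall>q\<in>U. \<exists>c. c \<noteq> 0 \<and> K q = rtv.span {chart_tvec M U \<Psi> q (c, 0) 0})"

lemma rtv_span_scale:
  assumes "c \<noteq> 0" shows "rtv.span {rtscale c X} = rtv.span {X}"
proof -
  have "rtscale c X \<in> rtv.span {X}" by (intro rtv.span_scale rtv.span_base) simp
  moreover have "rtscale (inverse c) (rtscale c X) \<in> rtv.span {rtscale c X}" by (intro rtv.span_scale rtv.span_base) simp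
  then have "X \<in> rtv.span {rtscale c X}" using assms by simp
  ultimately show ?thesis by (intro equalityI rtv.span_minimal) auto
qed

lemma rectifies_span:
  assumes M: "smooth_manifold M" and "rectifies M K U \<Psi>" "q \<in> U"
  shows "K q = rtv.span {chart_tvec M U \<Psi> q (1, 0) 0}"
proof -
  obtain c where c: "c \<noteq> 0" "K q = rtv.span {chart_tvec M U \<Psi> q (c, 0) 0}" using assms unfolding rectifies_def by blast
  have "compat_chart M U \<Psi>" using assms by (simp add: rectifies_def)
  from chart_tvec_linear(2)[OF M this assms(3), of "complex_of_real c" "(1, 0)" 0]
  have "chart_tvec M U \<Psi> q (c, 0) 0 = rtscale c (chart_tvec M U \<Psi> q (1, 0) 0)" by (simp add: rtscale_def zero_prod_def)
  then show ?thesis using c rtv_span_scale by metis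
qed

text \<open>In a chart a real field is an ordinary vector field \<open>\<xi>\<close> on an open set,
  to which \<open>flow_box\<close> applies; following the chart by the inverse of the flow box
  straightens the field.\<close>

lemma rectifying_chart:
  fixes M :: "('a, 'e::euclidean_space) mfd"
  assumes M: "smooth_manifold M" and dim: "DIM('e) = DIM('f) + 1" and W: "openin (mtop M) W" "p \<in> W"
    and X: "rvector_field M W X" and X0: "\<And>q. q \<in> W \<Longrightarrow> X q \<noteq> 0" and K: "\<And>q. q \<in> W \<Longrightarrow> K q = rtv.span {X q}"
  obtains U \<Psi> r where "p \<in> U" "U \<subseteq> W" "0 < r" "rectifies M K U (\<Psi> :: 'a \<Rightarrow> real \<times> 'f::euclidean_space)"
    "\<Psi> ` U = {-r<..<r} \<times> ball 0 r" "\<Psi> p = (0, 0)"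
proof -
  have "p \<in> topspace (mtop M)" using W openin_subset by blast
  then obtain V and \<phi> :: "'a \<Rightarrow> 'e" where V: "p \<in> V" "compat_chart M V \<phi>" using manifold_chart_ex[OF M] by blast
  have Xc: "cvector_field M W X" using X by (simp add: rvector_field_def)
  have o: "openin (mtop M) (V \<inter> W)" using compat_chart_openin[OF V(2)] W(1) by blast
  define Q where "Q = \<phi> ` (V \<inter> W)"
  have Q: "open Q" "\<phi> p \<in> Q" unfolding Q_def using compat_chart_open_iff[OF V(2), of "V \<inter> W"] o V W by auto
  define \<xi> where "\<xi> y = (\<Sum>b\<in>Basis. Re (X (inv_into V \<phi> y) (coord \<phi> b)) *\<^sub>R b)" for y
  have \<xi>s: "smooth_on Q \<xi>"
  proof -
    have "smooth_on Q ((\<lambda>q. X q (coord \<phi> b)) \<circ> inv_into V \<phi>)" for b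
    proof -
      have "smooth_fun M (V \<inter> W) (coord \<phi> b)"
        by (rule smooth_fun_subset[OF M coord_smooth[OF M V(2)] o]) auto
      then have "smooth_fun M (V \<inter> W) (\<lambda>q. X q (coord \<phi> b))" using Xc unfolding cvector_field_def by simp
      then show ?thesis unfolding Q_def by (rule iffD1[OF smooth_fun_chart_iff[OF M V(2) _ o], rotated]) auto
    qed
    then show ?thesis unfolding \<xi>_def smooth_on_def o_def
      by (intro allI ck_on_sum ck_on_linear_compose[OF Q(1) bounded_linear_scaleR_left]
          ck_on_linear_compose[OF Q(1) bounded_linear_Re] Q(1)) blast
  qed
  have X\<xi>: "X q = chart_tvec M V \<phi> q (\<xi> (\<phi> q)) 0" if q: "q \<in> V \<inter> W" for q
  proof -
    have "X q \<in> rtangent M q" using X q by (simp add: rvector_field_def)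
    then have Xq: "X q \<in> ctangent M q" "tconj (X q) = X q" by (auto simp: rtangent_def)
    obtain v w where vw: "X q = chart_tvec M V \<phi> q v w" using ctangent_chart(2)[OF M V(2) _ Xq(1)] q by blast
    \<comment> \<open>Conjugation negates the imaginary components, so those of a real vector
      vanish.\<close>
    have "w = - w"
      by (rule chart_tvec_inj(2)[OF M V(2), of q v "w" v "- w"]) (use Xq(2) q vw chart_tvec_linear(4)[OF M V(2), of q v w] in auto)
    then have "w = 0" by (metis add.right_inverse double_zero_sym scaleR_2 scaleR_eq_0_iff zero_neq_numeral)
    then have v: "X q = chart_tvec M V \<phi> q v 0" using vw by simp
    have "\<xi> (\<phi> q) = (\<Sum>b\<in>Basis. (v \<bullet> b) *\<^sub>R b)"
      unfolding \<xi>_def using q chart_tvec_coord[OF M V(2), of q v 0] v by (simp add: compat_chart_inv[OF V(2)])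
    then show ?thesis using v by (simp add: euclidean_representation)
  qed
  have "\<xi> (\<phi> p) \<noteq> 0"
    using X\<xi>[of p] X0[OF W(2)] V W chart_tvec_linear(3)[OF M V(2,1)] by auto
  from flow_box[OF dim Q(1) \<xi>s Q(2) this]
  obtain G :: "real \<times> 'f \<Rightarrow> 'e" and g r where r: "0 < r" and G: "smooth_on ({-r<..<r} \<times> ball 0 r) G"
    "open (G ` ({-r<..<r} \<times> ball 0 r))" "G ` ({-r<..<r} \<times> ball 0 r) \<subseteq> Q" "smooth_on (G ` ({-r<..<r} \<times> ball 0 r)) g"
    "\<And>z. z \<in> {-r<..<r} \<times> ball 0 r \<Longrightarrow> g (G z) = z" "G (0, 0) = \<phi> p"
    "\<And>z. z \<in> {-r<..<r} \<times> ball 0 r \<Longrightarrow> frechet_derivative G (at z) (1, 0) = \<xi> (G z)" by metis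
  let ?D = "{-r<..<r} \<times> ball (0::'f) r"
  have oD: "open ?D" by (intro open_Times) auto
  have GV: "G ` ?D \<subseteq> \<phi> ` V" using G(3) unfolding Q_def by blast
  define U where "U = V \<inter> \<phi> -` G ` ?D"
  have cc1: "compat_chart M U (\<lambda>q. g (\<phi> q))"
    unfolding U_def by (rule compat_chart_compose(1)[OF M V(2) oD G(2) GV _ G(1,4)]) (rule G(5))
  have cc2: "(\<lambda>q. g (\<phi> q)) ` U = ?D"
    unfolding U_def by (rule compat_chart_compose(2)[OF M V(2) oD G(2) GV _ G(1,4)]) (rule G(5))
  have cc3: "chart_tvec M U (\<lambda>q. g (\<phi> q)) q v w =
       chart_tvec M V \<phi> q (frechet_derivative G (at (g (\<phi> q))) v) (frechet_derivative G (at (g (\<phi> q))) w)"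
    if "q \<in> U" for q v w
    using that unfolding U_def by (intro compat_chart_compose(3)[OF M V(2) oD G(2) GV _ G(1,4)]) (rule G(5))
  have UW: "U \<subseteq> V \<inter> W"
  proof
    fix q assume q: "q \<in> U"
    then have "\<phi> q \<in> \<phi> ` (V \<inter> W)" using G(3) unfolding U_def Q_def by blast
    then show "q \<in> V \<inter> W" using q inj_on_image_mem_iff[OF compat_chart_inj[OF V(2)], of q "V \<inter> W"] unfolding U_def by auto
  qed
  have z: "(0, 0) \<in> ?D" using r by simp
  show ?thesis
  proof
    have "\<phi> p \<in> G ` ?D" using G(6) z by (metis image_eqI)
    then show "p \<in> U" unfolding U_def using V by simp
    show "U \<subseteq> W" using UW by blast
    show "0 < r" by (rule r)
    show "(\<lambda>q. g (\<phi> q)) ` U = ?D" by (rule cc2)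
    show "g (\<phi> p) = (0, 0)" using G(5)[OF z] G(6) by simp
    show "rectifies M K U (\<lambda>q. g (\<phi> q))" unfolding rectifies_def
    proof (intro conjI ballI exI)
      show "compat_chart M U (\<lambda>q. g (\<phi> q))" by (rule cc1)
      fix q assume q: "q \<in> U"
      have gq: "g (\<phi> q) \<in> ?D" using cc2 q by blast
      have "G (g (\<phi> q)) = \<phi> q" using q G(5) unfolding U_def by auto
      then have "frechet_derivative G (at (g (\<phi> q))) (1, 0) = \<xi> (\<phi> q)" using G(7)[OF gq] by simp
      moreover have "frechet_derivative G (at (g (\<phi> q))) 0 = 0"
        by (rule linear_0[OF has_derivative_linear[OF smooth_on_has_derivative[OF G(1) gq]]])
      moreover have "q \<in> V \<inter> W" using UW q by blast
      ultimately have "chart_tvec M U (\<lambda>q. g (\<phi> q)) q (1, 0) 0 = X q"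
        using cc3[OF q, of "(1, 0)" 0] X\<xi>[of q] by simp
      then show "K q = rtv.span {chart_tvec M U (\<lambda>q. g (\<phi> q)) q (1, 0) 0}" using K[of q] UW q by auto
    qed simp
  qed
qed

text \<open>Shrinks the box into \<open>W\<close> and stretches its time interval to the whole line.
  The coordinate vectors \<open>(0, b)\<close> keep their meaning, so a condition on them secured in
  the first chart persists in the new one; the vector \<open>(1, 0)\<close> is only
  rescaled.\<close>

lemma rectifying_chart_shrink:
  fixes \<Psi> :: "'a \<Rightarrow> real \<times> 'f::euclidean_space"
  assumes M: "smooth_manifold M" and rect: "rectifies M K U \<Psi>" and W: "openin (mtop M) W" "p \<in> W" "p \<in> U" and z: "\<Psi> p = (0, 0)"
  obtains U' \<Psi>' r where "p \<in> U'" "U' \<subseteq> U \<inter> W" "0 < r" "rectifies M K U' \<Psi>'" "\<Psi>' ` U' = UNIV \<times> ball (0::'f) r"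
    "\<And>q b. q \<in> U' \<Longrightarrow> chart_tvec M U' \<Psi>' q (0, b) 0 = chart_tvec M U \<Psi> q (0, b) 0"
proof -
  have c: "compat_chart M U \<Psi>" using rect by (simp add: rectifies_def)
  have o: "openin (mtop M) (U \<inter> W)" using compat_chart_openin[OF c] W by blast
  have "open (\<Psi> ` (U \<inter> W))" using compat_chart_open_iff[OF c, of "U \<inter> W"] o by auto
  moreover have "(0, 0) \<in> \<Psi> ` (U \<inter> W)" using W z by (metis IntI image_eqI)
  ultimately obtain A B where AB: "open A" "open B" "(0, 0) \<in> A \<times> B" "A \<times> B \<subseteq> \<Psi> ` (U \<inter> W)" by (rule open_prod_elim)
  obtain r1 where r1: "0 < r1" "ball 0 r1 \<subseteq> A" using AB(1,3) open_contains_ball[of A] by auto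
  obtain r2 where r2: "0 < r2" "ball 0 r2 \<subseteq> B" using AB(2,3) open_contains_ball[of B] by auto
  have r1A: "{-r1<..<r1} \<subseteq> A" using r1(2) by (auto simp: dist_real_def subset_iff)
  obtain h k h' where hk: "smooth_on {-r1<..<r1} h" "smooth_on UNIV k" "\<And>s. k s \<in> {-r1<..<r1}" "\<And>s. h (k s) = s"
    "\<And>t. t \<in> {-r1<..<r1} \<Longrightarrow> k (h t) = t" "h 0 = 0" "\<And>s. (k has_real_derivative h' s) (at s)" "\<And>s. h' s \<noteq> 0"
    using interval_diffeo[OF r1(1)] by metis
  define G where "G z = (k (fst z), snd z)" for z :: "real \<times> 'f"
  define g where "g z = (h (fst z), snd z)" for z :: "real \<times> 'f"
  let ?D = "UNIV \<times> ball (0::'f) r2"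
  have oD: "open ?D" by (intro open_Times) auto
  have GD: "G ` ?D = {-r1<..<r1} \<times> ball 0 r2"
  proof (intro equalityI subsetI)
    fix y assume "y \<in> {-r1<..<r1} \<times> ball (0::'f) r2"
    then have "y = G (h (fst y), snd y)" "(h (fst y), snd y) \<in> ?D" using hk(5) by (auto simp: G_def)
    then show "y \<in> G ` ?D" by blast
  qed (use hk(3) in \<open>auto simp: G_def\<close>)
  have oG: "open (G ` ?D)" unfolding GD by (intro open_Times) auto
  have GW: "G ` ?D \<subseteq> \<Psi> ` (U \<inter> W)" unfolding GD using r1A r2 AB(4) by blast
  then have GU: "G ` ?D \<subseteq> \<Psi> ` U" by blast
  have Gs: "smooth_on ?D G" unfolding G_def smooth_on_def
    using hk(2) unfolding smooth_on_def
    by (intro allI ck_on_Pair oD ck_on_bounded_linear[OF oD bounded_linear_snd]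
        ck_on_compose[OF oD ck_on_bounded_linear[OF oD bounded_linear_fst], of _ UNIV k]) auto
  have gs: "smooth_on (G ` ?D) g" unfolding g_def smooth_on_def
    using hk(1) unfolding smooth_on_def
    by (intro allI ck_on_Pair oG ck_on_bounded_linear[OF oG bounded_linear_snd]
        ck_on_compose[OF oG ck_on_bounded_linear[OF oG bounded_linear_fst], of _ "{-r1<..<r1}" h]) (auto simp: GD)
  have gG: "g (G z) = z" for z by (simp add: g_def G_def hk(4))
  define U' where "U' = U \<inter> \<Psi> -` G ` ?D"
  note cc = compat_chart_compose[OF M c oD oG GU gG Gs gs, folded U'_def]
  have Gd: "frechet_derivative G (at z) v = (h' (fst z) * fst v, snd v)" for z v
  proof -
    have "((\<lambda>z. k (fst z)) has_derivative (\<lambda>v. h' (fst z) * fst v)) (at z)"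
      using has_derivative_compose[OF bounded_linear_imp_has_derivative[OF bounded_linear_fst, of "at z"], of k "\<lambda>v. h' (fst z) * v"]
        hk(7)[of "fst z"] by (simp add: has_field_derivative_def)
    then have "(G has_derivative (\<lambda>v. (h' (fst z) * fst v, snd v))) (at z)"
      unfolding G_def by (intro has_derivative_Pair has_derivative_snd has_derivative_ident)
    from frechet_derivative_at[OF this, symmetric] show ?thesis by simp
  qed
  show ?thesis
  proof
    have "(0, 0) \<in> G ` ?D" unfolding GD using r1 r2 by simp
    then show "p \<in> U'" unfolding U'_def using W z by simp
    show "U' \<subseteq> U \<inter> W"
    proof
      fix q assume q: "q \<in> U'"
      then have "\<Psi> q \<in> \<Psi> ` (U \<inter> W)" using GW unfolding U'_def by blast
      then show "q \<in> U \<inter> W" using q inj_on_image_mem_iff[OF compat_chart_inj[OF c], of q "U \<inter> W"] unfolding U'_def by auto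
    qed
    show "0 < r2" by (rule r2)
    show "(\<lambda>q. g (\<Psi> q)) ` U' = ?D" by (rule cc(2))
    show "chart_tvec M U' (\<lambda>q. g (\<Psi> q)) q (0, b) 0 = chart_tvec M U \<Psi> q (0, b) 0" if "q \<in> U'" for q b
      unfolding cc(3)[OF that] Gd by (simp add: zero_prod_def)
    show "rectifies M K U' (\<lambda>q. g (\<Psi> q))" unfolding rectifies_def
    proof (intro conjI ballI exI)
      show "compat_chart M U' (\<lambda>q. g (\<Psi> q))" by (rule cc(1))
      fix q assume q: "q \<in> U'"
      let ?c = "h' (fst (g (\<Psi> q)))"
      show "inverse ?c \<noteq> 0" using hk(8) by simp
      have "chart_tvec M U' (\<lambda>q. g (\<Psi> q)) q (inverse ?c, 0) 0 = chart_tvec M U \<Psi> q (1, 0) 0"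
        unfolding cc(3)[OF q] Gd using hk(8) by (simp add: zero_prod_def)
      then show "K q = rtv.span {chart_tvec M U' (\<lambda>q. g (\<Psi> q)) q (inverse ?c, 0) 0}"
        using rectifies_span[OF M rect, of q] q unfolding U'_def by simp
    qed
  qed
qed

section \<open>The leaf space\<close>

text \<open>Ensures that the \<open>vector_derivative\<close> in \<open>velocity\<close> is a true
  derivative and not an arbitrary value.\<close>

lemma smooth_along_curve:
  assumes M: "smooth_manifold M" and \<gamma>: "smooth_map (euclidean_mfd {a<..<b}) M \<gamma>" and t: "t \<in> {a<..<b::real}"
    and f: "smooth_near M (\<gamma> t) f"
  shows "\<exists>T. open T \<and> t \<in> T \<and> smooth_on T (f \<circ> \<gamma>)"
proof -
  have cont: "continuous_map (top_of_set {a<..<b}) (mtop M) \<gamma>" using \<gamma> by (simp add: smooth_map_def euclidean_mfd_def)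
  have "\<gamma> t \<in> topspace (mtop M)" using continuous_map_image_subset_topspace[OF cont] t by auto
  from manifold_chart_at[OF M this] obtain V \<phi> where V: "(V, \<phi>) \<in> atlas M" "\<gamma> t \<in> V" "compat_chart M V \<phi>" .
  have "openin (top_of_set {a<..<b}) {s \<in> topspace (top_of_set {a<..<b}). \<gamma> s \<in> V}"
    by (rule openin_continuous_map_preimage[OF cont compat_chart_openin[OF V(3)]])
  then have o: "open ({a<..<b} \<inter> \<gamma> -` V)"
    using openin_open_eq[of "{a<..<b}"] by (simp add: Int_def vimage_def)
  have "smooth_on (id ` ({a<..<b} \<inter> \<gamma> -` V)) (\<phi> \<circ> \<gamma> \<circ> inv_into {a<..<b} id)"
    using \<gamma> V(1) unfolding smooth_map_def euclidean_mfd_def by auto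
  then have "smooth_on ({a<..<b} \<inter> \<gamma> -` V) (\<phi> \<circ> \<gamma> \<circ> inv_into {a<..<b} id)" by simp
  then have s1: "smooth_on ({a<..<b} \<inter> \<gamma> -` V) (\<lambda>s. \<phi> (\<gamma> s))"
    by (rule smooth_on_cong[OF o, rotated]) (auto simp: inv_into_f_f[of id, simplified])
  obtain T where T: "open T" "\<phi> (\<gamma> t) \<in> T" "T \<subseteq> \<phi> ` V" "smooth_on T (f \<circ> inv_into V \<phi>)"
    using f smooth_near_chart_iff[OF M V(3,2)] by blast
  define R where "R = ({a<..<b} \<inter> \<gamma> -` V) \<inter> (\<lambda>s. \<phi> (\<gamma> s)) -` T"
  have "continuous_on ({a<..<b} \<inter> \<gamma> -` V) (\<lambda>s. \<phi> (\<gamma> s))" using s1 ck_on_continuous unfolding smooth_on_def by blast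
  then have R: "open R" unfolding R_def using o T(1) by (rule continuous_open_preimage)
  have "smooth_on R (\<lambda>s. (f \<circ> inv_into V \<phi>) (\<phi> (\<gamma> s)))"
    by (rule smooth_on_compose[OF R smooth_on_subset[OF s1] T(4)]) (auto simp: R_def)
  then have "smooth_on R (f \<circ> \<gamma>)"
    by (rule smooth_on_cong[OF R, rotated]) (simp add: R_def compat_chart_inv[OF V(3)])
  then show ?thesis using R t V(2) T(2) by (intro exI[of _ R]) (auto simp: R_def)
qed

locale rectified =
  fixes M :: "('a, 'e::euclidean_space) mfd" and K :: "'a \<Rightarrow> 'a tvec set" and U :: "'a set"
    and \<Psi> :: "'a \<Rightarrow> real \<times> 'f::euclidean_space" and S :: "'f set"
  assumes M: "smooth_manifold M" and rect: "rectifies M K U \<Psi>" and img: "\<Psi> ` U = UNIV \<times> S"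
begin

lemma chart: "compat_chart M U \<Psi>" using rect by (simp add: rectifies_def)

lemmas inv = compat_chart_inv[OF chart]

lemma K_span: "q \<in> U \<Longrightarrow> K q = rtv.span {chart_tvec M U \<Psi> q (1, 0) 0}"
  by (rule rectifies_span[OF M rect])

lemma open_S: "open S"
proof -
  have "open (UNIV \<times> S :: (real \<times> 'f) set)" using chart img by (simp add: compat_chart_def)
  from open_image_snd[OF this] show ?thesis by simp
qed

definition lf :: "'f \<Rightarrow> 'a set" where "lf x = {q \<in> U. snd (\<Psi> q) = x}"

lemma snd_in_S: "q \<in> U \<Longrightarrow> snd (\<Psi> q) \<in> S"
  using img by (metis image_eqI mem_Times_iff)

lemma inv_in: "x \<in> S \<Longrightarrow> inv_into U \<Psi> (t, x) \<in> U" "x \<in> S \<Longrightarrow> \<Psi> (inv_into U \<Psi> (t, x)) = (t, x)"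
  using inv(2,3)[of "(t, x)"] img by auto

lemma inj_lf: "inj_on lf S"
proof (rule inj_onI)
  fix x y assume "x \<in> S" "y \<in> S" "lf x = lf y"
  moreover have "inv_into U \<Psi> (0, x) \<in> lf x" using inv_in[OF \<open>x \<in> S\<close>] by (simp add: lf_def)
  ultimately show "x = y" using inv_in[of x 0] by (simp add: lf_def)
qed

lemma integral_curve_lf:
  assumes x: "x \<in> S"
  shows "integral_curve_in M K U a b (\<lambda>t. inv_into U \<Psi> (t, x))"
proof -
  let ?\<gamma> = "\<lambda>t. inv_into U \<Psi> (t, x)"
  have h: "homeomorphic_map (subtopology (mtop M) U) (top_of_set (\<Psi> ` U)) \<Psi>" using chart by (simp add: compat_chart_def)
  have U: "topspace (subtopology (mtop M) U) = U" using compat_chart_subset[OF chart] by (auto simp: topspace_subtopology)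
  have cont: "continuous_map (top_of_set {a<..<b}) (mtop M) ?\<gamma>"
  proof -
    obtain g where g: "homeomorphic_maps (subtopology (mtop M) U) (top_of_set (\<Psi> ` U)) \<Psi> g" using h homeomorphic_map_maps by blast
    then have g': "continuous_map (top_of_set (\<Psi> ` U)) (subtopology (mtop M) U) g" "\<And>q. q \<in> U \<Longrightarrow> g (\<Psi> q) = q"
      unfolding homeomorphic_maps_def U by auto
    have "continuous_map (top_of_set {a<..<b}) (top_of_set (\<Psi> ` U)) (\<lambda>t. (t, x))"
      unfolding continuous_map_subtopology_eu img using x by (auto intro!: continuous_intros)
    from continuous_map_compose[OF this g'(1)] have "continuous_map (top_of_set {a<..<b}) (mtop M) (g \<circ> (\<lambda>t. (t, x)))"
      by (rule continuous_map_into_fulltopology)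
    then show ?thesis
      by (rule continuous_map_eq) (metis comp_apply g'(2) inv_in x)
  qed
  have sm: "smooth_map (euclidean_mfd {a<..<b}) M ?\<gamma>"
    unfolding smooth_map_def
  proof (intro conjI ballI, use cont in \<open>simp add: euclidean_mfd_def\<close>, clarify)
    fix V' \<phi>' V \<phi> assume V': "(V', \<phi>') \<in> atlas (euclidean_mfd {a<..<b})" and V: "(V, \<phi>) \<in> atlas M"
    have e: "V' = {a<..<b}" "\<phi>' = id" using V' by (auto simp: euclidean_mfd_def)
    note cV = compat_chart_atlas[OF M V]
    have "openin (top_of_set {a<..<b}) {s \<in> topspace (top_of_set {a<..<b}). ?\<gamma> s \<in> V}"
      by (rule openin_continuous_map_preimage[OF cont compat_chart_openin[OF cV]])
    then have o: "open ({a<..<b} \<inter> ?\<gamma> -` V)"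
      using openin_open_eq[of "{a<..<b}"] by (simp add: Int_def vimage_def)
    have "smooth_on (\<Psi> ` (U \<inter> V)) (\<phi> \<circ> inv_into U \<Psi>)" by (rule transition_smooth[OF M chart cV])
    moreover have "smooth_on ({a<..<b} \<inter> ?\<gamma> -` V) (\<lambda>t. (t, x))"
      unfolding smooth_on_def by (intro allI ck_on_Pair ck_on_const ck_on_bounded_linear[OF _ bounded_linear_ident] o)
    moreover have "(\<lambda>t. (t, x)) ` ({a<..<b} \<inter> ?\<gamma> -` V) \<subseteq> \<Psi> ` (U \<inter> V)"
    proof
      fix z assume "z \<in> (\<lambda>t. (t, x)) ` ({a<..<b} \<inter> ?\<gamma> -` V)"
      then obtain t where t: "z = (t, x)" "?\<gamma> t \<in> V" by auto
      then show "z \<in> \<Psi> ` (U \<inter> V)" using inv_in[OF x, of t] by (intro image_eqI[of _ _ "?\<gamma> t"]) auto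
    qed
    ultimately have "smooth_on ({a<..<b} \<inter> ?\<gamma> -` V) (\<lambda>t. (\<phi> \<circ> inv_into U \<Psi>) (t, x))"
      using smooth_on_compose[OF o] by blast
    then have "smooth_on ({a<..<b} \<inter> ?\<gamma> -` V) (\<phi> \<circ> ?\<gamma> \<circ> inv_into {a<..<b} id)"
      by (rule smooth_on_cong[OF o, rotated]) (auto simp: inv_into_f_f[of id, simplified])
    then show "smooth_on (\<phi>' ` (V' \<inter> ?\<gamma> -` V)) (\<phi> \<circ> ?\<gamma> \<circ> inv_into V' \<phi>')" unfolding e by simp
  qed
  have vel: "velocity M ?\<gamma> t = chart_tvec M U \<Psi> (?\<gamma> t) (1, 0) 0" for t
  proof
    fix f
    show "velocity M ?\<gamma> t f = chart_tvec M U \<Psi> (?\<gamma> t) (1, 0) 0 f"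
    proof (cases "smooth_near M (?\<gamma> t) f")
      case True
      let ?D = "frechet_derivative (f \<circ> inv_into U \<Psi>) (at (t, x))"
      have d: "((f \<circ> inv_into U \<Psi>) has_derivative ?D) (at (t, x))"
        using chart_has_derivative[OF M chart inv_in(1)[OF x] True] inv_in(2)[OF x] by simp
      have *: "((\<lambda>s. (f \<circ> inv_into U \<Psi>) (s, x)) has_derivative (\<lambda>s. ?D (s, 0))) (at t)"
        by (rule has_derivative_compose[of "\<lambda>s. (s, x)" _ _ _ "f \<circ> inv_into U \<Psi>", OF _ d])
          (auto intro!: derivative_eq_intros)
      have e: "(\<lambda>s. ?D (s, 0)) = (\<lambda>s. s *\<^sub>R ?D (1, 0))"
      proof
        fix s :: real
        have "(s, 0) = s *\<^sub>R (1, 0 :: 'f)" by simp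
        then show "?D (s, 0) = s *\<^sub>R ?D (1, 0)" by (metis linear_cmul[OF has_derivative_linear[OF d]])
      qed
      have "((f \<circ> ?\<gamma>) has_vector_derivative ?D (1, 0)) (at t)"
        unfolding has_vector_derivative_def using *[unfolded e] by (simp only: o_def)
      then have "vector_derivative (f \<circ> ?\<gamma>) (at t) = ?D (1, 0)" by (rule vector_derivative_at)
      moreover have "?D 0 = 0" by (rule linear_0[OF has_derivative_linear[OF d]])
      ultimately show ?thesis using True inv_in(2)[OF x] by (simp add: velocity_def chart_tvec_def)
    qed (simp add: velocity_def chart_tvec_def)
  qed
  have "chart_tvec M U \<Psi> (?\<gamma> t) (1, 0) 0 \<noteq> 0" for t
    using chart_tvec_inj(1)[OF M chart inv_in(1)[OF x], of t "(1, 0)" 0 0 0] chart_tvec_linear(3)[OF M chart inv_in(1)[OF x], of t]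
    by (auto simp: zero_prod_def)
  moreover have "chart_tvec M U \<Psi> (?\<gamma> t) (1, 0) 0 \<in> K (?\<gamma> t)" for t
    unfolding K_span[OF inv_in(1)[OF x]] by (rule rtv.span_base) simp
  ultimately show ?thesis unfolding integral_curve_in_def vel using sm inv_in(1)[OF x] by blast
qed

text \<open>The velocity is a multiple of the coordinate field \<open>(1, 0)\<close> and hence
  annihilates the coordinate functions of the second factor; along the curve these have zero
  derivative on an interval.\<close>

lemma integral_curve_const:
  assumes \<gamma>: "integral_curve_in M K U a b \<gamma>" and t: "t \<in> {a<..<b}" "s \<in> {a<..<b}"
  shows "snd (\<Psi> (\<gamma> t)) = snd (\<Psi> (\<gamma> s))"
proof (rule euclidean_eqI)
  fix b' :: 'f assume "b' \<in> Basis"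
  let ?f = "coord \<Psi> (0, b')"
  have sm: "smooth_map (euclidean_mfd {a<..<b}) M \<gamma>" and inU: "\<And>t. t \<in> {a<..<b} \<Longrightarrow> \<gamma> t \<in> U"
    and vK: "\<And>t. t \<in> {a<..<b} \<Longrightarrow> velocity M \<gamma> t \<in> K (\<gamma> t)" using \<gamma> unfolding integral_curve_in_def by auto
  have "((?f \<circ> \<gamma>) has_derivative (\<lambda>h. 0)) (at t within {a<..<b})" if t: "t \<in> {a<..<b}" for t
  proof -
    have f: "smooth_near M (\<gamma> t) ?f" by (rule smooth_near_fun[OF coord_smooth[OF M chart] inU[OF t]])
    obtain T where "t \<in> T" "smooth_on T (?f \<circ> \<gamma>)" using smooth_along_curve[OF M sm t f] by blast
    then have d: "(?f \<circ> \<gamma>) differentiable (at t)" using smooth_on_has_derivative differentiableI by blast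
    obtain c where "velocity M \<gamma> t = rtscale c (chart_tvec M U \<Psi> (\<gamma> t) (1, 0) 0)"
      using vK[OF t] unfolding K_span[OF inU[OF t]] rtv.span_singleton by blast
    then have "velocity M \<gamma> t ?f = 0"
      by (simp add: rtscale_def tscale_def chart_tvec_coord[OF M chart inU[OF t]])
    then have "vector_derivative (?f \<circ> \<gamma>) (at t) = 0" using f by (simp add: velocity_def)
    then have "((?f \<circ> \<gamma>) has_vector_derivative 0) (at t)" using d vector_derivative_works by metis
    then show ?thesis by (auto simp: has_vector_derivative_def intro: has_derivative_at_withinI)
  qed
  then obtain c where "\<And>t. t \<in> {a<..<b} \<Longrightarrow> (?f \<circ> \<gamma>) t = c"
    using has_derivative_zero_constant[of "{a<..<b}" "?f \<circ> \<gamma>"] by auto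
  then have "(?f \<circ> \<gamma>) t = (?f \<circ> \<gamma>) s" using t by simp
  then show "snd (\<Psi> (\<gamma> t)) \<bullet> b' = snd (\<Psi> (\<gamma> s)) \<bullet> b'" by (simp add: coord_def inner_prod_def)
qed

text \<open>The whole coordinate line is reached because the first coordinate ranges over all reals;
  nothing else is, because the transversal coordinates are constant along every integral curve in
  \<open>U\<close>.\<close>

lemma leaf_eq:
  assumes q: "q \<in> U"
  shows "leaf M K U q = lf (snd (\<Psi> q))"
proof (intro equalityI subsetI)
  fix q' assume "q' \<in> leaf M K U q"
  then obtain a b \<gamma> t s where \<gamma>: "integral_curve_in M K U a b \<gamma>" "t \<in> {a<..<b}" "s \<in> {a<..<b}" "q' = \<gamma> t" "q = \<gamma> s"
    unfolding leaf_def by blast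
  have "\<gamma> t \<in> U" using \<gamma>(1,2) unfolding integral_curve_in_def by blast
  then show "q' \<in> lf (snd (\<Psi> q))" using integral_curve_const[OF \<gamma>(1-3)] \<gamma>(4,5) by (simp add: lf_def)
next
  fix q' assume "q' \<in> lf (snd (\<Psi> q))"
  then have q': "q' \<in> U" "snd (\<Psi> q') = snd (\<Psi> q)" by (auto simp: lf_def)
  \<comment> \<open>One unit of slack on each side puts both parameters inside an open
    interval.\<close>
  define a where "a = min (fst (\<Psi> q)) (fst (\<Psi> q')) - 1"
  define b where "b = max (fst (\<Psi> q)) (fst (\<Psi> q')) + 1"
  let ?\<gamma> = "\<lambda>t. inv_into U \<Psi> (t, snd (\<Psi> q))"
  have "?\<gamma> (fst (\<Psi> q)) = q" "?\<gamma> (fst (\<Psi> q')) = q'"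
    using inv(1)[OF q] inv(1)[OF q'(1)] by (simp, subst q'(2)[symmetric], simp)
  moreover have "fst (\<Psi> q) \<in> {a<..<b}" "fst (\<Psi> q') \<in> {a<..<b}" by (auto simp: a_def b_def)
  ultimately have "q \<in> ?\<gamma> ` {a<..<b}" "q' \<in> ?\<gamma> ` {a<..<b}" by (metis image_eqI)+
  then show "q' \<in> leaf M K U q"
    unfolding leaf_def
    by (intro UnionI[of "?\<gamma> ` {a<..<b}"] CollectI exI conjI) (rule refl, rule integral_curve_lf[OF snd_in_S[OF q]])
qed

section \<open>The leaf space as a manifold\<close>

definition leafs :: "'a set set" where "leafs = leaf M K U ` U"
definition \<eta> :: "'a set \<Rightarrow> 'f" where "\<eta> = inv_into S lf"
text \<open>The points are the leaves themselves, as sets; topology and smooth structure are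
  transported from \<open>S\<close> by the global chart \<open>\<eta>\<close>, so that the manifold
  axioms reduce to those of an open set.\<close>

definition B :: "('a set, 'f) mfd" where
  "B = \<lparr>mtop = pullback_topology leafs \<eta> euclidean, atlas = {(leafs, \<eta>)}\<rparr>"
definition \<Phi> :: "'a \<Rightarrow> real \<times> 'a set" where "\<Phi> q = (fst (\<Psi> q), leaf M K U q)"
definition pr :: "'a \<Rightarrow> 'a set" where "pr = snd \<circ> \<Phi>"

lemma leafs_eq: "leafs = lf ` S"
proof -
  have "leafs = lf ` (\<lambda>q. snd (\<Psi> q)) ` U" unfolding leafs_def by (auto simp: leaf_eq)
  also have "(\<lambda>q. snd (\<Psi> q)) ` U = snd ` (\<Psi> ` U)" by auto
  finally show ?thesis unfolding img by simp
qed

lemma \<eta>_lf: "x \<in> S \<Longrightarrow> \<eta> (lf x) = x" unfolding \<eta>_def using inj_lf by simp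

lemma pr_eq: "q \<in> U \<Longrightarrow> pr q = lf (snd (\<Psi> q))" by (simp add: pr_def \<Phi>_def leaf_eq)

lemma \<eta>_pr: "q \<in> U \<Longrightarrow> \<eta> (pr q) = snd (\<Psi> q)" by (simp add: pr_eq \<eta>_lf snd_in_S)

lemma pr_leafs: "q \<in> U \<Longrightarrow> pr q \<in> leafs" by (simp add: pr_def \<Phi>_def leafs_def)

lemma \<eta>_img: "\<eta> ` leafs = S" unfolding leafs_eq image_image using \<eta>_lf by simp

lemma inj_\<eta>: "inj_on \<eta> leafs" unfolding leafs_eq by (auto intro!: inj_onI simp: \<eta>_lf)

lemma inv_\<eta>: "x \<in> S \<Longrightarrow> inv_into leafs \<eta> x = lf x"
  using inv_into_f_f[OF inj_\<eta>, of "lf x"] \<eta>_lf[of x] by (simp add: leafs_eq)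

lemma mtop_B: "mtop B = pullback_topology leafs \<eta> euclidean" "atlas B = {(leafs, \<eta>)}" by (simp_all add: B_def)

lemma topspace_B: "topspace (mtop B) = leafs" by (simp add: mtop_B topspace_pullback_topology)

lemma homeo_\<eta>: "homeomorphic_map (mtop B) (top_of_set S) \<eta>"
  unfolding homeomorphic_map_def quotient_map_def topspace_B
proof (intro conjI allI impI inj_\<eta>)
  show "\<eta> ` leafs = topspace (top_of_set S)" by (simp add: \<eta>_img)
  fix V assume "V \<subseteq> topspace (top_of_set S)"
  then have V: "V \<subseteq> S" by simp
  have "openin (mtop B) {x \<in> leafs. \<eta> x \<in> V} \<longleftrightarrow> (\<exists>T. open T \<and> {x \<in> leafs. \<eta> x \<in> V} = \<eta> -` T \<inter> leafs)"
    unfolding mtop_B openin_pullback_topology by simp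
  also have "\<dots> \<longleftrightarrow> open V"
  proof
    assume "\<exists>T. open T \<and> {x \<in> leafs. \<eta> x \<in> V} = \<eta> -` T \<inter> leafs"
    then obtain T where T: "open T" "{x \<in> leafs. \<eta> x \<in> V} = \<eta> -` T \<inter> leafs" by blast
    have "V = T \<inter> S"
    proof (intro equalityI subsetI)
      fix x assume "x \<in> V"
      then have "x \<in> S" "lf x \<in> {x \<in> leafs. \<eta> x \<in> V}" using V \<eta>_lf by (auto simp: leafs_eq)
      then show "x \<in> T \<inter> S" unfolding T(2) using \<eta>_lf by simp
    next
      fix x assume x: "x \<in> T \<inter> S"
      then have "lf x \<in> \<eta> -` T \<inter> leafs" using \<eta>_lf by (auto simp: leafs_eq)
      then show "x \<in> V" unfolding T(2)[symmetric] using \<eta>_lf x by simp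
    qed
    then show "open V" using T(1) open_S by auto
  qed blast
  finally show "openin (mtop B) {x \<in> leafs. \<eta> x \<in> V} = openin (top_of_set S) V"
    using openin_open_eq[OF open_S] V by auto
qed

lemma second_countable_euclidean: "second_countable (euclidean :: 'f topology)"
proof -
  obtain C :: "'f set set" where C: "countable C" "topological_basis C" using ex_countable_basis by blast
  show ?thesis unfolding second_countable_def
  proof (intro exI[of _ C] conjI ballI allI impI C(1))
    show "openin euclidean V" if "V \<in> C" for V using topological_basis_open[OF C(2) that] by simp
    show "\<exists>V\<in>C. x \<in> V \<and> V \<subseteq> T" if "openin euclidean T \<and> x \<in> T" for T and x :: 'f
      using topological_basisE[OF C(2)] that by (metis open_openin)
  qed
qed

lemma smooth_B: "smooth_manifold B"
  unfolding smooth_manifold_def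
proof (intro conjI)
  have h: "mtop B homeomorphic_space top_of_set S" by (rule homeomorphic_map_imp_homeomorphic_space[OF homeo_\<eta>])
  show "Hausdorff_space (mtop B)" unfolding homeomorphic_Hausdorff_space[OF h] by (simp add: Hausdorff_space_subtopology)
  show "second_countable (mtop B)" unfolding homeomorphic_space_second_countability[OF h]
    by (rule second_countable_subtopology[OF second_countable_euclidean])
  show "topspace (mtop B) = \<Union> (fst ` atlas B)" unfolding topspace_B mtop_B(2) by simp
  have o: "openin (mtop B) leafs" using openin_topspace[of "mtop B"] unfolding topspace_B .
  have "subtopology (mtop B) leafs = mtop B" using subtopology_topspace[of "mtop B"] unfolding topspace_B .
  then show "\<forall>(U, \<phi>)\<in>atlas B. openin (mtop B) U \<and> open (\<phi> ` U) \<and>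
    homeomorphic_map (subtopology (mtop B) U) (top_of_set (\<phi> ` U)) \<phi>"
    using homeo_\<eta> open_S \<eta>_img o by (simp add: mtop_B(2))
  have "smooth_on S (\<eta> \<circ> inv_into leafs \<eta>)"
    by (rule smooth_on_cong[OF open_S _ smooth_on_id[OF open_S]]) (simp add: inv_\<eta> \<eta>_lf)
  then show "\<forall>(U, \<phi>)\<in>atlas B. \<forall>(V, \<psi>)\<in>atlas B. smooth_on (\<phi> ` (U \<inter> V)) (\<psi> \<circ> inv_into U \<phi>)"
    by (simp add: mtop_B(2) \<eta>_img)
qed

lemma chart_B: "compat_chart B leafs \<eta>"
  by (rule compat_chart_atlas[OF smooth_B]) (simp add: mtop_B)

lemma smooth_near_pr:
  assumes q: "q \<in> U" and f: "smooth_near B (pr q) f"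
  shows "smooth_near M q (f \<circ> pr)"
proof -
  obtain T where T: "open T" "\<eta> (pr q) \<in> T" "T \<subseteq> S" "smooth_on T (f \<circ> inv_into leafs \<eta>)"
    using f unfolding smooth_near_chart_iff[OF smooth_B chart_B pr_leafs[OF q]] \<eta>_img by blast
  have o: "open (UNIV \<times> T :: (real \<times> 'f) set)" using T(1) by (intro open_Times) auto
  have "smooth_on ((UNIV :: real set) \<times> T) (\<lambda>z. (f \<circ> inv_into leafs \<eta>) (snd z))"
    by (rule smooth_on_compose[OF o smooth_on_bounded_linear[OF o bounded_linear_snd] T(4)]) auto
  then have "smooth_on (UNIV \<times> T) ((f \<circ> pr) \<circ> inv_into U \<Psi>)"
    by (rule smooth_on_cong[OF o, rotated]) (use T(3) inv_in in \<open>auto simp: inv_\<eta> pr_eq subset_iff\<close>)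
  moreover have "\<Psi> q \<in> UNIV \<times> T" using T(2) \<eta>_pr[OF q] by (simp add: mem_Times_iff)
  ultimately show ?thesis
    unfolding smooth_near_chart_iff[OF M chart q] img using o T(3) by (intro exI[of _ "UNIV \<times> T"]) auto
qed

text \<open>In coordinates the leaf projection forgets the first entry of \<open>(t, x)\<close>, and
  so does its differential.\<close>

lemma push_pr:
  assumes q: "q \<in> U"
  shows "push B pr q (chart_tvec M U \<Psi> q (a, v) (b, w)) = chart_tvec B leafs \<eta> (pr q) v w"
proof
  fix f
  show "push B pr q (chart_tvec M U \<Psi> q (a, v) (b, w)) f = chart_tvec B leafs \<eta> (pr q) v w f"
  proof (cases "smooth_near B (pr q) f")
    case True
    let ?D = "frechet_derivative (f \<circ> inv_into leafs \<eta>) (at (\<eta> (pr q)))"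
    have d: "((f \<circ> inv_into leafs \<eta>) has_derivative ?D) (at (\<eta> (pr q)))"
      by (rule chart_has_derivative[OF smooth_B chart_B pr_leafs[OF q] True])
    have "((\<lambda>z. (f \<circ> inv_into leafs \<eta>) (snd z)) has_derivative (\<lambda>z. ?D (snd z))) (at (\<Psi> q))"
      by (rule has_derivative_compose[OF bounded_linear_imp_has_derivative[OF bounded_linear_snd]])
        (unfold \<eta>_pr[OF q, symmetric], rule d)
    then have "((f \<circ> pr \<circ> inv_into U \<Psi>) has_derivative (\<lambda>z. ?D (snd z))) (at (\<Psi> q))"
    proof (rule has_derivative_transform_within_open)
      show "open (UNIV \<times> S :: (real \<times> 'f) set)" using open_S by (intro open_Times) auto
      show "\<Psi> q \<in> UNIV \<times> S" using img q by blast
      show "(f \<circ> inv_into leafs \<eta>) (snd z) = (f \<circ> pr \<circ> inv_into U \<Psi>) z" if "z \<in> UNIV \<times> S" for z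
        using that inv_in[of "snd z" "fst z"] by (auto simp: inv_\<eta> pr_eq)
    qed
    from frechet_derivative_at[OF this, symmetric] show ?thesis
      using True smooth_near_pr[OF q True] by (simp add: push_def chart_tvec_def)
  qed (simp add: push_def chart_tvec_def)
qed

text \<open>In the charts \<open>\<Psi>\<close> and \<open>map_prod id \<eta>\<close> the map
  \<open>\<Phi>\<close> is the identity, so smoothness in both directions is that of the transition
  maps between \<open>\<Psi>\<close> and the atlas.\<close>

lemma trivialization: "leaf_space_trivialization M K U B \<Phi>"
  unfolding leaf_space_trivialization_def
proof (intro conjI ballI smooth_B)
  show "topspace (mtop B) = leaf M K U ` U" by (simp add: topspace_B leafs_def)
  show "snd (\<Phi> p) = leaf M K U p" for p by (simp add: \<Phi>_def)
  let ?N = "open_submfd M U" and ?P = "prod_mfd (euclidean_mfd UNIV) B :: (real \<times> 'a set, real \<times> 'f) mfd"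
  have tU: "topspace (subtopology (mtop M) U) = U" using compat_chart_subset[OF chart] by (auto simp: topspace_subtopology)
  have tN: "topspace (mtop ?N) = U" "mtop ?N = subtopology (mtop M) U" using tU by (simp_all add: open_submfd_def)
  have tP: "topspace (mtop ?P) = UNIV \<times> leafs" "mtop ?P = prod_topology euclidean (mtop B)"
    by (simp_all add: prod_mfd_def euclidean_mfd_def topspace_B)
  have aP: "atlas ?P = {(UNIV \<times> leafs, map_prod id \<eta>)}" by (auto simp: prod_mfd_def euclidean_mfd_def mtop_B)
  have bij: "bij_betw \<Phi> U (UNIV \<times> leafs)"
  proof (rule bij_betw_byWitness[where f' = "\<lambda>(t, l). inv_into U \<Psi> (t, \<eta> l)"])
    show "\<forall>q\<in>U. (case \<Phi> q of (t, l) \<Rightarrow> inv_into U \<Psi> (t, \<eta> l)) = q"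
      using inv(1) \<eta>_pr by (auto simp: \<Phi>_def leaf_eq \<eta>_lf snd_in_S)
    show "\<forall>z\<in>UNIV \<times> leafs. \<Phi> (case z of (t, l) \<Rightarrow> inv_into U \<Psi> (t, \<eta> l)) = z"
      using inv_in by (auto simp: \<Phi>_def leaf_eq \<eta>_lf leafs_eq)
    show "\<Phi> ` U \<subseteq> UNIV \<times> leafs" by (auto simp: \<Phi>_def leafs_def)
    show "(\<lambda>(t, l). inv_into U \<Psi> (t, \<eta> l)) ` (UNIV \<times> leafs) \<subseteq> U" using inv_in(1) by (auto simp: leafs_eq \<eta>_lf)
  qed
  let ?F = "inv_into U \<Phi>"
  have F: "?F (t, l) = inv_into U \<Psi> (t, \<eta> l)" if l: "l \<in> leafs" for t l
  proof (rule inv_into_f_eq)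
    show "inj_on \<Phi> U" using bij by (simp add: bij_betw_def)
    show "inv_into U \<Psi> (t, \<eta> l) \<in> U" "\<Phi> (inv_into U \<Psi> (t, \<eta> l)) = (t, l)"
      using l inv_in by (auto simp: \<Phi>_def leaf_eq \<eta>_lf leafs_eq)
  qed
  have h: "homeomorphic_map (subtopology (mtop M) U) (top_of_set (\<Psi> ` U)) \<Psi>" using chart by (simp add: compat_chart_def)
  then obtain k where k: "homeomorphic_maps (subtopology (mtop M) U) (top_of_set (\<Psi> ` U)) \<Psi> k" using homeomorphic_map_maps by blast
  have k': "continuous_map (top_of_set (\<Psi> ` U)) (subtopology (mtop M) U) k" "\<And>q. q \<in> U \<Longrightarrow> k (\<Psi> q) = q"
    and c\<Psi>: "continuous_map (subtopology (mtop M) U) euclidean \<Psi>"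
    using k unfolding homeomorphic_maps_def tU by (auto intro: continuous_map_into_fulltopology)
  show "diffeomorphism ?N ?P \<Phi>"
    unfolding diffeomorphism_def tN(1) tP(1)
  proof (intro conjI bij)
    show "smooth_map ?N ?P \<Phi>" unfolding smooth_map_def tN(2) tP(2) aP
    proof (intro conjI ballI, goal_cases)
      case 1
      have "continuous_map (subtopology (mtop M) U) euclidean (fst \<circ> \<Phi>)"
      proof (rule continuous_map_eq)
        show "continuous_map (subtopology (mtop M) U) euclidean (fst \<circ> \<Psi>)"
          by (rule continuous_map_compose[OF c\<Psi>]) (auto intro!: continuous_intros)
      qed (simp add: \<Phi>_def)
      moreover have "continuous_map (subtopology (mtop M) U) (mtop B) (snd \<circ> \<Phi>)"
        unfolding mtop_B
      proof (rule continuous_map_pullback')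
        show "continuous_map (subtopology (mtop M) U) euclidean (\<eta> \<circ> (snd \<circ> \<Phi>))"
        proof (rule continuous_map_eq)
          show "continuous_map (subtopology (mtop M) U) euclidean (snd \<circ> \<Psi>)"
            by (rule continuous_map_compose[OF c\<Psi>]) (auto intro!: continuous_intros)
          show "(snd \<circ> \<Psi>) q = (\<eta> \<circ> (snd \<circ> \<Phi>)) q" if "q \<in> topspace (subtopology (mtop M) U)" for q
            using \<eta>_pr[of q] that unfolding tU by (simp add: pr_def)
        qed
        show "topspace (subtopology (mtop M) U) \<subseteq> (snd \<circ> \<Phi>) -` leafs" unfolding tU by (auto simp: \<Phi>_def leafs_def)
      qed
      ultimately show ?case unfolding continuous_map_pairwise by blast
    next
      case (2 x)
      then obtain V \<phi> where V: "(V, \<phi>) \<in> atlas M" "x = (V \<inter> U, \<phi>)" unfolding open_submfd_def by auto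
      note cV = compat_chart_atlas[OF M V(1)]
      have o: "open (\<phi> ` (V \<inter> U))"
        using compat_chart_open_iff[OF cV, of "V \<inter> U"] compat_chart_openin[OF cV] compat_chart_openin[OF chart] by auto
      have s: "V \<inter> U \<inter> \<Phi> -` (UNIV \<times> leafs) = V \<inter> U" by (auto simp: \<Phi>_def leafs_def)
      have "smooth_on (\<phi> ` (V \<inter> U)) (map_prod id \<eta> \<circ> \<Phi> \<circ> inv_into (V \<inter> U) \<phi>)"
      proof (rule smooth_on_cong[OF o _ transition_smooth[OF M cV chart]])
        fix y assume "y \<in> \<phi> ` (V \<inter> U)"
        then obtain q where q: "q \<in> V" "q \<in> U" "y = \<phi> q" by blast
        have "inv_into (V \<inter> U) \<phi> y = q" "inv_into V \<phi> y = q"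
          using q compat_chart_inj[OF cV] by (auto intro!: inv_into_f_eq intro: inj_on_subset)
        then show "(\<Psi> \<circ> inv_into V \<phi>) y = (map_prod id \<eta> \<circ> \<Phi> \<circ> inv_into (V \<inter> U) \<phi>) y"
          using \<eta>_pr[OF q(2)] by (simp add: pr_def \<Phi>_def prod_eq_iff)
      qed
      then show ?case unfolding V(2) by (simp add: s)
    qed
    show "smooth_map ?P ?N ?F" unfolding smooth_map_def tN(2) tP(2) aP
    proof (intro conjI ballI, goal_cases)
      case 1
      have t: "topspace (prod_topology euclidean (mtop B)) = (UNIV :: real set) \<times> leafs" using tP by simp
      have c\<eta>: "continuous_map (mtop B) euclidean \<eta>"
        using homeo_\<eta> homeomorphic_imp_continuous_map continuous_map_into_fulltopology by blast
      have "continuous_map (prod_topology euclidean (mtop B)) (prod_topology euclidean euclidean) (\<lambda>z. (fst z :: real, \<eta> (snd z)))"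
        unfolding continuous_map_pairwise o_def
        using continuous_map_fst[of euclidean "mtop B"] continuous_map_compose[OF continuous_map_snd[of euclidean "mtop B"] c\<eta>] by (simp add: o_def)
      then have "continuous_map (prod_topology euclidean (mtop B)) (top_of_set (\<Psi> ` U)) (\<lambda>z. (fst z :: real, \<eta> (snd z)))"
        unfolding img euclidean_product_topology continuous_map_in_subtopology t using \<eta>_img by auto
      from continuous_map_compose[OF this k'(1)]
      show ?case
      proof (rule continuous_map_eq)
        fix z assume "z \<in> topspace (prod_topology (euclidean :: real topology) (mtop B))"
        then obtain u l where z: "z = (u, l)" "l \<in> leafs" unfolding t by auto
        have "\<eta> l \<in> S" using z(2) \<eta>_img by blast
        then have "k (u, \<eta> l) = inv_into U \<Psi> (u, \<eta> l)" using k'(2)[OF inv_in(1)[of "\<eta> l" u]] inv_in(2)[of "\<eta> l" u] by simp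
        then show "(k \<circ> (\<lambda>z. (fst z, \<eta> (snd z)))) z = ?F z" using z F by simp
      qed
    next
      case (2 x)
      then have x: "x = (UNIV \<times> leafs, map_prod id \<eta>)" by simp
      show ?case unfolding x case_prod_conv
      proof
      fix y assume "y \<in> atlas (open_submfd M U)"
      then obtain V \<phi> where V: "(V, \<phi>) \<in> atlas M" "y = (V \<inter> U, \<phi>)"
        unfolding open_submfd_def by auto
      note cV = compat_chart_atlas[OF M V(1)]
      have o: "open (\<Psi> ` (U \<inter> V))"
        using compat_chart_open_iff[OF chart, of "U \<inter> V"] compat_chart_openin[OF cV] compat_chart_openin[OF chart] by auto
      have s: "map_prod id \<eta> ` ((UNIV \<times> leafs) \<inter> ?F -` (V \<inter> U)) = \<Psi> ` (U \<inter> V)"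
      proof (intro equalityI subsetI)
        fix z assume "z \<in> map_prod id \<eta> ` ((UNIV \<times> leafs) \<inter> ?F -` (V \<inter> U))"
        then obtain u l where l: "l \<in> leafs" "?F (u, l) \<in> V \<inter> U" "z = (u, \<eta> l)" by auto
        then have "\<Psi> (?F (u, l)) = z" using F[of l u] inv_in(2)[of "\<eta> l" u] \<eta>_img by auto
        then show "z \<in> \<Psi> ` (U \<inter> V)" using l(2) by blast
      next
        fix z assume "z \<in> \<Psi> ` (U \<inter> V)"
        then obtain q where q: "q \<in> U" "q \<in> V" "z = \<Psi> q" by blast
        have "?F (\<Phi> q) = q" using bij q(1) by (simp add: bij_betw_def)
        moreover have "\<Phi> q \<in> UNIV \<times> leafs" using q(1) by (simp add: \<Phi>_def leafs_def)
        moreover have "map_prod id \<eta> (\<Phi> q) = z" using \<eta>_pr[OF q(1)] q(3) by (simp add: \<Phi>_def pr_def prod_eq_iff)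
        ultimately show "z \<in> map_prod id \<eta> ` ((UNIV \<times> leafs) \<inter> ?F -` (V \<inter> U))" using q by (metis IntI image_eqI vimageI)
      qed
      have inj: "inj_on (map_prod (id :: real \<Rightarrow> real) \<eta>) (UNIV \<times> leafs)" using inj_\<eta> by (auto intro!: inj_onI dest: inj_onD)
      have "smooth_on (\<Psi> ` (U \<inter> V)) (\<phi> \<circ> ?F \<circ> inv_into (UNIV \<times> leafs) (map_prod id \<eta>))"
      proof (rule smooth_on_cong[OF o _ transition_smooth[OF M chart cV]])
        fix z assume "z \<in> \<Psi> ` (U \<inter> V)"
        then obtain q where q: "q \<in> U" "q \<in> V" "z = \<Psi> q" by blast
        have "inv_into (UNIV \<times> leafs) (map_prod id \<eta>) z = \<Phi> q"
          by (rule inv_into_f_eq[OF inj]) (use q \<eta>_pr[OF q(1)] in \<open>auto simp: \<Phi>_def leafs_def pr_def prod_eq_iff\<close>)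
        moreover have "?F (\<Phi> q) = q" using bij q(1) by (simp add: bij_betw_def)
        ultimately show "(\<phi> \<circ> inv_into U \<Psi>) z = (\<phi> \<circ> ?F \<circ> inv_into (UNIV \<times> leafs) (map_prod id \<eta>)) z"
          using inv(1) q by simp
      qed
      then show "case y of (V, \<psi>) \<Rightarrow> smooth_on (map_prod id \<eta> ` ((UNIV \<times> leafs) \<inter> ?F -` V))
          (\<psi> \<circ> ?F \<circ> inv_into (UNIV \<times> leafs) (map_prod id \<eta>))" unfolding V(2) case_prod_conv s .
      qed
    qed
  qed
qed

end

section \<open>The induced almost CR structure\<close>

text \<open>The sum \<open>u\<close> of the squared norms satisfies
  \<open>\<bar>u' s\<bar> \<le> c * u s\<close> on the compact interval from
  \<open>-\<bar>t\<bar>\<close> to \<open>\<bar>t\<bar>\<close>. So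
  \<open>u s * exp (- c * s)\<close> does not increase for positive times,
  \<open>u s * exp (c * s)\<close> does not decrease for negative ones, and \<open>u 0 = 0\<close>
  forces \<open>u t = 0\<close>. Unlike \<open>ode_estimate\<close> this has no bound on the length
  of the interval, so whole leaves are covered.\<close>

lemma gronwall_zero:
  fixes f :: "nat \<Rightarrow> real \<Rightarrow> complex" and A :: "nat \<Rightarrow> nat \<Rightarrow> real \<Rightarrow> complex"
  assumes f: "\<And>j t. j < m \<Longrightarrow> (f j has_vector_derivative (\<Sum>k<m. A j k t * f k t)) (at t)"
    and A: "\<And>j k. j < m \<Longrightarrow> k < m \<Longrightarrow> continuous_on UNIV (A j k)" and 0: "\<And>j. j < m \<Longrightarrow> f j 0 = 0" and j: "j < m"
  shows "f j t = 0"
proof -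
  let ?I = "{-\<bar>t\<bar>..\<bar>t\<bar>}"
  have "\<exists>C. \<forall>s\<in>?I. norm (A j k s) \<le> C" if "j < m" "k < m" for j k
  proof -
    have "bounded (A j k ` ?I)"
      by (intro compact_imp_bounded compact_continuous_image continuous_on_subset[OF A[OF that]]) auto
    then show ?thesis unfolding bounded_iff by blast
  qed
  then obtain C0 where C0: "\<And>j k s. j < m \<Longrightarrow> k < m \<Longrightarrow> s \<in> ?I \<Longrightarrow> norm (A j k s) \<le> C0 j k" by metis
  define C where "C = (\<Sum>j<m. \<Sum>k<m. \<bar>C0 j k\<bar>)"
  have C: "norm (A j k s) \<le> C" if "j < m" "k < m" "s \<in> ?I" for j k s
  proof -
    have "\<bar>C0 j k\<bar> \<le> (\<Sum>k<m. \<bar>C0 j k\<bar>)" using that by (intro member_le_sum) auto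
    also have "\<dots> \<le> C" unfolding C_def using that by (intro member_le_sum[of j]) (auto intro: sum_nonneg)
    finally show ?thesis using C0[OF that] by linarith
  qed
  have C00: "0 \<le> C" unfolding C_def by (intro sum_nonneg) auto
  define u where "u s = (\<Sum>j<m. (norm (f j s))\<^sup>2)" for s
  define u' where "u' s = (\<Sum>j<m. 2 * (f j s \<bullet> (\<Sum>k<m. A j k s * f k s)))" for s
  have du: "(u has_real_derivative u' s) (at s)" for s
  proof -
    have "((\<lambda>s. f j s \<bullet> f j s) has_derivative (\<lambda>h. f j s \<bullet> (h *\<^sub>R (\<Sum>k<m. A j k s * f k s)) + (h *\<^sub>R (\<Sum>k<m. A j k s * f k s)) \<bullet> f j s)) (at s)"
      if "j < m" for j
      using f[OF that, of s] unfolding has_vector_derivative_def by (intro has_derivative_inner)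
    then have "(u has_derivative (\<lambda>h. \<Sum>j<m. f j s \<bullet> (h *\<^sub>R (\<Sum>k<m. A j k s * f k s)) + (h *\<^sub>R (\<Sum>k<m. A j k s * f k s)) \<bullet> f j s)) (at s)"
      unfolding u_def power2_norm_eq_inner by (intro has_derivative_sum) auto
    moreover have "(\<Sum>j<m. f j s \<bullet> (h *\<^sub>R (\<Sum>k<m. A j k s * f k s)) + (h *\<^sub>R (\<Sum>k<m. A j k s * f k s)) \<bullet> f j s) = u' s * h" for h
      unfolding u'_def sum_distrib_right
      by (rule sum.cong[OF refl]) (simp add: inner_commute algebra_simps)
    ultimately show ?thesis unfolding has_field_derivative_def by simp
  qed
  have u0: "0 \<le> u s" for s unfolding u_def by (intro sum_nonneg) simp
  \<comment> \<open>Each product is split by \<open>2 * x * y \<le> x^2 + y^2\<close>; both kinds of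
    squares are summed \<open>m\<close> times, hence \<open>2 * C * m\<close>.\<close>
  define c where "c = 2 * C * m"
  have bd: "\<bar>u' s\<bar> \<le> c * u s" if s: "s \<in> ?I" for s
  proof -
    have "\<bar>u' s\<bar> \<le> (\<Sum>j<m. \<Sum>k<m. C * ((norm (f j s))\<^sup>2 + (norm (f k s))\<^sup>2))"
      unfolding u'_def
    proof (rule order_trans[OF sum_abs sum_mono])
      fix j assume j: "j \<in> {..<m}"
      have "\<bar>f j s \<bullet> (\<Sum>k<m. A j k s * f k s)\<bar> \<le> norm (f j s) * norm (\<Sum>k<m. A j k s * f k s)" by (rule Cauchy_Schwarz_ineq2)
      also have "\<dots> \<le> norm (f j s) * (\<Sum>k<m. C * norm (f k s))"
        by (intro mult_left_mono sum_norm_le) (use C[OF _ _ s] j in \<open>auto simp: norm_mult intro!: mult_right_mono\<close>)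
      finally have "\<bar>2 * (f j s \<bullet> (\<Sum>k<m. A j k s * f k s))\<bar> \<le> 2 * (norm (f j s) * (\<Sum>k<m. C * norm (f k s)))"
        unfolding abs_mult by simp
      also have "\<dots> = (\<Sum>k<m. C * (2 * norm (f j s) * norm (f k s)))"
        unfolding sum_distrib_left by (rule sum.cong) simp_all
      also have "\<dots> \<le> (\<Sum>k<m. C * ((norm (f j s))\<^sup>2 + (norm (f k s))\<^sup>2))"
        by (intro sum_mono mult_left_mono sum_squares_bound C00)
      finally show "\<bar>2 * (f j s \<bullet> (\<Sum>k<m. A j k s * f k s))\<bar> \<le> (\<Sum>k<m. C * ((norm (f j s))\<^sup>2 + (norm (f k s))\<^sup>2))" .
    qed
    also have "\<dots> = c * u s"
      unfolding c_def u_def by (simp add: sum.distrib distrib_left sum_distrib_left[symmetric])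
    finally show ?thesis .
  qed
  have "u t \<le> 0"
  proof (cases "0 \<le> t")
    case True
    have "\<exists>y. ((\<lambda>s. u s * exp (- c * s)) has_real_derivative y) (at s) \<and> y \<le> 0" if s: "0 \<le> s" "s \<le> t" for s
    proof (intro exI conjI)
      show "((\<lambda>s. u s * exp (- c * s)) has_real_derivative (u' s - c * u s) * exp (- c * s)) (at s)"
        by (auto intro!: derivative_eq_intros du simp: algebra_simps)
      have "u' s \<le> c * u s" using bd[of s] s by auto
      then show "(u' s - c * u s) * exp (- c * s) \<le> 0" by (intro mult_nonpos_nonneg) auto
    qed
    from DERIV_nonpos_imp_nonincreasing[OF True this] have "u t * exp (- c * t) \<le> u 0 * exp (- c * 0)" .
    also have "u 0 = 0" unfolding u_def using 0 by simp
    finally show ?thesis by (simp add: mult_le_0_iff)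
  next
    case False
    have *: "\<exists>y. ((\<lambda>s. u s * exp (c * s)) has_real_derivative y) (at s) \<and> 0 \<le> y" if s: "t \<le> s" "s \<le> 0" for s
    proof (intro exI conjI)
      show "((\<lambda>s. u s * exp (c * s)) has_real_derivative (u' s + c * u s) * exp (c * s)) (at s)"
        by (auto intro!: derivative_eq_intros du simp: algebra_simps)
      have "- (c * u s) \<le> u' s" using bd[of s] s False by auto
      then show "0 \<le> (u' s + c * u s) * exp (c * s)" by (intro mult_nonneg_nonneg) auto
    qed
    have "t \<le> 0" using False by simp
    from DERIV_nonneg_imp_nondecreasing[OF this *] have "u t * exp (c * t) \<le> u 0 * exp (c * 0)" .
    also have "u 0 = 0" unfolding u_def using 0 by simp
    finally show ?thesis by (simp add: mult_le_0_iff)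
  qed
  then have "u t = 0" using u0[of t] by simp
  then show ?thesis unfolding u_def using j by (simp add: sum_nonneg_eq_0_iff)
qed

text \<open>Tangent vectors see only germs. This is needed because identities such as the constancy
  of a component of the coordinate field hold on \<open>U\<close> only.\<close>

lemma ctangent_local:
  assumes M: "smooth_manifold M" and Z: "Z \<in> ctangent M p" and W: "openin (mtop M) W" "p \<in> W" and eq: "\<And>q. q \<in> W \<Longrightarrow> f q = h q"
  shows "Z f = Z h"
proof -
  have "p \<in> topspace (mtop M)" using W openin_subset by blast
  from manifold_chart_at[OF M this] obtain V \<phi> where V: "(V, \<phi>) \<in> atlas M" "p \<in> V" "compat_chart M V \<phi>" .
  obtain v w where vw: "Z = chart_tvec M V \<phi> p v w" using ctangent_chart(2)[OF M V(3,2) Z] by blast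
  have s: "smooth_near M p f \<longleftrightarrow> smooth_near M p h"
  proof
    show "smooth_near M p h" if "smooth_near M p f" by (rule smooth_near_cong[OF M W _ that]) (simp add: eq)
    show "smooth_near M p f" if "smooth_near M p h" by (rule smooth_near_cong[OF M W _ that]) (simp add: eq)
  qed
  have o: "open (\<phi> ` (V \<inter> W))" using compat_chart_open_iff[OF V(3), of "V \<inter> W"] W compat_chart_openin[OF V(3)] by auto
  have "frechet_derivative (h \<circ> inv_into V \<phi>) (at (\<phi> p)) = frechet_derivative (f \<circ> inv_into V \<phi>) (at (\<phi> p))"
    if f: "smooth_near M p f"
  proof (rule frechet_derivative_at[symmetric])
    show "((h \<circ> inv_into V \<phi>) has_derivative frechet_derivative (f \<circ> inv_into V \<phi>) (at (\<phi> p))) (at (\<phi> p))"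
      by (rule has_derivative_transform_within_open[OF chart_has_derivative[OF M V(3,2) f] o])
        (use V W eq compat_chart_inv[OF V(3)] in auto)
  qed
  then show ?thesis unfolding vw chart_tvec_def using s by simp
qed

lemma cvector_field_cong:
  assumes M: "smooth_manifold M" and X: "cvector_field M W X" and eq: "\<And>q. q \<in> W \<Longrightarrow> Y q = X q"
  shows "cvector_field M W Y"
  unfolding cvector_field_iff[OF M]
proof (intro conjI ballI allI impI)
  show W: "openin (mtop M) W" using X by (simp add: cvector_field_def)
  fix p assume p: "p \<in> W"
  show "Y p \<in> ctangent M p" unfolding eq[OF p] using X p by (simp add: cvector_field_def)
  fix f assume "smooth_near M p f"
  then have "smooth_near M p (\<lambda>q. X q f)" using X p unfolding cvector_field_iff[OF M] by blast
  then show "smooth_near M p (\<lambda>q. Y q f)" by (rule smooth_near_cong[OF M W p, rotated]) (simp add: eq)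
qed

text \<open>That the bracket takes values in the tangent spaces is a premise: in the application it
  lies in \<open>N\<close>, so the cancellation of second derivatives does not have to be
  computed.\<close>

lemma lie_bracket_field:
  assumes M: "smooth_manifold M" and X: "cvector_field M W X" and Y: "cvector_field M W Y"
    and t: "\<And>p. p \<in> W \<Longrightarrow> lie_bracket M X Y p \<in> ctangent M p"
  shows "cvector_field M W (lie_bracket M X Y)"
  unfolding cvector_field_iff[OF M]
proof (intro conjI ballI allI impI t)
  show W: "openin (mtop M) W" using X by (simp add: cvector_field_def)
  fix p f assume p: "p \<in> W" and f: "smooth_near M p f"
  have pt: "p \<in> topspace (mtop M)" using W p openin_subset by blast
  interpret germ_ring "smooth_near M p" p "nhdsin (mtop M) p" by (rule germ_ring_smooth[OF M pt])
  note Xs = X[unfolded cvector_field_iff[OF M], THEN conjunct2, rule_format, THEN conjunct2, rule_format]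
  note Ys = Y[unfolded cvector_field_iff[OF M], THEN conjunct2, rule_format, THEN conjunct2, rule_format]
  have s: "smooth_near M p (\<lambda>q. X q (\<lambda>q. Y q f) - Y q (\<lambda>q. X q f))"
    by (rule diff[OF Xs[OF p Ys[OF p f]] Ys[OF p Xs[OF p f]]])
  obtain V where V: "openin (mtop M) V" "p \<in> V" "\<And>q. q \<in> V \<Longrightarrow> smooth_near M q f" using smooth_near_open[OF M f] by blast
  show "smooth_near M p (\<lambda>q. lie_bracket M X Y q f)"
    by (rule smooth_near_cong[OF M V(1,2) _ s]) (simp add: lie_bracket_def V(3))
qed

lemma sum_split3:
  fixes F :: "nat \<Rightarrow> 'c::comm_monoid_add"
  shows "(\<Sum>i<2 * m + 1. F i) = F 0 + (\<Sum>\<alpha><m. F (Suc \<alpha>)) + (\<Sum>\<alpha><m. F (Suc m + \<alpha>))"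
proof -
  have "(\<Sum>i<Suc (m + m). F i) = F 0 + (\<Sum>i<m + m. F (Suc i))" by (rule sum.lessThan_Suc_shift)
  also have "(\<Sum>i<m + m. F (Suc i)) = (\<Sum>\<alpha><m. F (Suc \<alpha>)) + (\<Sum>\<alpha><m. F (Suc (m + \<alpha>)))"
  proof (induction m)
    case (Suc n)
    have *: "(\<Sum>i<n + k. G i) = (\<Sum>i<n. G i) + (\<Sum>i<k. G (n + i))" for G :: "nat \<Rightarrow> 'c" and n k
      by (induction k) (simp_all add: add.assoc)
    show ?case by (rule *)
  qed simp
  finally show ?thesis by (simp add: mult_2 add.assoc)
qed

section \<open>Projecting and lifting tangent vectors\<close>

context rectified
begin

lemma push_linear:
  "push B pr q (Z + W) = push B pr q Z + push B pr q W" "push B pr q (tscale c Z) = tscale c (push B pr q Z)"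
  "push B pr q (0 :: 'a tvec) = 0"
  by (auto simp: push_def tscale_def fun_eq_iff)

lemma push_sum: "push B pr q (\<Sum>i\<in>A. Z i) = (\<Sum>i\<in>A. push B pr q (Z i))"
proof (induction A rule: infinite_finite_induct)
  case (insert x F)
  then show ?case by (simp only: sum.insert push_linear not_False_eq_True)
qed (simp_all only: sum.infinite sum.empty push_linear not_False_eq_True)

text \<open>The last claim bounds the kernel of the projection by the complex line of the coordinate
  field; it is what allows later arguments to work modulo \<open>X\<close>.\<close>

lemma push_ctangent:
  assumes q: "q \<in> U" and Z: "Z \<in> ctangent M q"
  shows "push B pr q Z \<in> ctangent B (pr q)" "push B pr q (tconj Z) = tconj (push B pr q Z)"
    "push B pr q Z = 0 \<Longrightarrow> \<exists>a. Z = tscale a (chart_tvec M U \<Psi> q (1, 0) 0)"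
proof -
  obtain v w where vw: "Z = chart_tvec M U \<Psi> q v w" using ctangent_chart(2)[OF M chart q Z] by blast
  obtain a v' b w' where v: "v = (a, v')" "w = (b, w')" by (cases v, cases w)
  have p: "push B pr q Z = chart_tvec B leafs \<eta> (pr q) v' w'" unfolding vw v by (rule push_pr[OF q])
  show "push B pr q Z \<in> ctangent B (pr q)" unfolding p by (rule ctangent_chart(1)[OF smooth_B chart_B pr_leafs[OF q]])
  show "push B pr q (tconj Z) = tconj (push B pr q Z)"
    unfolding p unfolding vw v chart_tvec_linear(4)[OF M chart q] chart_tvec_linear(4)[OF smooth_B chart_B pr_leafs[OF q]]
    using push_pr[OF q, of a v' "- b" "- w'"] by simp
  assume "push B pr q Z = 0"
  then have "chart_tvec B leafs \<eta> (pr q) v' w' = chart_tvec B leafs \<eta> (pr q) 0 0"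
    unfolding p chart_tvec_linear(3)[OF smooth_B chart_B pr_leafs[OF q]] .
  then have "v' = 0" "w' = 0" using chart_tvec_inj[OF smooth_B chart_B pr_leafs[OF q]] by blast+
  then have "Z = tscale (Complex a b) (chart_tvec M U \<Psi> q (1, 0) 0)"
    unfolding vw v chart_tvec_linear(2)[OF M chart q] by (simp add: zero_prod_def)
  then show "\<exists>a. Z = tscale a (chart_tvec M U \<Psi> q (1, 0) 0)" by blast
qed

text \<open>The lift without \<open>t\<close> component. Its coefficients are the components of
  \<open>\<zeta>\<close> in the chart \<open>\<eta>\<close>, so a field on the leaf space lifts to a
  smooth field whose components do not depend on \<open>t\<close>.\<close>

definition lift :: "'a \<Rightarrow> 'a set tvec \<Rightarrow> 'a tvec" where
  "lift q \<zeta> = (\<Sum>b\<in>Basis. tscale (\<zeta> (coord \<eta> b)) (chart_tvec M U \<Psi> q (0, b) 0))"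

lemma topU: "q \<in> U \<Longrightarrow> q \<in> topspace (mtop M)" using compat_chart_subset[OF chart] by blast

lemma lift_ctangent: "q \<in> U \<Longrightarrow> lift q \<zeta> \<in> ctangent M q"
  unfolding lift_def by (intro ctangent_sum[OF M topU] ctangent_closed(3)[OF M] ctangent_chart(1)[OF M chart])

lemma lift_linear: "lift q (\<zeta> + \<zeta>') = lift q \<zeta> + lift q \<zeta>'" "lift q (tscale c \<zeta>) = tscale c (lift q \<zeta>)"
  unfolding lift_def by (simp_all add: ctv.scale_left_distrib sum.distrib ctv.scale_sum_right tscale_def[of c \<zeta>])

lemma lift_zero: "lift q 0 = 0" unfolding lift_def by (rule sum.neutral) simp

lemma lift_sum: "lift q (\<Sum>i\<in>A. Z i) = (\<Sum>i\<in>A. lift q (Z i))"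
proof (induction A rule: infinite_finite_induct)
  case (insert x F)
  then show ?case by (simp only: sum.insert lift_linear not_False_eq_True)
qed (simp_all only: sum.infinite sum.empty lift_zero not_False_eq_True)

lemma push_lift:
  assumes q: "q \<in> U" and \<zeta>: "\<zeta> \<in> ctangent B (pr q)"
  shows "push B pr q (lift q \<zeta>) = \<zeta>"
proof -
  have "push B pr q (chart_tvec M U \<Psi> q (0, b) 0) = chart_tvec B leafs \<eta> (pr q) b 0" for b
    using push_pr[OF q, of 0 b 0 0] by (simp add: zero_prod_def)
  then show ?thesis unfolding lift_def push_sum push_linear
    using chart_tvec_expand[OF smooth_B chart_B pr_leafs[OF q] \<zeta>] by simp
qed

lemma lift_conj:
  assumes q: "q \<in> U" shows "lift q (tconj \<zeta>) = tconj (lift q \<zeta>)"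
proof -
  have "(\<lambda>x. cnj (coord \<eta> b x)) = coord \<eta> b" for b by (rule ext) (simp add: coord_def)
  then have "tconj \<zeta> (coord \<eta> b) = cnj (\<zeta> (coord \<eta> b))" for b by (simp add: tconj_def)
  then show ?thesis unfolding lift_def tconj_sum tconj_simps by (simp add: chart_tvec_linear(4)[OF M chart q])
qed

lemma lift_chart:
  assumes q: "q \<in> U" shows "lift q (chart_tvec B leafs \<eta> (pr q) v 0) = chart_tvec M U \<Psi> q (0, v) 0"
proof -
  have "chart_tvec M U \<Psi> q (0, v) 0 = (\<Sum>b\<in>Basis. tscale (chart_tvec M U \<Psi> q (0, v) 0 (coord \<Psi> b)) (chart_tvec M U \<Psi> q b 0))"
    by (rule chart_tvec_expand[OF M chart q ctangent_chart(1)[OF M chart q]])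
  also have "\<dots> = (\<Sum>b\<in>Basis. tscale (complex_of_real (v \<bullet> b)) (chart_tvec M U \<Psi> q (0, b) 0))"
  proof -
    have "(\<Sum>b\<in>(Basis :: (real \<times> 'f) set). h b) = h (1, 0) + (\<Sum>b\<in>Basis. h (0, b))" for h :: "real \<times> 'f \<Rightarrow> 'a tvec"
    proof -
      have "(\<Sum>b\<in>(Basis :: (real \<times> 'f) set). h b) = (\<Sum>b\<in>(\<lambda>u. (u, 0)) ` Basis. h b) + (\<Sum>b\<in>Pair 0 ` Basis. h b)"
        unfolding Basis_prod_def by (intro sum.union_disjoint finite_imageI finite_Basis) auto
      also have "(\<Sum>b\<in>Pair (0::real) ` (Basis :: 'f set). h b) = (\<Sum>b\<in>Basis. h (0, b))"
        by (subst sum.reindex) (auto simp: inj_on_def)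
      also have "(\<Sum>b\<in>(\<lambda>u. (u, 0 :: 'f)) ` (Basis :: real set). h b) = h (1, 0)" by simp
      finally show ?thesis .
    qed
    then show ?thesis by (simp add: chart_tvec_coord[OF M chart q] inner_prod_def)
  qed
  finally show ?thesis unfolding lift_def by (simp add: chart_tvec_coord[OF smooth_B chart_B pr_leafs[OF q]])
qed

lemma lift_field:
  assumes e: "cvector_field B leafs e"
  shows "cvector_field M U (\<lambda>q. lift q (e (pr q)))"
  unfolding lift_def
proof (rule cvector_field_combination[OF M compat_chart_openin[OF chart] finite_Basis chart_tvec_field[OF M chart]])
  fix b q assume q: "q \<in> U"
  have "smooth_near B (pr q) (\<lambda>l. e l (coord \<eta> b))"
    using e pr_leafs[OF q] smooth_near_fun[OF coord_smooth[OF smooth_B chart_B] pr_leafs[OF q]]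
    unfolding cvector_field_iff[OF smooth_B] by blast
  from smooth_near_pr[OF q this] show "smooth_near M q (\<lambda>q. e (pr q) (coord \<eta> b))" by (simp add: o_def)
qed

text \<open>The section \<open>t = 0\<close> of the trivial bundle, at which data on
  \<open>U\<close> are frozen to give data on the leaf space.\<close>

definition slice :: "'a set \<Rightarrow> 'a" where "slice l = inv_into U \<Psi> (0, \<eta> l)"

lemma \<eta>_in_S: "l \<in> leafs \<Longrightarrow> \<eta> l \<in> S" using \<eta>_img by blast

lemma slice: "l \<in> leafs \<Longrightarrow> slice l \<in> U" "l \<in> leafs \<Longrightarrow> pr (slice l) = l" "l \<in> leafs \<Longrightarrow> \<Psi> (slice l) = (0, \<eta> l)"
proof -
  assume l: "l \<in> leafs"
  show U: "slice l \<in> U" and p: "\<Psi> (slice l) = (0, \<eta> l)" unfolding slice_def using inv_in[OF \<eta>_in_S[OF l]] by simp_all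
  have "\<eta> (pr (slice l)) = \<eta> l" unfolding \<eta>_pr[OF U] p by simp
  then show "pr (slice l) = l" using inj_onD[OF inj_\<eta>] pr_leafs[OF U] l by blast
qed

lemma smooth_slice:
  assumes f: "smooth_fun M U (f :: 'a \<Rightarrow> complex)"
  shows "smooth_fun B leafs (\<lambda>l. f (slice l))"
proof (rule iffD2[OF smooth_fun_chart_iff[OF smooth_B chart_B order_refl compat_chart_openin[OF chart_B]]])
  have f': "smooth_on (UNIV \<times> S) (f \<circ> inv_into U \<Psi>)"
    using iffD1[OF smooth_fun_chart_iff[OF M chart order_refl compat_chart_openin[OF chart]] f] unfolding img .
  have s: "smooth_on S (\<lambda>x. (0 :: real, x))"
    unfolding smooth_on_def by (intro allI ck_on_Pair open_S ck_on_const ck_on_bounded_linear[OF open_S bounded_linear_ident])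
  have "smooth_on S (\<lambda>x. (f \<circ> inv_into U \<Psi>) (0, x))"
    by (rule smooth_on_compose[OF open_S s f']) auto
  then have "smooth_on S ((\<lambda>l. f (slice l)) \<circ> inv_into leafs \<eta>)"
    by (rule smooth_on_cong[OF open_S, rotated]) (simp add: inv_\<eta> slice_def \<eta>_lf)
  then show "smooth_on (\<eta> ` leafs) ((\<lambda>l. f (slice l)) \<circ> inv_into leafs \<eta>)" unfolding \<eta>_img .
qed

text \<open>The components of the projected field are those of \<open>Z\<close> at the slice without
  the \<open>t\<close> component, hence smooth by restriction to \<open>t = 0\<close>.\<close>

lemma push_slice_field:
  assumes Z: "cvector_field M U Z"
  shows "cvector_field B leafs (\<lambda>l. push B pr (slice l) (Z (slice l)))"
proof (rule cvector_field_cong[OF smooth_B])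
  show "cvector_field B leafs (\<lambda>l. \<Sum>b\<in>Basis. tscale (Z (slice l) (coord \<Psi> (0, b))) (chart_tvec B leafs \<eta> l b 0))"
  proof (rule cvector_field_combination[OF smooth_B compat_chart_openin[OF chart_B] finite_Basis chart_tvec_field[OF smooth_B chart_B]])
    fix b l assume l: "l \<in> leafs"
    have "smooth_fun M U (\<lambda>q. Z q (coord \<Psi> (0, b)))"
      using Z coord_smooth[OF M chart] unfolding cvector_field_def by blast
    from smooth_near_fun[OF smooth_slice[OF this] l]
    show "smooth_near B l (\<lambda>l. Z (slice l) (coord \<Psi> (0, b)))" .
  qed
  fix l assume l: "l \<in> leafs"
  note q = slice[OF l]
  have Zq: "Z (slice l) \<in> ctangent M (slice l)" using Z q(1) by (simp add: cvector_field_def)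
  obtain v w where vw: "Z (slice l) = chart_tvec M U \<Psi> (slice l) v w" using ctangent_chart(2)[OF M chart q(1) Zq] by blast
  obtain a v' b w' where v: "v = (a, v')" "w = (b, w')" by (cases v, cases w)
  have p: "push B pr (slice l) (Z (slice l)) = chart_tvec B leafs \<eta> l v' w'" unfolding vw v push_pr[OF q(1)] q(2) ..
  show "push B pr (slice l) (Z (slice l)) = (\<Sum>b\<in>Basis. tscale (Z (slice l) (coord \<Psi> (0, b))) (chart_tvec B leafs \<eta> l b 0))"
    unfolding p
    by (subst chart_tvec_expand[OF smooth_B chart_B l ctangent_chart(1)[OF smooth_B chart_B l]])
      (simp add: vw v chart_tvec_coord[OF smooth_B chart_B l] chart_tvec_coord[OF M chart q(1)] inner_prod_def)
qed

text \<open>The flow of \<open>\<partial>\<^sub>t\<close> is \<open>(t, x) \<mapsto> (t + s, x)\<close>, so a smooth function is differentiated along it by \<open>\<partial>\<^sub>t\<close>.\<close>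

lemma smooth_along_leaf:
  assumes f: "smooth_fun M U f" and x: "x \<in> S"
  shows "((\<lambda>t. f (inv_into U \<Psi> (t, x))) has_vector_derivative
    chart_tvec M U \<Psi> (inv_into U \<Psi> (t, x)) (1, 0) 0 f) (at t)"
proof -
  let ?q = "inv_into U \<Psi> (t, x)"
  note q = inv_in[OF x, of t]
  have sn: "smooth_near M ?q f" by (rule smooth_near_fun[OF f q(1)])
  let ?D = "frechet_derivative (f \<circ> inv_into U \<Psi>) (at (t, x))"
  have d: "((f \<circ> inv_into U \<Psi>) has_derivative ?D) (at (t, x))"
    using chart_has_derivative[OF M chart q(1) sn] unfolding q(2) .
  have *: "((\<lambda>s. (f \<circ> inv_into U \<Psi>) (s, x)) has_derivative (\<lambda>s. ?D (s, 0))) (at t)"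
    by (rule has_derivative_compose[of "\<lambda>s. (s, x)" _ _ _ "f \<circ> inv_into U \<Psi>", OF _ d])
      (auto intro!: derivative_eq_intros)
  have e: "(\<lambda>s. ?D (s, 0)) = (\<lambda>s. s *\<^sub>R ?D (1, 0))"
  proof
    fix s :: real
    have "(s, 0) = s *\<^sub>R (1, 0 :: 'f)" by simp
    then show "?D (s, 0) = s *\<^sub>R ?D (1, 0)" by (metis linear_cmul[OF has_derivative_linear[OF d]])
  qed
  have "?D 0 = 0" by (rule linear_0[OF has_derivative_linear[OF d]])
  then have "chart_tvec M U \<Psi> ?q (1, 0) 0 f = ?D (1, 0)" using sn by (simp add: chart_tvec_def q(2))
  then show ?thesis unfolding has_vector_derivative_def using *[unfolded e] by (simp only: o_def)
qed

lemma continuous_along_leaf: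
  assumes f: "\<And>q. q \<in> U \<Longrightarrow> smooth_near M q f" and x: "x \<in> S"
  shows "continuous_on UNIV (\<lambda>t. f (inv_into U \<Psi> (t, x)))"
proof -
  have "smooth_fun M U f" using f compat_chart_openin[OF chart] by (simp add: smooth_fun_iff[OF M])
  from smooth_along_leaf[OF this x] show ?thesis
    by (intro continuous_at_imp_continuous_on ballI) (rule has_vector_derivative_continuous)
qed

end

lemma complex_linear_sum:
  assumes M: "smooth_manifold M" and p: "p \<in> topspace (mtop M)" and lin: "complex_linear_on (ctangent M p) \<omega>"
    and V: "\<And>i. i \<in> A \<Longrightarrow> V i \<in> ctangent M p"
  shows "\<omega> (\<Sum>i\<in>A. tscale (c i) (V i)) = (\<Sum>i\<in>A. c i * \<omega> (V i))"
proof -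
  have add: "\<omega> (V + W) = \<omega> V + \<omega> W" if "V \<in> ctangent M p" "W \<in> ctangent M p" for V W
    using lin that unfolding complex_linear_on_def by blast
  have scale: "\<omega> (tscale k W) = k * \<omega> W" if "W \<in> ctangent M p" for k W
    using lin that unfolding complex_linear_on_def by blast
  have 0: "\<omega> 0 = 0" using scale[OF ctangent_closed(1)[OF M p], of 0] by simp
  show ?thesis using V
  proof (induction A rule: infinite_finite_induct)
    case (insert i A)
    have "\<omega> (tscale (c i) (V i) + (\<Sum>i\<in>A. tscale (c i) (V i))) = \<omega> (tscale (c i) (V i)) + \<omega> (\<Sum>i\<in>A. tscale (c i) (V i))"
      by (rule add) (auto intro!: ctangent_sum[OF M p] ctangent_closed(3)[OF M] insert)
    moreover have "\<omega> (\<Sum>i\<in>A. tscale (c i) (V i)) = (\<Sum>i\<in>A. c i * \<omega> (V i))"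
      by (rule insert.IH) (use insert.prems in auto)
    moreover have "\<omega> (tscale (c i) (V i)) = c i * \<omega> (V i)" by (rule scale) (use insert.prems in auto)
    ultimately show ?case unfolding sum.insert[OF insert.hyps] by (simp only:)
  qed (simp_all only: 0 sum.infinite sum.empty not_False_eq_True)
qed

text \<open>Abstracts from how the box was found. \<open>N\<close> is framed by the coordinate field
  and the fields \<open>Z i\<close> with \<open>i < m\<close>; the constant coordinate vector
  \<open>b0\<close> is not orthogonal to \<open>K\<close> at any point of \<open>U\<close>. Because
  it is constant, its field projects to a well-defined field on the leaf space, where it supplies
  the one direction missing from the projections of \<open>N\<close> and its conjugate.\<close>

locale robinson_box = rectified M K U \<Psi> S
  for M :: "('a, 'e::euclidean_space) mfd" and K :: "'a \<Rightarrow> 'a tvec set" and U :: "'a set"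
    and \<Psi> :: "'a \<Rightarrow> real \<times> 'f::euclidean_space" and S :: "'f set" +
  fixes g :: "'a metric" and N :: "'a \<Rightarrow> 'a tvec set" and m :: nat and Z :: "nat \<Rightarrow> 'a \<Rightarrow> 'a tvec" and b0 :: 'f
  assumes g: "lorentzian_metric M g" and dim: "DIM('f) = 2 * m + 1"
    and Z_field: "\<And>i. i < m \<Longrightarrow> cvector_field M U (Z i)"
    and N_span: "\<And>q. q \<in> U \<Longrightarrow> N q = {tscale a (chart_tvec M U \<Psi> q (1, 0) 0) + (\<Sum>i<m. tscale (c i) (Z i q)) |a c. True}"
    and N_indep: "\<And>q a c. q \<in> U \<Longrightarrow> tscale a (chart_tvec M U \<Psi> q (1, 0) 0) + (\<Sum>i<m. tscale (c i) (Z i q)) = 0 \<Longrightarrow>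
      a = 0 \<and> (\<forall>i<m. c i = 0)"
    and null: "\<And>q V W. q \<in> U \<Longrightarrow> V \<in> N q \<Longrightarrow> W \<in> N q \<Longrightarrow> complexify g q V W = 0"
    and KN: "\<And>q. q \<in> U \<Longrightarrow> ctv.span (K q) = N q \<inter> tconj ` N q"
    and bracket: "\<And>i q. i < m \<Longrightarrow> q \<in> U \<Longrightarrow> lie_bracket M (\<lambda>q. chart_tvec M U \<Psi> q (1, 0) 0) (Z i) q \<in> N q"
    and b0: "\<And>q. q \<in> U \<Longrightarrow> complexify g q (chart_tvec M U \<Psi> q (1, 0) 0) (chart_tvec M U \<Psi> q (0, b0) 0) \<noteq> 0"
begin

abbreviation X :: "'a \<Rightarrow> 'a tvec" where "X q \<equiv> chart_tvec M U \<Psi> q (1, 0) 0"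
abbreviation L :: "'a \<Rightarrow> 'a tvec" where "L q \<equiv> chart_tvec M U \<Psi> q (0, b0) 0"
abbreviation G :: "'a \<Rightarrow> 'a tvec \<Rightarrow> 'a tvec \<Rightarrow> complex" where "G \<equiv> complexify g"
abbreviation push' :: "'a \<Rightarrow> 'a tvec \<Rightarrow> 'a set tvec" where "push' \<equiv> push B pr"

lemma X_tangent: "q \<in> U \<Longrightarrow> X q \<in> ctangent M q" "q \<in> U \<Longrightarrow> tconj (X q) = X q"
  using ctangent_chart(1)[OF M chart] chart_tvec_linear(4)[OF M chart, of q "(1, 0)" 0] by auto

lemma L_tangent: "q \<in> U \<Longrightarrow> L q \<in> ctangent M q" "q \<in> U \<Longrightarrow> tconj (L q) = L q"
  using ctangent_chart(1)[OF M chart] chart_tvec_linear(4)[OF M chart, of q "(0, b0)" 0] by auto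

lemma Z_tangent: "q \<in> U \<Longrightarrow> i < m \<Longrightarrow> Z i q \<in> ctangent M q"
  using Z_field unfolding cvector_field_def by blast

lemma N_mem:
  assumes q: "q \<in> U"
  shows "X q \<in> N q" "i < m \<Longrightarrow> Z i q \<in> N q" "tscale a (X q) + (\<Sum>i<m. tscale (c i) (Z i q)) \<in> N q"
proof -
  show *: "tscale a (X q) + (\<Sum>i<m. tscale (c i) (Z i q)) \<in> N q" for a c unfolding N_span[OF q] by blast
  show "X q \<in> N q" using *[of 1 "\<lambda>_. 0"] by simp
  assume i: "i < m"
  have "(\<Sum>j<m. tscale (if j = i then 1 else 0) (Z j q)) = (\<Sum>j<m. if j = i then Z j q else 0)"
    by (rule sum.cong) auto
  then show "Z i q \<in> N q" using *[of 0 "\<lambda>j. if j = i then 1 else 0"] i by simp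
qed

lemma N_tangent: "q \<in> U \<Longrightarrow> W \<in> N q \<Longrightarrow> W \<in> ctangent M q"
  by (auto simp: N_span intro!: ctangent_closed(2,3)[OF M] ctangent_sum[OF M topU] X_tangent Z_tangent)

lemma K_cspan:
  assumes q: "q \<in> U" and W: "W \<in> ctv.span (K q)" shows "\<exists>a. W = tscale a (X q)"
proof -
  have "K q \<subseteq> ctv.span {X q}"
    unfolding K_span[OF q] rtv.span_singleton ctv.span_singleton by (auto simp: rtscale_def)
  then have "ctv.span (K q) \<subseteq> ctv.span {X q}" by (rule ctv.span_minimal) (rule ctv.subspace_span)
  then show ?thesis using W unfolding ctv.span_singleton by blast
qed

lemma push_X: "q \<in> U \<Longrightarrow> push' q (X q) = 0"
  using push_pr[of q 1 0 0 0] chart_tvec_linear(3)[OF smooth_B chart_B pr_leafs] by (simp add: zero_prod_def)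

lemma push_L: "q \<in> U \<Longrightarrow> push' q (L q) = chart_tvec B leafs \<eta> (pr q) b0 0"
  using push_pr[of q 0 b0 0 0] by (simp add: zero_prod_def)

lemma G_X:
  assumes q: "q \<in> U"
  shows "G q (X q) (X q) = 0" "i < m \<Longrightarrow> G q (X q) (Z i q) = 0" "i < m \<Longrightarrow> G q (X q) (tconj (Z i q)) = 0"
proof -
  show "G q (X q) (X q) = 0" by (intro null q N_mem)
  assume i: "i < m"
  show *: "G q (X q) (Z i q) = 0" by (intro null q N_mem i)
  have "G q (tconj (X q)) (tconj (Z i q)) = 0"
    unfolding complexify_conj[OF M g topU[OF q] X_tangent(1)[OF q] Z_tangent[OF q i]] * by simp
  then show "G q (X q) (tconj (Z i q)) = 0" unfolding X_tangent(2)[OF q] .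
qed

text \<open>The combination is a multiple of \<open>X\<close>. Pairing with \<open>X\<close> kills
  \<open>N\<close> and its conjugate and leaves \<open>r * g(X, L)\<close>, so \<open>r = 0\<close>.
  The conjugate part then agrees with an element of \<open>N\<close>, so it lies in the intersection
  of \<open>N\<close> with its conjugate, which is the complex line of \<open>X\<close>;
  independence of \<open>X\<close> and the \<open>Z i\<close> finishes both parts.\<close>

lemma frame_indep:
  assumes q: "q \<in> U"
    and 0: "push' q (tscale r (L q) + ((\<Sum>\<alpha><m. tscale (c \<alpha>) (tconj (Z \<alpha> q))) + (\<Sum>\<alpha><m. tscale (d \<alpha>) (Z \<alpha> q)))) = 0"
  shows "r = 0" "\<alpha> < m \<Longrightarrow> c \<alpha> = 0" "\<alpha> < m \<Longrightarrow> d \<alpha> = 0"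
proof -
  let ?c = "\<Sum>\<alpha><m. tscale (c \<alpha>) (tconj (Z \<alpha> q))" and ?d = "\<Sum>\<alpha><m. tscale (d \<alpha>) (Z \<alpha> q)"
  note cl = ctangent_closed[OF M] and qt = topU[OF q]
  have ct: "?c \<in> ctangent M q" "?d \<in> ctangent M q" "tscale r (L q) \<in> ctangent M q"
    by (auto intro!: ctangent_sum[OF M qt] cl(3,4) Z_tangent q L_tangent)
  obtain a where a: "tscale r (L q) + (?c + ?d) = tscale a (X q)"
    using push_ctangent(3)[OF q cl(2)[OF ct(3) cl(2)[OF ct(1,2)]] 0] by blast
  have "G q (X q) (tscale r (L q) + (?c + ?d)) = r * G q (X q) (L q)"
  proof -
    have "G q (X q) ?c = 0" "G q (X q) ?d = 0"
      using complexify_sum2[OF M g qt X_tangent(1)[OF q], of "{..<m}" "\<lambda>\<alpha>. tconj (Z \<alpha> q)" c]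
        complexify_sum2[OF M g qt X_tangent(1)[OF q], of "{..<m}" "\<lambda>\<alpha>. Z \<alpha> q" d]
      by (simp_all add: cl(4) Z_tangent q G_X)
    then show ?thesis
      using complexify_add2[OF M g qt ct(3) cl(2)[OF ct(1,2)] X_tangent(1)[OF q]]
        complexify_add2[OF M g qt ct(1,2) X_tangent(1)[OF q]]
        complexify_scale2[OF M g qt L_tangent(1)[OF q] X_tangent(1)[OF q], of r] by simp
  qed
  moreover have "G q (X q) (tscale a (X q)) = 0"
    using complexify_scale2[OF M g qt X_tangent(1)[OF q] X_tangent(1)[OF q], of a] G_X(1)[OF q] by simp
  ultimately show r: "r = 0" using a b0[OF q] by simp
  have cd: "?c + ?d = tscale a (X q)" using a unfolding r by simp
  have "tscale a (X q) + (\<Sum>\<alpha><m. tscale (- d \<alpha>) (Z \<alpha> q)) \<in> N q" by (rule N_mem(3)[OF q])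
  moreover have e: "tscale a (X q) + (\<Sum>\<alpha><m. tscale (- d \<alpha>) (Z \<alpha> q)) = ?c"
    unfolding cd[symmetric] by (simp add: sum_negf)
  ultimately have "?c \<in> N q" by simp
  moreover have "?c \<in> tconj ` N q"
  proof
    show "?c = tconj (tscale 0 (X q) + (\<Sum>\<alpha><m. tscale (cnj (c \<alpha>)) (Z \<alpha> q)))"
      by (simp add: tconj_sum tconj_simps(2))
  qed (rule N_mem(3)[OF q])
  ultimately have "?c \<in> ctv.span (K q)" unfolding KN[OF q] by blast
  then obtain a' where a': "?c = tscale a' (X q)" using K_cspan[OF q] by blast
  have "tscale (a - a') (X q) + (\<Sum>\<alpha><m. tscale (- d \<alpha>) (Z \<alpha> q)) = 0"
  proof -
    have "tscale (a - a') (X q) + (\<Sum>\<alpha><m. tscale (- d \<alpha>) (Z \<alpha> q)) =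
        (tscale a (X q) + (\<Sum>\<alpha><m. tscale (- d \<alpha>) (Z \<alpha> q))) - tscale a' (X q)"
      unfolding ctv.scale_left_diff_distrib by (simp only: diff_conv_add_uminus ac_simps)
    then show ?thesis unfolding e a' by (simp only: diff_self)
  qed
  from N_indep[OF q this] show "\<alpha> < m \<Longrightarrow> d \<alpha> = 0" by simp
  have "tconj ?c = tconj (tscale a' (X q))" using a' by (rule arg_cong)
  then have "(\<Sum>\<alpha><m. tscale (cnj (c \<alpha>)) (Z \<alpha> q)) = tscale (cnj a') (X q)"
    unfolding tconj_sum tconj_simps(2,3) X_tangent(2)[OF q] .
  then have "tscale (- cnj a') (X q) + (\<Sum>\<alpha><m. tscale (cnj (c \<alpha>)) (Z \<alpha> q)) = 0" by simp
  from N_indep[OF q this] show "\<alpha> < m \<Longrightarrow> c \<alpha> = 0" by simp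
qed

section \<open>The frame of the leaf space and its dual coframe\<close>

definition e :: "nat \<Rightarrow> 'a set \<Rightarrow> 'a set tvec" where "e \<alpha> l = push' (slice l) (Z \<alpha> (slice l))"
definition \<xi> :: "'a set \<Rightarrow> 'a set tvec" where "\<xi> l = chart_tvec B leafs \<eta> l b0 0"

text \<open>The (1,0)-vectors come first so that the dual coframe is ordered as in a CR coframe.\<close>

definition fr :: "nat \<Rightarrow> 'a set \<Rightarrow> 'a set tvec" where
  "fr i l = (if i = 0 then \<xi> l else if i \<le> m then tconj (e (i - 1) l) else e (i - Suc m) l)"

lemma e_field: "\<alpha> < m \<Longrightarrow> cvector_field B leafs (e \<alpha>)"
  unfolding e_def[abs_def] by (rule push_slice_field[OF Z_field])

lemma e_tangent: "\<alpha> < m \<Longrightarrow> l \<in> leafs \<Longrightarrow> e \<alpha> l \<in> ctangent B l"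
  using e_field unfolding cvector_field_def by blast

lemma \<xi>_field: "cvector_field B leafs \<xi>"
  unfolding \<xi>_def[abs_def] by (rule chart_tvec_field[OF smooth_B chart_B])

lemma \<xi>_tangent: "l \<in> leafs \<Longrightarrow> \<xi> l \<in> ctangent B l" "l \<in> leafs \<Longrightarrow> tconj (\<xi> l) = \<xi> l"
  unfolding \<xi>_def using ctangent_chart(1)[OF smooth_B chart_B] chart_tvec_linear(4)[OF smooth_B chart_B, of l b0 0] by auto

lemma fr_field: "i < 2 * m + 1 \<Longrightarrow> cvector_field B leafs (fr i)"
proof -
  assume i: "i < 2 * m + 1"
  consider "i = 0" | "i \<noteq> 0" "i \<le> m" | "m < i" by linarith
  then show ?thesis
  proof cases
    case 1
    then show ?thesis using \<xi>_field by (simp add: fr_def[abs_def])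
  next
    case 2
    then have "cvector_field B leafs (\<lambda>l. tconj (e (i - 1) l))" by (intro cvector_field_conj[OF smooth_B e_field]) auto
    then show ?thesis using 2 by (simp add: fr_def[abs_def])
  next
    case 3
    then have "cvector_field B leafs (e (i - Suc m))" using i by (intro e_field) auto
    then show ?thesis using 3 by (simp add: fr_def[abs_def])
  qed
qed

lemma fr_sum: "(\<Sum>i<2 * m + 1. tscale (c i) (fr i l)) = tscale (c 0) (\<xi> l) +
    ((\<Sum>\<alpha><m. tscale (c (Suc \<alpha>)) (tconj (e \<alpha> l))) + (\<Sum>\<alpha><m. tscale (c (Suc m + \<alpha>)) (e \<alpha> l)))"
  unfolding sum_split3 add.assoc
  by (intro arg_cong2[of _ _ _ _ "(+)"] sum.cong) (auto simp: fr_def)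

lemma topB: "l \<in> leafs \<Longrightarrow> l \<in> topspace (mtop B)" by (simp add: topspace_B)

lemma fr_indep: assumes l: "l \<in> leafs" shows "ctv.indep_family (2 * m + 1) (\<lambda>i. fr i l)"
  unfolding ctv.indep_family_def
proof (intro allI impI)
  fix c i assume s: "(\<Sum>i<2 * m + 1. tscale (c i) (fr i l)) = 0" and i: "i < 2 * m + 1"
  note q = slice[OF l]
  have pc: "push' (slice l) (tconj (Z \<alpha> (slice l))) = tconj (e \<alpha> l)" if "\<alpha> < m" for \<alpha>
    unfolding e_def by (rule push_ctangent(2)[OF q(1) Z_tangent[OF q(1) that]])
  have "push' (slice l) (tscale (c 0) (L (slice l)) + ((\<Sum>\<alpha><m. tscale (c (Suc \<alpha>)) (tconj (Z \<alpha> (slice l)))) +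
      (\<Sum>\<alpha><m. tscale (c (Suc m + \<alpha>)) (Z \<alpha> (slice l))))) = 0"
    unfolding push_linear push_sum push_L[OF q(1)] q(2)
    using s unfolding fr_sum by (simp add: pc e_def \<xi>_def)
  note z = frame_indep[OF q(1) this]
  have "i = 0 \<or> (\<exists>\<alpha><m. i = Suc \<alpha>) \<or> (\<exists>\<alpha><m. i = Suc m + \<alpha>)"
  proof (cases "i \<le> m")
    case True
    then show ?thesis by (cases i) auto
  next
    case False
    then have "i - Suc m < m" "i = Suc m + (i - Suc m)" using i by auto
    then show ?thesis by blast
  qed
  then show "c i = 0" using z by blast
qed

text \<open>A count: \<open>2 * m + 1\<close> independent vectors in a space spanned by
  \<open>2 * m + 1\<close> coordinate vectors.\<close>

lemma fr_spans: assumes l: "l \<in> leafs" and \<zeta>: "\<zeta> \<in> ctangent B l" shows "\<exists>c. \<zeta> = (\<Sum>i<2 * m + 1. tscale (c i) (fr i l))"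
proof -
  let ?Y = "(\<lambda>b. chart_tvec B leafs \<eta> l b 0) ` Basis"
  have sp: "\<zeta> \<in> ctv.span ?Y" if "\<zeta> \<in> ctangent B l" for \<zeta>
    by (subst chart_tvec_expand[OF smooth_B chart_B l that]) (intro ctv.span_sum ctv.span_scale ctv.span_base imageI)
  show ?thesis
  proof (rule ctv.indep_family_spans[OF fr_indep[OF l]])
    show "finite ?Y" by simp
    show "card ?Y \<le> 2 * m + 1" using card_image_le[OF finite_Basis, of "\<lambda>b. chart_tvec B leafs \<eta> l b 0"] dim by simp
    show "fr i l \<in> ctv.span ?Y" if "i < 2 * m + 1" for i
      using fr_field[OF that] l by (intro sp) (simp add: cvector_field_def)
    show "\<zeta> \<in> ctv.span ?Y" by (rule sp[OF \<zeta>])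
  qed
qed

definition co :: "'a set \<Rightarrow> 'a set tvec \<Rightarrow> nat \<Rightarrow> complex" where
  "co l \<zeta> = (SOME c. \<zeta> = (\<Sum>i<2 * m + 1. tscale (c i) (fr i l)))"

lemma co_sum: "l \<in> leafs \<Longrightarrow> \<zeta> \<in> ctangent B l \<Longrightarrow> \<zeta> = (\<Sum>i<2 * m + 1. tscale (co l \<zeta> i) (fr i l))"
  unfolding co_def by (rule someI_ex[OF fr_spans])

lemma co_unique:
  assumes l: "l \<in> leafs" and \<zeta>: "\<zeta> = (\<Sum>i<2 * m + 1. tscale (c i) (fr i l))" and i: "i < 2 * m + 1"
  shows "co l \<zeta> i = c i"
proof -
  have "\<zeta> = (\<Sum>i<2 * m + 1. tscale (co l \<zeta> i) (fr i l))" unfolding co_def by (rule someI[of _ c]) (rule \<zeta>)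
  then have "(\<Sum>i<2 * m + 1. tscale (co l \<zeta> i) (fr i l)) - (\<Sum>i<2 * m + 1. tscale (c i) (fr i l)) = 0" using \<zeta> by simp
  then have "(\<Sum>i<2 * m + 1. tscale (co l \<zeta> i - c i) (fr i l)) = 0"
    by (simp only: ctv.scale_left_diff_distrib sum_subtractf)
  then show ?thesis using fr_indep[OF l] i unfolding ctv.indep_family_def by auto
qed

definition \<theta>0 :: "'a set form" where "\<theta>0 l \<zeta> = co l \<zeta> 0"
text \<open>Dual to \<open>tconj (e \<alpha>)\<close> and not to \<open>e \<alpha>\<close>: the
  \<open>e \<alpha>\<close> project from \<open>N\<close>, so they have to be of type (0,1) and be
  annihilated by all \<open>\<theta> \<alpha>\<close>.\<close>

definition \<theta> :: "nat \<Rightarrow> 'a set form" where "\<theta> \<alpha> l \<zeta> = co l \<zeta> (Suc \<alpha>)"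
abbreviation \<theta>c :: "nat \<Rightarrow> 'a set form" where "\<theta>c \<alpha> \<equiv> conj_form (\<theta> \<alpha>)"

text \<open>The coefficient of \<open>e \<alpha>\<close> is read off by the conjugate of
  \<open>\<theta> \<alpha>\<close>, because conjugating the expansion swaps the two groups of
  vectors and fixes the real vector \<open>\<xi>\<close>.\<close>

lemma expansion_unique:
  assumes l: "l \<in> leafs"
    and \<zeta>: "\<zeta> = tscale r (\<xi> l) + ((\<Sum>\<alpha><m. tscale (c \<alpha>) (tconj (e \<alpha> l))) + (\<Sum>\<alpha><m. tscale (d \<alpha>) (e \<alpha> l)))"
  shows "\<theta>0 l \<zeta> = r" "\<alpha> < m \<Longrightarrow> \<theta> \<alpha> l \<zeta> = c \<alpha>" "\<alpha> < m \<Longrightarrow> \<theta>c \<alpha> l \<zeta> = d \<alpha>"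
proof -
  have *: "co l \<zeta> 0 = r" "\<alpha> < m \<Longrightarrow> co l \<zeta> (Suc \<alpha>) = c \<alpha>"
    if "\<zeta> = tscale r (\<xi> l) + ((\<Sum>\<alpha><m. tscale (c \<alpha>) (tconj (e \<alpha> l))) + (\<Sum>\<alpha><m. tscale (d \<alpha>) (e \<alpha> l)))" for \<zeta> r c d
  proof -
    define k where "k i = (if i = 0 then r else if i \<le> m then c (i - 1) else d (i - Suc m))" for i
    have "\<zeta> = (\<Sum>i<2 * m + 1. tscale (k i) (fr i l))"
      unfolding that fr_sum by (simp add: k_def)
    note u = co_unique[OF l this]
    show "co l \<zeta> 0 = r" using u[of 0] by (simp add: k_def)
    show "\<alpha> < m \<Longrightarrow> co l \<zeta> (Suc \<alpha>) = c \<alpha>" using u[of "Suc \<alpha>"] by (simp add: k_def)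
  qed
  show "\<theta>0 l \<zeta> = r" "\<alpha> < m \<Longrightarrow> \<theta> \<alpha> l \<zeta> = c \<alpha>" unfolding \<theta>0_def \<theta>_def using *[OF \<zeta>] by auto
  have "tconj \<zeta> = tscale (cnj r) (\<xi> l) + ((\<Sum>\<alpha><m. tscale (cnj (d \<alpha>)) (tconj (e \<alpha> l))) + (\<Sum>\<alpha><m. tscale (cnj (c \<alpha>)) (e \<alpha> l)))"
    unfolding \<zeta> tconj_simps(1,2) tconj_sum tconj_simps(3) \<xi>_tangent(2)[OF l] by (simp only: add.commute[of "\<Sum>\<alpha><m. tscale (cnj (c \<alpha>)) (e \<alpha> l)"])
  from *(2)[OF this] show "\<alpha> < m \<Longrightarrow> \<theta>c \<alpha> l \<zeta> = d \<alpha>" unfolding conj_form_def \<theta>_def by simp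
qed

lemma expansion:
  assumes l: "l \<in> leafs" and \<zeta>: "\<zeta> \<in> ctangent B l"
  shows "\<zeta> = tscale (\<theta>0 l \<zeta>) (\<xi> l) + ((\<Sum>\<alpha><m. tscale (\<theta> \<alpha> l \<zeta>) (tconj (e \<alpha> l))) + (\<Sum>\<alpha><m. tscale (\<theta>c \<alpha> l \<zeta>) (e \<alpha> l)))"
proof -
  note s = co_sum[OF l \<zeta>, unfolded fr_sum]
  have "(\<Sum>\<alpha><m. tscale (\<theta>c \<alpha> l \<zeta>) (e \<alpha> l)) = (\<Sum>\<alpha><m. tscale (co l \<zeta> (Suc m + \<alpha>)) (e \<alpha> l))"
    using expansion_unique(3)[OF l s] by (intro sum.cong) auto
  then show ?thesis unfolding \<theta>0_def \<theta>_def using s by simp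
qed

lemma forms_linear:
  assumes l: "l \<in> leafs"
  shows "complex_linear_on (ctangent B l) (\<theta>0 l)" "\<alpha> < m \<Longrightarrow> complex_linear_on (ctangent B l) (\<theta> \<alpha> l)"
    "\<alpha> < m \<Longrightarrow> complex_linear_on (ctangent B l) (\<theta>c \<alpha> l)"
proof -
  have a: "\<zeta> + \<zeta>' = tscale (\<theta>0 l \<zeta> + \<theta>0 l \<zeta>') (\<xi> l) + ((\<Sum>\<alpha><m. tscale (\<theta> \<alpha> l \<zeta> + \<theta> \<alpha> l \<zeta>') (tconj (e \<alpha> l))) +
      (\<Sum>\<alpha><m. tscale (\<theta>c \<alpha> l \<zeta> + \<theta>c \<alpha> l \<zeta>') (e \<alpha> l)))" if "\<zeta> \<in> ctangent B l" "\<zeta>' \<in> ctangent B l" for \<zeta> \<zeta>'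
    by (subst (1) expansion[OF l that(1)], subst (1) expansion[OF l that(2)])
      (simp only: ctv.scale_left_distrib sum.distrib ac_simps)
  have s: "tscale k \<zeta> = tscale (k * \<theta>0 l \<zeta>) (\<xi> l) + ((\<Sum>\<alpha><m. tscale (k * \<theta> \<alpha> l \<zeta>) (tconj (e \<alpha> l))) +
      (\<Sum>\<alpha><m. tscale (k * \<theta>c \<alpha> l \<zeta>) (e \<alpha> l)))" if "\<zeta> \<in> ctangent B l" for k \<zeta>
    by (subst (1) expansion[OF l that])
      (simp only: ctv.scale_right_distrib ctv.scale_sum_right ctv.scale_scale)
  note u = expansion_unique[OF l a] expansion_unique[OF l s]
  show "complex_linear_on (ctangent B l) (\<theta>0 l)" unfolding complex_linear_on_def using u by simp
  show "\<alpha> < m \<Longrightarrow> complex_linear_on (ctangent B l) (\<theta> \<alpha> l)" unfolding complex_linear_on_def using u by simp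
  show "\<alpha> < m \<Longrightarrow> complex_linear_on (ctangent B l) (\<theta>c \<alpha> l)" unfolding complex_linear_on_def using u by simp
qed

lemma co_smooth:
  assumes V: "V \<subseteq> leafs" and Y: "cvector_field B V Y" and i: "i < 2 * m + 1" and l: "l \<in> V"
  shows "smooth_near B l (\<lambda>l. co l (Y l) i)"
proof -
  have oV: "openin (mtop B) V" using Y by (simp add: cvector_field_def)
  show ?thesis
  proof (rule field_coefficients_smooth[OF smooth_B oV l, of "2 * m + 1" fr Y "\<lambda>i l. co l (Y l) i" i])
    show "cvector_field B V (fr j)" if "j < 2 * m + 1" for j by (rule cvector_field_subset[OF smooth_B fr_field[OF that] oV V])
    show "Y l = (\<Sum>j<2 * m + 1. tscale (co l (Y l) j) (fr j l))" if "l \<in> V" for l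
      by (rule co_sum) (use that V Y in \<open>auto simp: cvector_field_def\<close>)
    show "ctv.indep_family (2 * m + 1) (\<lambda>j. fr j l)" using fr_indep l V by blast
  qed (use Y i in auto)
qed

lemma forms_cform: "cform B leafs \<theta>0" "\<alpha> < m \<Longrightarrow> cform B leafs (\<theta> \<alpha>)"
proof -
  have o: "openin (mtop B) leafs" by (rule compat_chart_openin[OF chart_B])
  have "smooth_fun B V (\<lambda>l. co l (Y l) i)" if "V \<subseteq> leafs" "cvector_field B V Y" "i < 2 * m + 1" for V Y i
    unfolding smooth_fun_iff[OF smooth_B] using co_smooth[OF that] that(2) by (auto simp: cvector_field_def)
  then show "cform B leafs \<theta>0" "\<alpha> < m \<Longrightarrow> cform B leafs (\<theta> \<alpha>)"
    unfolding cform_def \<theta>0_def \<theta>_def using o forms_linear unfolding \<theta>0_def[abs_def] \<theta>_def[abs_def] by auto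
qed

subsection \<open>Invariance under the flow\<close>

text \<open>The functions \<open>f j\<close> are the values of \<open>\<omega>\<close> on the
  projected \<open>Z j\<close> along the leaf through \<open>q\<close>. They vanish at time 0
  because the frame \<open>e\<close> was read off on the slice. The \<open>X\<close> part of the
  bracket disappears under projection, so the equation closes up in the \<open>f k\<close>, and its
  coefficients are continuous because bracket coefficients are smooth.\<close>

lemma push_Z_annihilated:
  assumes \<omega>: "\<omega> = \<theta>0 \<or> (\<exists>\<alpha><m. \<omega> = \<theta> \<alpha>)" and q: "q \<in> U" and j: "j < m"
  shows "\<omega> (pr q) (push' q (Z j q)) = 0"
proof -
  define x where "x = snd (\<Psi> q)"
  define \<gamma> where "\<gamma> t = inv_into U \<Psi> (t, x)" for t
  define l where "l = pr q"
  have xS: "x \<in> S" unfolding x_def by (rule snd_in_S[OF q])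
  have \<gamma>U: "\<gamma> t \<in> U" for t unfolding \<gamma>_def by (rule inv_in(1)[OF xS])
  have l: "l \<in> leafs" unfolding l_def by (rule pr_leafs[OF q])
  have prl: "pr (\<gamma> t) = l" for t
    unfolding l_def pr_eq[OF \<gamma>U] pr_eq[OF q] using inv_in(2)[OF xS] by (simp add: \<gamma>_def x_def)
  have \<gamma>q: "\<gamma> (fst (\<Psi> q)) = q" unfolding \<gamma>_def x_def using inv(1)[OF q] by simp
  have \<eta>l: "\<eta> l = x" unfolding l_def x_def by (rule \<eta>_pr[OF q])
  have \<gamma>0: "\<gamma> 0 = slice l" unfolding \<gamma>_def slice_def \<eta>l ..
  have lin: "complex_linear_on (ctangent B l) (\<omega> l)" using \<omega> forms_linear[OF l] by blast
  note \<omega>sum = complex_linear_sum[OF smooth_B topB[OF l] lin]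
  let ?d = "\<lambda>b. chart_tvec B leafs \<eta> l b 0"
  have dct: "?d b \<in> ctangent B l" for b by (rule ctangent_chart(1)[OF smooth_B chart_B l])
  \<comment> \<open>All points \<open>\<gamma> t\<close> lie over the same \<open>l\<close>, so the
    numbers \<open>\<omega> l (?d b)\<close> do not depend on \<open>t\<close> and only the
    components of \<open>W\<close> have to be differentiated.\<close>
  have coordp: "\<omega> l (push' (\<gamma> t) W) = (\<Sum>b\<in>Basis. W (coord \<Psi> (0, b)) * \<omega> l (?d b))" if W: "W \<in> ctangent M (\<gamma> t)" for W t
  proof -
    obtain v w where vw: "W = chart_tvec M U \<Psi> (\<gamma> t) v w" using ctangent_chart(2)[OF M chart \<gamma>U W] by blast
    obtain a v' b w' where v: "v = (a, v')" "w = (b, w')" by (cases v, cases w)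
    have p: "push' (\<gamma> t) W = chart_tvec B leafs \<eta> l v' w'" unfolding vw v push_pr[OF \<gamma>U] prl ..
    have "push' (\<gamma> t) W = (\<Sum>b\<in>Basis. tscale (W (coord \<Psi> (0, b))) (?d b))"
      unfolding p by (subst chart_tvec_expand[OF smooth_B chart_B l ctangent_chart(1)[OF smooth_B chart_B l]])
        (simp add: vw v chart_tvec_coord[OF smooth_B chart_B l] chart_tvec_coord[OF M chart \<gamma>U] inner_prod_def)
    then show ?thesis using \<omega>sum[of Basis ?d "\<lambda>b. W (coord \<Psi> (0, b))"] dct by simp
  qed
  define f where "f j t = \<omega> l (push' (\<gamma> t) (Z j (\<gamma> t)))" for j t
  have oU: "openin (mtop M) U" by (rule compat_chart_openin[OF chart])
  have Xf: "cvector_field M U X" by (rule chart_tvec_field[OF M chart])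
  \<comment> \<open>\<open>X\<close> and the \<open>Z i\<close> as one family, so that
    \<open>field_coefficients_smooth\<close> applies to the expansion of the bracket.\<close>
  define fam where "fam i = (case i of 0 \<Rightarrow> X | Suc i \<Rightarrow> Z i)" for i
  have famsum: "(\<Sum>i<Suc m. tscale (c i) (fam i p)) = tscale (c 0) (X p) + (\<Sum>i<m. tscale (c (Suc i)) (Z i p))" for c p
    unfolding sum.lessThan_Suc_shift by (simp add: fam_def)
  define br where "br j = lie_bracket M X (Z j)" for j
  have "\<exists>c. br j p = (\<Sum>i<Suc m. tscale (c i) (fam i p))" if jp: "j < m" "p \<in> U" for j p
  proof -
    have "br j p \<in> N p" unfolding br_def by (rule bracket[OF jp])
    then obtain a c where ac: "br j p = tscale a (X p) + (\<Sum>i<m. tscale (c i) (Z i p))" unfolding N_span[OF jp(2)] by blast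
    show ?thesis
      by (rule exI[of _ "\<lambda>i. case i of 0 \<Rightarrow> a | Suc i \<Rightarrow> c i"]) (simp only: famsum ac nat.case)
  qed
  then obtain A where A: "\<And>j p. j < m \<Longrightarrow> p \<in> U \<Longrightarrow> br j p = (\<Sum>i<Suc m. tscale (A j p i) (fam i p))" by metis
  have As: "smooth_near M p (\<lambda>p. A j p i)" if jp: "j < m" "p \<in> U" "i < Suc m" for j p i
  proof (rule field_coefficients_smooth[OF M oU jp(2), of "Suc m" fam "br j" "\<lambda>i p. A j p i" i])
    show "cvector_field M U (fam k)" if "k < Suc m" for k using that Xf Z_field by (cases k) (auto simp: fam_def)
    show "cvector_field M U (br j)" unfolding br_def
      by (rule lie_bracket_field[OF M Xf Z_field[OF jp(1)]]) (use N_tangent bracket jp(1) in blast)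
    show "br j p = (\<Sum>k<Suc m. tscale (A j p k) (fam k p))" if "p \<in> U" for p by (rule A[OF jp(1) that])
    show "ctv.indep_family (Suc m) (\<lambda>k. fam k p)" unfolding ctv.indep_family_def famsum
    proof (intro allI impI)
      fix c k assume "tscale (c 0) (X p) + (\<Sum>i<m. tscale (c (Suc i)) (Z i p)) = 0" "k < Suc m"
      then show "c k = 0" using N_indep[OF jp(2), of "c 0" "\<lambda>i. c (Suc i)"] by (cases k) auto
    qed
  qed (use jp in auto)
  have df: "(f j has_vector_derivative (\<Sum>k<m. A j (\<gamma> t) (Suc k) * f k t)) (at t)" if j: "j < m" for j t
  proof -
    have Zs: "smooth_fun M U (\<lambda>p. Z j p (coord \<Psi> (0, b)))" for b
      using Z_field[OF j] coord_smooth[OF M chart] unfolding cvector_field_def by blast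
    have "((\<lambda>t. \<Sum>b\<in>Basis. Z j (\<gamma> t) (coord \<Psi> (0, b)) * \<omega> l (?d b)) has_vector_derivative
      (\<Sum>b\<in>Basis. X (\<gamma> t) (\<lambda>p. Z j p (coord \<Psi> (0, b))) * \<omega> l (?d b))) (at t)"
      unfolding \<gamma>_def
      by (intro has_vector_derivative_sum bounded_linear.has_vector_derivative[OF bounded_linear_mult_left]
          smooth_along_leaf[OF Zs xS])
    \<comment> \<open>The second term of the bracket vanishes on these coordinate functions, since
      \<open>X\<close> has the constant component 0 along \<open>(0, b)\<close>.\<close>
    moreover have "X (\<gamma> t) (\<lambda>p. Z j p (coord \<Psi> (0, b))) = br j (\<gamma> t) (coord \<Psi> (0, b))" for b
    proof -
      have "Z j (\<gamma> t) (\<lambda>p. X p (coord \<Psi> (0, b))) = Z j (\<gamma> t) (\<lambda>p. 0)"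
        by (rule ctangent_local[OF M Z_tangent[OF \<gamma>U j] oU \<gamma>U]) (simp add: chart_tvec_coord[OF M chart] inner_prod_def)
      also have "\<dots> = 0"
      proof -
        obtain v w where vw: "Z j (\<gamma> t) = chart_tvec M U \<Psi> (\<gamma> t) v w"
          using ctangent_chart(2)[OF M chart \<gamma>U Z_tangent[OF \<gamma>U j]] by blast
        have "frechet_derivative ((\<lambda>p. 0 :: complex) \<circ> inv_into U \<Psi>) (at (\<Psi> (\<gamma> t))) = (\<lambda>_. 0)"
          by (rule frechet_derivative_at[symmetric]) (simp add: o_def)
        then show ?thesis unfolding vw chart_tvec_def by simp
      qed
      finally show ?thesis unfolding br_def lie_bracket_def
        using smooth_near_fun[OF coord_smooth[OF M chart] \<gamma>U] by simp
    qed
    moreover have "br j (\<gamma> t) \<in> ctangent M (\<gamma> t)" unfolding br_def by (rule N_tangent[OF \<gamma>U bracket[OF j \<gamma>U]])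
    ultimately have "((\<lambda>t. f j t) has_vector_derivative \<omega> l (push' (\<gamma> t) (br j (\<gamma> t)))) (at t)"
      unfolding f_def coordp[OF Z_tangent[OF \<gamma>U j]] using coordp by simp
    moreover have "\<omega> l (push' (\<gamma> t) (br j (\<gamma> t))) = (\<Sum>k<m. A j (\<gamma> t) (Suc k) * f k t)"
    proof -
      have "push' (\<gamma> t) (br j (\<gamma> t)) = (\<Sum>k<m. tscale (A j (\<gamma> t) (Suc k)) (push' (\<gamma> t) (Z k (\<gamma> t))))"
        unfolding A[OF j \<gamma>U] famsum push_linear push_sum push_X[OF \<gamma>U] by simp
      moreover have "push' (\<gamma> t) (Z k (\<gamma> t)) \<in> ctangent B l" if "k < m" for k
        using push_ctangent(1)[OF \<gamma>U Z_tangent[OF \<gamma>U that]] unfolding prl .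
      ultimately show ?thesis
        using \<omega>sum[of "{..<m}" "\<lambda>k. push' (\<gamma> t) (Z k (\<gamma> t))" "\<lambda>k. A j (\<gamma> t) (Suc k)"] by (simp add: f_def)
    qed
    ultimately show ?thesis by simp
  qed
  have "f j (fst (\<Psi> q)) = 0"
  proof (rule gronwall_zero[where A = "\<lambda>j k t. A j (\<gamma> t) (Suc k)", OF df _ _ j])
    show "continuous_on UNIV (\<lambda>t. A j (\<gamma> t) (Suc k))" if "j < m" "k < m" for j k
      unfolding \<gamma>_def by (rule continuous_along_leaf[OF As xS]) (use that in auto)
    show "f j 0 = 0" if j: "j < m" for j
    proof -
      have "(\<Sum>\<alpha><m. tscale (if \<alpha> = j then 1 else 0) (e \<alpha> l)) = (\<Sum>\<alpha><m. if \<alpha> = j then e \<alpha> l else 0)"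
        by (rule sum.cong) auto
      then have "e j l = tscale 0 (\<xi> l) + ((\<Sum>\<alpha><m. tscale 0 (tconj (e \<alpha> l))) + (\<Sum>\<alpha><m. tscale (if \<alpha> = j then 1 else 0) (e \<alpha> l)))"
        using j by simp
      from expansion_unique[OF l this] have "\<omega> l (e j l) = 0" using \<omega> by auto
      then show ?thesis by (simp add: f_def \<gamma>0 e_def)
    qed
  qed auto
  then show ?thesis unfolding f_def \<gamma>q l_def .
qed

lemma form_rules:
  assumes l: "l \<in> leafs" and \<zeta>: "\<zeta> \<in> ctangent B l"
  shows "\<zeta>' \<in> ctangent B l \<Longrightarrow> \<theta>0 l (\<zeta> + \<zeta>') = \<theta>0 l \<zeta> + \<theta>0 l \<zeta>'" "\<theta>0 l (tscale c \<zeta>) = c * \<theta>0 l \<zeta>"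
    "\<zeta>' \<in> ctangent B l \<Longrightarrow> \<alpha> < m \<Longrightarrow> \<theta> \<alpha> l (\<zeta> + \<zeta>') = \<theta> \<alpha> l \<zeta> + \<theta> \<alpha> l \<zeta>'" "\<alpha> < m \<Longrightarrow> \<theta> \<alpha> l (tscale c \<zeta>) = c * \<theta> \<alpha> l \<zeta>"
    "\<zeta>' \<in> ctangent B l \<Longrightarrow> \<alpha> < m \<Longrightarrow> \<theta>c \<alpha> l (\<zeta> + \<zeta>') = \<theta>c \<alpha> l \<zeta> + \<theta>c \<alpha> l \<zeta>'" "\<alpha> < m \<Longrightarrow> \<theta>c \<alpha> l (tscale c \<zeta>) = c * \<theta>c \<alpha> l \<zeta>"
    "\<theta>0 l (tconj \<zeta>) = cnj (\<theta>0 l \<zeta>)" "\<theta> \<alpha> l (tconj \<zeta>) = cnj (\<theta>c \<alpha> l \<zeta>)" "\<theta>c \<alpha> l (tconj \<zeta>) = cnj (\<theta> \<alpha> l \<zeta>)"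
proof -
  show "\<zeta>' \<in> ctangent B l \<Longrightarrow> \<theta>0 l (\<zeta> + \<zeta>') = \<theta>0 l \<zeta> + \<theta>0 l \<zeta>'" "\<theta>0 l (tscale c \<zeta>) = c * \<theta>0 l \<zeta>"
    "\<zeta>' \<in> ctangent B l \<Longrightarrow> \<alpha> < m \<Longrightarrow> \<theta> \<alpha> l (\<zeta> + \<zeta>') = \<theta> \<alpha> l \<zeta> + \<theta> \<alpha> l \<zeta>'" "\<alpha> < m \<Longrightarrow> \<theta> \<alpha> l (tscale c \<zeta>) = c * \<theta> \<alpha> l \<zeta>"
    "\<zeta>' \<in> ctangent B l \<Longrightarrow> \<alpha> < m \<Longrightarrow> \<theta>c \<alpha> l (\<zeta> + \<zeta>') = \<theta>c \<alpha> l \<zeta> + \<theta>c \<alpha> l \<zeta>'" "\<alpha> < m \<Longrightarrow> \<theta>c \<alpha> l (tscale c \<zeta>) = c * \<theta>c \<alpha> l \<zeta>"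
    using forms_linear[OF l] \<zeta> unfolding complex_linear_on_def by blast+
  show "\<theta> \<alpha> l (tconj \<zeta>) = cnj (\<theta>c \<alpha> l \<zeta>)" "\<theta>c \<alpha> l (tconj \<zeta>) = cnj (\<theta> \<alpha> l \<zeta>)"
    by (simp_all add: conj_form_def tconj_simps(3))
  have "tconj \<zeta> = tscale (cnj (\<theta>0 l \<zeta>)) (\<xi> l) + ((\<Sum>\<alpha><m. tscale (cnj (\<theta>c \<alpha> l \<zeta>)) (tconj (e \<alpha> l))) + (\<Sum>\<alpha><m. tscale (cnj (\<theta> \<alpha> l \<zeta>)) (e \<alpha> l)))"
    by (subst expansion[OF l \<zeta>], unfold tconj_simps(1,2) tconj_sum tconj_simps(3) \<xi>_tangent(2)[OF l])
      (simp only: add.commute[of "\<Sum>\<alpha><m. tscale (cnj (\<theta> \<alpha> l \<zeta>)) (e \<alpha> l)"])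
  from expansion_unique(1)[OF l this] show "\<theta>0 l (tconj \<zeta>) = cnj (\<theta>0 l \<zeta>)" .
qed

lemma eq_by_forms:
  assumes l: "l \<in> leafs" and "\<zeta> \<in> ctangent B l" "\<zeta>' \<in> ctangent B l" "\<theta>0 l \<zeta> = \<theta>0 l \<zeta>'"
    "\<And>\<alpha>. \<alpha> < m \<Longrightarrow> \<theta> \<alpha> l \<zeta> = \<theta> \<alpha> l \<zeta>'" "\<And>\<alpha>. \<alpha> < m \<Longrightarrow> \<theta>c \<alpha> l \<zeta> = \<theta>c \<alpha> l \<zeta>'"
  shows "\<zeta> = \<zeta>'"
  by (subst expansion[OF l assms(2)], subst expansion[OF l assms(3)])
    (intro arg_cong2[of _ _ _ _ "(+)"] sum.cong refl; simp add: assms)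

lemma combo_tangent:
  assumes l: "l \<in> leafs"
  shows "(\<Sum>\<alpha><m. tscale (c \<alpha>) (tconj (e \<alpha> l))) + (\<Sum>\<alpha><m. tscale (d \<alpha>) (e \<alpha> l)) \<in> ctangent B l"
  by (intro ctangent_closed(2)[OF smooth_B] ctangent_sum[OF smooth_B topB[OF l]] ctangent_closed(3,4)[OF smooth_B] e_tangent l) auto

lemma combo_forms:
  assumes l: "l \<in> leafs"
  shows "\<theta>0 l ((\<Sum>\<alpha><m. tscale (c \<alpha>) (tconj (e \<alpha> l))) + (\<Sum>\<alpha><m. tscale (d \<alpha>) (e \<alpha> l))) = 0"
    "\<alpha> < m \<Longrightarrow> \<theta> \<alpha> l ((\<Sum>\<alpha><m. tscale (c \<alpha>) (tconj (e \<alpha> l))) + (\<Sum>\<alpha><m. tscale (d \<alpha>) (e \<alpha> l))) = c \<alpha>"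
    "\<alpha> < m \<Longrightarrow> \<theta>c \<alpha> l ((\<Sum>\<alpha><m. tscale (c \<alpha>) (tconj (e \<alpha> l))) + (\<Sum>\<alpha><m. tscale (d \<alpha>) (e \<alpha> l))) = d \<alpha>"
proof -
  have "(\<Sum>\<alpha><m. tscale (c \<alpha>) (tconj (e \<alpha> l))) + (\<Sum>\<alpha><m. tscale (d \<alpha>) (e \<alpha> l)) =
    tscale 0 (\<xi> l) + ((\<Sum>\<alpha><m. tscale (c \<alpha>) (tconj (e \<alpha> l))) + (\<Sum>\<alpha><m. tscale (d \<alpha>) (e \<alpha> l)))"
    by (simp only: ctv.scale_zero_left add_0)
  note u = expansion_unique[OF l this]
  show "\<theta>0 l ((\<Sum>\<alpha><m. tscale (c \<alpha>) (tconj (e \<alpha> l))) + (\<Sum>\<alpha><m. tscale (d \<alpha>) (e \<alpha> l))) = 0" by (rule u)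
  show "\<alpha> < m \<Longrightarrow> \<theta> \<alpha> l ((\<Sum>\<alpha><m. tscale (c \<alpha>) (tconj (e \<alpha> l))) + (\<Sum>\<alpha><m. tscale (d \<alpha>) (e \<alpha> l))) = c \<alpha>" by (rule u)
  show "\<alpha> < m \<Longrightarrow> \<theta>c \<alpha> l ((\<Sum>\<alpha><m. tscale (c \<alpha>) (tconj (e \<alpha> l))) + (\<Sum>\<alpha><m. tscale (d \<alpha>) (e \<alpha> l))) = d \<alpha>" by (rule u)
qed

lemma e_forms:
  assumes l: "l \<in> leafs" and \<beta>: "\<beta> < m"
  shows "\<theta>0 l (e \<beta> l) = 0" "\<alpha> < m \<Longrightarrow> \<theta> \<alpha> l (e \<beta> l) = 0" "\<alpha> < m \<Longrightarrow> \<theta>c \<alpha> l (e \<beta> l) = (if \<alpha> = \<beta> then 1 else 0)"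
proof -
  have "(\<Sum>\<alpha><m. tscale (if \<alpha> = \<beta> then 1 else 0) (e \<alpha> l)) = (\<Sum>\<alpha><m. if \<alpha> = \<beta> then e \<alpha> l else 0)"
    by (rule sum.cong) auto
  then have s: "(\<Sum>\<alpha><m. tscale 0 (tconj (e \<alpha> l))) + (\<Sum>\<alpha><m. tscale (if \<alpha> = \<beta> then 1 else 0) (e \<alpha> l)) = e \<beta> l"
    using \<beta> by simp
  note u = combo_forms[OF l, where c = "\<lambda>_. 0" and d = "\<lambda>\<alpha>. if \<alpha> = \<beta> then 1 else 0", unfolded s]
  show "\<theta>0 l (e \<beta> l) = 0" by (rule u)
  show "\<alpha> < m \<Longrightarrow> \<theta> \<alpha> l (e \<beta> l) = 0" by (rule u)
  show "\<alpha> < m \<Longrightarrow> \<theta>c \<alpha> l (e \<beta> l) = (if \<alpha> = \<beta> then 1 else 0)" by (rule u)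
qed

text \<open>Invariance gives one inclusion. The other is a count: the \<open>m\<close> projected
  vectors are independent by \<open>frame_indep\<close> and lie in the span of the \<open>m\<close>
  vectors \<open>e \<beta>\<close>.\<close>

lemma push_N:
  assumes q: "q \<in> U"
  shows "push' q ` N q = {\<zeta> \<in> ctangent B (pr q). \<theta>0 (pr q) \<zeta> = 0 \<and> (\<forall>\<alpha><m. \<theta> \<alpha> (pr q) \<zeta> = 0)}"
proof (intro equalityI subsetI)
  note l = pr_leafs[OF q]
  have ct: "push' q (Z j q) \<in> ctangent B (pr q)" if "j < m" for j by (rule push_ctangent(1)[OF q Z_tangent[OF q that]])
  have pN: "push' q (tscale a (X q) + (\<Sum>i<m. tscale (c i) (Z i q))) = (\<Sum>i<m. tscale (c i) (push' q (Z i q)))" for a c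
    unfolding push_linear push_sum push_X[OF q] by simp
  {
    fix \<zeta> assume "\<zeta> \<in> push' q ` N q"
    then obtain c where \<zeta>: "\<zeta> = (\<Sum>i<m. tscale (c i) (push' q (Z i q)))" unfolding N_span[OF q] using pN by auto
    have "\<omega> (pr q) \<zeta> = 0" if \<omega>: "\<omega> = \<theta>0 \<or> (\<exists>\<alpha><m. \<omega> = \<theta> \<alpha>)" for \<omega>
    proof -
      have "complex_linear_on (ctangent B (pr q)) (\<omega> (pr q))" using \<omega> forms_linear[OF l] by blast
      from complex_linear_sum[OF smooth_B topB[OF l] this, of "{..<m}"] show ?thesis
        unfolding \<zeta> using ct push_Z_annihilated[OF \<omega> q] by simp
    qed
    moreover have "\<zeta> \<in> ctangent B (pr q)" unfolding \<zeta>
      by (intro ctangent_sum[OF smooth_B topB[OF l]] ctangent_closed(3)[OF smooth_B] ct) auto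
    ultimately show "\<zeta> \<in> {\<zeta> \<in> ctangent B (pr q). \<theta>0 (pr q) \<zeta> = 0 \<and> (\<forall>\<alpha><m. \<theta> \<alpha> (pr q) \<zeta> = 0)}" by blast
  next
    let ?Y = "(\<lambda>\<beta>. e \<beta> (pr q)) ` {..<m}"
    have sp: "\<zeta> \<in> ctv.span ?Y" if "\<zeta> \<in> ctangent B (pr q)" "\<theta>0 (pr q) \<zeta> = 0" "\<And>\<alpha>. \<alpha> < m \<Longrightarrow> \<theta> \<alpha> (pr q) \<zeta> = 0" for \<zeta>
    proof -
      have "(\<Sum>\<alpha><m. tscale (\<theta> \<alpha> (pr q) \<zeta>) (tconj (e \<alpha> (pr q)))) = 0" using that(3) by (intro sum.neutral) simp
      then have "\<zeta> = (\<Sum>\<alpha><m. tscale (\<theta>c \<alpha> (pr q) \<zeta>) (e \<alpha> (pr q)))"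
        using expansion[OF l that(1)] unfolding that(2) by (simp only: ctv.scale_zero_left add_0)
      then show ?thesis by (metis (no_types, lifting) ctv.span_sum ctv.span_scale ctv.span_base imageI)
    qed
    fix \<zeta> assume "\<zeta> \<in> {\<zeta> \<in> ctangent B (pr q). \<theta>0 (pr q) \<zeta> = 0 \<and> (\<forall>\<alpha><m. \<theta> \<alpha> (pr q) \<zeta> = 0)}"
    then have \<zeta>: "\<zeta> \<in> ctv.span ?Y" using sp by blast
    have "ctv.indep_family m (\<lambda>j. push' q (Z j q))" unfolding ctv.indep_family_def
    proof (intro allI impI)
      fix c j assume s: "(\<Sum>i<m. tscale (c i) (push' q (Z i q))) = 0" and j: "j < m"
      have "tscale 0 (L q) + ((\<Sum>\<alpha><m. tscale 0 (tconj (Z \<alpha> q))) + (\<Sum>\<alpha><m. tscale (c \<alpha>) (Z \<alpha> q))) =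
          tscale 0 (X q) + (\<Sum>\<alpha><m. tscale (c \<alpha>) (Z \<alpha> q))"
        by (simp only: ctv.scale_zero_left add_0 sum.neutral_const)
      then have "push' q (tscale 0 (L q) + ((\<Sum>\<alpha><m. tscale 0 (tconj (Z \<alpha> q))) + (\<Sum>\<alpha><m. tscale (c \<alpha>) (Z \<alpha> q)))) = 0"
        unfolding pN[of 0 c, symmetric] using s pN[of 0 c] by metis
      from frame_indep(3)[OF q this j] show "c j = 0" .
    qed
    then obtain c where "\<zeta> = (\<Sum>j<m. tscale (c j) (push' q (Z j q)))"
    proof (rule exE[OF ctv.indep_family_spans])
      show "card ?Y \<le> m" using card_image_le[of "{..<m}" "\<lambda>\<beta>. e \<beta> (pr q)"] by simp
      show "push' q (Z i q) \<in> ctv.span ?Y" if i: "i < m" for i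
        by (rule sp[OF ct[OF i]]) (use push_Z_annihilated[OF _ q i] in blast)+
    qed (use \<zeta> in auto)
    then have "\<zeta> = push' q (tscale 0 (X q) + (\<Sum>i<m. tscale (c i) (Z i q)))" using pN[of 0 c] by metis
    then show "\<zeta> \<in> push' q ` N q" using N_mem(3)[OF q] by blast
  }
qed

lemma N_add_X: "q \<in> U \<Longrightarrow> W \<in> N q \<Longrightarrow> tscale a (X q) + W \<in> N q"
proof -
  assume q: "q \<in> U" and "W \<in> N q"
  then obtain b c where W: "W = tscale b (X q) + (\<Sum>i<m. tscale (c i) (Z i q))" unfolding N_span[OF q] by blast
  have "tscale a (X q) + W = tscale (a + b) (X q) + (\<Sum>i<m. tscale (c i) (Z i q))"
    unfolding W ctv.scale_left_distrib by (simp only: add.assoc)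
  then show ?thesis using N_mem(3)[OF q] by metis
qed

text \<open>\<open>Y\<close> and the lift of its projection have the same projection, so they differ
  by a multiple of \<open>X\<close>.\<close>

lemma decomposition:
  assumes q: "q \<in> U" and Y: "Y \<in> ctangent M q"
  obtains a where "Y = tscale a (X q) + lift q (push' q Y)"
proof -
  have "push' q (Y - lift q (push' q Y)) = 0"
  proof -
    have "Y - lift q (push' q Y) = Y + tscale (-1) (lift q (push' q Y))" by simp
    then show ?thesis by (simp only: push_linear push_lift[OF q push_ctangent(1)[OF q Y]]) simp
  qed
  then obtain a where "Y - lift q (push' q Y) = tscale a (X q)"
    using push_ctangent(3)[OF q ctangent_diff(2)[OF M Y lift_ctangent[OF q]]] by blast
  then show ?thesis using that[of a] by (simp only: diff_eq_eq)
qed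

text \<open>A replacement for the fields \<open>Z\<close>: these vectors project to the fixed frame
  \<open>e\<close> along the whole leaf, so the components of a vector with respect to them are
  values of pulled-back forms.\<close>

definition E :: "'a \<Rightarrow> nat \<Rightarrow> 'a tvec" where "E q \<alpha> = lift q (e \<alpha> (pr q))"

lemma E_tangent: "q \<in> U \<Longrightarrow> E q \<alpha> \<in> ctangent M q" unfolding E_def by (rule lift_ctangent)

text \<open>By \<open>push_N\<close> the vector \<open>e \<alpha>\<close> is the projection of an
  element of \<open>N\<close>, and the lift differs from that element by a multiple of
  \<open>X\<close>, which lies in \<open>N\<close>.\<close>

lemma E_N: assumes q: "q \<in> U" and \<alpha>: "\<alpha> < m" shows "E q \<alpha> \<in> N q"
proof -
  note l = pr_leafs[OF q]
  have "e \<alpha> (pr q) \<in> push' q ` N q" unfolding push_N[OF q] using e_tangent[OF \<alpha> l] e_forms[OF l \<alpha>] by simp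
  then obtain W where W: "W \<in> N q" "e \<alpha> (pr q) = push' q W" by blast
  obtain a where "W = tscale a (X q) + lift q (push' q W)" using decomposition[OF q N_tangent[OF q W(1)]] .
  then have "E q \<alpha> = tscale (- a) (X q) + W" unfolding E_def W(2)
    by (metis add.commute add_diff_cancel_left' ctv.scale_minus_left diff_conv_add_uminus)
  then show ?thesis using N_add_X[OF q W(1), of "- a"] by (simp only:)
qed

lemma lift_expansion:
  assumes q: "q \<in> U" and \<zeta>: "\<zeta> \<in> ctangent B (pr q)"
  shows "lift q \<zeta> = tscale (\<theta>0 (pr q) \<zeta>) (L q) + ((\<Sum>\<alpha><m. tscale (\<theta> \<alpha> (pr q) \<zeta>) (tconj (E q \<alpha>))) + (\<Sum>\<alpha><m. tscale (\<theta>c \<alpha> (pr q) \<zeta>) (E q \<alpha>)))"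
proof -
  have "lift q (\<xi> (pr q)) = L q" unfolding \<xi>_def by (rule lift_chart[OF q])
  then show ?thesis
    by (subst expansion[OF pr_leafs[OF q] \<zeta>]) (simp only: lift_linear lift_sum lift_conj[OF q] E_def)
qed

lemma G_E:
  assumes q: "q \<in> U" and \<alpha>: "\<alpha> < m" shows "G q (X q) (E q \<alpha>) = 0" "G q (X q) (tconj (E q \<alpha>)) = 0"
proof -
  show *: "G q (X q) (E q \<alpha>) = 0" by (rule null[OF q N_mem(1)[OF q] E_N[OF q \<alpha>]])
  have "G q (tconj (X q)) (tconj (E q \<alpha>)) = 0"
    unfolding complexify_conj[OF M g topU[OF q] X_tangent(1)[OF q] E_tangent[OF q]] * by simp
  then show "G q (X q) (tconj (E q \<alpha>)) = 0" unfolding X_tangent(2)[OF q] .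
qed

text \<open>\<open>X\<close> is orthogonal to itself, to the \<open>E q \<alpha>\<close> by nullity
  of \<open>N\<close>, and to their conjugates because \<open>X\<close> and \<open>g\<close> are
  real; only the component along \<open>L\<close> survives.\<close>

lemma G_X_theta:
  assumes q: "q \<in> U" and Y: "Y \<in> ctangent M q"
  shows "G q (X q) Y = \<theta>0 (pr q) (push' q Y) * G q (X q) (L q)"
proof -
  note qt = topU[OF q] and cl = ctangent_closed[OF M] and x = X_tangent(1)[OF q]
  let ?\<zeta> = "push' q Y"
  let ?c = "\<Sum>\<alpha><m. tscale (\<theta> \<alpha> (pr q) ?\<zeta>) (tconj (E q \<alpha>))" and ?d = "\<Sum>\<alpha><m. tscale (\<theta>c \<alpha> (pr q) ?\<zeta>) (E q \<alpha>)"
  obtain a where a: "Y = tscale a (X q) + lift q ?\<zeta>" using decomposition[OF q Y] .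
  have ct: "?c \<in> ctangent M q" "?d \<in> ctangent M q" "tscale (\<theta>0 (pr q) ?\<zeta>) (L q) \<in> ctangent M q" "tscale a (X q) \<in> ctangent M q"
    by (auto intro!: ctangent_sum[OF M qt] cl(3,4) E_tangent q L_tangent X_tangent)
  have "G q (X q) ?c = 0" "G q (X q) ?d = 0"
    using complexify_sum2[OF M g qt x, of "{..<m}" "\<lambda>\<alpha>. tconj (E q \<alpha>)" "\<lambda>\<alpha>. \<theta> \<alpha> (pr q) ?\<zeta>"]
      complexify_sum2[OF M g qt x, of "{..<m}" "\<lambda>\<alpha>. E q \<alpha>" "\<lambda>\<alpha>. \<theta>c \<alpha> (pr q) ?\<zeta>"]
    by (simp_all add: cl(4) E_tangent q G_E)
  moreover have "G q (X q) Y = G q (X q) (tscale a (X q)) + (G q (X q) (tscale (\<theta>0 (pr q) ?\<zeta>) (L q)) + (G q (X q) ?c + G q (X q) ?d))"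
    by (subst a, subst lift_expansion[OF q push_ctangent(1)[OF q Y]])
      (simp only: complexify_add2[OF M g qt _ _ x] ct cl(2))
  ultimately show ?thesis
    using complexify_scale2[OF M g qt x x, of a] complexify_scale2[OF M g qt L_tangent(1)[OF q] x, of "\<theta>0 (pr q) ?\<zeta>"] G_X(1)[OF q] by simp
qed

subsection \<open>The almost CR structure of the leaf space\<close>

definition H :: "'a set \<Rightarrow> 'a set tvec set" where "H l = {\<zeta> \<in> rtangent B l. \<theta>0 l \<zeta> = 0}"
text \<open>Multiplication by \<open>\<i>\<close> on the vectors \<open>tconj (e \<alpha>)\<close>
  of type (1,0) and by \<open>-\<i>\<close> on the \<open>e \<alpha>\<close>. It is given on all
  complexified vectors, with value 0 on \<open>\<xi>\<close>, so that it is complex linear before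
  any restriction to \<open>H\<close>.\<close>

definition J :: "'a set \<Rightarrow> 'a set tvec \<Rightarrow> 'a set tvec" where
  "J l \<zeta> = (\<Sum>\<alpha><m. tscale (\<i> * \<theta> \<alpha> l \<zeta>) (tconj (e \<alpha> l))) + (\<Sum>\<alpha><m. tscale (- \<i> * \<theta>c \<alpha> l \<zeta>) (e \<alpha> l))"

lemma J_forms:
  assumes l: "l \<in> leafs"
  shows "J l \<zeta> \<in> ctangent B l" "\<theta>0 l (J l \<zeta>) = 0" "\<alpha> < m \<Longrightarrow> \<theta> \<alpha> l (J l \<zeta>) = \<i> * \<theta> \<alpha> l \<zeta>"
    "\<alpha> < m \<Longrightarrow> \<theta>c \<alpha> l (J l \<zeta>) = - \<i> * \<theta>c \<alpha> l \<zeta>"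
  unfolding J_def by (rule combo_tangent[OF l] combo_forms[OF l]; assumption?)+

lemma J_linear:
  assumes l: "l \<in> leafs" and \<zeta>: "\<zeta> \<in> ctangent B l"
  shows "\<zeta>' \<in> ctangent B l \<Longrightarrow> J l (\<zeta> + \<zeta>') = J l \<zeta> + J l \<zeta>'" "J l (tscale c \<zeta>) = tscale c (J l \<zeta>)"
    "J l (tconj \<zeta>) = tconj (J l \<zeta>)" "\<theta>0 l \<zeta> = 0 \<Longrightarrow> J l (J l \<zeta>) = - \<zeta>"
proof -
  note cl = ctangent_closed[OF smooth_B] and f = form_rules[OF l] and j = J_forms[OF l]
  show "J l (\<zeta> + \<zeta>') = J l \<zeta> + J l \<zeta>'" if \<zeta>': "\<zeta>' \<in> ctangent B l"
    by (rule eq_by_forms[OF l]) (simp_all add: j f cl \<zeta> \<zeta>' algebra_simps)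
  show "J l (tscale c \<zeta>) = tscale c (J l \<zeta>)"
    by (rule eq_by_forms[OF l]) (simp_all add: j f cl \<zeta>)
  show "J l (tconj \<zeta>) = tconj (J l \<zeta>)"
    by (rule eq_by_forms[OF l]) (simp_all add: j f cl \<zeta>)
  show "J l (J l \<zeta>) = - \<zeta>" if 0: "\<theta>0 l \<zeta> = 0"
  proof -
    note minus = f(2)[OF \<zeta>, where c = "-1", folded ctv_minus] f(4)[OF \<zeta>, where c = "-1", folded ctv_minus]
      f(6)[OF \<zeta>, where c = "-1", folded ctv_minus]
    have "- \<zeta> \<in> ctangent B l" unfolding ctv_minus by (rule cl(3)[OF \<zeta>])
    then show ?thesis by (intro eq_by_forms[OF l]) (simp_all add: j minus 0)
  qed
qed

lemma H_tangent: "\<zeta> \<in> H l \<Longrightarrow> \<zeta> \<in> ctangent B l" "\<zeta> \<in> H l \<Longrightarrow> tconj \<zeta> = \<zeta>" "\<zeta> \<in> H l \<Longrightarrow> \<theta>0 l \<zeta> = 0"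
  by (auto simp: H_def rtangent_def)

text \<open>\<open>\<theta>0\<close> is real, so it also annihilates the real and imaginary parts of
  a vector that it annihilates.\<close>

lemma H_cspan:
  assumes l: "l \<in> leafs" shows "ctv.span (H l) = {\<zeta> \<in> ctangent B l. \<theta>0 l \<zeta> = 0}"
proof (intro equalityI subsetI)
  note cl = ctangent_closed[OF smooth_B] and f = form_rules[OF l]
  have "ctv.subspace {\<zeta> \<in> ctangent B l. \<theta>0 l \<zeta> = 0}"
  proof (rule ctv.subspaceI)
    show "0 \<in> {\<zeta> \<in> ctangent B l. \<theta>0 l \<zeta> = 0}"
      using cl(1)[OF topB[OF l]] f(2)[OF cl(1)[OF topB[OF l]], of 0] by simp
  qed (auto simp: f cl)
  moreover have "H l \<subseteq> {\<zeta> \<in> ctangent B l. \<theta>0 l \<zeta> = 0}" using H_tangent by blast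
  ultimately have "ctv.span (H l) \<subseteq> {\<zeta> \<in> ctangent B l. \<theta>0 l \<zeta> = 0}" by (intro ctv.span_minimal)
  then show "\<zeta> \<in> {\<zeta> \<in> ctangent B l. \<theta>0 l \<zeta> = 0}" if "\<zeta> \<in> ctv.span (H l)" for \<zeta> using that by blast
  fix \<zeta> assume "\<zeta> \<in> {\<zeta> \<in> ctangent B l. \<theta>0 l \<zeta> = 0}"
  then have \<zeta>: "\<zeta> \<in> ctangent B l" "\<theta>0 l \<zeta> = 0" by auto
  have "\<theta>0 l (tscale c (\<zeta> + tscale d (tconj \<zeta>))) = 0" for c d using \<zeta> by (simp add: f cl)
  from this[of "1/2" 1] this[of "1 / (2 * \<i>)" "-1"] have "tRe \<zeta> \<in> H l" "tIm \<zeta> \<in> H l"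
    using rtangent_tRe[OF smooth_B \<zeta>(1)] by (auto simp: H_def tRe_def tIm_def)
  then have "tRe \<zeta> + tscale \<i> (tIm \<zeta>) \<in> ctv.span (H l)" by (intro ctv.span_add ctv.span_scale ctv.span_base)
  then show "\<zeta> \<in> ctv.span (H l)" using tRe_tIm(1)[of \<zeta>] by simp
qed

text \<open>The complex-linear extension used in \<open>J_eigen\<close> coincides with
  \<open>J\<close> itself. In the dual coframe the eigenvalue equation for \<open>k\<close> reads
  \<open>(\<i> - k) * \<theta> = 0\<close> and \<open>(\<i> + k) * \<theta>c = 0\<close>, so for
  \<open>k\<close> equal to \<open>\<i>\<close> or \<open>-\<i>\<close> one family of components is
  free and the other vanishes.\<close>

lemma eigen:
  assumes l: "l \<in> leafs"
  shows "H01 H J l = {\<zeta> \<in> ctangent B l. \<theta>0 l \<zeta> = 0 \<and> (\<forall>\<alpha><m. \<theta> \<alpha> l \<zeta> = 0)}"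
    "H10 H J l = {\<zeta> \<in> ctangent B l. \<theta>0 l \<zeta> = 0 \<and> (\<forall>\<alpha><m. \<theta>c \<alpha> l \<zeta> = 0)}"
proof -
  note cl = ctangent_closed[OF smooth_B] and f = form_rules[OF l] and j = J_forms[OF l]
  have Jr: "J l (tRe \<zeta>) + tscale \<i> (J l (tIm \<zeta>)) = J l \<zeta>" if \<zeta>: "\<zeta> \<in> ctangent B l" for \<zeta>
  proof -
    have ct: "tRe \<zeta> \<in> ctangent B l" "tIm \<zeta> \<in> ctangent B l" using rtangent_tRe[OF smooth_B \<zeta>] by (auto simp: rtangent_def)
    have "J l \<zeta> = J l (tRe \<zeta> + tscale \<i> (tIm \<zeta>))" using tRe_tIm(1)[of \<zeta>] by simp
    then show ?thesis using J_linear(1)[OF l ct(1) cl(3)[OF ct(2)], of \<i>] J_linear(2)[OF l ct(2), of \<i>] by simp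
  qed
  have *: "J l \<zeta> = tscale k \<zeta> \<longleftrightarrow> (\<forall>\<alpha><m. (\<i> - k) * \<theta> \<alpha> l \<zeta> = 0) \<and> (\<forall>\<alpha><m. (\<i> + k) * \<theta>c \<alpha> l \<zeta> = 0)"
    if \<zeta>: "\<zeta> \<in> ctangent B l" "\<theta>0 l \<zeta> = 0" for \<zeta> k
  proof
    assume a: "J l \<zeta> = tscale k \<zeta>"
    have "(\<i> - k) * \<theta> \<alpha> l \<zeta> = 0" "(\<i> + k) * \<theta>c \<alpha> l \<zeta> = 0" if \<alpha>: "\<alpha> < m" for \<alpha>
      using j(3)[OF \<alpha>, of \<zeta>] j(4)[OF \<alpha>, of \<zeta>] unfolding a f(4)[OF \<zeta>(1) \<alpha>] f(6)[OF \<zeta>(1) \<alpha>]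
      by (simp_all only: left_diff_distrib distrib_right) simp_all
    then show "(\<forall>\<alpha><m. (\<i> - k) * \<theta> \<alpha> l \<zeta> = 0) \<and> (\<forall>\<alpha><m. (\<i> + k) * \<theta>c \<alpha> l \<zeta> = 0)" by blast
  next
    assume a: "(\<forall>\<alpha><m. (\<i> - k) * \<theta> \<alpha> l \<zeta> = 0) \<and> (\<forall>\<alpha><m. (\<i> + k) * \<theta>c \<alpha> l \<zeta> = 0)"
    show "J l \<zeta> = tscale k \<zeta>"
    proof (rule eq_by_forms[OF l])
      show "\<theta> \<alpha> l (J l \<zeta>) = \<theta> \<alpha> l (tscale k \<zeta>)" if "\<alpha> < m" for \<alpha>
        using a that by (simp add: j f \<zeta> left_diff_distrib)
      show "\<theta>c \<alpha> l (J l \<zeta>) = \<theta>c \<alpha> l (tscale k \<zeta>)" if "\<alpha> < m" for \<alpha>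
      proof -
        have "\<i> * \<theta>c \<alpha> l \<zeta> + k * \<theta>c \<alpha> l \<zeta> = 0" using a that by (simp add: distrib_right)
        then have "k * \<theta>c \<alpha> l \<zeta> = - (\<i> * \<theta>c \<alpha> l \<zeta>)" by (simp add: eq_neg_iff_add_eq_0 add.commute)
        then show ?thesis using that by (simp add: j f \<zeta>)
      qed
    qed (simp_all add: j f cl \<zeta>)
  qed
  have mem: "\<zeta> \<in> J_eigen H J k l \<longleftrightarrow> \<zeta> \<in> ctangent B l \<and> \<theta>0 l \<zeta> = 0 \<and> (\<forall>\<alpha><m. (\<i> - k) * \<theta> \<alpha> l \<zeta> = 0) \<and> (\<forall>\<alpha><m. (\<i> + k) * \<theta>c \<alpha> l \<zeta> = 0)" for \<zeta> k
    unfolding J_eigen_def H_cspan[OF l] using Jr * by auto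
  show "H01 H J l = {\<zeta> \<in> ctangent B l. \<theta>0 l \<zeta> = 0 \<and> (\<forall>\<alpha><m. \<theta> \<alpha> l \<zeta> = 0)}"
    "H10 H J l = {\<zeta> \<in> ctangent B l. \<theta>0 l \<zeta> = 0 \<and> (\<forall>\<alpha><m. \<theta>c \<alpha> l \<zeta> = 0)}"
    by (auto simp: mem)
qed

text \<open>The statement for the conjugate of \<open>N\<close> follows from that for
  \<open>N\<close>, as projection commutes with conjugation. For the orthogonal complement of
  \<open>K\<close>, \<open>G_X_theta\<close> turns orthogonality to \<open>X\<close> into vanishing
  of \<open>\<theta>0\<close> on the projection, and vectors of \<open>H\<close> are reached by
  their lifts, which are real.\<close>

lemma descends: "descends_to M g N K U B pr H J"
  unfolding descends_to_def
proof (intro ballI conjI)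
  fix q assume q: "q \<in> U"
  note l = pr_leafs[OF q] and qt = topU[OF q]
  show N: "push' q ` N q = H01 H J (pr q)" unfolding push_N[OF q] eigen(1)[OF l] ..
  have "push' q ` tconj ` N q = tconj ` push' q ` N q"
    unfolding image_image using push_ctangent(2)[OF q N_tangent[OF q]] by (intro image_cong) auto
  also have "\<dots> = H10 H J (pr q)"
    unfolding push_N[OF q] eigen(2)[OF l]
  proof (intro equalityI subsetI)
    fix \<zeta> assume "\<zeta> \<in> tconj ` {\<zeta> \<in> ctangent B (pr q). \<theta>0 (pr q) \<zeta> = 0 \<and> (\<forall>\<alpha><m. \<theta> \<alpha> (pr q) \<zeta> = 0)}"
    then show "\<zeta> \<in> {\<zeta> \<in> ctangent B (pr q). \<theta>0 (pr q) \<zeta> = 0 \<and> (\<forall>\<alpha><m. \<theta>c \<alpha> (pr q) \<zeta> = 0)}"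
      by (auto simp: form_rules[OF l] ctangent_closed[OF smooth_B])
  next
    fix \<zeta> assume "\<zeta> \<in> {\<zeta> \<in> ctangent B (pr q). \<theta>0 (pr q) \<zeta> = 0 \<and> (\<forall>\<alpha><m. \<theta>c \<alpha> (pr q) \<zeta> = 0)}"
    then have "tconj \<zeta> \<in> {\<zeta> \<in> ctangent B (pr q). \<theta>0 (pr q) \<zeta> = 0 \<and> (\<forall>\<alpha><m. \<theta> \<alpha> (pr q) \<zeta> = 0)}"
      by (auto simp: form_rules[OF l] ctangent_closed[OF smooth_B])
    from imageI[OF this, of tconj]
    show "\<zeta> \<in> tconj ` {\<zeta> \<in> ctangent B (pr q). \<theta>0 (pr q) \<zeta> = 0 \<and> (\<forall>\<alpha><m. \<theta> \<alpha> (pr q) \<zeta> = 0)}"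
      unfolding tconj_simps(3) .
  qed
  finally show "push' q ` tconj ` N q = H10 H J (pr q)" .
  have Xr: "X q \<in> rtangent M q" using X_tangent q by (simp add: rtangent_def)
  have perp: "Y \<in> perp M g K q \<longleftrightarrow> Y \<in> rtangent M q \<and> \<theta>0 (pr q) (push' q Y) = 0" for Y
  proof -
    have "(\<forall>W\<in>K q. g q Y W = 0) \<longleftrightarrow> \<theta>0 (pr q) (push' q Y) = 0" if Y: "Y \<in> rtangent M q"
    proof -
      have "(\<forall>W\<in>K q. g q Y W = 0) \<longleftrightarrow> g q Y (X q) = 0"
      proof
        assume "\<forall>W\<in>K q. g q Y W = 0"
        moreover have "X q \<in> K q" unfolding K_span[OF q] by (rule rtv.span_base) simp
        ultimately show "g q Y (X q) = 0" by blast
      next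
        assume 0: "g q Y (X q) = 0"
        show "\<forall>W\<in>K q. g q Y W = 0" unfolding K_span[OF q] rtv.span_singleton
        proof
          fix W assume "W \<in> range (\<lambda>k. rtscale k (X q))"
          then obtain k where "W = rtscale k (X q)" by blast
          then show "g q Y W = 0"
            using metric_rules(1)[OF M g qt Y rtangent_closed(2)[OF M Xr, of k]] metric_rules(3)[OF M g qt Xr Y, of k]
              metric_rules(1)[OF M g qt Xr Y] 0 by simp
        qed
      qed
      also have "\<dots> \<longleftrightarrow> G q (X q) Y = 0"
        unfolding complexify_real[OF M g qt Xr Y] using metric_rules(1)[OF M g qt Xr Y] by simp
      also have "\<dots> \<longleftrightarrow> \<theta>0 (pr q) (push' q Y) = 0"
        using G_X_theta[OF q, of Y] Y b0[OF q] by (simp add: rtangent_def)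
      finally show ?thesis .
    qed
    then show ?thesis unfolding perp_def by blast
  qed
  show "push' q ` perp M g K q = H (pr q)"
  proof (intro equalityI subsetI)
    fix \<zeta> assume "\<zeta> \<in> push' q ` perp M g K q"
    then obtain Y where Y: "Y \<in> rtangent M q" "\<theta>0 (pr q) (push' q Y) = 0" "\<zeta> = push' q Y" using perp by blast
    have Yc: "Y \<in> ctangent M q" "tconj Y = Y" using Y(1) by (auto simp: rtangent_def)
    show "\<zeta> \<in> H (pr q)" unfolding H_def rtangent_def using Y(2,3) push_ctangent(1,2)[OF q Yc(1)] Yc(2) by simp
  next
    fix \<zeta> assume \<zeta>: "\<zeta> \<in> H (pr q)"
    have p: "push' q (lift q \<zeta>) = \<zeta>" by (rule push_lift[OF q H_tangent(1)[OF \<zeta>]])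
    have "tconj (lift q \<zeta>) = lift q \<zeta>" using lift_conj[OF q, of \<zeta>] H_tangent(2)[OF \<zeta>] by simp
    then have "lift q \<zeta> \<in> perp M g K q" unfolding perp p using H_tangent(3)[OF \<zeta>] lift_ctangent[OF q] by (simp add: rtangent_def)
    then show "\<zeta> \<in> push' q ` perp M g K q" using p by (metis imageI)
  qed
qed

lemma coef_smooth:
  assumes V: "V \<subseteq> leafs" and Y: "cvector_field B V Y" and \<alpha>: "\<alpha> < m" and l: "l \<in> V"
  shows "smooth_near B l (\<lambda>l. k * \<theta> \<alpha> l (Y l))" "smooth_near B l (\<lambda>l. k * \<theta>c \<alpha> l (Y l))"
proof -
  have t: "l \<in> topspace (mtop B)" using topB l V by blast
  have *: "smooth_near B l (\<lambda>l. \<theta> \<alpha> l (Y l))" if "cvector_field B V Y" for Y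
    using forms_cform(2)[OF \<alpha>] V that l unfolding cform_def by (meson smooth_near_fun)
  show "smooth_near B l (\<lambda>l. k * \<theta> \<alpha> l (Y l))" by (rule smooth_near_linear[OF smooth_B t *[OF Y] bounded_linear_mult_right])
  show "smooth_near B l (\<lambda>l. k * \<theta>c \<alpha> l (Y l))" unfolding conj_form_def
    by (rule smooth_near_linear[OF smooth_B t *[OF cvector_field_conj[OF smooth_B Y]]
          bounded_linear_compose[OF bounded_linear_mult_right bounded_linear_cnj]])
qed

lemma J_field:
  assumes Y: "rvector_field B V Y" and YH: "\<And>l. l \<in> V \<Longrightarrow> Y l \<in> H l"
  shows "rvector_field B V (\<lambda>l. J l (Y l))"
proof -
  have Yc: "cvector_field B V Y" using Y by (simp add: rvector_field_def)
  have oV: "openin (mtop B) V" using Yc by (simp add: cvector_field_def)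
  have V: "V \<subseteq> leafs" using openin_subset[OF oV] unfolding topspace_B .
  have ef: "cvector_field B V (e \<alpha>)" if "\<alpha> < m" for \<alpha> by (rule cvector_field_subset[OF smooth_B e_field[OF that] oV V])
  have "cvector_field B V (\<lambda>l. tscale 1 (\<Sum>\<alpha><m. tscale (\<i> * \<theta> \<alpha> l (Y l)) (tconj (e \<alpha> l))) +
      tscale 1 (\<Sum>\<alpha><m. tscale (- \<i> * \<theta>c \<alpha> l (Y l)) (e \<alpha> l)))"
    by (intro cvector_field_linear2[OF smooth_B] cvector_field_combination[OF smooth_B oV] coef_smooth[OF V Yc]
        cvector_field_conj[OF smooth_B] ef) auto
  then have c: "cvector_field B V (\<lambda>l. J l (Y l))" unfolding J_def by (simp only: ctv.scale_one)
  have "J l (Y l) \<in> rtangent B l" if l: "l \<in> V" for l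
  proof -
    have ll: "l \<in> leafs" using l V by blast
    show ?thesis unfolding rtangent_def
      using J_forms(1)[OF ll] J_linear(3)[OF ll H_tangent(1)[OF YH[OF l]]] H_tangent(2)[OF YH[OF l]] by simp
  qed
  then show ?thesis unfolding rvector_field_def using c by blast
qed

text \<open>The real and imaginary parts of the \<open>e \<alpha>\<close> form a smooth real frame
  of \<open>H\<close>: on a real vector \<open>\<theta>c\<close> is the conjugate of
  \<open>\<theta>\<close>, so \<open>m\<close> complex numbers, that is \<open>2 * m\<close> real
  ones, determine it.\<close>

lemma H_distribution: "real_distribution B (2 * m) H"
proof -
  define R where "R i l = (if i < m then tRe (e i l) else tIm (e (i - m) l))" for i l
  have R_field: "rvector_field B leafs (R i)" if "i < 2 * m" for i
    unfolding R_def[abs_def] using rvector_field_tRe[OF smooth_B e_field] that by (cases "i < m") auto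
  have Rsum: "(\<Sum>i<2 * m. rtscale (c i) (R i l)) = (\<Sum>\<alpha><m. rtscale (c \<alpha>) (tRe (e \<alpha> l))) + (\<Sum>\<alpha><m. rtscale (c (m + \<alpha>)) (tIm (e \<alpha> l)))" for c l
  proof -
    have *: "(\<Sum>i<n + k. F i) = (\<Sum>i<n. F i) + (\<Sum>i<k. F (n + i))" for F :: "nat \<Rightarrow> 'a set tvec" and n k
      by (induction k) (simp_all only: add_0_right lessThan_0 sum.empty add_Suc_right sum.lessThan_Suc add.assoc)
    show ?thesis unfolding mult_2 * by (intro arg_cong2[of _ _ _ _ "(+)"] sum.cong) (auto simp: R_def)
  qed
  have i: "z / (\<i> * 2) = - (\<i> * z / 2)" for z by (simp add: field_simps)
  have pair: "rtscale a (tRe V) + rtscale b (tIm V) = tscale (Complex a (- b) / 2) V + tscale (Complex a b / 2) (tconj V)" for a b and V :: "'a set tvec"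
    by (rule ext) (simp add: rtscale_def tscale_def tRe_def tIm_def Complex_eq i add_divide_distrib diff_divide_distrib algebra_simps)
  have Rsum': "(\<Sum>i<2 * m. rtscale (c i) (R i l)) =
      (\<Sum>\<alpha><m. tscale (Complex (c \<alpha>) (c (m + \<alpha>)) / 2) (tconj (e \<alpha> l))) + (\<Sum>\<alpha><m. tscale (Complex (c \<alpha>) (- c (m + \<alpha>)) / 2) (e \<alpha> l))" for c l
    unfolding Rsum sum.distrib[symmetric] pair by (simp only: add.commute)
  have span: "H l = rtv.span ((\<lambda>i. R i l) ` {..<2 * m}) \<and> rtv.dim (H l) = 2 * m" if l: "l \<in> leafs" for l
  proof
    show s: "H l = rtv.span ((\<lambda>i. R i l) ` {..<2 * m})" unfolding rtv.span_family
    proof (intro equalityI subsetI)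
      fix \<zeta> assume \<zeta>: "\<zeta> \<in> H l"
      \<comment> \<open>The factor 2 undoes the division in \<open>pair\<close>, where a real
        combination of \<open>tRe\<close> and \<open>tIm\<close> is rewritten with halved complex
        coefficients.\<close>
      define c where "c i = (if i < m then 2 * Re (\<theta> i l \<zeta>) else 2 * Im (\<theta> (i - m) l \<zeta>))" for i
      have "\<zeta> = (\<Sum>i<2 * m. rtscale (c i) (R i l))" unfolding Rsum'
      proof (rule eq_by_forms[OF l H_tangent(1)[OF \<zeta>] combo_tangent[OF l]], unfold combo_forms(1)[OF l])
        show "\<theta>0 l \<zeta> = 0" by (rule H_tangent(3)[OF \<zeta>])
        fix \<alpha> assume \<alpha>: "\<alpha> < m"
        show "\<theta> \<alpha> l \<zeta> = \<theta> \<alpha> l ((\<Sum>\<alpha><m. tscale (Complex (c \<alpha>) (c (m + \<alpha>)) / 2) (tconj (e \<alpha> l))) + (\<Sum>\<alpha><m. tscale (Complex (c \<alpha>) (- c (m + \<alpha>)) / 2) (e \<alpha> l)))"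
          unfolding combo_forms(2)[OF l \<alpha>] using \<alpha> by (simp add: c_def complex_eq_iff)
        have "\<theta>c \<alpha> l \<zeta> = cnj (\<theta> \<alpha> l \<zeta>)" unfolding conj_form_def H_tangent(2)[OF \<zeta>] ..
        then show "\<theta>c \<alpha> l \<zeta> = \<theta>c \<alpha> l ((\<Sum>\<alpha><m. tscale (Complex (c \<alpha>) (c (m + \<alpha>)) / 2) (tconj (e \<alpha> l))) + (\<Sum>\<alpha><m. tscale (Complex (c \<alpha>) (- c (m + \<alpha>)) / 2) (e \<alpha> l)))"
          unfolding combo_forms(3)[OF l \<alpha>] using \<alpha> by (simp add: c_def complex_eq_iff)
      qed
      then show "\<zeta> \<in> {\<Sum>i<2 * m. rtscale (c i) (R i l) |c. True}" by blast
    next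
      fix \<zeta> assume "\<zeta> \<in> {\<Sum>i<2 * m. rtscale (c i) (R i l) |c. True}"
      then obtain c where \<zeta>: "\<zeta> = (\<Sum>i<2 * m. rtscale (c i) (R i l))" by blast
      have ct: "\<zeta> \<in> ctangent B l" "\<theta>0 l \<zeta> = 0" unfolding \<zeta> Rsum' by (rule combo_tangent[OF l], rule combo_forms(1)[OF l])
      have "tconj (rtscale a (R i l)) = rtscale a (R i l)" for a i
        unfolding rtscale_def tconj_simps(2) R_def by (simp add: tconj_tRe)
      then have "tconj \<zeta> = \<zeta>" unfolding \<zeta> tconj_sum by simp
      then show "\<zeta> \<in> H l" unfolding H_def rtangent_def using ct by simp
    qed
    have "rtv.indep_family (2 * m) (\<lambda>i. R i l)" unfolding rtv.indep_family_def
    proof (intro allI impI)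
      fix c i assume s: "(\<Sum>i<2 * m. rtscale (c i) (R i l)) = 0" and i: "i < 2 * m"
      have "Complex (c \<alpha>) (c (m + \<alpha>)) / 2 = 0" if \<alpha>: "\<alpha> < m" for \<alpha>
      proof -
        have "\<theta> \<alpha> l (tscale 0 0) = 0 * \<theta> \<alpha> l 0"
          by (rule form_rules(4)[OF l ctangent_closed(1)[OF smooth_B topB[OF l]] \<alpha>])
        then have "\<theta> \<alpha> l 0 = 0" by simp
        then show ?thesis using combo_forms(2)[OF l \<alpha>, of "\<lambda>\<alpha>. Complex (c \<alpha>) (c (m + \<alpha>)) / 2" "\<lambda>\<alpha>. Complex (c \<alpha>) (- c (m + \<alpha>)) / 2"]
          s unfolding Rsum' by metis
      qed
      then have z: "c \<alpha> = 0" "c (m + \<alpha>) = 0" if "\<alpha> < m" for \<alpha> using that by (simp_all add: complex_eq_iff)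
      show "c i = 0" using z(1)[of i] z(2)[of "i - m"] i by (cases "i < m") auto
    qed
    from rtv.dim_indep_family[OF this] show "rtv.dim (H l) = 2 * m" unfolding s .
  qed
  show ?thesis unfolding real_distribution_def topspace_B
  proof (intro ballI exI conjI)
    show "openin (mtop B) leafs" by (rule compat_chart_openin[OF chart_B])
    show "\<forall>i<2 * m. rvector_field B leafs (R i)" using R_field by blast
    show "H q = rtv.span ((\<lambda>i. R i q) ` {..<2 * m})" if "q \<in> leafs" for q using span[OF that] by blast
    show "rtv.dim (H q) = 2 * m" if "q \<in> leafs" for q using span[OF that] by blast
  qed
qed

lemma almost_CR: "almost_CR B m H J"
  unfolding almost_CR_def topspace_B
proof (intro conjI dim H_distribution ballI allI impI)
  fix l assume l: "l \<in> leafs"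
  note t = H_tangent and jl = J_linear[OF l]
  show "J l ` H l \<subseteq> H l"
  proof
    fix \<zeta> assume "\<zeta> \<in> J l ` H l"
    then obtain \<zeta>' where \<zeta>': "\<zeta>' \<in> H l" "\<zeta> = J l \<zeta>'" by blast
    show "\<zeta> \<in> H l" unfolding H_def rtangent_def \<zeta>'(2)
      using J_forms(1,2)[OF l] jl(3)[OF t(1)[OF \<zeta>'(1)]] t(2)[OF \<zeta>'(1)] by simp
  qed
  show "J l (\<zeta> + \<zeta>') = J l \<zeta> + J l \<zeta>'" if "\<zeta> \<in> H l" "\<zeta>' \<in> H l" for \<zeta> \<zeta>' by (rule jl(1)[OF t(1)[OF that(1)] t(1)[OF that(2)]])
  show "J l (rtscale c \<zeta>) = rtscale c (J l \<zeta>)" if "\<zeta> \<in> H l" for c \<zeta> unfolding rtscale_def by (rule jl(2)[OF t(1)[OF that]])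
  show "J l (J l \<zeta>) = - \<zeta>" if "\<zeta> \<in> H l" for \<zeta> by (rule jl(4)[OF t(1)[OF that] t(3)[OF that]])
qed (use J_field in blast)

text \<open>These forms are, in this order, the coefficient functions \<open>co\<close> of the frame
  \<open>fr\<close>, hence its dual basis; the coefficients of \<open>\<omega>\<close> are its
  values on \<open>fr\<close>.\<close>

lemma coframe: "coframe B (\<theta>0 # map \<theta> [0..<m] @ map \<theta>c [0..<m])"
  unfolding coframe_def topspace_B
proof (intro ballI allI impI)
  let ?fs = "\<theta>0 # map \<theta> [0..<m] @ map \<theta>c [0..<m]"
  have len: "length ?fs = 2 * m + 1" by simp
  fix l \<omega> assume l: "l \<in> leafs" and \<omega>: "complex_linear_on (ctangent B l) \<omega>"
  have fs: "(?fs ! i) l \<zeta> = co l \<zeta> i" if \<zeta>: "\<zeta> \<in> ctangent B l" and i: "i < 2 * m + 1" for i \<zeta>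
  proof -
    have tail: "\<theta>c \<alpha> l \<zeta> = co l \<zeta> (Suc m + \<alpha>)" if "\<alpha> < m" for \<alpha>
      by (rule expansion_unique(3)[OF l co_sum[OF l \<zeta>, unfolded fr_sum] that])
    consider "i = 0" | "i \<noteq> 0" "i \<le> m" | "m < i" by linarith
    then show ?thesis
    proof cases
      case 3
      then obtain k where k: "i = Suc m + k" "k < m" by (rule_tac that[of "i - Suc m"]) (use i in auto)
      then have "?fs ! i = \<theta>c k" by (simp add: nth_append)
      then show ?thesis unfolding k(1) using tail[OF k(2)] by (simp only:)
    qed (auto simp: \<theta>0_def \<theta>_def nth_Cons' nth_append)
  qed
  have frt: "fr i l \<in> ctangent B l" if "i < 2 * m + 1" for i using fr_field[OF that] l by (simp add: cvector_field_def)
  have co_fr: "co l (fr j l) i = (if i = j then 1 else 0)" if "i < 2 * m + 1" "j < 2 * m + 1" for i j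
  proof (rule co_unique[OF l _ that(1)])
    have "(\<Sum>i<2 * m + 1. tscale (if i = j then 1 else 0) (fr i l)) = (\<Sum>i<2 * m + 1. if i = j then fr i l else 0)"
      by (rule sum.cong) auto
    then show "fr j l = (\<Sum>i<2 * m + 1. tscale (if i = j then 1 else 0) (fr i l))" using that(2) by simp
  qed
  show "\<exists>!c. c \<in> extensional {..<length ?fs} \<and> (\<forall>\<zeta>\<in>ctangent B l. \<omega> \<zeta> = (\<Sum>i<length ?fs. c i * (?fs ! i) l \<zeta>))"
    unfolding len
  proof (rule ex1I)
    show "restrict (\<lambda>i. \<omega> (fr i l)) {..<2 * m + 1} \<in> extensional {..<2 * m + 1} \<and>
      (\<forall>\<zeta>\<in>ctangent B l. \<omega> \<zeta> = (\<Sum>i<2 * m + 1. restrict (\<lambda>i. \<omega> (fr i l)) {..<2 * m + 1} i * (?fs ! i) l \<zeta>))"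
    proof (intro conjI ballI)
      fix \<zeta> assume \<zeta>: "\<zeta> \<in> ctangent B l"
      have "\<omega> \<zeta> = \<omega> (\<Sum>i<2 * m + 1. tscale (co l \<zeta> i) (fr i l))" using co_sum[OF l \<zeta>] by simp
      also have "\<dots> = (\<Sum>i<2 * m + 1. co l \<zeta> i * \<omega> (fr i l))"
        by (rule complex_linear_sum[OF smooth_B topB[OF l] \<omega>]) (use frt in auto)
      also have "\<dots> = (\<Sum>i<2 * m + 1. restrict (\<lambda>i. \<omega> (fr i l)) {..<2 * m + 1} i * (?fs ! i) l \<zeta>)"
        by (rule sum.cong[OF refl]) (simp add: fs[OF \<zeta>] mult.commute)
      finally show "\<omega> \<zeta> = (\<Sum>i<2 * m + 1. restrict (\<lambda>i. \<omega> (fr i l)) {..<2 * m + 1} i * (?fs ! i) l \<zeta>)" .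
    qed simp
    fix c assume c: "c \<in> extensional {..<2 * m + 1} \<and> (\<forall>\<zeta>\<in>ctangent B l. \<omega> \<zeta> = (\<Sum>i<2 * m + 1. c i * (?fs ! i) l \<zeta>))"
    show "c = restrict (\<lambda>i. \<omega> (fr i l)) {..<2 * m + 1}"
    proof (rule extensionalityI[of _ "{..<2 * m + 1}"])
      fix j assume "j \<in> {..<2 * m + 1}"
      then have j: "j < 2 * m + 1" by simp
      have "\<omega> (fr j l) = (\<Sum>i<2 * m + 1. c i * (?fs ! i) l (fr j l))" using c frt[OF j] by blast
      also have "\<dots> = (\<Sum>i<2 * m + 1. if i = j then c i else 0)"
        by (rule sum.cong[OF refl]) (use fs[OF frt[OF j]] co_fr j in auto)
      finally show "c j = restrict (\<lambda>i. \<omega> (fr i l)) {..<2 * m + 1} j" using j by simp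
    qed (use c in auto)
  qed
qed

lemma CR_coframe: "CR_coframe B m H J \<theta>0 \<theta>"
  unfolding CR_coframe_def topspace_B
proof (intro conjI ballI allI impI coframe)
  show "rform B leafs \<theta>0" unfolding rform_def
  proof (intro conjI forms_cform(1) ballI)
    fix l \<zeta> assume l: "l \<in> leafs" and "\<zeta> \<in> rtangent B l"
    then have "\<zeta> \<in> ctangent B l" "tconj \<zeta> = \<zeta>" by (auto simp: rtangent_def)
    then have "cnj (\<theta>0 l \<zeta>) = \<theta>0 l \<zeta>" using form_rules(7)[OF l, of \<zeta>] by simp
    then show "\<theta>0 l \<zeta> \<in> \<real>" by (simp add: Reals_cnj_iff)
  qed
  show "H l = {X \<in> rtangent B l. \<theta>0 l X = 0}" for l by (rule H_def)
  show "H01 H J l = {Z \<in> ctangent B l. \<theta>0 l Z = 0 \<and> (\<forall>\<alpha><m. \<theta> \<alpha> l Z = 0)}" if "l \<in> leafs" for l by (rule eigen(1)[OF that])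
qed (rule forms_cform(2))

subsection \<open>The normal form of the metric\<close>

text \<open>The mixed part of the Gram matrix of the lifted frame. The conjugate stands in the first
  slot because \<open>\<theta> \<alpha>\<close> is dual to the conjugate of
  \<open>e \<alpha>\<close>.\<close>

definition h :: "'a \<Rightarrow> nat \<Rightarrow> nat \<Rightarrow> complex" where "h q \<alpha> \<beta> = G q (tconj (E q \<alpha>)) (E q \<beta>)"
text \<open>The second term of \<open>lam\<close> compensates for \<open>L\<close> not being null.\<close>

definition lam :: "'a form" where "lam q Y = 1/2 * (G q (L q) Y - 1/2 * G q (L q) (L q) * \<theta>0 (pr q) (push' q Y))"

lemma E_field: "\<alpha> < m \<Longrightarrow> cvector_field M U (\<lambda>q. E q \<alpha>)" unfolding E_def by (rule lift_field[OF e_field])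

lemma L_field: "cvector_field M U L" by (rule chart_tvec_field[OF M chart])

lemma h_smooth: assumes "\<alpha> < m" "\<beta> < m" shows "smooth_fun M U (\<lambda>q. h q \<alpha> \<beta>)"
  unfolding smooth_fun_iff[OF M] h_def
  using compat_chart_openin[OF chart] complexify_smooth[OF M g cvector_field_conj[OF M E_field[OF assms(1)]] E_field[OF assms(2)]] by blast

lemma h_hermitian: assumes q: "q \<in> U" shows "h q \<alpha> \<beta> = cnj (h q \<beta> \<alpha>)"
proof -
  note c = complexify_conj[OF M g topU[OF q]] and s = complexify_sym[OF M g topU[OF q]] and E = E_tangent[OF q]
  have "cnj (h q \<beta> \<alpha>) = G q (tconj (tconj (E q \<beta>))) (tconj (E q \<alpha>))"
    unfolding h_def by (rule c[symmetric]) (use E ctangent_closed(4)[OF M] in auto)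
  also have "\<dots> = G q (tconj (E q \<alpha>)) (E q \<beta>)" unfolding tconj_simps(3) by (rule s) (use E ctangent_closed(4)[OF M] in auto)
  finally show ?thesis unfolding h_def by simp
qed

text \<open>Expresses the pullback of \<open>\<theta>0\<close> through the metric alone; smoothness
  and reality of \<open>lam\<close> then come from those of \<open>g\<close>.\<close>

lemma theta_push: "q \<in> U \<Longrightarrow> Y \<in> ctangent M q \<Longrightarrow> \<theta>0 (pr q) (push' q Y) = G q (X q) Y / G q (X q) (L q)"
  using G_X_theta[of q Y] b0[of q] by simp

lemma real_G:
  assumes q: "q \<in> U" and "Y \<in> rtangent M q"
  shows "G q (X q) Y \<in> \<real>" "G q (L q) Y \<in> \<real>"
proof -
  have "X q \<in> rtangent M q" "L q \<in> rtangent M q" using X_tangent L_tangent q by (auto simp: rtangent_def)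
  then show "G q (X q) Y \<in> \<real>" "G q (L q) Y \<in> \<real>" using complexify_real[OF M g topU[OF q] _ assms(2)] by auto
qed

lemma lam_form: "rform M U lam"
  unfolding rform_def cform_def
proof (intro conjI ballI allI impI compat_chart_openin[OF chart])
  note oU = compat_chart_openin[OF chart]
  fix q assume q: "q \<in> U"
  note qt = topU[OF q] and l = pr_leafs[OF q] and Lq = L_tangent(1)[OF q] and p = push_ctangent(1)[OF q]
  show "complex_linear_on (ctangent M q) (lam q)" unfolding complex_linear_on_def
  proof (intro conjI ballI allI)
    fix Y Y' assume Y: "Y \<in> ctangent M q" "Y' \<in> ctangent M q"
    show "lam q (Y + Y') = lam q Y + lam q Y'"
      unfolding lam_def push_linear complexify_add2[OF M g qt Y Lq] form_rules(1)[OF l p[OF Y(1)] p[OF Y(2)]]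
      by (simp add: algebra_simps add_divide_distrib)
  next
    fix c Y assume Y: "Y \<in> ctangent M q"
    show "lam q (tscale c Y) = c * lam q Y"
      unfolding lam_def push_linear complexify_scale2[OF M g qt Y Lq] form_rules(2)[OF l p[OF Y]]
      by (simp add: algebra_simps)
  qed
  fix Y assume Y: "Y \<in> rtangent M q"
  then have "Y \<in> ctangent M q" by (simp add: rtangent_def)
  moreover have "L q \<in> rtangent M q" using L_tangent q by (simp add: rtangent_def)
  ultimately show "lam q Y \<in> \<real>" unfolding lam_def
    using real_G[OF q Y] real_G[OF q, of "L q"] theta_push[OF q] by (auto intro!: Reals_mult Reals_diff Reals_divide)
next
  fix V Y assume V: "V \<subseteq> U" and Y: "cvector_field M V Y"
  have oV: "openin (mtop M) V" using Y by (simp add: cvector_field_def)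
  show "smooth_fun M V (\<lambda>q. lam q (Y q))" unfolding smooth_fun_iff[OF M]
  proof (intro conjI oV ballI)
    fix q assume q: "q \<in> V"
    have qU: "q \<in> U" using q V by blast
    have qt: "q \<in> topspace (mtop M)" by (rule topU[OF qU])
    interpret germ_ring "smooth_near M q" q "nhdsin (mtop M) q" by (rule germ_ring_smooth[OF M qt])
    have Lf: "cvector_field M V L" by (rule cvector_field_subset[OF M L_field oV V])
    have Xf: "cvector_field M V X" by (rule cvector_field_subset[OF M chart_tvec_field[OF M chart] oV V])
    note s = complexify_smooth[OF M g _ _ q]
    have sm: "smooth_near M q (\<lambda>q. 1/2 * (G q (L q) (Y q) - 1/2 * G q (L q) (L q) * (G q (X q) (Y q) / G q (X q) (L q))))"
      by (rule mult[OF const diff[OF s[OF Lf Y] mult[OF mult[OF const s[OF Lf Lf]] divide[OF s[OF Xf Y] s[OF Xf Lf] b0[OF qU]]]]])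
    show "smooth_near M q (\<lambda>q. lam q (Y q))"
    proof (rule smooth_near_cong[OF M oV q _ sm])
      fix p assume p: "p \<in> V"
      have "Y p \<in> ctangent M p" "p \<in> U" using Y p V by (auto simp: cvector_field_def)
      then show "lam p (Y p) = 1/2 * (G p (L p) (Y p) - 1/2 * G p (L p) (L p) * (G p (X p) (Y p) / G p (X p) (L p)))"
        unfolding lam_def using theta_push by simp
    qed
  qed
qed

text \<open>On \<open>K\<close> the pullback of \<open>\<theta>0\<close> vanishes, so only half of
  \<open>g(L, -)\<close> remains there, and \<open>b0\<close> makes \<open>g(L, X)\<close>
  nonzero.\<close>

lemma lam_nonzero:
  assumes q: "q \<in> U" and Y: "Y \<in> K q" "Y \<noteq> 0" shows "lam q Y \<noteq> 0"
proof -
  obtain r where r: "Y = tscale (complex_of_real r) (X q)" using Y(1) unfolding K_span[OF q] rtv.span_singleton by (auto simp: rtscale_def)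
  have "r \<noteq> 0" using Y(2) unfolding r by (auto simp: tscale_def zero_fun_def)
  moreover have "G q (L q) (X q) = G q (X q) (L q)"
    by (rule complexify_sym[OF M g topU[OF q] L_tangent(1)[OF q] X_tangent(1)[OF q]])
  moreover have "\<theta>0 (pr q) (push' q Y) = G q (X q) Y / G q (X q) (L q)"
    unfolding r by (rule theta_push[OF q ctangent_closed(3)[OF M X_tangent(1)[OF q]]])
  then have "\<theta>0 (pr q) (push' q Y) = 0"
    using complexify_scale2[OF M g topU[OF q] X_tangent(1)[OF q] X_tangent(1)[OF q]] G_X(1)[OF q] by (simp add: r)
  ultimately show ?thesis unfolding lam_def
    using complexify_scale2[OF M g topU[OF q] X_tangent(1)[OF q] L_tangent(1)[OF q]] b0[OF q] by (simp add: r)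
qed

text \<open>Both vectors are split into parts along \<open>X\<close> and \<open>L\<close>, a part
  \<open>A\<close> in the conjugate of \<open>N\<close> and a part \<open>D\<close> in
  \<open>N\<close>. Nullity of \<open>N\<close> kills the pairings of \<open>D\<close> with
  \<open>D\<close> and of \<open>A\<close> with \<open>A\<close>; those of \<open>A\<close> with
  \<open>D\<close> give the Hermitian term. The coefficient along \<open>X\<close> is not visible on
  the leaf space and is eliminated through \<open>g(L, Y)\<close>, which produces
  \<open>lam\<close>. The factors 4 and 2 compensate for the halves in \<open>symprod\<close> and
  \<open>lam\<close>.\<close>

lemma metric_form:
  assumes q: "q \<in> U" and Y: "Y \<in> rtangent M q" and Y': "Y' \<in> rtangent M q"
  shows "complex_of_real (g q Y Y') = 4 * symprod (pull B pr \<theta>0 q) (lam q) Y Y' +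
    2 * (\<Sum>\<alpha><m. \<Sum>\<beta><m. h q \<alpha> \<beta> * symprod (pull B pr (\<theta> \<alpha>) q) (pull B pr (\<theta>c \<beta>) q) Y Y')"
proof -
  note qt = topU[OF q] and cl = ctangent_closed[OF M] and x = X_tangent(1)[OF q] and Lq = L_tangent(1)[OF q]
  note add1 = complexify_add[OF M g qt] and add2 = complexify_add2[OF M g qt]
    and sc1 = complexify_scale[OF M g qt] and sc2 = complexify_scale2[OF M g qt] and sym = complexify_sym[OF M g qt]
  define y0 where "y0 Y = \<theta>0 (pr q) (push' q Y)" for Y
  define y where "y \<alpha> Y = \<theta> \<alpha> (pr q) (push' q Y)" for \<alpha> Y
  define yc where "yc \<alpha> Y = \<theta>c \<alpha> (pr q) (push' q Y)" for \<alpha> Y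
  define A where "A Y = (\<Sum>\<alpha><m. tscale (y \<alpha> Y) (tconj (E q \<alpha>)))" for Y
  define D where "D Y = (\<Sum>\<alpha><m. tscale (yc \<alpha> Y) (E q \<alpha>))" for Y
  have Yc: "Y \<in> ctangent M q" "Y' \<in> ctangent M q" using Y Y' by (auto simp: rtangent_def)
  have AD: "A W \<in> ctangent M q" "D W \<in> ctangent M q" for W
    unfolding A_def D_def by (intro ctangent_sum[OF M qt] cl(3,4) E_tangent q)+
  have DN: "D W \<in> N q" for W
  proof -
    have sub: "ctv.subspace (N q)"
    proof (rule ctv.subspaceI)
      have "tscale 0 (X q) + (\<Sum>i<m. tscale 0 (Z i q)) \<in> N q" by (rule N_mem(3)[OF q])
      then show "0 \<in> N q" by simp
      fix V W assume "V \<in> N q" "W \<in> N q"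
      then obtain a c b d where v: "V = tscale a (X q) + (\<Sum>i<m. tscale (c i) (Z i q))" "W = tscale b (X q) + (\<Sum>i<m. tscale (d i) (Z i q))"
        unfolding N_span[OF q] by blast
      have "V + W = tscale (a + b) (X q) + (\<Sum>i<m. tscale (c i + d i) (Z i q))"
        unfolding v by (simp only: ctv.scale_left_distrib sum.distrib ac_simps)
      then show "V + W \<in> N q" using N_mem(3)[OF q, of "a + b" "\<lambda>i. c i + d i"] by simp
    next
      fix k V assume "V \<in> N q"
      then obtain a c where v: "V = tscale a (X q) + (\<Sum>i<m. tscale (c i) (Z i q))" unfolding N_span[OF q] by blast
      have "tscale k V = tscale (k * a) (X q) + (\<Sum>i<m. tscale (k * c i) (Z i q))"
        unfolding v by (simp only: ctv.scale_right_distrib ctv.scale_sum_right ctv.scale_scale)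
      then show "tscale k V \<in> N q" using N_mem(3)[OF q, of "k * a" "\<lambda>i. k * c i"] by simp
    qed
    show ?thesis unfolding D_def by (intro ctv.subspace_sum[OF sub] ctv.subspace_scale[OF sub] E_N q) simp
  qed
  \<comment> \<open>Presents \<open>A\<close> as a conjugate of some \<open>D\<close>, so that
    \<open>complexify_conj\<close> transfers nullity from \<open>D\<close> to
    \<open>A\<close>.\<close>
  have Aconj: "A W = tconj (D (tconj W))" if "W \<in> ctangent M q" for W
    unfolding A_def D_def tconj_sum tconj_simps(2) y_def yc_def push_ctangent(2)[OF q that]
    by (simp add: conj_form_def tconj_simps(3))
  have DD: "G q (D V) (D W) = 0" for V W by (rule null[OF q DN DN])
  have AA: "G q (A V) (A W) = 0" if "V \<in> ctangent M q" "W \<in> ctangent M q" for V W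
    unfolding Aconj[OF that(1)] Aconj[OF that(2)] complexify_conj[OF M g qt AD(2) AD(2)] DD by simp
  have AD': "G q (A V) (D W) = (\<Sum>\<alpha><m. \<Sum>\<beta><m. h q \<alpha> \<beta> * (y \<alpha> V * yc \<beta> W))" for V W
  proof -
    have ED: "G q (tconj (E q \<alpha>)) (D W) = (\<Sum>\<beta><m. yc \<beta> W * h q \<alpha> \<beta>)" for \<alpha>
      unfolding D_def h_def by (rule complexify_sum2[OF M g qt]) (intro cl(4) E_tangent q)+
    have "G q (A V) (D W) = (\<Sum>\<alpha><m. y \<alpha> V * G q (tconj (E q \<alpha>)) (D W))"
      unfolding A_def by (rule complexify_sum[OF M g qt AD(2)]) (intro cl(4) E_tangent q)
    then show ?thesis by (simp add: ED sum_distrib_left mult.assoc mult.commute mult.left_commute)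
  qed
  have dec: "\<exists>a. W = tscale a (X q) + (tscale (y0 W) (L q) + (A W + D W))" if W: "W \<in> ctangent M q" for W
    using decomposition[OF q W] lift_expansion[OF q push_ctangent(1)[OF q W]] unfolding A_def D_def y0_def y_def yc_def by metis
  obtain a where a: "Y = tscale a (X q) + (tscale (y0 Y) (L q) + (A Y + D Y))" using dec[OF Yc(1)] by blast
  obtain a' where a': "Y' = tscale a' (X q) + (tscale (y0 Y') (L q) + (A Y' + D Y'))" using dec[OF Yc(2)] by blast
  let ?l = "G q (X q) (L q)"
  have GX: "G q (X q) W = y0 W * ?l" if "W \<in> ctangent M q" for W unfolding y0_def by (rule G_X_theta[OF q that])
  have pA: "G q (X q) (A W) = 0" "G q (X q) (D W) = 0" for W
    unfolding A_def D_def
    using complexify_sum2[OF M g qt x, of "{..<m}" "\<lambda>\<alpha>. tconj (E q \<alpha>)" "\<lambda>\<alpha>. y \<alpha> W"]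
      complexify_sum2[OF M g qt x, of "{..<m}" "\<lambda>\<alpha>. E q \<alpha>" "\<lambda>\<alpha>. yc \<alpha> W"]
    by (simp_all add: cl(4) E_tangent q G_E)
  have mem: "tscale k (X q) \<in> ctangent M q" "tscale k (L q) \<in> ctangent M q" for k by (intro cl(3) x Lq)+
  have LW: "G q (L q) W = b * ?l + (y0 W * G q (L q) (L q) + (G q (L q) (A W) + G q (L q) (D W)))"
    if "W = tscale b (X q) + (tscale (y0 W) (L q) + (A W + D W))" for W b
    by (subst that) (simp only: add2[OF _ _ Lq] mem AD cl(2) sc2[OF x Lq] sc2[OF Lq Lq] sym[OF Lq x])
  have "G q Y Y' = a * G q (X q) Y' + (y0 Y * G q (L q) Y' + (G q (A Y) Y' + G q (D Y) Y'))"
    by (subst (1) a) (simp only: add1[OF _ _ Yc(2)] mem AD cl(2) sc1[OF x Yc(2)] sc1[OF Lq Yc(2)])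
  also have "G q (A Y) Y' = y0 Y' * G q (L q) (A Y) + G q (A Y) (D Y')"
    by (subst a') (simp add: add2 mem AD cl(2) sc2[OF x AD(1)] sc2[OF Lq AD(1)] sym[OF AD(1) x] sym[OF AD(1) Lq] pA AA[OF Yc])
  also have "G q (D Y) Y' = y0 Y' * G q (L q) (D Y) + G q (A Y') (D Y)"
    by (subst a') (simp add: add2 mem AD cl(2) sc2[OF x AD(2)] sc2[OF Lq AD(2)] sym[OF AD(2) x] sym[OF AD(2) Lq] pA DD sym[OF AD(2) AD(1)])
  finally have "G q Y Y' = a * (y0 Y' * ?l) + y0 Y * G q (L q) Y' + y0 Y' * (G q (L q) (A Y) + G q (L q) (D Y)) +
      (G q (A Y) (D Y') + G q (A Y') (D Y))" unfolding GX[OF Yc(2)] by (simp add: algebra_simps)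
  \<comment> \<open>\<open>LW\<close> solved for the coefficient \<open>a\<close> of
    \<open>X\<close>: the pairings of \<open>L\<close> with \<open>A Y\<close> and
    \<open>D Y\<close> enter with the opposite sign and cancel those above.\<close>
  also have "a * (y0 Y' * ?l) = y0 Y' * (G q (L q) Y - y0 Y * G q (L q) (L q) - (G q (L q) (A Y) + G q (L q) (D Y)))"
    unfolding LW[OF a] by (simp add: algebra_simps)
  finally have GY: "G q Y Y' = y0 Y * G q (L q) Y' + y0 Y' * G q (L q) Y - y0 Y * y0 Y' * G q (L q) (L q) +
      (G q (A Y) (D Y') + G q (A Y') (D Y))" by (simp add: algebra_simps)
  have "complex_of_real (g q Y Y') = G q Y Y'" by (rule complexify_real[OF M g qt Y Y', symmetric])
  moreover have "4 * symprod (pull B pr \<theta>0 q) (lam q) Y Y' = y0 Y * G q (L q) Y' + y0 Y' * G q (L q) Y - y0 Y * y0 Y' * G q (L q) (L q)"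
    unfolding symprod_def pull_def lam_def y0_def[symmetric] by (simp add: algebra_simps add_divide_distrib diff_divide_distrib)
  moreover have "2 * (\<Sum>\<alpha><m. \<Sum>\<beta><m. h q \<alpha> \<beta> * symprod (pull B pr (\<theta> \<alpha>) q) (pull B pr (\<theta>c \<beta>) q) Y Y') =
      G q (A Y) (D Y') + G q (A Y') (D Y)"
    unfolding AD' symprod_def pull_def y_def[symmetric] yc_def[symmetric] sum.distrib[symmetric] sum_distrib_left
    by (intro sum.cong refl) (simp add: algebra_simps)
  ultimately show ?thesis using GY by simp
qed

end

section \<open>Adapted frames\<close>

lemma sum_omit:
  fixes f :: "nat \<Rightarrow> 'b::ab_group_add"
  assumes "k < Suc n" shows "(\<Sum>i<Suc n. f i) = f k + (\<Sum>j<n. f (if j < k then j else Suc j))"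
proof -
  have "bij_betw (\<lambda>j. if j < k then j else Suc j) {..<n} ({..<Suc n} - {k})"
    by (rule bij_betw_byWitness[of _ "\<lambda>i. if i < k then i else i - 1"]) (use assms in \<open>auto split: if_splits\<close>)
  then have "(\<Sum>j<n. f (if j < k then j else Suc j)) = sum f ({..<Suc n} - {k})" by (rule sum.reindex_bij_betw)
  then show ?thesis using sum.remove[of "{..<Suc n}" k f] assms by simp
qed

context vector_space
begin

text \<open>Steinitz exchange with explicit indices: a vector with nonzero \<open>k\<close>-th
  coefficient takes the place of \<open>Z k\<close>, and the remaining members are renumbered by
  skipping \<open>k\<close>.\<close>

lemma exchange_family:
  fixes Z :: "nat \<Rightarrow> 'b"
  assumes indep: "local.indep_family (Suc n) Z" and x: "x = (\<Sum>i<Suc n. scale (c i) (Z i))" and k: "k < Suc n" "c k \<noteq> 0"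
  defines "Z' \<equiv> \<lambda>j. Z (if j < k then j else Suc j)"
  shows "span (Z ` {..<Suc n}) = {scale a x + (\<Sum>i<n. scale (d i) (Z' i)) |a d. True}"
    and "scale a x + (\<Sum>i<n. scale (d i) (Z' i)) = 0 \<Longrightarrow> a = 0 \<and> (\<forall>i<n. d i = 0)"
proof -
  define \<sigma> where "\<sigma> j = (if j < k then j else Suc j)" for j
  have Z': "Z' = (\<lambda>j. Z (\<sigma> j))" by (simp add: Z'_def \<sigma>_def)
  have omit: "(\<Sum>i<Suc n. f i) = f k + (\<Sum>j<n. f (\<sigma> j))" for f :: "nat \<Rightarrow> 'b"
    unfolding \<sigma>_def by (rule sum_omit[OF k(1)])
  have \<sigma>: "\<sigma> j \<noteq> k" "(if \<sigma> j < k then \<sigma> j else \<sigma> j - 1) = j" for j by (auto simp: \<sigma>_def)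
  show "span (Z ` {..<Suc n}) = {scale a x + (\<Sum>i<n. scale (d i) (Z' i)) |a d. True}"
  proof (intro equalityI subsetI)
    fix y assume "y \<in> span (Z ` {..<Suc n})"
    then obtain l where y: "y = (\<Sum>i<Suc n. scale (l i) (Z i))" unfolding span_family by blast
    define a where "a = l k / c k"
    have ac: "a * c k = l k" using k(2) by (simp add: a_def)
    have "scale a x + (\<Sum>i<n. scale (l (\<sigma> i) - a * c (\<sigma> i)) (Z' i)) = y"
      unfolding x y omit Z' scale_right_distrib scale_sum_right scale_scale ac scale_left_diff_distrib sum_subtractf by simp
    then show "y \<in> {scale a x + (\<Sum>i<n. scale (d i) (Z' i)) |a d. True}"
      by (intro CollectI exI[of _ a] exI[of _ "\<lambda>i. l (\<sigma> i) - a * c (\<sigma> i)"]) simp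
  next
    have "x \<in> span (Z ` {..<Suc n})" unfolding x span_family by blast
    moreover have "Z' i \<in> span (Z ` {..<Suc n})" if "i < n" for i
      unfolding Z'_def using that by (intro span_base imageI) auto
    moreover fix y assume "y \<in> {scale a x + (\<Sum>i<n. scale (d i) (Z' i)) |a d. True}"
    ultimately show "y \<in> span (Z ` {..<Suc n})" by (auto intro!: span_add span_scale span_sum)
  qed
  assume 0: "scale a x + (\<Sum>i<n. scale (d i) (Z' i)) = 0"
  \<comment> \<open>The given relation rewritten in the original family; the inverse of the
    renumbering subtracts 1 beyond \<open>k\<close>. At index \<open>k\<close> it yields
    \<open>a * c k = 0\<close>, which forces \<open>a = 0\<close>.\<close>
  define l where "l i = a * c i + (if i = k then 0 else d (if i < k then i else i - 1))" for i
  have l: "l k = a * c k" "l (\<sigma> j) = a * c (\<sigma> j) + d j" for j using \<sigma>[of j] by (simp_all add: l_def)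
  have "(\<Sum>i<Suc n. scale (l i) (Z i)) = scale a x + (\<Sum>i<n. scale (d i) (Z' i))"
    unfolding x omit Z' l scale_right_distrib scale_sum_right scale_scale scale_left_distrib sum.distrib by (simp only: add.assoc)
  then have l0: "l i = 0" if "i < Suc n" for i using indep 0 that unfolding indep_family_def by metis
  have a: "a = 0" using l0[OF k(1)] k(2) by (simp add: l)
  have "d i = 0" if "i < n" for i
  proof -
    have "\<sigma> i < Suc n" using that by (simp add: \<sigma>_def)
    from l0[OF this] show ?thesis by (simp add: l a)
  qed
  then show "a = 0 \<and> (\<forall>i<n. d i = 0)" using a by blast
qed

end

text \<open>\<open>K\<close> lies in \<open>N\<close>, so its generator is a combination of a local
  frame of \<open>N\<close>. Some coefficient is nonzero at \<open>p\<close>; being smooth there, it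
  stays nonzero nearby, so that one and the same member can be exchanged for the generator on a
  whole neighbourhood.\<close>

lemma adapted_frame:
  assumes M: "smooth_manifold M" and AR: "almost_robinson M g m N K" and p: "p \<in> topspace (mtop M)"
  obtains W X Z where "openin (mtop M) W" "p \<in> W" "rvector_field M W X" "\<And>q. q \<in> W \<Longrightarrow> K q = rtv.span {X q}" "\<And>q. q \<in> W \<Longrightarrow> X q \<noteq> 0"
    "\<And>i. i < m \<Longrightarrow> cvector_field M W (Z i)"
    "\<And>q. q \<in> W \<Longrightarrow> N q = {tscale a (X q) + (\<Sum>i<m. tscale (c i) (Z i q)) |a c. True}"
    "\<And>q a c. q \<in> W \<Longrightarrow> tscale a (X q) + (\<Sum>i<m. tscale (c i) (Z i q)) = 0 \<Longrightarrow> a = 0 \<and> (\<forall>i<m. c i = 0)"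
proof -
  have "\<exists>W X. p \<in> W \<and> openin (mtop M) W \<and> (\<forall>i<1. rvector_field M W (X i)) \<and>
     (\<forall>q\<in>W. K q = rtv.span ((\<lambda>i. X i q) ` {..<1::nat}) \<and> rtv.dim (K q) = 1)"
    using AR p unfolding almost_robinson_def real_distribution_def by blast
  then obtain W1 X' where W1: "p \<in> W1" "openin (mtop M) W1" and X': "rvector_field M W1 (X' 0)"
    and K': "\<And>q. q \<in> W1 \<Longrightarrow> K q = rtv.span ((\<lambda>i. X' i q) ` {..<1::nat}) \<and> rtv.dim (K q) = 1" by auto
  define X where "X = X' 0"
  have "(\<lambda>i. X' i q) ` {..<1::nat} = {X q}" for q by (auto simp: X_def)
  then have K: "K q = rtv.span {X q}" if "q \<in> W1" for q using K'[OF that] by simp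
  have X0: "X q \<noteq> 0" if "q \<in> W1" for q
  proof
    have "rtv.indep_family 1 (\<lambda>i. X' i q)" by (rule rtv.indep_family_if_dim) (use K'[OF that] in metis)
    moreover assume "X q = 0"
    ultimately show False unfolding rtv.indep_family_def by (auto simp: X_def dest: spec[of _ "\<lambda>_. 1"])
  qed
  have "\<exists>W Z. p \<in> W \<and> openin (mtop M) W \<and> (\<forall>i<m + 1. cvector_field M W (Z i)) \<and>
     (\<forall>q\<in>W. N q = ctv.span ((\<lambda>i. Z i q) ` {..<m + 1}) \<and> ctv.dim (N q) = m + 1)"
    using AR p unfolding almost_robinson_def complex_distribution_def by blast
  then obtain W2 Z where W2: "p \<in> W2" "openin (mtop M) W2" and Z: "\<And>i. i < Suc m \<Longrightarrow> cvector_field M W2 (Z i)"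
    and N': "\<And>q. q \<in> W2 \<Longrightarrow> N q = ctv.span ((\<lambda>i. Z i q) ` {..<Suc m}) \<and> ctv.dim (N q) = Suc m" unfolding Suc_eq_plus1[symmetric] by blast
  have N: "N q = ctv.span ((\<lambda>i. Z i q) ` {..<Suc m})" if "q \<in> W2" for q using N'[OF that] by blast
  have indep: "ctv.indep_family (Suc m) (\<lambda>i. Z i q)" if "q \<in> W2" for q
    by (rule ctv.indep_family_if_dim) (use N'[OF that] in metis)
  let ?W = "W1 \<inter> W2"
  have oW: "openin (mtop M) ?W" by (intro openin_Int W1 W2)
  have "\<exists>c. X q = (\<Sum>i<Suc m. tscale (c i) (Z i q))" if q: "q \<in> ?W" for q
  proof -
    have "ctv.span (K q) = N q \<inter> tconj ` N q"
      using AR openin_subset[OF W1(2)] q unfolding almost_robinson_def by blast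
    moreover have "X q \<in> ctv.span (K q)" by (rule ctv.span_base) (use K[of q] q rtv.span_base[of "X q" "{X q}"] in simp)
    ultimately have "X q \<in> ctv.span ((\<lambda>i. Z i q) ` {..<Suc m})" using N q by blast
    then show ?thesis unfolding ctv.span_family by blast
  qed
  then obtain c where c: "\<And>q. q \<in> ?W \<Longrightarrow> X q = (\<Sum>i<Suc m. tscale (c q i) (Z i q))" by metis
  have pW: "p \<in> ?W" using W1 W2 by simp
  have "\<exists>k<Suc m. c p k \<noteq> 0"
  proof (rule ccontr)
    assume "\<not> (\<exists>k<Suc m. c p k \<noteq> 0)"
    then have "(\<Sum>i<Suc m. tscale (c p i) (Z i p)) = 0" by (intro sum.neutral) simp
    then show False using c[OF pW] X0[OF W1(1)] by simp
  qed
  then obtain k where k: "k < Suc m" "c p k \<noteq> 0" by blast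
  have "smooth_near M p (\<lambda>q. c q k)"
  proof (rule field_coefficients_smooth[OF M oW pW, of "Suc m" Z X "\<lambda>i q. c q i" k])
    show "cvector_field M ?W (Z j)" if "j < Suc m" for j by (rule cvector_field_subset[OF M Z[OF that] oW]) simp
    show "cvector_field M ?W X" using X' unfolding rvector_field_def X_def
      by (intro cvector_field_subset[OF M _ oW, of W1]) auto
  qed (use c indep W2 k in auto)
  then obtain W3 where W3: "openin (mtop M) W3" "p \<in> W3" "\<And>q. q \<in> W3 \<Longrightarrow> c q k \<noteq> 0"
    using smooth_near_nonzero[OF M p, of "\<lambda>q. c q k"] k(2) by blast
  let ?V = "?W \<inter> W3"
  have oV: "openin (mtop M) ?V" by (intro openin_Int oW W3)
  show ?thesis
  proof (rule that[of ?V X "\<lambda>j. Z (if j < k then j else Suc j)"])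
    show "openin (mtop M) ?V" by (rule oV)
    show "p \<in> ?V" using pW W3 by simp
    show "rvector_field M ?V X" using X' cvector_field_subset[OF M _ oV, of W1 X] unfolding rvector_field_def X_def by auto
    show "cvector_field M ?V (Z (if i < k then i else Suc i))" if "i < m" for i
      by (rule cvector_field_subset[OF M Z oV]) (use that in auto)
    fix q assume q: "q \<in> ?V"
    then have qW: "q \<in> ?W" "q \<in> W2" and ck: "c q k \<noteq> 0" using W3(3) by auto
    note ex = ctv.exchange_family[OF indep[OF qW(2)] c[OF qW(1)] k(1) ck]
    show "N q = {tscale a (X q) + (\<Sum>i<m. tscale (c i) (Z (if i < k then i else Suc i) q)) |a c. True}"
      unfolding N[OF qW(2)] by (rule ex(1))
    show "a = 0 \<and> (\<forall>i<m. d i = 0)"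
      if "tscale a (X q) + (\<Sum>i<m. tscale (d i) (Z (if i < k then i else Suc i) q)) = 0" for a d
      by (rule ex(2)[OF that])
  qed (use K X0 in auto)
qed

text \<open>Nondegeneracy gives a vector not orthogonal to \<open>X\<close>, hence a coordinate
  vector with this property; it cannot be \<open>(1, 0)\<close>, which is orthogonal to
  \<open>X\<close> by hypothesis.\<close>

lemma transversal_direction:
  fixes \<Psi> :: "'a \<Rightarrow> real \<times> 'f::euclidean_space"
  assumes M: "smooth_manifold M" and g: "lorentzian_metric M g" and c: "compat_chart M U \<Psi>" and p: "p \<in> U"
    and X: "X \<in> ctangent M p" "X \<noteq> 0" and null: "complexify g p X (chart_tvec M U \<Psi> p (1, 0) 0) = 0"
  obtains b where "complexify g p X (chart_tvec M U \<Psi> p (0, b) 0) \<noteq> 0"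
proof -
  have pt: "p \<in> topspace (mtop M)" using compat_chart_openin[OF c] p openin_subset by blast
  note ct = ctangent_chart(1)[OF M c p]
  obtain W where W: "W \<in> ctangent M p" "complexify g p W X \<noteq> 0" using complexify_nondegenerate[OF M g pt X(1)] X(2) by blast
  have "complexify g p X W \<noteq> 0" unfolding complexify_sym[OF M g pt X(1) W(1)] by (rule W(2))
  moreover have "complexify g p X W = (\<Sum>b\<in>Basis. W (coord \<Psi> b) * complexify g p X (chart_tvec M U \<Psi> p b 0))"
    by (subst chart_tvec_expand[OF M c p W(1)], rule complexify_sum2[OF M g pt X(1) ct])
  ultimately obtain b where b: "b \<in> Basis" "complexify g p X (chart_tvec M U \<Psi> p b 0) \<noteq> 0"
    by (metis (no_types, lifting) mult_zero_right sum.neutral)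
  then have "b \<noteq> (1, 0)" using null by auto
  then obtain b' where "b = (0, b')" using b(1) by (auto simp: Basis_prod_def)
  then show ?thesis using that b(2) by blast
qed

theorem proposition4p22:
  fixes M :: "('a, 'e::euclidean_space) mfd"
    and g :: "'a metric"
    and vol :: "'a \<Rightarrow> 'a tvec list \<Rightarrow> real"
    and \<tau> :: "'a \<Rightarrow> 'a tvec"
    and N K :: "'a \<Rightarrow> 'a tvec set"
    and m :: nat
  assumes "smooth_manifold M"
    and "DIM('e) = 2 * m + 2"
    and "lorentzian_metric M g"
    and "orientation_form M vol"
    and "time_orientation_field M g \<tau>"
    and "nearly_robinson M g m N K"
    and "DIM('f::euclidean_space) = 2 * m + 1"
  shows "\<forall>p\<in>topspace (mtop M). \<exists>U (B :: ('a set, 'f) mfd) \<Phi> H J.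
    p \<in> U \<and> openin (mtop M) U \<and>
    leaf_space_trivialization M K U B \<Phi> \<and>
    almost_CR B m H J \<and>
    descends_to M g N K U B (snd \<circ> \<Phi>) H J \<and>
    (\<exists>\<theta>\<^sub>0 \<theta> h lam.
      CR_coframe B m H J \<theta>\<^sub>0 \<theta> \<and>
      (\<forall>\<alpha><m. \<forall>\<beta><m. smooth_fun M U (\<lambda>q. h q \<alpha> \<beta> :: complex) \<and>
         (\<forall>q\<in>U. h q \<alpha> \<beta> = cnj (h q \<beta> \<alpha>))) \<and>
      rform M U lam \<and>
      (\<forall>q\<in>U. \<forall>X\<in>K q. X \<noteq> 0 \<longrightarrow> lam q X \<noteq> 0) \<and>
      (\<forall>q\<in>U. \<forall>X\<in>rtangent M q. \<forall>Y\<in>rtangent M q.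
         complex_of_real (g q X Y) =
           4 * symprod (pull B (snd \<circ> \<Phi>) \<theta>\<^sub>0 q) (lam q) X Y +
           2 * (\<Sum>\<alpha><m. \<Sum>\<beta><m. h q \<alpha> \<beta> *
             symprod (pull B (snd \<circ> \<Phi>) (\<theta> \<alpha>) q) (pull B (snd \<circ> \<Phi>) (conj_form (\<theta> \<beta>)) q) X Y)))"
proof
  note M = assms(1) and g = assms(3) and NR = assms(6)
  have AR: "almost_robinson M g m N K" using NR unfolding nearly_robinson_def by blast
  have null: "complexify g q V W = 0" if "q \<in> topspace (mtop M)" "V \<in> N q" "W \<in> N q" for q V W
    using AR that unfolding almost_robinson_def by blast
  have KN: "ctv.span (K q) = N q \<inter> tconj ` N q" if "q \<in> topspace (mtop M)" for q
    using AR that unfolding almost_robinson_def by blast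
  have K_N: "V \<in> N q" if "q \<in> topspace (mtop M)" "V \<in> K q" for q V
    using KN[OF that(1)] ctv.span_base[OF that(2)] by blast
  fix p assume p: "p \<in> topspace (mtop M)"
  obtain W X Z where W: "openin (mtop M) W" "p \<in> W" and X: "rvector_field M W X"
    and KX: "\<And>q. q \<in> W \<Longrightarrow> K q = rtv.span {X q}" and X0: "\<And>q. q \<in> W \<Longrightarrow> X q \<noteq> 0"
    and Z: "\<And>i. i < m \<Longrightarrow> cvector_field M W (Z i)"
    and N_span: "\<And>q. q \<in> W \<Longrightarrow> N q = {tscale a (X q) + (\<Sum>i<m. tscale (c i) (Z i q)) |a c. True}"
    and N_indep: "\<And>q a c. q \<in> W \<Longrightarrow> tscale a (X q) + (\<Sum>i<m. tscale (c i) (Z i q)) = 0 \<Longrightarrow> a = 0 \<and> (\<forall>i<m. c i = 0)"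
    by (rule adapted_frame[OF M AR p]) (rule that; assumption)
  have dim: "DIM('e) = DIM('f) + 1" using assms(2,7) by simp
  \<comment> \<open>A first chart serves to choose \<open>b0\<close> and a neighbourhood on which it
    stays transversal; the box for the theorem is cut out of this chart afterwards.\<close>
  obtain U0 \<Psi>0 r0 where U0: "p \<in> U0" "U0 \<subseteq> W" and rect0: "rectifies M K U0 (\<Psi>0 :: 'a \<Rightarrow> real \<times> 'f)" and z: "\<Psi>0 p = (0, 0)"
  proof (rule rectifying_chart[OF M dim W X X0 KX])
    fix U \<Psi> r assume "p \<in> U" "U \<subseteq> W" "rectifies M K U (\<Psi> :: 'a \<Rightarrow> real \<times> 'f)" "\<Psi> p = (0, 0)"
    then show thesis by (rule that)
  qed
  have c0: "compat_chart M U0 \<Psi>0" using rect0 by (simp add: rectifies_def)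
  have Xc: "cvector_field M W X" and Xt: "\<And>q. q \<in> W \<Longrightarrow> X q \<in> ctangent M q" using X by (auto simp: rvector_field_def cvector_field_def)
  have XK: "X q \<in> K q" if "q \<in> W" for q unfolding KX[OF that] by (rule rtv.span_base) simp
  have "chart_tvec M U0 \<Psi>0 p (1, 0) 0 \<in> K p" unfolding rectifies_span[OF M rect0 U0(1)] by (rule rtv.span_base) simp
  then have "complexify g p (X p) (chart_tvec M U0 \<Psi>0 p (1, 0) 0) = 0" by (intro null K_N XK p W)
  then obtain b0 where b0: "complexify g p (X p) (chart_tvec M U0 \<Psi>0 p (0, b0) 0) \<noteq> 0"
    by (rule transversal_direction[OF M g c0 U0(1) Xt[OF W(2)] X0[OF W(2)]])
  have oU0: "openin (mtop M) U0" by (rule compat_chart_openin[OF c0])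
  have sm: "smooth_near M p (\<lambda>q. complexify g q (X q) (chart_tvec M U0 \<Psi>0 q (0, b0) 0))"
    by (rule complexify_smooth[OF M g cvector_field_subset[OF M Xc oU0 U0(2)] chart_tvec_field[OF M c0] U0(1)])
  obtain V where V: "openin (mtop M) V" "p \<in> V"
    and nz: "\<And>q. q \<in> V \<Longrightarrow> complexify g q (X q) (chart_tvec M U0 \<Psi>0 q (0, b0) 0) \<noteq> 0"
    by (rule smooth_near_nonzero[OF M p sm]) (rule b0, (rule that; assumption))
  obtain U \<Psi> r where U: "p \<in> U" "U \<subseteq> U0 \<inter> V" and rect: "rectifies M K U (\<Psi> :: 'a \<Rightarrow> real \<times> 'f)" and img: "\<Psi> ` U = UNIV \<times> ball 0 r"
    and same: "\<And>q b. q \<in> U \<Longrightarrow> chart_tvec M U \<Psi> q (0, b) 0 = chart_tvec M U0 \<Psi>0 q (0, b) 0"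
    by (rule rectifying_chart_shrink[OF M rect0 V U0(1) z]) (rule that; assumption)
  have chart: "compat_chart M U \<Psi>" using rect by (simp add: rectifies_def)
  note oU = compat_chart_openin[OF chart]
  have UW: "q \<in> W" and Ut: "q \<in> topspace (mtop M)" if "q \<in> U" for q using that U U0 openin_subset[OF oU] by blast+
  define T where "T q = chart_tvec M U \<Psi> q (1, 0) 0" for q
  have KT: "K q = rtv.span {T q}" if "q \<in> U" for q unfolding T_def by (rule rectifies_span[OF M rect that])
  have TK: "T q \<in> K q" if "q \<in> U" for q unfolding KT[OF that] by (rule rtv.span_base) simp
  \<comment> \<open>\<open>T\<close> and \<open>X\<close> span the same line; the factor between
    them stems from the flow box and the rescaling of \<open>t\<close> and is used only
    pointwise.\<close>
  have "\<exists>a. a \<noteq> 0 \<and> T q = tscale a (X q)" if q: "q \<in> U" for q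
  proof -
    have "T q \<in> rtv.span {X q}" using TK[OF q] KX[OF UW[OF q]] by simp
    then obtain a where a: "T q = tscale (complex_of_real a) (X q)" unfolding rtv.span_singleton by (auto simp: rtscale_def)
    have "X q \<in> rtv.span {T q}" using XK[OF UW[OF q]] KT[OF q] by simp
    then obtain b where b: "X q = tscale (complex_of_real b) (T q)" unfolding rtv.span_singleton by (auto simp: rtscale_def)
    have "complex_of_real a \<noteq> 0"
    proof
      assume "complex_of_real a = 0"
      then have "T q = 0" using a by simp
      then show False using b X0[OF UW[OF q]] by simp
    qed
    then show ?thesis using a by blast
  qed
  then obtain s where s: "\<And>q. q \<in> U \<Longrightarrow> s q \<noteq> 0" and TX: "\<And>q. q \<in> U \<Longrightarrow> T q = tscale (s q) (X q)" by metis
  have N_span': "N q = {tscale a (T q) + (\<Sum>i<m. tscale (c i) (Z i q)) |a c. True}" if q: "q \<in> U" for q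
  proof -
    have 1: "tscale a (X q) = tscale (a / s q) (T q)" for a using s[OF q] by (simp add: TX[OF q])
    have 2: "tscale a (T q) = tscale (a * s q) (X q)" for a by (simp add: TX[OF q])
    show ?thesis unfolding N_span[OF UW[OF q]]
    proof (intro Collect_cong iffI; elim exE conjE)
      fix v a c assume v: "v = tscale a (X q) + (\<Sum>i<m. tscale (c i) (Z i q))"
      show "\<exists>a c. v = tscale a (T q) + (\<Sum>i<m. tscale (c i) (Z i q)) \<and> True"
        unfolding v 1[of a] by (rule exI[of _ "a / s q"], rule exI[of _ c]) simp
    next
      fix v a c assume v: "v = tscale a (T q) + (\<Sum>i<m. tscale (c i) (Z i q))"
      show "\<exists>a c. v = tscale a (X q) + (\<Sum>i<m. tscale (c i) (Z i q)) \<and> True"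
        unfolding v 2[of a] by (rule exI[of _ "a * s q"], rule exI[of _ c]) simp
    qed
  qed
  have TN: "T q \<in> N q" if "q \<in> U" for q using K_N[OF Ut TK] that by blast
  have ZN: "Z i q \<in> N q" if q: "q \<in> U" and i: "i < m" for i q
  proof -
    have "(\<Sum>j<m. tscale (if j = i then 1 else 0) (Z j q)) = (\<Sum>j<m. if j = i then Z j q else 0)" by (rule sum.cong) auto
    then have "tscale 0 (T q) + (\<Sum>j<m. tscale (if j = i then 1 else 0) (Z j q)) = Z i q" using i by simp
    then show ?thesis unfolding N_span'[OF q] by (intro CollectI exI conjI TrueI) (rule sym)
  qed
  have ZU: "cvector_field M U (Z i)" if "i < m" for i by (rule cvector_field_subset[OF M Z[OF that] oU]) (use UW in blast)
  have Tr: "rvector_field M U T" unfolding rvector_field_def rtangent_def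
    using chart_tvec_field[OF M chart] ctangent_chart(1)[OF M chart] chart_tvec_linear(4)[OF M chart, of _ "(1, 0)" 0]
    by (simp add: T_def[abs_def])
  interpret robinson_box M K U \<Psi> "ball 0 r" g N m Z b0
  proof
    fix q assume q: "q \<in> U"
    note nT = T_def[symmetric]
    show "N q = {tscale a (chart_tvec M U \<Psi> q (1, 0) 0) + (\<Sum>i<m. tscale (c i) (Z i q)) |a c. True}"
      unfolding nT by (rule N_span'[OF q])
    show "a = 0 \<and> (\<forall>i<m. c i = 0)" if "tscale a (chart_tvec M U \<Psi> q (1, 0) 0) + (\<Sum>i<m. tscale (c i) (Z i q)) = 0" for a c
      using N_indep[OF UW[OF q], of "a * s q" c] that s[OF q] unfolding nT TX[OF q] by simp
    \<comment> \<open>The bracket is taken with \<open>T\<close> and not with the original generator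
      \<open>X\<close>; the nearly Robinson condition covers every real section of \<open>K\<close>,
      and \<open>T\<close> is one.\<close>
    show "lie_bracket M (\<lambda>q. chart_tvec M U \<Psi> q (1, 0) 0) (Z i) q \<in> N q" if i: "i < m" for i
    proof -
      have "\<forall>p\<in>U. lie_bracket M T (Z i) p \<in> N p"
        using NR Tr ZU[OF i] TK ZN i unfolding nearly_robinson_def by metis
      then show ?thesis using q unfolding T_def[abs_def] by blast
    qed
    \<comment> \<open>Transversality survives the change of chart, since \<open>same\<close>
      identifies the coordinate vectors \<open>(0, b0)\<close> of both charts and \<open>T\<close>
      is a nonzero multiple of \<open>X\<close>.\<close>
    have "complexify g q (T q) (chart_tvec M U \<Psi> q (0, b0) 0) = s q * complexify g q (X q) (chart_tvec M U \<Psi> q (0, b0) 0)"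
      unfolding TX[OF q] by (rule complexify_scale[OF M g Ut[OF q] Xt[OF UW[OF q]] ctangent_chart(1)[OF M chart q]])
    then show "complexify g q (chart_tvec M U \<Psi> q (1, 0) 0) (chart_tvec M U \<Psi> q (0, b0) 0) \<noteq> 0"
      using s[OF q] nz[of q] U q same[OF q] unfolding nT by auto
  qed (use M g rect img assms(7) ZU null KN Ut in auto)
  have pr: "snd \<circ> \<Phi> = pr" by (simp add: pr_def)
  show "\<exists>U (B :: ('a set, 'f) mfd) \<Phi> H J.
    p \<in> U \<and> openin (mtop M) U \<and>
    leaf_space_trivialization M K U B \<Phi> \<and>
    almost_CR B m H J \<and>
    descends_to M g N K U B (snd \<circ> \<Phi>) H J \<and>
    (\<exists>\<theta>\<^sub>0 \<theta> h lam.
      CR_coframe B m H J \<theta>\<^sub>0 \<theta> \<and>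
      (\<forall>\<alpha><m. \<forall>\<beta><m. smooth_fun M U (\<lambda>q. h q \<alpha> \<beta> :: complex) \<and>
         (\<forall>q\<in>U. h q \<alpha> \<beta> = cnj (h q \<beta> \<alpha>))) \<and>
      rform M U lam \<and>
      (\<forall>q\<in>U. \<forall>X\<in>K q. X \<noteq> 0 \<longrightarrow> lam q X \<noteq> 0) \<and>
      (\<forall>q\<in>U. \<forall>X\<in>rtangent M q. \<forall>Y\<in>rtangent M q.
         complex_of_real (g q X Y) =
           4 * symprod (pull B (snd \<circ> \<Phi>) \<theta>\<^sub>0 q) (lam q) X Y +
           2 * (\<Sum>\<alpha><m. \<Sum>\<beta><m. h q \<alpha> \<beta> *
             symprod (pull B (snd \<circ> \<Phi>) (\<theta> \<alpha>) q) (pull B (snd \<circ> \<Phi>) (conj_form (\<theta> \<beta>)) q) X Y)))"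
  proof (rule exI[of _ U], rule exI[of _ B], rule exI[of _ \<Phi>], rule exI[of _ H], rule exI[of _ J], unfold pr, intro conjI)
    show "\<exists>\<theta>\<^sub>0 \<theta> h lam.
      CR_coframe B m H J \<theta>\<^sub>0 \<theta> \<and>
      (\<forall>\<alpha><m. \<forall>\<beta><m. smooth_fun M U (\<lambda>q. h q \<alpha> \<beta> :: complex) \<and>
         (\<forall>q\<in>U. h q \<alpha> \<beta> = cnj (h q \<beta> \<alpha>))) \<and>
      rform M U lam \<and>
      (\<forall>q\<in>U. \<forall>X\<in>K q. X \<noteq> 0 \<longrightarrow> lam q X \<noteq> 0) \<and>
      (\<forall>q\<in>U. \<forall>X\<in>rtangent M q. \<forall>Y\<in>rtangent M q.
         complex_of_real (g q X Y) =
           4 * symprod (pull B pr \<theta>\<^sub>0 q) (lam q) X Y +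
           2 * (\<Sum>\<alpha><m. \<Sum>\<beta><m. h q \<alpha> \<beta> *
             symprod (pull B pr (\<theta> \<alpha>) q) (pull B pr (conj_form (\<theta> \<beta>)) q) X Y))"
      by (rule exI[of _ \<theta>0], rule exI[of _ \<theta>], rule exI[of _ h], rule exI[of _ lam], intro conjI allI impI ballI)
        (fact CR_coframe lam_form | rule h_smooth h_hermitian lam_nonzero metric_form; assumption)+
  qed (fact U(1) oU trivialization almost_CR descends)+
qed

end
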